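(* Let $K$ be a field of characteristic $0$ and let $I\subset K[X]=K[x_1,x_2,\dots]$ be a homogeneous symmetric ideal satisfying the following condition $(\dagger)$: there exists $f\in I$ which can be written $f=\sum_{i=1}^N c_i m_i$ with $N\ge1$, $c_i\in K\setminus\{0\}$ and $m_1,\dots,m_N$ pairwise distinct monomials, such that $\mathrm{Supp}(m_i)\not\subset\mathrm{Supp}(m_1)$ for all $i\ne1$. Then for every partition $\mu\vdash n_0$ the isotypic Hilbert series \[ H^\mu(K[X]/I;\,t)=\sum_{d\ge0}\Bigl(\lim_{n\to\infty}c_{\mu(n),d}(n)\Bigr)t^d \] is a rational function of $t$.
   Context: $K[X]=K[x_i\mid i\ge1]$ is graded by degree, $K[X_n]=K[x_1,\dots,x_n]$, $I_n=I\cap K[X_n]$. $\mathrm{Sym}(\infty)=\bigcup_{n\ge1}\mathrm{Sym}(n)$ acts on $K[X]$ by $\sigma\cdot x_i=x_{\sigma(i)}$; an ideal is symmetric if it is stable under this action. $\mathrm{Supp}(m)$ is the set of variables appearing in the monomial $m$. For a partition $\mu=(\mu_1\ge\dots\ge\mu_\ell>0)$ of $n_0$ and $n\ge n_0$, the padded partition is $\mu(n)=(n-n_0+\mu_1,\mu_2,\dots,\mu_\ell)\vdash n$. $V^\lambda$ is the irreducible representation of $\mathrm{Sym}(n)$ indexed by $\lambda\vdash n$ (so $V^{(n)}$ is trivial), and $c_{\mu(n),d}(n)$ is the multiplicity of $V^{\mu(n)}$ in the degree-$d$ piece $[K[X_n]/I_n]_d$. For each $d$ the sequence $c_{\mu(n),d}(n)$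 is eventually constant in $n$, so that the limits exist. *)

theory Defs
  imports
    "HOL-Analysis.Analysis"
    "HOL-Algebra.Algebraic_Closure_Type"
    "HOL-Library.Poly_Mapping"
    "HOL-Library.Set_Algebras"
    "HOL-Computational_Algebra.Polynomial_FPS"
    "HOL-Combinatorics.Permutations"
begin

section \<open>The polynomial ring in infinitely many variables\<close>

text \<open>
  Variables are numbered from \<open>0\<close>: \<open>var i\<close> stands for \<open>x\<^sub>i\<^sub>+\<^sub>1\<close>. Accordingly the first \<open>n\<close> variables
  have indices in \<open>{..<n}\<close>, and \<open>Sym(n)\<close> consists of the permutations of \<open>{..<n}\<close>.
  A monomial is its exponent function, so \<open>Poly_Mapping.keys m\<close> is the support of \<open>m\<close>.
\<close>

type_synonym monomial = "nat \<Rightarrow>\<^sub>0 nat"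
type_synonym 'k polynomials = "monomial \<Rightarrow>\<^sub>0 'k"

definition var :: "nat \<Rightarrow> 'k::field polynomials"
  where "var i = Poly_Mapping.single (Poly_Mapping.single i 1) 1"

definition scalar_mult :: "'k::field \<Rightarrow> 'k polynomials \<Rightarrow> 'k polynomials"
  where "scalar_mult c p = Poly_Mapping.single 0 c * p"

definition mdegree :: "monomial \<Rightarrow> nat"
  where "mdegree m = (\<Sum>i\<in>Poly_Mapping.keys m. Poly_Mapping.lookup m i)"

definition is_form :: "nat \<Rightarrow> 'k::field polynomials \<Rightarrow> bool"
  where "is_form d p \<longleftrightarrow> (\<forall>m\<in>Poly_Mapping.keys p. mdegree m = d)"

definition hom_component :: "nat \<Rightarrow> 'k::field polynomials \<Rightarrow> 'k polynomials"
  where "hom_component d p =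
    (\<Sum>m\<in>{m \<in> Poly_Mapping.keys p. mdegree m = d}. Poly_Mapping.single m (Poly_Mapping.lookup p m))"

definition polys_in :: "nat \<Rightarrow> 'k::field polynomials set"
  where "polys_in n = {p. \<forall>m\<in>Poly_Mapping.keys p. Poly_Mapping.keys m \<subseteq> {..<n}}"

text \<open>The \<open>K\<close>-algebra endomorphism sending \<open>x\<^sub>i\<close> to \<open>x\<close> with index \<open>\<sigma> i\<close>.\<close>

definition perm_act :: "(nat \<Rightarrow> nat) \<Rightarrow> 'k::field polynomials \<Rightarrow> 'k polynomials"
  where "perm_act \<sigma> p =
    (\<Sum>m\<in>Poly_Mapping.keys p. scalar_mult (Poly_Mapping.lookup p m)
       (\<Prod>i\<in>Poly_Mapping.keys m. var (\<sigma> i) ^ Poly_Mapping.lookup m i))"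

definition poly_ideal :: "'k::field polynomials set \<Rightarrow> bool"
  where "poly_ideal I \<longleftrightarrow> 0 \<in> I \<and> (\<forall>p\<in>I. \<forall>q\<in>I. p + q \<in> I) \<and> (\<forall>p\<in>I. \<forall>r. r * p \<in> I)"

definition homogeneous_ideal :: "'k::field polynomials set \<Rightarrow> bool"
  where "homogeneous_ideal I \<longleftrightarrow> poly_ideal I \<and> (\<forall>p\<in>I. \<forall>d. hom_component d p \<in> I)"

definition sym_infinity :: "(nat \<Rightarrow> nat) set"
  where "sym_infinity = (\<Union>n. {\<sigma>. \<sigma> permutes {..<n}})"

definition symmetric_ideal :: "'k::field polynomials set \<Rightarrow> bool"
  where "symmetric_ideal I \<longleftrightarrow> poly_ideal I \<and> (\<forall>\<sigma>\<in>sym_infinity. \<forall>p\<in>I. perm_act \<sigma> p \<in> I)"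

definition dagger_condition :: "'k::field polynomials set \<Rightarrow> bool"
  where "dagger_condition I \<longleftrightarrow>
    (\<exists>f\<in>I. \<exists>(N::nat) (c :: nat \<Rightarrow> 'k) (m :: nat \<Rightarrow> monomial).
       N \<ge> 1 \<and> (\<forall>i\<in>{1..N}. c i \<noteq> 0) \<and> inj_on m {1..N} \<and>
       f = (\<Sum>i=1..N. Poly_Mapping.single (m i) (c i)) \<and>
       (\<forall>i\<in>{1..N}. i \<noteq> 1 \<longrightarrow> \<not> Poly_Mapping.keys (m i) \<subseteq> Poly_Mapping.keys (m 1)))"


section \<open>Representations of the symmetric groups\<close>

text \<open>
  A representation of \<open>Sym(n)\<close> over \<open>'k\<close> is a \<open>'k\<close>-module together with an action, of which only
  the values at permutations of \<open>{..<n}\<close> matter. The ring multiplication and unit that the record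
  type \<open>module\<close> inherits from \<open>ring\<close> are never used.
\<close>

record ('k, 'v) sym_rep = "('k, 'v) module" +
  act :: "(nat \<Rightarrow> nat) \<Rightarrow> 'v \<Rightarrow> 'v"

definition subrep :: "nat \<Rightarrow> 'v set \<Rightarrow> ('k::field, 'v) sym_rep \<Rightarrow> bool"
  where "subrep n U V \<longleftrightarrow>
    submodule U (ring_of_type_algebra :: 'k ring) V \<and>
    (\<forall>\<sigma>. \<sigma> permutes {..<n} \<longrightarrow> (\<forall>u\<in>U. act V \<sigma> u \<in> U))"

definition irreducible_rep :: "nat \<Rightarrow> ('k::field, 'v) sym_rep \<Rightarrow> bool"
  where "irreducible_rep n V \<longleftrightarrow>
    carrier V \<noteq> {\<zero>\<^bsub>V\<^esub>} \<and> (\<forall>U. subrep n U V \<longrightarrow> U = {\<zero>\<^bsub>V\<^esub>} \<or> U = carrier V)"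

definition rep_iso :: "nat \<Rightarrow> ('k::field, 'v) sym_rep \<Rightarrow> ('k, 'w) sym_rep \<Rightarrow> bool"
  where "rep_iso n V W \<longleftrightarrow>
    (\<exists>f. bij_betw f (carrier V) (carrier W) \<and>
      (\<forall>u\<in>carrier V. \<forall>v\<in>carrier V. f (u \<oplus>\<^bsub>V\<^esub> v) = f u \<oplus>\<^bsub>W\<^esub> f v) \<and>
      (\<forall>c. \<forall>v\<in>carrier V. f (c \<odot>\<^bsub>V\<^esub> v) = c \<odot>\<^bsub>W\<^esub> f v) \<and>
      (\<forall>\<sigma>. \<sigma> permutes {..<n} \<longrightarrow> (\<forall>v\<in>carrier V. f (act V \<sigma> v) = act W \<sigma> (f v))))"

text \<open>\<open>V\<close> is the internal direct sum of the irreducible subrepresentations \<open>U 0, \<dots>, U (r - 1)\<close>.\<close>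

definition irreducible_decomposition ::
    "nat \<Rightarrow> ('k::field, 'v) sym_rep \<Rightarrow> nat \<Rightarrow> (nat \<Rightarrow> 'v set) \<Rightarrow> bool"
  where "irreducible_decomposition n V r U \<longleftrightarrow>
    (\<forall>i<r. subrep n (U i) V \<and> irreducible_rep n (V\<lparr>carrier := U i\<rparr>)) \<and>
    (\<forall>v\<in>carrier V. \<exists>!w. w \<in> (\<Pi>\<^sub>E i\<in>{..<r}. U i) \<and> v = finsum V w {..<r})"

text \<open>The number of summands isomorphic to \<open>S\<close> in a decomposition of \<open>V\<close> into irreducibles.\<close>

definition multiplicity_of :: "nat \<Rightarrow> ('k::field, 's) sym_rep \<Rightarrow> ('k, 'v) sym_rep \<Rightarrow> nat"
  where "multiplicity_of n S V =
    (THE m. \<exists>r U. irreducible_decomposition n V r U \<and>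
                  m = card {i. i < r \<and> rep_iso n S (V\<lparr>carrier := U i\<rparr>)})"


section \<open>Partitions and Specht modules\<close>

definition is_partition :: "nat list \<Rightarrow> nat \<Rightarrow> bool"
  where "is_partition \<mu> n \<longleftrightarrow> sorted_wrt (\<ge>) \<mu> \<and> (\<forall>k\<in>set \<mu>. k > 0) \<and> sum_list \<mu> = n"

text \<open>Only meaningful for \<open>n \<ge> sum_list \<mu>\<close>; the empty partition is padded to \<open>(n)\<close>.\<close>

definition padded :: "nat list \<Rightarrow> nat \<Rightarrow> nat list"
  where "padded \<mu> n = (case \<mu> of [] \<Rightarrow> [n] | k # ks \<Rightarrow> (n - sum_list \<mu> + k) # ks)"

definition cells :: "nat list \<Rightarrow> (nat \<times> nat) set"
  where "cells la = {(i, j). i < length la \<and> j < la ! i}"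

text \<open>
  The product of the Vandermonde polynomials of the columns of the tableau \<open>t\<close>; the index
  \<open>(i, i', j)\<close> stands for the cells in rows \<open>i < i'\<close> of column \<open>j\<close>.
\<close>

definition specht_poly :: "nat list \<Rightarrow> (nat \<times> nat \<Rightarrow> nat) \<Rightarrow> 'k::field polynomials"
  where "specht_poly la t =
    (\<Prod>(i, i', j)\<in>{(i, i', j). i < i' \<and> (i, j) \<in> cells la \<and> (i', j) \<in> cells la}.
       var (t (i, j)) - var (t (i', j)))"

text \<open>
  The irreducible representation indexed by a partition \<open>la\<close> of \<open>n\<close>, in Specht's original
  realization: the span of the Specht polynomials of all tableaux of shape \<open>la\<close>. The monomial
  whose exponent at each entry of \<open>t\<close> is the row of that entry encodes the tabloid of \<open>t\<close>; up to a
  sign depending only on \<open>la\<close>, expanding the Vandermonde determinants turns the Specht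
  polynomial of \<open>t\<close> into the polytabloid of \<open>t\<close>, so this is the usual Specht module.
  In particular the shape \<open>(n)\<close> gives the trivial representation.
\<close>

definition specht_module :: "nat list \<Rightarrow> nat \<Rightarrow> ('k::field, 'k polynomials) sym_rep"
  where "specht_module la n = \<lparr>
    carrier = module.span scalar_mult {specht_poly la t | t. bij_betw t (cells la) {..<n}},
    monoid.mult = undefined, one = undefined,
    zero = 0, add = (+), smult = scalar_mult, act = perm_act \<rparr>"


section \<open>Isotypic Hilbert series\<close>

text \<open>
  The degree \<open>d\<close> piece of the quotient ring by \<open>I\<^sub>n\<close>: its elements are the cosets modulo \<open>I\<^sub>n\<close> of the
  forms of degree \<open>d\<close> in the first \<open>n\<close> variables. Cosets are added as sets; in the scalar
  multiplication \<open>I\<^sub>n\<close> is added so that \<open>0\<close> times a coset is the coset \<open>I\<^sub>n\<close>.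
\<close>

definition quotient_piece ::
    "'k::field polynomials set \<Rightarrow> nat \<Rightarrow> nat \<Rightarrow> ('k, 'k polynomials set) sym_rep"
  where "quotient_piece I n d = (let In = I \<inter> polys_in n in \<lparr>
    carrier = {p +o In | p. p \<in> polys_in n \<and> is_form d p},
    monoid.mult = undefined, one = undefined,
    zero = In, add = (+), smult = (\<lambda>c A. scalar_mult c ` A + In),
    act = (\<lambda>\<sigma> A. perm_act \<sigma> ` A) \<rparr>)"

definition isotypic_mult :: "'k::field polynomials set \<Rightarrow> nat list \<Rightarrow> nat \<Rightarrow> nat \<Rightarrow> nat"
  where "isotypic_mult I \<mu> d n =
    multiplicity_of n (specht_module (padded \<mu> n) n) (quotient_piece I n d)"

definition isotypic_hilbert_series :: "'k::field polynomials set \<Rightarrow> nat list \<Rightarrow> rat fps"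
  where "isotypic_hilbert_series I \<mu> = Abs_fps (\<lambda>d. of_nat (lim (\<lambda>n. isotypic_mult I \<mu> d n)))"

text \<open>Division of formal power series is total, so the quotient is stated multiplicatively.\<close>

definition is_rational_series :: "rat fps \<Rightarrow> bool"
  where "is_rational_series H \<longleftrightarrow>
    (\<exists>P Q :: rat poly. Q \<noteq> 0 \<and> H * fps_of_poly Q = fps_of_poly P)"

end

theory Submission
  imports Defs
begin

text \<open>
  Fix a tableau of shape \<open>\<mu>(n)\<close> whose rows below the first do not depend on \<open>n\<close>. The multiplicity of
  \<open>V\<^bsup>\<mu>(n)\<^esup>\<close> in a representation is the rank of the row symmetrizer composed with the column
  antisymmetrizer \<open>\<kappa>\<close>. The polynomials which the row symmetrizers map into \<open>I\<close> for large \<open>n\<close> form a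
  subspace \<open>J \<supseteq> I\<close> containing all \<open>p - \<sigma> p\<close> with \<open>\<sigma>\<close> fixing a certain finite set of variables, and
  the isotypic Hilbert series is the difference of the Hilbert series of \<open>K[X]/J\<close> and
  \<open>K[X]/(J + \<kappa> K[X])\<close>. Modulo such a subspace, only the multiset of the exponents (letters) of a
  monomial outside the fixed variables matters.

  Let \<open>k\<close> be the size of the support of \<open>m\<^sub>1\<close>, and let \<open>e\<close> exceed all exponents of \<open>f\<close>. If a monomial
  has \<open>k\<close> exponents that are at least \<open>e\<close>, then \<open>(\<dagger>)\<close> rewrites it in terms of monomials with more
  variables. Hence only boundedly many big letters survive in the graded space of a filtration by
  weight. It is finitely generated over the operators that adjoin a letter below \<open>e\<close> or multiply by
  an elementary symmetric polynomial of the \<open>e\<close>-th powers of the variables with big exponents, and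
  so Dickson's lemma makes its Hilbert series rational.
\<close>

section \<open>Rational power series\<close>

text \<open>The obstacle is that \<open>J\<close> is not an ideal. A row symmetrizer commutes only
  with multiplication by polynomials that its row group fixes, so an element of \<open>J\<close> may
  be multiplied by a power of one variable of large index, or by a symmetric polynomial in
  sufficiently many variables, but not by an arbitrary variable. Hence the two kinds of operators. A
  big variable \<open>x_i\<close> can still be controlled: \<open>x_i^e\<close> is a root of a monic
  polynomial whose coefficients are, up to sign, the elementary symmetric polynomials of the
  \<open>e\<close>-th powers of the big variables, so finitely many exponents suffice. A symmetric
  polynomial in many variables agrees with the one in the big variables only up to terms in which
  another variable has become big, and (\<dagger>) eliminates a monomial only up to terms with more
  variables; both errors have larger weight. In each degree the weight is bounded, so the errors
  disappear after finitely many steps, and on the graded pieces the operators act like the variables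
  of a polynomial ring on a finitely generated module.\<close>

lemma is_rational_seriesI:
  "Q \<noteq> 0 \<Longrightarrow> H * fps_of_poly Q = fps_of_poly P \<Longrightarrow> is_rational_series H"
  unfolding is_rational_series_def by blast

lemma is_rational_series_poly: "is_rational_series (fps_of_poly P)"
  unfolding is_rational_series_def by (rule exI[of _ P], rule exI[of _ 1]) simp

lemma is_rational_series_add:
  assumes "is_rational_series A" "is_rational_series B"
  shows "is_rational_series (A + B)"
proof -
  obtain P Q where PQ: "Q \<noteq> 0" "A * fps_of_poly Q = fps_of_poly P"
    using assms(1) unfolding is_rational_series_def by blast
  obtain R S where RS: "S \<noteq> 0" "B * fps_of_poly S = fps_of_poly R"
    using assms(2) unfolding is_rational_series_def by blast
  have "(A + B) * fps_of_poly (Q * S)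
      = (A * fps_of_poly Q) * fps_of_poly S + (B * fps_of_poly S) * fps_of_poly Q"
    by (simp add: fps_of_poly_mult algebra_simps)
  also have "\<dots> = fps_of_poly (P * S + R * Q)"
    by (simp add: PQ RS fps_of_poly_mult fps_of_poly_add)
  finally show ?thesis
    by (intro is_rational_seriesI[of "Q * S"]) (use PQ(1) RS(1) in simp)
qed

lemma is_rational_series_poly_mult:
  assumes "is_rational_series A"
  shows "is_rational_series (fps_of_poly R * A)"
proof -
  obtain P Q where PQ: "Q \<noteq> 0" "A * fps_of_poly Q = fps_of_poly P"
    using assms unfolding is_rational_series_def by blast
  have "fps_of_poly R * A * fps_of_poly Q = fps_of_poly (R * P)"
    by (simp add: PQ fps_of_poly_mult mult.assoc)
  then show ?thesis
    by (intro is_rational_seriesI[of Q]) (use PQ(1) in simp)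
qed

lemma is_rational_series_X_power_mult:
  "is_rational_series A \<Longrightarrow> is_rational_series (fps_X ^ d * A)"
  using is_rational_series_poly_mult[of A "Polynomial.monom 1 d"] by (simp add: fps_of_poly_monom')

lemma is_rational_series_diff:
  assumes "is_rational_series A" "is_rational_series B"
  shows "is_rational_series (A - B)"
  using is_rational_series_add[OF assms(1) is_rational_series_poly_mult[OF assms(2), of "-1"]]
  by (simp add: fps_of_poly_uminus)

lemma is_rational_series_sum:
  "(\<And>i. i \<in> S \<Longrightarrow> is_rational_series (A i)) \<Longrightarrow> is_rational_series (\<Sum>i\<in>S. A i)"
proof (induction S rule: infinite_finite_induct)
  case (insert x F)
  then show ?case by (simp add: is_rational_series_add)
qed (use is_rational_series_poly[of 0] in auto)

lemma is_rational_series_cancel: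
  assumes "is_rational_series (A * fps_of_poly R)" "R \<noteq> 0"
  shows "is_rational_series A"
proof -
  obtain P Q where PQ: "Q \<noteq> 0" "A * fps_of_poly R * fps_of_poly Q = fps_of_poly P"
    using assms unfolding is_rational_series_def by blast
  then have "A * fps_of_poly (R * Q) = fps_of_poly P"
    by (simp add: fps_of_poly_mult mult.assoc)
  then show ?thesis
    by (intro is_rational_seriesI[of "R * Q"]) (use PQ(1) assms(2) in simp)
qed

section \<open>Complements of up-sets of exponent vectors\<close>

lemma nat_seq_mono_subseq:
  fixes s :: "nat \<Rightarrow> nat"
  shows "\<exists>r :: nat \<Rightarrow> nat. strict_mono r \<and> (\<forall>i j. i \<le> j \<longrightarrow> s (r i) \<le> s (r j))"
proof -
  obtain r :: "nat \<Rightarrow> nat" where r: "strict_mono r" "monoseq (\<lambda>n. s (r n))"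
    using seq_monosub[of s] by (elim exE conjE)
  consider "\<forall>m. \<forall>n\<ge>m. s (r m) \<le> s (r n)" | "\<forall>m. \<forall>n\<ge>m. s (r n) \<le> s (r m)"
    using r(2) unfolding monoseq_def by (elim disjE)
  then show ?thesis
  proof cases
    case 1
    with r(1) show ?thesis by (intro exI[of _ r] conjI) auto
  next
    case 2
    \<comment> \<open>A nonincreasing sequence of naturals is constant from the place of its minimum
      on, so without its first \<open>n0\<close> terms it is nondecreasing as well.\<close>
    define n0 where "n0 = (ARG_MIN (\<lambda>n. s (r n)) n. True)"
    have min: "s (r n0) \<le> s (r n)" for n
      unfolding n0_def by (rule arg_min_nat_le) simp
    have "s (r (i + n0)) = s (r n0)" for i
      using 2[rule_format, of n0 "i + n0"] min[of "i + n0"] by simp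
    moreover have "strict_mono (\<lambda>i. r (i + n0))"
      using r(1) by (simp add: strict_mono_def)
    ultimately show ?thesis by (intro exI[of _ "\<lambda>i. r (i + n0)"] conjI) simp_all
  qed
qed

text \<open>Thin out for the tails first, by induction, and then for the heads; a further
  subsequence keeps the tails monotone.\<close>

lemma dickson:
  fixes f :: "nat \<Rightarrow> nat list"
  assumes "\<And>i. length (f i) = N"
  shows "\<exists>r :: nat \<Rightarrow> nat. strict_mono r \<and> (\<forall>i j. i \<le> j \<longrightarrow> list_all2 (\<le>) (f (r i)) (f (r j)))"
  using assms
proof (induction N arbitrary: f)
  case 0
  then show ?case
    by (intro exI[of _ id]) (simp add: strict_mono_def)
next
  case (Suc N)
  have tl: "length (tl (f i)) = N" for i using Suc.prems[of i] by simp
  from Suc.IH[of "\<lambda>i. tl (f i)", OF tl]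
  obtain r :: "nat \<Rightarrow> nat" where r: "strict_mono r" "\<forall>i j. i \<le> j \<longrightarrow> list_all2 (\<le>) (tl (f (r i))) (tl (f (r j)))"
    by (elim exE conjE)
  from nat_seq_mono_subseq[of "\<lambda>i. hd (f (r i))"]
  obtain q :: "nat \<Rightarrow> nat" where q: "strict_mono q" "\<forall>i j. i \<le> j \<longrightarrow> hd (f (r (q i))) \<le> hd (f (r (q j)))"
    by (elim exE conjE)
  have ne: "f i \<noteq> []" for i using Suc.prems[of i] by auto
  show ?case
  proof (intro exI[of _ "r \<circ> q"] conjI allI impI)
    show "strict_mono (r \<circ> q)" using r(1) q(1) by (simp add: strict_mono_o)
    fix i j :: nat assume ij: "i \<le> j"
    then have "q i \<le> q j" using q(1) by (simp add: strict_mono_less_eq)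
    then have "list_all2 (\<le>) (hd (f (r (q i))) # tl (f (r (q i)))) (hd (f (r (q j))) # tl (f (r (q j))))"
      using r(2) q(2) ij by simp
    then show "list_all2 (\<le>) (f ((r \<circ> q) i)) (f ((r \<circ> q) j))" using ne by simp
  qed
qed

definition incr :: "nat \<Rightarrow> nat list \<Rightarrow> nat list"
  where "incr l \<omega> = list_update \<omega> l (Suc (\<omega> ! l))"

lemma length_incr [simp]: "length (incr l \<omega>) = length \<omega>"
  by (simp add: incr_def)

lemma incr_Cons [simp]: "incr 0 (c # \<omega>) = Suc c # \<omega>" "incr (Suc l) (c # \<omega>) = c # incr l \<omega>"
  by (simp_all add: incr_def)

text \<open>The exponent vectors of a monomial ideal in \<open>N\<close> variables. Closure is asked
  only under unit steps, because this is how the operators act; \<open>upset_ge\<close> upgrades it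
  to the componentwise order.\<close>

definition upset :: "nat \<Rightarrow> nat list set \<Rightarrow> bool"
  where "upset N A \<longleftrightarrow> (\<forall>\<omega>\<in>A. length \<omega> = N \<longrightarrow> (\<forall>l<N. incr l \<omega> \<in> A))"

lemma upsetD: "upset N A \<Longrightarrow> \<omega> \<in> A \<Longrightarrow> length \<omega> = N \<Longrightarrow> l < N \<Longrightarrow> incr l \<omega> \<in> A"
  by (simp add: upset_def)

lemma upset_ge:
  assumes "upset N A" "list_all2 (\<le>) \<omega> \<omega>'" "\<omega> \<in> A" "length \<omega> = N"
  shows "\<omega>' \<in> A"
  using assms
proof (induction N arbitrary: A \<omega> \<omega>')
  case (Suc N)
  obtain c v where v: "\<omega> = c # v" using Suc.prems(4) by (cases \<omega>) auto
  obtain c' v' where v': "\<omega>' = c' # v'" "c \<le> c'" "list_all2 (\<le>) v v'"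
    using Suc.prems(2) unfolding v by (auto simp: list_all2_Cons1)
  have lv: "length v = N" using Suc.prems(4) v by simp
  have up: "(c + n) # v \<in> A" for n
  proof (induction n)
    case (Suc n)
    then have "incr 0 ((c + n) # v) \<in> A"
      by (rule upsetD[OF \<open>upset (Suc N) A\<close>]) (simp_all add: lv)
    then show ?case by simp
  qed (use Suc.prems(3) v in simp)
  have "upset N {u. c' # u \<in> A}"
    unfolding upset_def
  proof safe
    fix u l assume "c' # u \<in> A" "l < length u" "N = length u"
    then have "incr (Suc l) (c' # u) \<in> A"
      by (intro upsetD[OF \<open>upset (Suc N) A\<close>]) auto
    then show "c' # incr l u \<in> A" by simp
  qed
  moreover have "v \<in> {u. c' # u \<in> A}" using up[of "c' - c"] v'(2) by simp
  ultimately have "v' \<in> {u. c' # u \<in> A}"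
    using v'(3) lv by (intro Suc.IH[of "{u. c' # u \<in> A}" v v']) simp_all
  then show ?case using v'(1) by simp
qed simp

text \<open>The degree of the monomial with exponents \<omega> in variables of degrees
  \<delta>.\<close>

definition wdot :: "nat list \<Rightarrow> nat list \<Rightarrow> nat"
  where "wdot \<delta> \<omega> = sum_list (map2 (*) \<delta> \<omega>)"

lemma wdot_simps [simp]: "wdot [] \<omega> = 0" "wdot \<delta> [] = 0" "wdot (d # \<delta>) (c # \<omega>) = d * c + wdot \<delta> \<omega>"
  by (simp_all add: wdot_def)

lemma wdot_incr:
  assumes "l < length \<delta>" "length \<omega> = length \<delta>"
  shows "wdot \<delta> (incr l \<omega>) = wdot \<delta> \<omega> + \<delta> ! l"
  using assms
proof (induction \<delta> arbitrary: l \<omega>)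
  case (Cons d \<delta>)
  then show ?case by (cases \<omega>; cases l) auto
qed simp

lemma wdot_append:
  "length \<delta> = length \<omega> \<Longrightarrow> wdot (\<delta> @ \<delta>') (\<omega> @ \<omega>') = wdot \<delta> \<omega> + wdot \<delta>' \<omega>'"
  by (simp add: wdot_def zip_append)

lemma wdot_conv_sum: "length \<delta> = length \<omega> \<Longrightarrow> wdot \<delta> \<omega> = (\<Sum>l<length \<delta>. \<delta> ! l * \<omega> ! l)"
  by (simp add: wdot_def sum_list_sum_nth atLeast0LessThan)

lemma finite_wdot_le:
  assumes "\<forall>d\<in>set \<delta>. d > 0"
  shows "finite {\<omega>. length \<omega> = length \<delta> \<and> wdot \<delta> \<omega> \<le> n}"
  using assms
proof (induction \<delta> arbitrary: n)
  case (Cons d \<delta>)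
  have "{\<omega>. length \<omega> = length (d # \<delta>) \<and> wdot (d # \<delta>) \<omega> \<le> n}
      \<subseteq> (\<lambda>(c, \<omega>). c # \<omega>) ` ({..n} \<times> {\<omega>. length \<omega> = length \<delta> \<and> wdot \<delta> \<omega> \<le> n})"
  proof
    fix \<omega> assume "\<omega> \<in> {\<omega>. length \<omega> = length (d # \<delta>) \<and> wdot (d # \<delta>) \<omega> \<le> n}"
    then have "length \<omega> = Suc (length \<delta>)" and w: "wdot (d # \<delta>) \<omega> \<le> n" by auto
    then obtain c u where u: "\<omega> = c # u" "length u = length \<delta>" by (auto simp: length_Suc_conv)
    have "c * 1 \<le> c * d" using Cons.prems by (intro mult_left_mono) auto
    moreover have "c * d + wdot \<delta> u \<le> n" using w u(1) by (simp add: mult.commute)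
    ultimately have "c \<le> n" "wdot \<delta> u \<le> n" by linarith+
    then show "\<omega> \<in> (\<lambda>(c, \<omega>). c # \<omega>) ` ({..n} \<times> {\<omega>. length \<omega> = length \<delta> \<and> wdot \<delta> \<omega> \<le> n})"
      using u by auto
  qed
  then show ?case
    by (rule finite_subset) (use Cons in auto)
qed simp

text \<open>For an up-set \<open>A\<close> this is the Hilbert function of a weighted polynomial
  ring modulo the monomial ideal belonging to \<open>A\<close>.\<close>

definition cocount :: "nat list \<Rightarrow> nat list set \<Rightarrow> nat \<Rightarrow> nat"
  where "cocount \<delta> A n = card {\<omega>. length \<omega> = length \<delta> \<and> \<omega> \<notin> A \<and> wdot \<delta> \<omega> = n}"

lemma finite_cocount:
  assumes "\<forall>d\<in>set \<delta>. d > 0"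
  shows "finite {\<omega>. length \<omega> = length \<delta> \<and> \<omega> \<notin> A \<and> wdot \<delta> \<omega> = n}"
  by (rule finite_subset[OF _ finite_wdot_le[OF assms, of n]]) auto

text \<open>Multiplication by the first variable: vectors that start with \<open>0\<close> survive
  in the quotient by this variable, and every other vector is \<open>incr 0\<close> of a unique one,
  which has to avoid the colon ideal \<open>{\<omega>. incr 0 \<omega> \<in> A}\<close>.\<close>

lemma cocount_Cons:
  assumes "\<forall>e\<in>set (d # \<delta>). e > 0"
  shows "cocount (d # \<delta>) A n = cocount \<delta> {\<omega>. 0 # \<omega> \<in> A} n
    + (if d \<le> n then cocount (d # \<delta>) {\<omega>. incr 0 \<omega> \<in> A} (n - d) else 0)"
proof -
  let ?S = "\<lambda>A n. {\<omega>. length \<omega> = Suc (length \<delta>) \<and> \<omega> \<notin> A \<and> wdot (d # \<delta>) \<omega> = n}"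
  let ?T = "{\<omega>. length \<omega> = length \<delta> \<and> 0 # \<omega> \<notin> A \<and> wdot \<delta> \<omega> = n}"
  let ?U = "if d \<le> n then ?S {\<omega>. incr 0 \<omega> \<in> A} (n - d) else {}"
  have U: "length v = Suc (length \<delta>) \<and> incr 0 v \<notin> A \<and> d \<le> n \<and> wdot (d # \<delta>) v = n - d" if "v \<in> ?U" for v
    using that by (cases "d \<le> n") auto
  have U_Cons: "\<exists>c u. v = c # u" if "v \<in> ?U" for v
    using U[OF that] by (cases v) auto
  have "?S A n = (#) 0 ` ?T \<union> incr 0 ` ?U"
  proof (intro equalityI subsetI)
    fix \<omega> assume \<omega>: "\<omega> \<in> ?S A n"
    then obtain c u where u: "\<omega> = c # u" "length u = length \<delta>" by (cases \<omega>) auto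
    show "\<omega> \<in> (#) 0 ` ?T \<union> incr 0 ` ?U"
    proof (cases c)
      case 0
      then have "u \<in> ?T" using \<omega> u by simp
      then show ?thesis using u(1) 0 by blast
    next
      case (Suc c')
      then have "d \<le> n" "wdot (d # \<delta>) (c' # u) = n - d" using \<omega> u by auto
      then have "c' # u \<in> ?U" using \<omega> u Suc by simp
      moreover have "\<omega> = incr 0 (c' # u)" using u Suc by simp
      ultimately show ?thesis by blast
    qed
  next
    fix \<omega> assume "\<omega> \<in> (#) 0 ` ?T \<union> incr 0 ` ?U"
    then show "\<omega> \<in> ?S A n"
    proof
      assume "\<omega> \<in> (#) 0 ` ?T"
      then show ?thesis by auto
    next
      assume "\<omega> \<in> incr 0 ` ?U"
      then obtain v where v: "v \<in> ?U" "\<omega> = incr 0 v" by blast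
      show ?thesis using wdot_incr[of 0 "d # \<delta>" v] U[OF v(1)] v(2) by simp
    qed
  qed
  moreover have "(#) 0 ` ?T \<inter> incr 0 ` ?U = {}"
    using U_Cons by fastforce
  moreover have "inj_on (incr 0) ?U"
  proof (rule inj_onI)
    fix v w assume v: "v \<in> ?U" and w: "w \<in> ?U" and "incr 0 v = incr 0 w"
    obtain c u c' u' where "v = c # u" "w = c' # u'" using U_Cons[OF v] U_Cons[OF w] by blast
    with \<open>incr 0 v = incr 0 w\<close> show "v = w" by simp
  qed
  moreover have "finite ?T" "finite ?U"
    using finite_cocount[of \<delta> "{\<omega>. 0 # \<omega> \<in> A}" n] assms
      finite_cocount[OF assms, of "{\<omega>. incr 0 \<omega> \<in> A}" "n - d"] by simp_all
  ultimately have "card (?S A n) = card ?T + card ?U"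
    by (metis (no_types, lifting) card_Un_disjoint card_image finite_imageI inj_on_Cons1)
  then show ?thesis
    by (cases "d \<le> n") (simp_all add: cocount_def)
qed

text \<open>The slices of \<open>A\<close> at first entry \<open>c\<close> grow with
  \<open>c\<close>. If they jumped for arbitrarily large \<open>c\<close>, Dickson's lemma would
  find two comparable jumps, and the earlier one would force the later vector into \<open>A\<close>
  before its jump.\<close>

lemma upset_slices_stabilize:
  assumes "upset (Suc N) A"
  shows "\<exists>c0. \<forall>c\<ge>c0. \<forall>\<omega>. length \<omega> = N \<longrightarrow> (Suc c # \<omega> \<in> A \<longleftrightarrow> c # \<omega> \<in> A)"
proof (rule ccontr)
  have up: "Suc c # \<omega> \<in> A" if "c # \<omega> \<in> A" "length \<omega> = N" for c \<omega>
    using upsetD[OF assms, of "c # \<omega>" 0] that by simp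
  assume neg: "\<not> ?thesis"
  have ex: "\<exists>p. fst p \<ge> c0 \<and> length (snd p) = N \<and> Suc (fst p) # snd p \<in> A \<and> fst p # snd p \<notin> A" for c0
  proof (rule ccontr)
    assume none: "\<not> ?thesis"
    have "Suc c # \<omega> \<in> A \<longleftrightarrow> c # \<omega> \<in> A" if "c \<ge> c0" "length \<omega> = N" for c \<omega>
    proof (rule ccontr)
      assume "\<not> ?thesis"
      then have "Suc c # \<omega> \<in> A \<and> c # \<omega> \<notin> A" using up[of c \<omega>] that by blast
      then have "\<exists>p. fst p \<ge> c0 \<and> length (snd p) = N \<and> Suc (fst p) # snd p \<in> A \<and> fst p # snd p \<notin> A"
        using that by (intro exI[of _ "(c, \<omega>)"]) simp
      with none show False by (rule notE)
    qed
    then have "\<forall>c\<ge>c0. \<forall>\<omega>. length \<omega> = N \<longrightarrow> (Suc c # \<omega> \<in> A \<longleftrightarrow> c # \<omega> \<in> A)" by simp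
    then show False using neg by (rule exI[THEN notE[rotated]])
  qed
  define P where "P c0 = (SOME p. fst p \<ge> c0 \<and> length (snd p) = N \<and> Suc (fst p) # snd p \<in> A \<and> fst p # snd p \<notin> A)" for c0
  have P: "fst (P c0) \<ge> c0 \<and> length (snd (P c0)) = N
      \<and> Suc (fst (P c0)) # snd (P c0) \<in> A \<and> fst (P c0) # snd (P c0) \<notin> A" for c0
    unfolding P_def by (rule someI_ex[OF ex])
  define C W where "C = (\<lambda>c0. fst (P c0))" and "W = (\<lambda>c0. snd (P c0))"
  have CW: "\<And>c0. C c0 \<ge> c0" "\<And>c0. length (W c0) = N"
      "\<And>c0. Suc (C c0) # W c0 \<in> A" "\<And>c0. C c0 # W c0 \<notin> A"
    using P by (auto simp: C_def W_def)
  from dickson[of W, OF CW(2)]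
  obtain r :: "nat \<Rightarrow> nat" where r: "strict_mono r" "\<forall>i j. i \<le> j \<longrightarrow> list_all2 (\<le>) (W (r i)) (W (r j))"
    by (elim exE conjE)
  \<comment> \<open>The second index is so large that \<open>C ?j\<close> is at least
    \<open>Suc (C ?i)\<close>, the first entry after the earlier jump.\<close>
  let ?i = "r 0" and ?j = "r (Suc (C (r 0)))"
  have "Suc (C ?i) \<le> ?j" using r(1) by (rule strict_mono_imp_increasing)
  also have "\<dots> \<le> C ?j" by (rule CW(1))
  finally have "list_all2 (\<le>) (Suc (C ?i) # W ?i) (C ?j # W ?j)" using r(2) by simp
  from upset_ge[OF assms this CW(3)] have "C ?j # W ?j \<in> A" using CW(2) by simp
  then show False using CW(4) by blast
qed

text \<open>Outer induction on the number of variables, inner induction on the index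
  \<open>c0\<close> from which the slices are constant. Passing to the colon ideal of the first
  variable lowers \<open>c0\<close> by one; for \<open>c0 = 0\<close> it changes no vector of the
  relevant length, and the recursion turns into an equation for \<open>H A\<close> times
  \<open>1 - X^d\<close>.\<close>

lemma cocount_rational:
  assumes "\<forall>d\<in>set \<delta>. d > 0" "upset (length \<delta>) A"
  shows "is_rational_series (Abs_fps (\<lambda>n. of_nat (cocount \<delta> A n)))"
  using assms
proof (induction \<delta> arbitrary: A)
  case Nil
  have "{\<omega>. length \<omega> = length [] \<and> \<omega> \<notin> A \<and> wdot [] \<omega> = n}
      = (if n = 0 \<and> [] \<notin> A then {[]} else {})" for n
    by auto
  then have "Abs_fps (\<lambda>n. rat_of_nat (cocount [] A n)) = fps_of_poly [:if [] \<notin> A then 1 else 0:]"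
    by (intro fps_ext) (auto simp: cocount_def coeff_pCons split: nat.splits)
  then show ?case by (simp only: is_rational_series_poly)
next
  case (Cons d \<delta>)
  define H where "H A = Abs_fps (\<lambda>n. of_nat (cocount (d # \<delta>) A n) :: rat)" for A
  have pos: "\<forall>d\<in>set \<delta>. d > 0" "d > 0" using Cons.prems by auto
  have slice: "is_rational_series (Abs_fps (\<lambda>n. of_nat (cocount \<delta> {\<omega>. 0 # \<omega> \<in> A} n)))"
    if A: "upset (Suc (length \<delta>)) A" for A
  proof (rule Cons.IH[OF pos(1)])
    show "upset (length \<delta>) {\<omega>. 0 # \<omega> \<in> A}"
      unfolding upset_def
    proof safe
      fix u l assume "0 # u \<in> A" "l < length \<delta>" "length u = length \<delta>"
      then have "incr (Suc l) (0 # u) \<in> A"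
        by (intro upsetD[OF A]) auto
      then show "0 # incr l u \<in> A" by simp
    qed
  qed
  have rec: "H A = Abs_fps (\<lambda>n. of_nat (cocount \<delta> {\<omega>. 0 # \<omega> \<in> A} n)) + fps_X ^ d * H {\<omega>. incr 0 \<omega> \<in> A}" for A
  proof (rule fps_ext)
    fix n
    show "H A $ n = (Abs_fps (\<lambda>n. of_nat (cocount \<delta> {\<omega>. 0 # \<omega> \<in> A} n)) + fps_X ^ d * H {\<omega>. incr 0 \<omega> \<in> A}) $ n"
      using cocount_Cons[OF Cons.prems(1), of A n]
      by (simp add: H_def fps_X_power_mult_nth)
  qed
  have main: "is_rational_series (H A)"
    if "upset (Suc (length \<delta>)) A"
      "\<And>(c :: nat) (\<omega> :: nat list). c \<ge> c0 \<Longrightarrow> length \<omega> = length \<delta> \<Longrightarrow> (Suc c # \<omega> \<in> A \<longleftrightarrow> c # \<omega> \<in> A)" for A c0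
    using that
  proof (induction c0 arbitrary: A)
    case 0
    have "incr 0 \<omega> \<in> A \<longleftrightarrow> \<omega> \<in> A" if "length \<omega> = Suc (length \<delta>)" for \<omega>
      using that "0.prems"(2) by (auto simp: length_Suc_conv)
    then have "cocount (d # \<delta>) {\<omega>. incr 0 \<omega> \<in> A} n = cocount (d # \<delta>) A n" for n
      unfolding cocount_def by (intro arg_cong[where f = card]) auto
    then have "H {\<omega>. incr 0 \<omega> \<in> A} = H A" by (simp add: H_def)
    with rec[of A] have "H A * fps_of_poly (1 - Polynomial.monom 1 d) = Abs_fps (\<lambda>n. of_nat (cocount \<delta> {\<omega>. 0 # \<omega> \<in> A} n))"
      by (simp add: fps_of_poly_diff fps_of_poly_monom' algebra_simps)
    moreover have "1 - Polynomial.monom 1 d \<noteq> (0 :: rat poly)"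
    proof
      assume "1 - Polynomial.monom 1 d = (0 :: rat poly)"
      then have "poly.coeff (1 - Polynomial.monom 1 d :: rat poly) d = 0" by simp
      then show False using pos(2) by simp
    qed
    ultimately show ?case
      by (intro is_rational_series_cancel[of "H A" "1 - Polynomial.monom 1 d"]) (simp_all add: slice[OF "0.prems"(1)])
  next
    case (Suc c0)
    have "is_rational_series (H {\<omega>. incr 0 \<omega> \<in> A})"
    proof (rule Suc.IH)
      show "upset (Suc (length \<delta>)) {\<omega>. incr 0 \<omega> \<in> A}"
        unfolding upset_def
      proof safe
        fix \<omega> l assume "incr 0 \<omega> \<in> A" "length \<omega> = Suc (length \<delta>)" "l < Suc (length \<delta>)"
        then have "incr l (incr 0 \<omega>) \<in> A" by (intro upsetD[OF Suc.prems(1), of "incr 0 \<omega>" l]) auto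
        moreover have "incr l (incr 0 \<omega>) = incr 0 (incr l \<omega>)"
          using \<open>length \<omega> = Suc (length \<delta>)\<close> by (cases \<omega>; cases l) auto
        ultimately show "incr 0 (incr l \<omega>) \<in> A" by simp
      qed
    next
      fix c :: nat and \<omega> :: "nat list" assume "c \<ge> c0" "length \<omega> = length \<delta>"
      then show "(Suc c # \<omega> \<in> {\<omega>. incr 0 \<omega> \<in> A}) = (c # \<omega> \<in> {\<omega>. incr 0 \<omega> \<in> A})"
        using Suc.prems(2)[of "Suc c" \<omega>] by simp
    qed
    then have "is_rational_series (fps_X ^ d * H {\<omega>. incr 0 \<omega> \<in> A})"
      by (rule is_rational_series_X_power_mult)
    with slice[OF Suc.prems(1)] show ?case
      by (subst rec) (rule is_rational_series_add)
  qed
  have up: "upset (Suc (length \<delta>)) A" using Cons.prems(2) by simp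
  from upset_slices_stabilize[OF up] obtain c0
    where c0: "\<forall>c\<ge>c0. \<forall>\<omega>. length \<omega> = length \<delta> \<longrightarrow> (Suc c # \<omega> \<in> A \<longleftrightarrow> c # \<omega> \<in> A)" ..
  have "is_rational_series (H A)" by (rule main[OF up, of c0]) (use c0 in blast)
  then show ?case unfolding H_def .
qed

section \<open>Dimension relative to a subspace\<close>

text \<open>
  A separate locale, because definitions made in \<open>vector_space\<close> itself would be shadowed by their
  copies in the class \<open>real_vector\<close>.
\<close>

locale rel_vector_space = vector_space
begin

lemma ex_linear_projection:
  assumes "subspace J"
  shows "\<exists>p. Vector_Spaces.linear scale scale p \<and> (\<forall>x. p x \<in> J) \<and> (\<forall>x\<in>J. p x = x)"
proof -
  interpret vp: vector_space_pair scale scale ..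
  obtain B where B: "B \<subseteq> J" "independent B" "J \<subseteq> span B"
    using basis_exists[of J] by metis
  obtain p where p: "Vector_Spaces.linear scale scale p" "\<forall>x\<in>B. p x = x" "range p = span B"
    using vp.linear_independent_extend_subspace[OF B(2), of id] by auto
  interpret p: Vector_Spaces.linear scale scale p by (fact p(1))
  have J: "J = span B" using B assms by (simp add: span_minimal subset_antisym)
  have "p x = x" if "x \<in> J" for x
    using that unfolding J by (induction rule: span_induct_alt) (simp_all add: p.add p.scale p(2))
  then show ?thesis using p(1,3) J by blast
qed

lemma ex_linear_kernel:
  assumes "subspace J"
  shows "\<exists>f. Vector_Spaces.linear scale scale f \<and> (\<forall>x. f x = 0 \<longleftrightarrow> x \<in> J)"
proof -
  obtain p where p: "Vector_Spaces.linear scale scale p" "\<And>x. p x \<in> J" "\<And>x. x \<in> J \<Longrightarrow> p x = x"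
    using ex_linear_projection[OF assms] by blast
  interpret p: Vector_Spaces.linear scale scale p by (fact p(1))
  have "Vector_Spaces.linear scale scale (\<lambda>x. x - p x)"
    by unfold_locales (simp_all add: p.add p.scale algebra_simps scale_right_diff_distrib)
  moreover have "x - p x = 0 \<longleftrightarrow> x \<in> J" for x
    using p(2)[of x] p(3)[of x] by auto
  ultimately show ?thesis by (intro exI[of _ "\<lambda>x. x - p x"]) simp
qed

text \<open>A model of the quotient by \<open>J\<close> inside the same space: a chosen linear
  endomorphism with kernel \<open>J\<close>, such as \<open>x - p x\<close> for a projection
  \<open>p\<close> onto \<open>J\<close>.\<close>

definition qmap :: "'b set \<Rightarrow> 'b \<Rightarrow> 'b"
  where "qmap J = (SOME f. Vector_Spaces.linear scale scale f \<and> (\<forall>x. f x = 0 \<longleftrightarrow> x \<in> J))"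

lemma linear_qmap: "subspace J \<Longrightarrow> Vector_Spaces.linear scale scale (qmap J)"
  and qmap_eq_0_iff: "subspace J \<Longrightarrow> qmap J x = 0 \<longleftrightarrow> x \<in> J"
  unfolding qmap_def using someI_ex[OF ex_linear_kernel[of J]] by simp_all

lemma qmap_eq_iff:
  assumes "subspace J"
  shows "qmap J x = qmap J y \<longleftrightarrow> x - y \<in> J"
proof -
  interpret q: Vector_Spaces.linear scale scale "qmap J" by (rule linear_qmap[OF assms])
  show ?thesis using qmap_eq_0_iff[OF assms, of "x - y"] by (simp add: q.diff)
qed

definition rdim :: "'b set \<Rightarrow> 'b set \<Rightarrow> nat"
  where "rdim J V = dim (qmap J ` V)"

text \<open>A basis of the image of \<open>V\<close> modulo \<open>J\<close>, as an indexed family: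
  in the main application the indices are pairs of a generator and an exponent vector, and it is
  these that get counted.\<close>

definition rel_basis :: "'b set \<Rightarrow> 'b set \<Rightarrow> 'i set \<Rightarrow> ('i \<Rightarrow> 'b) \<Rightarrow> bool"
  where "rel_basis J V A v \<longleftrightarrow> finite A \<and> v ` A \<subseteq> V \<and>
    (\<forall>x\<in>V. \<exists>a. x - (\<Sum>i\<in>A. a i *s v i) \<in> J) \<and>
    (\<forall>a. (\<Sum>i\<in>A. a i *s v i) \<in> J \<longrightarrow> (\<forall>i\<in>A. a i = 0))"

definition rel_fg :: "'b set \<Rightarrow> 'b set \<Rightarrow> bool"
  where "rel_fg J V \<longleftrightarrow> (\<exists>F. finite F \<and> (\<forall>x\<in>V. \<exists>y\<in>span F. x - y \<in> J))"

lemma rdim_eq_card: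
  assumes J: "subspace J" and b: "rel_basis J V A v"
  shows "rdim J V = card A"
proof -
  interpret q: Vector_Spaces.linear scale scale "qmap J" by (rule linear_qmap[OF J])
  have fin: "finite A" and V: "v ` A \<subseteq> V" and sp: "\<forall>x\<in>V. \<exists>a. x - (\<Sum>i\<in>A. a i *s v i) \<in> J"
    and ind: "\<And>a. (\<Sum>i\<in>A. a i *s v i) \<in> J \<Longrightarrow> \<forall>i\<in>A. a i = 0"
    using b unfolding rel_basis_def by simp_all
  let ?w = "\<lambda>i. qmap J (v i)"
  have qsum: "qmap J (\<Sum>i\<in>A. a i *s v i) = (\<Sum>i\<in>A. a i *s ?w i)" for a
    by (simp add: q.sum q.scale)
  have inj: "inj_on ?w A"
  proof (rule inj_onI, rule ccontr)
    fix i j assume ij: "i \<in> A" "j \<in> A" "?w i = ?w j" "i \<noteq> j"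
    have "v i - v j \<in> J" using ij(3) qmap_eq_iff[OF J] by simp
    moreover have "(\<Sum>l\<in>A. (if l = i then 1 else if l = j then -1 else 0) *s v l) = v i - v j"
    proof -
      have "(\<Sum>l\<in>A. (if l = i then 1 else if l = j then -1 else 0) *s v l)
          = (\<Sum>l\<in>A. (if l = i then v l else 0) - (if l = j then v l else 0))"
        using ij(4) by (intro sum.cong) auto
      also have "\<dots> = v i - v j" using ij fin by (simp add: sum_subtractf)
      finally show ?thesis .
    qed
    ultimately have "\<forall>l\<in>A. (if l = i then 1 else if l = j then -1 else 0 :: 'a) = 0"
      by (intro ind) simp
    then show False using ij(1) by force
  qed
  have indep: "independent (?w ` A)"
  proof
    assume "dependent (?w ` A)"
    then obtain u where u: "\<exists>x\<in>?w ` A. u x \<noteq> 0" "(\<Sum>x\<in>?w ` A. u x *s x) = 0"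
      using dependent_finite[of "?w ` A"] fin by auto
    have "(\<Sum>i\<in>A. u (?w i) *s ?w i) = 0"
      using u(2) by (simp add: sum.reindex[OF inj])
    then have "qmap J (\<Sum>i\<in>A. u (?w i) *s v i) = 0" by (simp add: qsum)
    then have "(\<Sum>i\<in>A. u (?w i) *s v i) \<in> J" using qmap_eq_0_iff[OF J] by simp
    from ind[OF this] u(1) show False by auto
  qed
  have "qmap J ` V \<subseteq> span (?w ` A)"
  proof
    fix y assume "y \<in> qmap J ` V"
    then obtain x where x: "x \<in> V" "y = qmap J x" by auto
    obtain a where "x - (\<Sum>i\<in>A. a i *s v i) \<in> J" using sp x(1) by blast
    then have "qmap J x = qmap J (\<Sum>i\<in>A. a i *s v i)" by (rule iffD2[OF qmap_eq_iff[OF J]])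
    then have "y = (\<Sum>i\<in>A. a i *s ?w i)" using x(2) by (simp only: qsum)
    moreover have "(\<Sum>i\<in>A. a i *s ?w i) \<in> span (?w ` A)" by (intro span_sum span_scale span_base imageI)
    ultimately show "y \<in> span (?w ` A)" by simp
  qed
  then have "card (?w ` A) = dim (qmap J ` V)"
    using V indep by (intro basis_card_eq_dim) auto
  then show ?thesis by (simp add: rdim_def card_image[OF inj])
qed

lemma rel_basis_exists:
  assumes J: "subspace J" and fg: "rel_fg J V"
  shows "\<exists>A. rel_basis J V A (\<lambda>x. x)"
proof -
  interpret q: Vector_Spaces.linear scale scale "qmap J" by (rule linear_qmap[OF J])
  obtain F where F: "finite F" "\<forall>x\<in>V. \<exists>y\<in>span F. x - y \<in> J"
    using fg unfolding rel_fg_def by blast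
  obtain B where B: "B \<subseteq> qmap J ` V" "independent B" "qmap J ` V \<subseteq> span B"
    using basis_exists[of "qmap J ` V"] by metis
  have "qmap J ` V \<subseteq> span (qmap J ` F)"
  proof
    fix z assume "z \<in> qmap J ` V"
    then obtain x where x: "x \<in> V" "z = qmap J x" by auto
    obtain y where y: "y \<in> span F" "x - y \<in> J" using F(2) x(1) by blast
    then have "z = qmap J y" using x(2) qmap_eq_iff[OF J] by simp
    then show "z \<in> span (qmap J ` F)" using y(1) q.span_image by blast
  qed
  then have "finite B" using independent_span_bound[of "qmap J ` F" B] F(1) B by auto
  define r where "r = inv_into V (qmap J)"
  have r: "r b \<in> V" "qmap J (r b) = b" if "b \<in> B" for b
    using that B(1) unfolding r_def by (auto intro: inv_into_into f_inv_into_f)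
  have inj: "inj_on r B" by (rule inj_on_inverseI[of _ "qmap J"]) (rule r)
  have reindex: "(\<Sum>x\<in>r ` B. a x *s x) = (\<Sum>b\<in>B. a (r b) *s r b)" for a
    by (simp add: sum.reindex[OF inj])
  have qsum: "qmap J (\<Sum>b\<in>B. a b *s r b) = (\<Sum>b\<in>B. a b *s b)" for a
    by (simp add: q.sum q.scale r)
  have "rel_basis J V (r ` B) (\<lambda>x. x)"
    unfolding rel_basis_def
  proof (intro conjI ballI allI impI)
    show "finite (r ` B)" using \<open>finite B\<close> by simp
    show "(\<lambda>x. x) ` r ` B \<subseteq> V" using r by auto
  next
    fix x assume "x \<in> V"
    then have "qmap J x \<in> span B" using B(3) by auto
    then obtain u where "qmap J x = (\<Sum>b\<in>B. u b *s b)"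
      using span_finite[OF \<open>finite B\<close>] by auto
    then have "qmap J x = qmap J (\<Sum>b\<in>B. u b *s r b)" by (simp only: qsum)
    then have "x - (\<Sum>b\<in>B. u b *s r b) \<in> J" by (rule iffD1[OF qmap_eq_iff[OF J]])
    moreover have "(\<Sum>y\<in>r ` B. u (qmap J y) *s y) = (\<Sum>b\<in>B. u b *s r b)"
      by (simp add: reindex r)
    ultimately show "\<exists>a. x - (\<Sum>y\<in>r ` B. a y *s y) \<in> J" by metis
  next
    fix a y assume "(\<Sum>y\<in>r ` B. a y *s y) \<in> J" "y \<in> r ` B"
    then have "qmap J (\<Sum>b\<in>B. a (r b) *s r b) = 0" by (simp add: reindex qmap_eq_0_iff[OF J])
    then have "(\<Sum>b\<in>B. a (r b) *s b) = 0" by (simp only: qsum)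
    then have "a (r b) = 0" if "b \<in> B" for b
      using independentD[OF B(2) \<open>finite B\<close> subset_refl, of "\<lambda>b. a (r b)"] that by simp
    then show "a y = 0" using \<open>y \<in> r ` B\<close> by auto
  qed
  then show ?thesis by blast
qed

lemma rel_fg_subset: "rel_fg J V \<Longrightarrow> V' \<subseteq> V \<Longrightarrow> J \<subseteq> J' \<Longrightarrow> rel_fg J' V'"
  unfolding rel_fg_def by (meson subset_iff)

lemma rdim_cong:
  assumes "subspace J" "\<And>x. x \<in> V \<Longrightarrow> \<exists>y\<in>V'. x - y \<in> J" "\<And>y. y \<in> V' \<Longrightarrow> \<exists>x\<in>V. x - y \<in> J"
  shows "rdim J V = rdim J V'"
proof -
  have "qmap J ` V = qmap J ` V'"
  proof (intro equalityI subsetI)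
    fix z assume "z \<in> qmap J ` V"
    then obtain x where x: "x \<in> V" "z = qmap J x" by blast
    obtain y where y: "y \<in> V'" "x - y \<in> J" using assms(2)[OF x(1)] by blast
    have "z = qmap J y" unfolding x(2) using y(2) by (rule iffD2[OF qmap_eq_iff[OF assms(1)]])
    then show "z \<in> qmap J ` V'" using y(1) by (rule image_eqI)
  next
    fix z assume "z \<in> qmap J ` V'"
    then obtain y where y: "y \<in> V'" "z = qmap J y" by blast
    obtain x where x: "x \<in> V" "x - y \<in> J" using assms(3)[OF y(1)] by blast
    have "z = qmap J x" unfolding y(2) using x(2) by (rule iffD2[OF qmap_eq_iff[OF assms(1)], symmetric])
    then show "z \<in> qmap J ` V" using x(1) by (rule image_eqI)
  qed
  then show ?thesis by (simp add: rdim_def)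
qed

text \<open>A basis of \<open>V \<inter> K\<close> modulo \<open>J\<close> and a basis of
  \<open>V\<close> modulo \<open>K\<close> together form a basis of \<open>V\<close> modulo
  \<open>J\<close>. This additivity later turns a rank into a difference of two Hilbert
  functions.\<close>

lemma rdim_add:
  assumes J: "subspace J" and K: "subspace K" and V: "subspace V" and JK: "J \<subseteq> K" and fg: "rel_fg J V"
  shows "rdim J V = rdim J (V \<inter> K) + rdim K V"
proof -
  obtain A where A: "rel_basis J (V \<inter> K) A (\<lambda>x. x)"
    using rel_basis_exists[OF J rel_fg_subset[OF fg, of "V \<inter> K" J]] by auto
  obtain C where C: "rel_basis K V C (\<lambda>x. x)"
    using rel_basis_exists[OF K rel_fg_subset[OF fg, of V K]] JK by auto
  have finA: "finite A" and AV: "A \<subseteq> V \<inter> K" and spA: "\<forall>x\<in>V \<inter> K. \<exists>a. x - (\<Sum>i\<in>A. a i *s i) \<in> J"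
    and indA: "\<And>a. (\<Sum>i\<in>A. a i *s i) \<in> J \<Longrightarrow> \<forall>i\<in>A. a i = 0"
    using A unfolding rel_basis_def by simp_all
  have finC: "finite C" and CV: "C \<subseteq> V" and spC: "\<forall>x\<in>V. \<exists>a. x - (\<Sum>i\<in>C. a i *s i) \<in> K"
    and indC: "\<And>a. (\<Sum>i\<in>C. a i *s i) \<in> K \<Longrightarrow> \<forall>i\<in>C. a i = 0"
    using C unfolding rel_basis_def by simp_all
  have disj: "A \<inter> C = {}"
  proof (rule ccontr)
    assume "A \<inter> C \<noteq> {}"
    then obtain c where c: "c \<in> A" "c \<in> C" by auto
    have "(\<Sum>i\<in>C. (if i = c then 1 else 0) *s i) = (\<Sum>i\<in>C. if i = c then i else 0)"
      by (intro sum.cong) auto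
    also have "\<dots> = c" using c finC by simp
    finally have "\<forall>i\<in>C. (if i = c then 1 else 0 :: 'a) = 0"
      using c AV by (intro indC) auto
    then show False using c(2) by force
  qed
  have union: "(\<Sum>i\<in>A \<union> C. a i *s i) = (\<Sum>i\<in>A. a i *s i) + (\<Sum>i\<in>C. a i *s i)" for a
    using finA finC disj by (rule sum.union_disjoint)
  have "rel_basis J V (A \<union> C) (\<lambda>x. x)"
    unfolding rel_basis_def
  proof (intro conjI ballI allI impI)
    show "finite (A \<union> C)" using finA finC by simp
    show "(\<lambda>x. x) ` (A \<union> C) \<subseteq> V" using AV CV by auto
  next
    fix x assume x: "x \<in> V"
    obtain c where c: "x - (\<Sum>i\<in>C. c i *s i) \<in> K" using spC x by blast
    have "x - (\<Sum>i\<in>C. c i *s i) \<in> V"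
      using x CV by (intro subspace_diff[OF V] subspace_sum[OF V] subspace_scale[OF V]) auto
    with c have "x - (\<Sum>i\<in>C. c i *s i) \<in> V \<inter> K" by simp
    from bspec[OF spA this] obtain a where a: "x - (\<Sum>i\<in>C. c i *s i) - (\<Sum>i\<in>A. a i *s i) \<in> J" ..
    let ?e = "\<lambda>i. if i \<in> A then a i else c i"
    have "(\<Sum>i\<in>A. ?e i *s i) = (\<Sum>i\<in>A. a i *s i)" by (intro sum.cong) auto
    moreover have "(\<Sum>i\<in>C. ?e i *s i) = (\<Sum>i\<in>C. c i *s i)" using disj by (intro sum.cong) auto
    ultimately have "x - (\<Sum>i\<in>A \<union> C. ?e i *s i) = x - (\<Sum>i\<in>C. c i *s i) - (\<Sum>i\<in>A. a i *s i)"
      unfolding union by (simp add: algebra_simps)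
    with a have "x - (\<Sum>i\<in>A \<union> C. ?e i *s i) \<in> J" by (simp only:)
    then show "\<exists>a. x - (\<Sum>i\<in>A \<union> C. a i *s i) \<in> J" by (rule exI[of _ ?e])
  next
    fix a y assume s: "(\<Sum>i\<in>A \<union> C. a i *s i) \<in> J" and y: "y \<in> A \<union> C"
    have "(\<Sum>i\<in>A. a i *s i) \<in> K"
      using AV by (intro subspace_sum[OF K] subspace_scale[OF K]) auto
    moreover have "(\<Sum>i\<in>C. a i *s i) = (\<Sum>i\<in>A \<union> C. a i *s i) - (\<Sum>i\<in>A. a i *s i)"
      by (simp add: union)
    ultimately have "(\<Sum>i\<in>C. a i *s i) \<in> K" using s JK subspace_diff[OF K] by auto
    from indC[OF this] have zC: "\<forall>i\<in>C. a i = 0" .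
    then have "(\<Sum>i\<in>A. a i *s i) \<in> J" using s by (simp add: union)
    from indA[OF this] zC y show "a y = 0" by auto
  qed
  then have "rdim J V = card (A \<union> C)" by (rule rdim_eq_card[OF J])
  also have "\<dots> = card A + card C" using finA finC disj by (rule card_Un_disjoint)
  also have "card A = rdim J (V \<inter> K)" using rdim_eq_card[OF J A] by simp
  also have "card C = rdim K V" using rdim_eq_card[OF K C] by simp
  finally show ?thesis .
qed

text \<open>Whether a combination of elements of \<open>V\<close> lies in the subspace depends only
  on the intersection with \<open>V\<close>, so a relative basis for \<open>J\<close> is one for
  \<open>K\<close>. This permits replacing a subspace that grows with \<open>n\<close> by the
  union.\<close>

lemma rdim_eq_if_Int_eq:
  assumes J: "subspace J" and K: "subspace K" and V: "subspace V" and eq: "V \<inter> J = V \<inter> K" and fg: "rel_fg J V"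
  shows "rdim J V = rdim K V"
proof -
  obtain A where A: "rel_basis J V A (\<lambda>x. x)" using rel_basis_exists[OF J fg] by blast
  have AV: "A \<subseteq> V" using A by (auto simp: rel_basis_def)
  have sV: "(\<Sum>i\<in>A. a i *s i) \<in> V" for a
    using AV by (intro subspace_sum[OF V] subspace_scale[OF V]) auto
  have "x - (\<Sum>i\<in>A. a i *s i) \<in> J \<longleftrightarrow> x - (\<Sum>i\<in>A. a i *s i) \<in> K" if "x \<in> V" for x a
    using eq subspace_diff[OF V that sV] by blast
  moreover have "(\<Sum>i\<in>A. a i *s i) \<in> J \<longleftrightarrow> (\<Sum>i\<in>A. a i *s i) \<in> K" for a
    using eq sV by blast
  ultimately have "rel_basis K V A (\<lambda>x. x)" using A unfolding rel_basis_def by simp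
  from rdim_eq_card[OF K this] rdim_eq_card[OF J A] show ?thesis by simp
qed

definition comb :: "'b set \<Rightarrow> 'i set \<Rightarrow> ('i \<Rightarrow> 'b) \<Rightarrow> 'b set"
  where "comb K A v = {x. \<exists>a. x - (\<Sum>p\<in>A. a p *s v p) \<in> K}"

lemma combI: "x - (\<Sum>p\<in>A. a p *s v p) \<in> K \<Longrightarrow> x \<in> comb K A v"
  unfolding comb_def by (intro CollectI exI)

lemma subspace_comb:
  assumes K: "subspace K"
  shows "subspace (comb K A v)"
proof (rule subspaceI)
  show "0 \<in> comb K A v" by (rule combI[of _ "\<lambda>_. 0"]) (simp add: subspace_0[OF K])
next
  fix x y assume "x \<in> comb K A v" "y \<in> comb K A v"
  then obtain a b where ab: "x - (\<Sum>p\<in>A. a p *s v p) \<in> K" "y - (\<Sum>p\<in>A. b p *s v p) \<in> K"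
    unfolding comb_def by blast
  have "x + y - (\<Sum>p\<in>A. (a p + b p) *s v p) = (x - (\<Sum>p\<in>A. a p *s v p)) + (y - (\<Sum>p\<in>A. b p *s v p))"
    by (simp add: scale_left_distrib sum.distrib algebra_simps)
  then have "x + y - (\<Sum>p\<in>A. (a p + b p) *s v p) \<in> K" using subspace_add[OF K ab] by (simp only:)
  then show "x + y \<in> comb K A v" by (rule combI)
next
  fix c x assume "x \<in> comb K A v"
  then obtain a where a: "x - (\<Sum>p\<in>A. a p *s v p) \<in> K"
    unfolding comb_def by blast
  have "c *s x - (\<Sum>p\<in>A. (c * a p) *s v p) = c *s (x - (\<Sum>p\<in>A. a p *s v p))"
    by (simp add: scale_right_diff_distrib scale_sum_right)
  then have "c *s x - (\<Sum>p\<in>A. (c * a p) *s v p) \<in> K" using subspace_scale[OF K a] by simp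
  then show "c *s x \<in> comb K A v" by (rule combI)
qed

lemma comb_base:
  assumes K: "subspace K" and p: "p \<in> A" "finite A"
  shows "v p \<in> comb K A v"
proof -
  have "(\<Sum>q\<in>A. (if q = p then 1 else 0) *s v q) = (\<Sum>q\<in>A. if q = p then v q else 0)"
    by (intro sum.cong) auto
  also have "\<dots> = v p" using p by simp
  finally have "v p - (\<Sum>q\<in>A. (if q = p then 1 else 0) *s v q) \<in> K" using subspace_0[OF K] by simp
  then show ?thesis by (rule combI)
qed

lemma subset_comb: "K \<subseteq> comb K A v"
  by (intro subsetI combI[of _ "\<lambda>_. 0"]) simp

end

section \<open>Filtered families\<close>

fun lex_less :: "nat list \<Rightarrow> nat list \<Rightarrow> bool" where
  "lex_less (a # x) (b # y) \<longleftrightarrow> a < b \<or> a = b \<and> lex_less x y"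
| "lex_less _ _ \<longleftrightarrow> False"

lemma lex_less_irrefl: "\<not> lex_less x x"
  by (induction x) auto

lemma lex_less_trans: "lex_less x y \<Longrightarrow> lex_less y z \<Longrightarrow> lex_less x z"
proof (induction x y arbitrary: z rule: lex_less.induct)
  case (1 a x b y)
  then show ?case by (cases z) auto
qed auto

lemma lex_less_total: "length x = length y \<Longrightarrow> x \<noteq> y \<Longrightarrow> lex_less x y \<or> lex_less y x"
  by (induction x y rule: list_induct2) auto

lemma lex_less_incr: "lex_less x y \<Longrightarrow> length x = length y \<Longrightarrow> l < length x \<Longrightarrow> lex_less (incr l x) (incr l y)"
proof (induction x y arbitrary: l rule: lex_less.induct)
  case (1 a x b y)
  then show ?case by (cases l) auto
qed auto

lemma incr_inject: "incr l x = incr l y \<Longrightarrow> length x = length y \<Longrightarrow> l < length x \<Longrightarrow> x = y"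
proof (induction x arbitrary: l y)
  case (Cons a x)
  then obtain b y' where "y = b # y'" by (cases y) auto
  with Cons show ?case by (cases l) auto
qed simp

text \<open>A monomial order on a free module, comparing exponents before generators. It is total on
  vectors of one length and compatible with incrementing an exponent.\<close>

definition pair_less :: "nat \<times> nat list \<Rightarrow> nat \<times> nat list \<Rightarrow> bool"
  where "pair_less p q \<longleftrightarrow> lex_less (snd p) (snd q) \<or> snd p = snd q \<and> fst p < fst q"

lemma pair_less_irrefl: "\<not> pair_less p p"
  by (simp add: pair_less_def lex_less_irrefl)

lemma pair_less_trans: "pair_less p q \<Longrightarrow> pair_less q s \<Longrightarrow> pair_less p s"
  unfolding pair_less_def using lex_less_trans[of "snd p" "snd q" "snd s"] by auto

lemma pair_less_total: "length (snd p) = length (snd q) \<Longrightarrow> p \<noteq> q \<Longrightarrow> pair_less p q \<or> pair_less q p"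
  unfolding pair_less_def using lex_less_total[of "snd p" "snd q"] by (cases "snd p = snd q") (auto simp: prod_eq_iff)

definition pair_incr :: "nat \<Rightarrow> nat \<times> nat list \<Rightarrow> nat \<times> nat list"
  where "pair_incr l p = (fst p, incr l (snd p))"

lemma pair_less_incr:
  "pair_less p q \<Longrightarrow> length (snd p) = length (snd q) \<Longrightarrow> l < length (snd p) \<Longrightarrow>
    pair_less (pair_incr l p) (pair_incr l q)"
  unfolding pair_less_def pair_incr_def using lex_less_incr by auto

definition graded_index ::
    "nat \<Rightarrow> (nat \<Rightarrow> nat) \<Rightarrow> (nat \<Rightarrow> nat) \<Rightarrow> nat list \<Rightarrow> nat list \<Rightarrow> nat \<Rightarrow> nat \<Rightarrow> (nat \<times> nat list) set"
  where "graded_index r dg wg \<delta> \<epsilon> d w = {p. fst p < r \<and> length (snd p) = length \<delta> \<and>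
    dg (fst p) + wdot \<delta> (snd p) = d \<and> wg (fst p) + wdot \<epsilon> (snd p) = w}"

text \<open>
  \<open>U d w\<close> is a decreasing filtration (in \<open>w\<close>) of the degree \<open>d\<close> part, ending in \<open>J\<close>; its graded
  pieces are spanned by the \<open>u (i, \<omega>)\<close>, where \<open>\<omega>\<close> is the exponent vector of a monomial in operators
  of degrees \<open>\<delta>\<close> and weights \<open>\<epsilon>\<close>. The assumption \<open>U_step\<close> expresses that these operators act on the
  associated graded space.
\<close>

locale filtered_family = rel_vector_space scale for scale :: "'a::field \<Rightarrow> 'b::ab_group_add \<Rightarrow> 'b" (infixr "*s" 75) +
  fixes r :: nat and dg wg :: "nat \<Rightarrow> nat" and \<delta> \<epsilon> :: "nat list" and u :: "nat \<times> nat list \<Rightarrow> 'b"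
    and J :: "'b set" and U :: "nat \<Rightarrow> nat \<Rightarrow> 'b set" and B :: "nat \<Rightarrow> nat"
  assumes pos: "\<forall>d\<in>set \<delta>. d > 0"
    and len: "length \<epsilon> = length \<delta>"
    and J: "subspace J"
    and U: "\<And>d w. subspace (U d w)" "\<And>d w. J \<subseteq> U d w" "\<And>d w. U d (Suc w) \<subseteq> U d w" "\<And>d w. B d \<le> w \<Longrightarrow> U d w \<subseteq> J"
    and u_in: "\<And>d w p. p \<in> graded_index r dg wg \<delta> \<epsilon> d w \<Longrightarrow> u p \<in> U d w"
    and U_span: "\<And>d w x. x \<in> U d w \<Longrightarrow> \<exists>a. x - (\<Sum>p\<in>graded_index r dg wg \<delta> \<epsilon> d w. a p *s u p) \<in> U d (Suc w)"
    and U_step: "\<And>d w a l. l < length \<delta> \<Longrightarrow> (\<Sum>p\<in>graded_index r dg wg \<delta> \<epsilon> d w. a p *s u p) \<in> U d (Suc w) \<Longrightarrow>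
      (\<Sum>p\<in>graded_index r dg wg \<delta> \<epsilon> d w. a p *s u (pair_incr l p)) \<in> U (d + \<delta> ! l) (Suc (w + \<epsilon> ! l))"
begin

abbreviation S :: "nat \<Rightarrow> nat \<Rightarrow> (nat \<times> nat list) set"
  where "S \<equiv> graded_index r dg wg \<delta> \<epsilon>"

lemmas S_def = graded_index_def[of r dg wg \<delta> \<epsilon>]

lemma finite_S: "finite (S d w)"
proof (rule finite_subset)
  show "S d w \<subseteq> {..<r} \<times> {\<omega>. length \<omega> = length \<delta> \<and> wdot \<delta> \<omega> \<le> d}"
    unfolding S_def by auto
  show "finite ({..<r} \<times> {\<omega>. length \<omega> = length \<delta> \<and> wdot \<delta> \<omega> \<le> d})"
    using finite_wdot_le[OF pos] by simp
qed

lemma U_antimono: "w \<le> w' \<Longrightarrow> U d w' \<subseteq> U d w"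
  by (rule lift_Suc_antimono_le) (rule U(3))

text \<open>\<open>p\<close> is the leading index of a relation in a graded piece, like a leading
  monomial in the theory of Groebner bases. The other indices correspond to the standard
  monomials.\<close>

definition reducible :: "nat \<times> nat list \<Rightarrow> bool"
  where "reducible p \<longleftrightarrow> (\<exists>d w a. p \<in> S d w \<and> u p - (\<Sum>q\<in>{q \<in> S d w. pair_less q p}. a q *s u q) \<in> U d (Suc w))"

lemma reducibleI:
  "p \<in> S d w \<Longrightarrow> u p - (\<Sum>q\<in>{q \<in> S d w. pair_less q p}. a q *s u q) \<in> U d (Suc w) \<Longrightarrow> reducible p"
  unfolding reducible_def by (intro exI conjI)

lemma S_unique: "p \<in> S d w \<Longrightarrow> p \<in> S d' w' \<Longrightarrow> d = d' \<and> w = w'"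
  by (simp add: S_def)

lemma pair_incr_S: "p \<in> S d w \<Longrightarrow> l < length \<delta> \<Longrightarrow> pair_incr l p \<in> S (d + \<delta> ! l) (w + \<epsilon> ! l)"
  using wdot_incr[of l \<delta> "snd p"] wdot_incr[of l \<epsilon> "snd p"] len by (simp add: S_def pair_incr_def)

lemma inj_pair_incr: "l < length \<delta> \<Longrightarrow> inj_on (pair_incr l) (S d w)"
  by (rule inj_onI) (auto simp: S_def pair_incr_def prod_eq_iff dest: incr_inject)

text \<open>\<open>U_step\<close> carries the relation with leading index \<open>p\<close> to the
  incremented indices, and the order is compatible with this, so the leading index of the new
  relation is \<open>pair_incr l p\<close>. Hence, for each generator, the reducible exponents form
  an up-set.\<close>

lemma reducible_incr:
  assumes "reducible p" "l < length \<delta>"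
  shows "reducible (pair_incr l p)"
proof -
  obtain d w a where p: "p \<in> S d w" and a: "u p - (\<Sum>q\<in>{q \<in> S d w. pair_less q p}. a q *s u q) \<in> U d (Suc w)"
    using assms(1) unfolding reducible_def by blast
  let ?T = "{q \<in> S d w. pair_less q p}" and ?i = "pair_incr l"
  \<comment> \<open>\<open>U_step\<close> speaks of sums over all of \<open>S d w\<close>; these
    coefficients bring the relation into this form.\<close>
  let ?c = "\<lambda>q. if q = p then 1 else if pair_less q p then - a q else 0"
  have split: "(\<Sum>q\<in>S d w. ?c q *s f q) = f p - (\<Sum>q\<in>?T. a q *s f q)" for f :: "nat \<times> nat list \<Rightarrow> 'b"
  proof -
    have "(\<Sum>q\<in>S d w. ?c q *s f q) = (\<Sum>q\<in>S d w. (if q = p then f q else 0) - (if pair_less q p then a q *s f q else 0))"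
      by (intro sum.cong) (auto simp: pair_less_irrefl)
    also have "\<dots> = f p - (\<Sum>q\<in>?T. a q *s f q)"
      using p finite_S by (simp add: sum_subtractf sum.inter_filter)
    finally show ?thesis .
  qed
  have "(\<Sum>q\<in>S d w. ?c q *s u q) \<in> U d (Suc w)" unfolding split by (rule a)
  from U_step[OF assms(2) this]
  have in_U: "u (?i p) - (\<Sum>q\<in>?T. a q *s u (?i q)) \<in> U (d + \<delta> ! l) (Suc (w + \<epsilon> ! l))"
    using split[of "\<lambda>q. u (?i q)"] by simp
  let ?S' = "S (d + \<delta> ! l) (w + \<epsilon> ! l)"
  let ?T' = "{q \<in> ?S'. pair_less q (?i p)}"
  have injT: "inj_on ?i ?T" by (rule inj_on_subset[OF inj_pair_incr[OF assms(2)]]) auto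
  have sub: "?i ` ?T \<subseteq> ?T'"
  proof
    fix q' assume "q' \<in> ?i ` ?T"
    then obtain q where q: "q' = ?i q" "q \<in> S d w" "pair_less q p" by blast
    then have "pair_less (?i q) (?i p)"
      using p assms(2) by (intro pair_less_incr) (auto simp: S_def)
    then show "q' \<in> ?T'" using q pair_incr_S[OF q(2) assms(2)] by simp
  qed
  \<comment> \<open>Smaller indices that are not increments get the coefficient
    \<open>0\<close>.\<close>
  let ?b = "\<lambda>q'. if q' \<in> ?i ` ?T then a (inv_into ?T ?i q') else 0"
  have "(\<Sum>q'\<in>?T'. ?b q' *s u q') = (\<Sum>q'\<in>?i ` ?T. ?b q' *s u q')"
    by (rule sum.mono_neutral_right) (use finite_S sub in auto)
  also have "\<dots> = (\<Sum>q\<in>?T. ?b (?i q) *s u (?i q))"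
    by (rule sum.reindex[OF injT, unfolded o_def])
  also have "\<dots> = (\<Sum>q\<in>?T. a q *s u (?i q))"
    by (rule sum.cong) (simp_all add: inv_into_f_f[OF injT])
  finally have "u (?i p) - (\<Sum>q'\<in>?T'. ?b q' *s u q') \<in> U (d + \<delta> ! l) (Suc (w + \<epsilon> ! l))"
    using in_U by simp
  with pair_incr_S[OF p assms(2)] show ?thesis by (rule reducibleI)
qed

definition NR :: "nat \<Rightarrow> (nat \<times> nat list) set"
  where "NR d = {p. \<not> reducible p \<and> (\<exists>w. p \<in> S d w)}"

lemma card_NR:
  "card (NR d) = (\<Sum>i<r. if dg i \<le> d then cocount \<delta> {\<omega>. reducible (i, \<omega>)} (d - dg i) else 0)"
proof -
  let ?C = "\<lambda>i. {\<omega>. dg i \<le> d \<and> length \<omega> = length \<delta> \<and> \<omega> \<notin> {\<omega>. reducible (i, \<omega>)} \<and> wdot \<delta> \<omega> = d - dg i}"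
  have "NR d = (SIGMA i:{..<r}. ?C i)"
    unfolding NR_def S_def by auto
  moreover have fin: "finite (?C i)" for i
    by (rule finite_subset[OF _ finite_wdot_le[OF pos, of d]]) auto
  moreover have "card (?C i) = (if dg i \<le> d then cocount \<delta> {\<omega>. reducible (i, \<omega>)} (d - dg i) else 0)" for i
    by (simp add: cocount_def)
  ultimately show ?thesis by (simp add: card_SigmaI)
qed

lemma rational_NR: "is_rational_series (Abs_fps (\<lambda>d. of_nat (card (NR d))))"
proof -
  have "Abs_fps (\<lambda>d. of_nat (card (NR d))) =
      (\<Sum>i<r. fps_X ^ dg i * Abs_fps (\<lambda>d. rat_of_nat (cocount \<delta> {\<omega>. reducible (i, \<omega>)} d)))"
    by (rule fps_ext) (auto simp: card_NR fps_sum_nth fps_X_power_mult_nth intro!: sum.cong)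
  moreover have "is_rational_series (Abs_fps (\<lambda>d. rat_of_nat (cocount \<delta> {\<omega>. reducible (i, \<omega>)} d)))" for i
  proof (rule cocount_rational[OF pos])
    show "upset (length \<delta>) {\<omega>. reducible (i, \<omega>)}"
      unfolding upset_def using reducible_incr[of "(i, _)"] by (simp add: pair_incr_def)
  qed
  ultimately show ?thesis
    by (simp only: is_rational_series_sum is_rational_series_X_power_mult)
qed

lemma finite_NR: "finite (NR d)"
proof (rule finite_subset)
  show "NR d \<subseteq> {..<r} \<times> {\<omega>. length \<omega> = length \<delta> \<and> wdot \<delta> \<omega> \<le> d}"
    unfolding NR_def S_def by auto
  show "finite ({..<r} \<times> {\<omega>. length \<omega> = length \<delta> \<and> wdot \<delta> \<omega> \<le> d})"
    using finite_wdot_le[OF pos] by simp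
qed

text \<open>In a nontrivial relation take the smallest weight \<open>w\<close> that occurs and,
  within this weight, the largest index \<open>p\<close>. The terms of larger weight lie in
  \<open>U d (Suc w)\<close>, so the relation would make \<open>p\<close> reducible.\<close>

lemma NR_independent:
  assumes "(\<Sum>p\<in>NR d. a p *s u p) \<in> J"
  shows "\<forall>p\<in>NR d. a p = 0"
proof (rule ccontr)
  define wt where "wt p = wg (fst p) + wdot \<epsilon> (snd p)" for p :: "nat \<times> nat list"
  have NR_S: "p \<in> S d (wt p)" if "p \<in> NR d" for p
    using that by (auto simp: NR_def S_def wt_def)
  assume neg: "\<not> ?thesis"
  define P where "P = {p \<in> NR d. a p \<noteq> 0}"
  have P: "finite P" "P \<noteq> {}" using neg finite_NR[of d] by (auto simp: P_def)
  define w where "w = Min (wt ` P)"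
  define T where "T = {p \<in> P. wt p = w}"
  have w_le: "w \<le> wt p" if "p \<in> P" for p using that P by (simp add: w_def)
  have "w \<in> wt ` P" unfolding w_def using P by (intro Min_in) auto
  then have T: "finite T" "T \<noteq> {}" using P by (auto simp: T_def)
  \<comment> \<open>The largest index is the one with the most predecessors in the finite set
    \<open>T\<close>.\<close>
  define rk where "rk p = card {q \<in> T. pair_less q p}" for p
  have "Max (rk ` T) \<in> rk ` T" using T by (intro Max_in) auto
  then obtain p where p: "p \<in> T" "rk p = Max (rk ` T)" by auto
  have rk_le: "rk q \<le> rk p" if "q \<in> T" for q
    using that T(1) unfolding p(2) by (intro Max_ge) auto
  have max: "pair_less q p" if q: "q \<in> T" "q \<noteq> p" for q
  proof (rule ccontr)
    assume "\<not> ?thesis"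
    moreover have "length (snd q) = length (snd p)"
      using NR_S[of q] NR_S[of p] q(1) p(1) by (auto simp: T_def P_def S_def)
    ultimately have "pair_less p q" using pair_less_total q(2) by blast
    then have "{s \<in> T. pair_less s p} \<subset> {s \<in> T. pair_less s q}"
      using p(1) pair_less_irrefl pair_less_trans by blast
    then have "rk p < rk q" unfolding rk_def using T(1) by (intro psubset_card_mono) auto
    then show False using rk_le[OF q(1)] by simp
  qed
  have pS: "p \<in> S d w" "p \<in> NR d" "a p \<noteq> 0" using p(1) NR_S[of p] by (auto simp: T_def P_def)
  have "(\<Sum>q\<in>NR d. a q *s u q) = (\<Sum>q\<in>P. a q *s u q)"
    by (rule sum.mono_neutral_right) (auto simp: P_def finite_NR)
  also have "\<dots> = (\<Sum>q\<in>P - T. a q *s u q) + (\<Sum>q\<in>T. a q *s u q)"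
    by (rule sum.subset_diff) (use P T in \<open>auto simp: T_def\<close>)
  also have "(\<Sum>q\<in>T. a q *s u q) = a p *s u p + (\<Sum>q\<in>T - {p}. a q *s u q)"
    by (rule sum.remove) (use p T in auto)
  finally have eq: "a p *s u p + (\<Sum>q\<in>T - {p}. a q *s u q) = (\<Sum>q\<in>NR d. a q *s u q) - (\<Sum>q\<in>P - T. a q *s u q)"
    by (simp add: algebra_simps)
  have "(\<Sum>q\<in>P - T. a q *s u q) \<in> U d (Suc w)"
  proof (intro subspace_sum[OF U(1)] subspace_scale[OF U(1)])
    fix q assume q: "q \<in> P - T"
    then have "Suc w \<le> wt q" using w_le[of q] by (auto simp: T_def)
    moreover have "u q \<in> U d (wt q)" using q NR_S[of q] u_in by (auto simp: P_def)
    ultimately show "u q \<in> U d (Suc w)" using U_antimono by blast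
  qed
  moreover have "(\<Sum>q\<in>NR d. a q *s u q) \<in> U d (Suc w)" using assms U(2) by blast
  ultimately have "a p *s u p + (\<Sum>q\<in>T - {p}. a q *s u q) \<in> U d (Suc w)"
    unfolding eq by (intro subspace_diff[OF U(1)])
  then have "(1 / a p) *s (a p *s u p + (\<Sum>q\<in>T - {p}. a q *s u q)) \<in> U d (Suc w)"
    by (rule subspace_scale[OF U(1)])
  then have in_U: "u p + (\<Sum>q\<in>T - {p}. (a q / a p) *s u q) \<in> U d (Suc w)"
    using pS(3) by (simp add: scale_right_distrib scale_sum_right)
  let ?L = "{q \<in> S d w. pair_less q p}"
  let ?b = "\<lambda>q. if q \<in> T - {p} then - (a q / a p) else 0"
  have TL: "T - {p} \<subseteq> ?L"
  proof
    fix q assume q: "q \<in> T - {p}"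
    then have "q \<in> S d w" using NR_S[of q] by (auto simp: T_def P_def)
    then show "q \<in> ?L" using max q by simp
  qed
  have "(\<Sum>q\<in>?L. ?b q *s u q) = (\<Sum>q\<in>T - {p}. ?b q *s u q)"
    by (rule sum.mono_neutral_right) (use finite_S TL in auto)
  also have "\<dots> = - (\<Sum>q\<in>T - {p}. (a q / a p) *s u q)"
    by (simp add: sum_negf)
  finally have "u p - (\<Sum>q\<in>?L. ?b q *s u q) \<in> U d (Suc w)" using in_U by simp
  with pS(1) have "reducible p" by (rule reducibleI)
  then show False using pS(2) by (simp add: NR_def)
qed

abbreviation SP :: "nat \<Rightarrow> 'b set"
  where "SP d \<equiv> comb J (NR d) u"

text \<open>Downward induction on the weight, from the point where the filtration has reached
  \<open>J\<close>. Within one weight a reducible index is rewritten in smaller indices up to higher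
  weight, and the number of predecessors goes down.\<close>

lemma U_SP: "U d w \<subseteq> SP d"
proof (induction "B d - w" arbitrary: w)
  case 0
  then have "U d w \<subseteq> J" by (intro U(4)) simp
  then show ?case using subset_comb by (rule subset_trans)
next
  case (Suc n)
  then have IH: "U d (Suc w) \<subseteq> SP d" by simp
  define rk where "rk p = card {q \<in> S d w. pair_less q p}" for p
  have uSP: "p \<in> S d w \<Longrightarrow> u p \<in> SP d" for p
  proof (induction "rk p" arbitrary: p rule: less_induct)
    case less
    show ?case
    proof (cases "reducible p")
      case False
      then have "p \<in> NR d" using less.prems by (auto simp: NR_def)
      then show ?thesis by (intro comb_base J finite_NR)
    next
      case True
      then obtain d' w' a where p': "p \<in> S d' w'"
        and a': "u p - (\<Sum>q\<in>{q \<in> S d' w'. pair_less q p}. a q *s u q) \<in> U d' (Suc w')"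
        unfolding reducible_def by blast
      have "d' = d" "w' = w" using S_unique[OF p' less.prems] by simp_all
      with a' have a: "u p - (\<Sum>q\<in>{q \<in> S d w. pair_less q p}. a q *s u q) \<in> SP d" using IH by auto
      have "(\<Sum>q\<in>{q \<in> S d w. pair_less q p}. a q *s u q) \<in> SP d"
      proof (intro subspace_sum[OF subspace_comb[OF J]] subspace_scale[OF subspace_comb[OF J]])
        fix q assume q: "q \<in> {q \<in> S d w. pair_less q p}"
        have "{s \<in> S d w. pair_less s q} \<subset> {s \<in> S d w. pair_less s p}"
          using q pair_less_irrefl pair_less_trans by blast
        then have "rk q < rk p" unfolding rk_def using finite_S by (intro psubset_card_mono) auto
        then show "u q \<in> SP d" using less.hyps q by blast
      qed
      from subspace_add[OF subspace_comb[OF J] a this] show ?thesis by simp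
    qed
  qed
  show ?case
  proof
    fix x assume "x \<in> U d w"
    from U_span[OF this] obtain a where "x - (\<Sum>p\<in>S d w. a p *s u p) \<in> U d (Suc w)" ..
    with IH have "x - (\<Sum>p\<in>S d w. a p *s u p) \<in> SP d" by blast
    moreover have "(\<Sum>p\<in>S d w. a p *s u p) \<in> SP d"
      by (intro subspace_sum[OF subspace_comb[OF J]] subspace_scale[OF subspace_comb[OF J]] uSP)
    ultimately have "(x - (\<Sum>p\<in>S d w. a p *s u p)) + (\<Sum>p\<in>S d w. a p *s u p) \<in> SP d"
      by (rule subspace_add[OF subspace_comb[OF J]])
    then show "x \<in> SP d" by simp
  qed
qed

theorem rational_rdim: "is_rational_series (Abs_fps (\<lambda>d. of_nat (rdim J (U d 0))))"
proof -
  have "rel_basis J (U d 0) (NR d) u" for d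
    unfolding rel_basis_def
  proof (intro conjI allI impI)
    show "finite (NR d)" by (rule finite_NR)
    show "u ` NR d \<subseteq> U d 0"
      using u_in U_antimono[of 0] unfolding NR_def by blast
    show "\<forall>x\<in>U d 0. \<exists>a. x - (\<Sum>i\<in>NR d. a i *s u i) \<in> J"
      using U_SP[of d 0] unfolding comb_def by blast
  next
    fix a assume "(\<Sum>i\<in>NR d. a i *s u i) \<in> J"
    then show "\<forall>i\<in>NR d. a i = 0" by (rule NR_independent)
  qed
  then have "rdim J (U d 0) = card (NR d)" for d by (rule rdim_eq_card[OF J])
  then show ?thesis using rational_NR by simp
qed

end

section \<open>Monomials and polynomials\<close>

abbreviation lk :: "('a \<Rightarrow>\<^sub>0 'b::zero) \<Rightarrow> 'a \<Rightarrow> 'b" where "lk \<equiv> Poly_Mapping.lookup"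
abbreviation ks :: "('a \<Rightarrow>\<^sub>0 'b::zero) \<Rightarrow> 'a set" where "ks \<equiv> Poly_Mapping.keys"
abbreviation sgl :: "'a \<Rightarrow> 'b \<Rightarrow> ('a \<Rightarrow>\<^sub>0 'b::zero)" where "sgl \<equiv> Poly_Mapping.single"

lemma lookup_scalar_mult [simp]: "lk (scalar_mult c p) m = c * lk p m"
  unfolding scalar_mult_def mult_map_scale_conv_mult[symmetric]
  by (simp add: Poly_Mapping.map.rep_eq when_def)

global_interpretation pv: rel_vector_space "scalar_mult :: 'k::field \<Rightarrow> 'k polynomials \<Rightarrow> 'k polynomials"
  by unfold_locales
    (auto intro!: poly_mapping_eqI simp: lookup_add algebra_simps)

lemma sum_keys: "(\<Sum>m\<in>ks p. sgl m (lk p m)) = p"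
  by (rule poly_mapping_eqI) (simp add: lookup_sum lookup_single when_def in_keys_iff)

lemma scalar_mult_single [simp]: "scalar_mult c (sgl m a) = sgl m (c * a)"
  by (simp add: scalar_mult_def mult_single)

lemma scalar_mult_mult_left: "scalar_mult c (p * q) = scalar_mult c p * q"
  by (simp add: scalar_mult_def mult.assoc)

lemma scalar_mult_mult_right: "scalar_mult c (p * q) = p * scalar_mult c q"
  by (simp add: scalar_mult_def ac_simps)

lemma poly_in_subspace:
  assumes "pv.subspace S" "\<And>m. m \<in> ks p \<Longrightarrow> sgl m 1 \<in> S"
  shows "p \<in> S"
proof -
  have "(\<Sum>m\<in>ks p. scalar_mult (lk p m) (sgl m 1)) \<in> S"
    using assms by (intro pv.subspace_sum pv.subspace_scale)
  then show ?thesis by (simp add: sum_keys)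
qed

lemma poly_ideal_subspace:
  assumes "poly_ideal I" shows "pv.subspace I"
  by (rule pv.subspaceI) (use assms in \<open>auto simp: poly_ideal_def scalar_mult_def\<close>)

lemma poly_ideal_mult: "poly_ideal I \<Longrightarrow> p \<in> I \<Longrightarrow> r * p \<in> I"
  by (simp add: poly_ideal_def)

lemma mdegree_superset: "finite A \<Longrightarrow> ks m \<subseteq> A \<Longrightarrow> mdegree m = (\<Sum>i\<in>A. lk m i)"
  unfolding mdegree_def by (rule sum.mono_neutral_left) (auto simp: in_keys_iff)

lemma mdegree_add [simp]: "mdegree (m + m') = mdegree m + mdegree m'"
proof -
  have "ks (m + m') \<subseteq> ks m \<union> ks m'" by (rule keys_add)
  then show ?thesis
    by (simp add: mdegree_superset[of "ks m \<union> ks m'"] lookup_add sum.distrib)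
qed

lemma mdegree_0 [simp]: "mdegree 0 = 0"
  by (simp add: mdegree_def)

lemma mdegree_single [simp]: "mdegree (sgl i a) = a"
  by (simp add: mdegree_def)

lemma mdegree_sum: "mdegree (\<Sum>i\<in>A. f i) = (\<Sum>i\<in>A. mdegree (f i))"
  by (induction A rule: infinite_finite_induct) simp_all

lemma keys_add_nat: "ks (m + m') = ks m \<union> ks m'" for m m' :: monomial
  by (auto simp: in_keys_iff lookup_add)

lemma lookup_le_mdegree: "lk m i \<le> mdegree m"
proof (cases "i \<in> ks m")
  case True
  then show ?thesis unfolding mdegree_def by (intro member_le_sum) auto
qed (simp add: in_keys_iff)

lemma card_keys_le_mdegree: "card (ks m) \<le> mdegree m"
proof -
  have "card (ks m) = (\<Sum>i\<in>ks m. 1)" by simp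
  also have "\<dots> \<le> (\<Sum>i\<in>ks m. lk m i)" by (rule sum_mono) (simp add: in_keys_iff)
  finally show ?thesis by (simp add: mdegree_def)
qed

lemma keys_sum_subset: "ks (\<Sum>i\<in>A. f i) \<subseteq> (\<Union>i\<in>A. ks (f i))"
  for f :: "'i \<Rightarrow> ('a \<Rightarrow>\<^sub>0 'b::comm_monoid_add)"
proof (induction A rule: infinite_finite_induct)
  case (insert x F)
  then show ?case using keys_add[of "f x" "\<Sum>i\<in>F. f i"] by auto
qed simp_all

text \<open>Forms, polynomials in the first \<open>n\<close> variables and the layers of the weight
  filtration all have this shape, so linearity and products are settled once in terms of
  monomials.\<close>

definition keys_within :: "monomial set \<Rightarrow> 'k::field polynomials set"
  where "keys_within T = {p. ks p \<subseteq> T}"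

lemma subspace_keys_within: "pv.subspace (keys_within T)"
proof (rule pv.subspaceI)
  fix p q :: "'a polynomials" assume "p \<in> keys_within T" "q \<in> keys_within T"
  then show "p + q \<in> keys_within T" using keys_add[of p q] by (auto simp: keys_within_def)
next
  fix c and p :: "'a polynomials" assume "p \<in> keys_within T"
  moreover have "ks (scalar_mult c p) \<subseteq> ks p" by (auto simp: in_keys_iff)
  ultimately show "scalar_mult c p \<in> keys_within T" by (auto simp: keys_within_def)
qed (simp add: keys_within_def)

lemma keys_within_single [simp]: "sgl m c \<in> keys_within T \<longleftrightarrow> c = 0 \<or> m \<in> T"
  by (auto simp: keys_within_def)

lemma keys_within_mono: "S \<subseteq> T \<Longrightarrow> keys_within S \<subseteq> keys_within T"
  by (auto simp: keys_within_def)

lemma keys_within_mult: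
  assumes "p \<in> keys_within S" "q \<in> keys_within T" "\<And>a b. a \<in> S \<Longrightarrow> b \<in> T \<Longrightarrow> a + b \<in> U"
  shows "p * q \<in> keys_within U"
  using assms keys_mult[of p q] unfolding keys_within_def by blast

lemma is_form_keys_within: "{p. is_form d p} = keys_within {m. mdegree m = d}"
  by (auto simp: is_form_def keys_within_def)

lemma polys_in_keys_within: "polys_in n = keys_within {m. ks m \<subseteq> {..<n}}"
  by (auto simp: polys_in_def keys_within_def)

lemma ex_polys_in: "\<exists>n. p \<in> polys_in n"
proof -
  let ?A = "\<Union>m\<in>ks p. ks m"
  have "finite ?A" by simp
  then obtain n where "\<forall>i\<in>?A. i < n" using finite_nat_set_iff_bounded by blast
  then show ?thesis by (auto simp: polys_in_def)
qed

lemma polys_in_mono: "m \<le> n \<Longrightarrow> polys_in m \<subseteq> polys_in n"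
  unfolding polys_in_keys_within by (rule keys_within_mono) auto

lemma lookup_hom_component: "lk (hom_component d p) m = (if mdegree m = d then lk p m else 0)"
  unfolding hom_component_def
  by (simp add: lookup_sum lookup_single when_def in_keys_iff)

lemma hom_component_add: "hom_component d (p + q) = hom_component d p + hom_component d q"
  by (rule poly_mapping_eqI) (simp add: lookup_hom_component lookup_add)

lemma hom_component_0 [simp]: "hom_component d 0 = 0"
  by (rule poly_mapping_eqI) (simp add: lookup_hom_component)

lemma hom_component_scalar: "hom_component d (scalar_mult c p) = scalar_mult c (hom_component d p)"
  by (rule poly_mapping_eqI) (simp add: lookup_hom_component)

lemma hom_component_sum: "hom_component d (\<Sum>i\<in>A. f i) = (\<Sum>i\<in>A. hom_component d (f i))"
  by (induction A rule: infinite_finite_induct) (simp_all add: hom_component_add)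

lemma hom_component_form: "is_form d p \<Longrightarrow> hom_component d p = p"
  by (rule poly_mapping_eqI) (auto simp: lookup_hom_component is_form_def in_keys_iff)

lemma is_form_hom_component: "is_form d (hom_component d p)"
  by (auto simp: is_form_def in_keys_iff lookup_hom_component split: if_splits)

definition forms_in :: "nat \<Rightarrow> nat \<Rightarrow> 'k::field polynomials set"
  where "forms_in n d = keys_within {m. ks m \<subseteq> {..<n} \<and> mdegree m = d}"

lemma forms_in_iff: "p \<in> forms_in n d \<longleftrightarrow> p \<in> polys_in n \<and> is_form d p"
  by (auto simp: forms_in_def keys_within_def polys_in_def is_form_def)

lemma subspace_forms_in: "pv.subspace (forms_in n d)"
  unfolding forms_in_def by (rule subspace_keys_within)

lemma finite_monomials: "finite {m :: monomial. ks m \<subseteq> {..<n} \<and> mdegree m = d}"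
proof (rule finite_imageD)
  let ?f = "\<lambda>m :: monomial. \<lambda>i\<in>{..<n}. lk m i"
  show "finite (?f ` {m. ks m \<subseteq> {..<n} \<and> mdegree m = d})"
  proof (rule finite_subset)
    show "?f ` {m. ks m \<subseteq> {..<n} \<and> mdegree m = d} \<subseteq> {..<n} \<rightarrow>\<^sub>E {..d}"
    proof
      fix h assume "h \<in> ?f ` {m. ks m \<subseteq> {..<n} \<and> mdegree m = d}"
      then obtain m where "h = ?f m" "mdegree m = d" by blast
      then show "h \<in> {..<n} \<rightarrow>\<^sub>E {..d}" using lookup_le_mdegree[of m] by (simp add: PiE_iff)
    qed
    show "finite ({..<n} \<rightarrow>\<^sub>E {..d})" by (intro finite_PiE) auto
  qed
  show "inj_on ?f {m. ks m \<subseteq> {..<n} \<and> mdegree m = d}"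
  proof (rule inj_onI, rule poly_mapping_eqI)
    fix a b :: monomial and i
    assume a: "a \<in> {m. ks m \<subseteq> {..<n} \<and> mdegree m = d}" and b: "b \<in> {m. ks m \<subseteq> {..<n} \<and> mdegree m = d}"
      and eq: "?f a = ?f b"
    show "lk a i = lk b i"
    proof (cases "i < n")
      case True
      then show ?thesis using fun_cong[OF eq, of i] by simp
    next
      case False
      then have "i \<notin> ks a" "i \<notin> ks b" using a b by auto
      then show ?thesis by (simp add: in_keys_iff)
    qed
  qed
qed

lemma rel_fg_forms_in: 
  assumes "pv.subspace J" shows "pv.rel_fg J (forms_in n d :: 'k::field polynomials set)"
proof -
  let ?F = "(\<lambda>m. sgl m 1) ` {m. ks m \<subseteq> {..<n} \<and> mdegree m = d} :: 'k polynomials set"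
  have "\<exists>y\<in>pv.span ?F. x - y \<in> J" if x: "x \<in> forms_in n d" for x
  proof (rule bexI[of _ x])
    show "x - x \<in> J" using assms by (simp add: pv.subspace_0)
    show "x \<in> pv.span ?F"
    proof (rule poly_in_subspace[OF pv.subspace_span])
      fix m assume "m \<in> ks x"
      then have "sgl m 1 \<in> ?F" using x by (auto simp: forms_in_def keys_within_def)
      then show "sgl m 1 \<in> pv.span ?F" by (rule pv.span_base)
    qed
  qed
  moreover have "finite ?F" using finite_monomials by simp
  ultimately show ?thesis unfolding pv.rel_fg_def by blast
qed

section \<open>Substitution of variables\<close>

definition mono_act :: "(nat \<Rightarrow> nat) \<Rightarrow> monomial \<Rightarrow> monomial"
  where "mono_act \<sigma> m = (\<Sum>i\<in>ks m. sgl (\<sigma> i) (lk m i))"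

lemma mono_act_superset: "finite A \<Longrightarrow> ks m \<subseteq> A \<Longrightarrow> mono_act \<sigma> m = (\<Sum>i\<in>A. sgl (\<sigma> i) (lk m i))"
  unfolding mono_act_def by (rule sum.mono_neutral_left) (auto simp: in_keys_iff)

lemma mono_act_add: "mono_act \<sigma> (m + m') = mono_act \<sigma> m + mono_act \<sigma> m'"
  by (simp add: mono_act_superset[of "ks m \<union> ks m'"] keys_add_nat lookup_add single_add sum.distrib)

lemma mono_act_0 [simp]: "mono_act \<sigma> 0 = 0"
  by (simp add: mono_act_def)

lemma mono_act_single [simp]: "mono_act \<sigma> (sgl i a) = sgl (\<sigma> i) a"
  by (simp add: mono_act_def)

lemma mono_act_sum: "mono_act \<sigma> (\<Sum>i\<in>A. f i) = (\<Sum>i\<in>A. mono_act \<sigma> (f i))"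
  by (induction A rule: infinite_finite_induct) (simp_all add: mono_act_add)

lemma mono_act_comp: "mono_act \<sigma> (mono_act \<tau> m) = mono_act (\<sigma> \<circ> \<tau>) m"
  by (simp add: mono_act_def[of \<tau>] mono_act_def[of "\<sigma> \<circ> \<tau>"] mono_act_sum)

lemma mono_act_id: "(\<And>i. i \<in> ks m \<Longrightarrow> \<sigma> i = i) \<Longrightarrow> mono_act \<sigma> m = m"
  by (simp add: mono_act_def sum_keys cong: sum.cong)

lemma mdegree_mono_act [simp]: "mdegree (mono_act \<sigma> m) = mdegree m"
  by (simp add: mono_act_def mdegree_sum) (simp add: mdegree_def)

lemma lookup_mono_act_inj:
  assumes "inj \<sigma>"
  shows "lk (mono_act \<sigma> m) (\<sigma> i) = lk m i"
  using assms by (simp add: mono_act_def lookup_sum lookup_single when_def inj_eq in_keys_iff)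

lemma keys_mono_act:
  assumes "inj \<sigma>"
  shows "ks (mono_act \<sigma> m) = \<sigma> ` ks m"
proof
  show "ks (mono_act \<sigma> m) \<subseteq> \<sigma> ` ks m"
    unfolding mono_act_def using keys_sum_subset[of "\<lambda>i. sgl (\<sigma> i) (lk m i)" "ks m"] by (auto split: if_splits)
  show "\<sigma> ` ks m \<subseteq> ks (mono_act \<sigma> m)"
    using lookup_mono_act_inj[OF assms] by (auto simp: in_keys_iff)
qed

lemma var_power: "var i ^ a = (sgl (sgl i a) 1 :: 'k::field polynomials)"
proof (induction a)
  case 0
  then show ?case by (simp flip: single_one)
next
  case (Suc a)
  then show ?case by (simp add: var_def mult_single flip: single_add)
qed

lemma prod_single_1: "(\<Prod>i\<in>A. sgl (f i) (1 :: 'k::field)) = sgl (\<Sum>i\<in>A. f i) 1"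
  for f :: "'i \<Rightarrow> monomial"
  by (induction A rule: infinite_finite_induct) (simp_all add: mult_single flip: single_one)

lemma perm_act_eq: "perm_act \<sigma> p = (\<Sum>m\<in>ks p. sgl (mono_act \<sigma> m) (lk p m))"
  unfolding perm_act_def by (simp add: var_power prod_single_1 mono_act_def)

lemma perm_act_superset: "finite A \<Longrightarrow> ks p \<subseteq> A \<Longrightarrow> perm_act \<sigma> p = (\<Sum>m\<in>A. sgl (mono_act \<sigma> m) (lk p m))"
  unfolding perm_act_eq by (rule sum.mono_neutral_left) (auto simp: in_keys_iff)

lemma perm_act_single [simp]: "perm_act \<sigma> (sgl m c) = sgl (mono_act \<sigma> m) c"
  by (simp add: perm_act_eq)

lemma perm_act_add: "perm_act \<sigma> (p + q) = perm_act \<sigma> p + perm_act \<sigma> q"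
  using keys_add[of p q]
  by (simp add: perm_act_superset[of "ks p \<union> ks q"] lookup_add single_add sum.distrib)

lemma perm_act_0 [simp]: "perm_act \<sigma> 0 = 0"
  by (simp add: perm_act_eq)

lemma perm_act_scalar: "perm_act \<sigma> (scalar_mult c p) = scalar_mult c (perm_act \<sigma> p)"
proof -
  have "ks (scalar_mult c p) \<subseteq> ks p" by (auto simp: in_keys_iff)
  then have "perm_act \<sigma> (scalar_mult c p) = (\<Sum>m\<in>ks p. scalar_mult c (sgl (mono_act \<sigma> m) (lk p m)))"
    by (simp add: perm_act_superset[of "ks p"])
  then show ?thesis by (simp add: perm_act_eq pv.scale_sum_right)
qed

lemma perm_act_uminus: "perm_act \<sigma> (- p) = - perm_act \<sigma> p"
  by (metis add.right_inverse add_eq_0_iff perm_act_0 perm_act_add)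

lemma perm_act_diff: "perm_act \<sigma> (p - q) = perm_act \<sigma> p - perm_act \<sigma> q"
  using perm_act_add[of \<sigma> p "- q"] by (simp add: perm_act_uminus)

lemma perm_act_sum: "perm_act \<sigma> (\<Sum>i\<in>A. f i) = (\<Sum>i\<in>A. perm_act \<sigma> (f i))"
  by (induction A rule: infinite_finite_induct) (simp_all add: perm_act_add)

text \<open>Holds for every substitution of variables, injective or not. The sign of a transposition
  is found later with a substitution that identifies two variables.\<close>

lemma perm_act_mult: "perm_act \<sigma> (p * q) = perm_act \<sigma> p * perm_act \<sigma> q"
proof -
  have "perm_act \<sigma> (p * q)
      = perm_act \<sigma> ((\<Sum>m\<in>ks p. sgl m (lk p m)) * (\<Sum>m\<in>ks q. sgl m (lk q m)))"
    by (simp only: sum_keys)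
  also have "\<dots> = perm_act \<sigma> p * perm_act \<sigma> q"
    by (simp add: sum_product perm_act_sum mult_single mono_act_add perm_act_eq[of \<sigma> p] perm_act_eq[of \<sigma> q])
  finally show ?thesis .
qed

lemma perm_act_1 [simp]: "perm_act \<sigma> 1 = 1"
  using perm_act_single[of \<sigma> 0 1] by simp

lemma perm_act_prod: "perm_act \<sigma> (\<Prod>i\<in>A. f i) = (\<Prod>i\<in>A. perm_act \<sigma> (f i))"
  by (induction A rule: infinite_finite_induct) (simp_all add: perm_act_mult)

lemma perm_act_power: "perm_act \<sigma> (p ^ n) = perm_act \<sigma> p ^ n"
  by (induction n) (simp_all add: perm_act_mult)

lemma perm_act_var [simp]: "perm_act \<sigma> (var i) = var (\<sigma> i)"
  by (simp add: var_def)

lemma perm_act_comp: "perm_act \<sigma> (perm_act \<tau> p) = perm_act (\<sigma> \<circ> \<tau>) p"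
  by (simp add: perm_act_eq[of \<tau>] perm_act_eq[of "\<sigma> \<circ> \<tau>"] perm_act_sum mono_act_comp)

lemma perm_act_fix: "(\<And>m i. m \<in> ks p \<Longrightarrow> i \<in> ks m \<Longrightarrow> \<sigma> i = i) \<Longrightarrow> perm_act \<sigma> p = p"
  by (simp add: perm_act_eq mono_act_id sum_keys cong: sum.cong)

lemma perm_act_id [simp]: "perm_act id p = p"
  by (rule perm_act_fix) simp

abbreviation pinv :: "('a \<Rightarrow> 'a) \<Rightarrow> 'a \<Rightarrow> 'a" where "pinv \<equiv> inv_into UNIV"

lemma perm_act_pinv:
  assumes "bij \<sigma>"
  shows "perm_act \<sigma> (perm_act (pinv \<sigma>) p) = p" "perm_act (pinv \<sigma>) (perm_act \<sigma> p) = p"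
proof -
  have "\<sigma> \<circ> pinv \<sigma> = id" "pinv \<sigma> \<circ> \<sigma> = id"
    using assms by (auto simp: fun_eq_iff bij_is_surj surj_f_inv_f bij_is_inj)
  then show "perm_act \<sigma> (perm_act (pinv \<sigma>) p) = p" "perm_act (pinv \<sigma>) (perm_act \<sigma> p) = p"
    by (simp_all add: perm_act_comp)
qed

lemma keys_perm_act_subset: "ks (perm_act \<sigma> p) \<subseteq> mono_act \<sigma> ` ks p"
  unfolding perm_act_eq using keys_sum_subset[of "\<lambda>m. sgl (mono_act \<sigma> m) (lk p m)" "ks p"]
  by (auto split: if_splits)

lemma is_form_perm_act: "is_form d p \<Longrightarrow> is_form d (perm_act \<sigma> p)"
  unfolding is_form_def using keys_perm_act_subset[of \<sigma> p] by auto

lemma hom_component_perm_act: "hom_component d (perm_act \<sigma> p) = perm_act \<sigma> (hom_component d p)"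
proof -
  have *: "hom_component d (sgl m c) = (if mdegree m = d then sgl m c else 0)" for m and c :: 'a
    by (rule poly_mapping_eqI) (auto simp: lookup_hom_component lookup_single when_def)
  have "hom_component d (perm_act \<sigma> (\<Sum>m\<in>ks p. sgl m (lk p m)))
      = perm_act \<sigma> (hom_component d (\<Sum>m\<in>ks p. sgl m (lk p m)))"
    by (simp add: perm_act_sum hom_component_sum * if_distrib cong: if_cong)
  then show ?thesis by (simp add: sum_keys)
qed

lemma perm_act_polys_in:
  assumes "\<sigma> permutes {..<n}" "p \<in> polys_in n"
  shows "perm_act \<sigma> p \<in> polys_in n"
  unfolding polys_in_def
proof (intro CollectI ballI)
  fix m assume "m \<in> ks (perm_act \<sigma> p)"
  then obtain m' where m': "m' \<in> ks p" "m = mono_act \<sigma> m'" using keys_perm_act_subset by blast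
  then have "ks m = \<sigma> ` ks m'" using keys_mono_act[OF permutes_inj[OF assms(1)]] by simp
  also have "\<dots> \<subseteq> \<sigma> ` {..<n}" using m'(1) assms(2) by (intro image_mono) (auto simp: polys_in_def)
  also have "\<dots> = {..<n}" by (rule permutes_image[OF assms(1)])
  finally show "ks m \<subseteq> {..<n}" .
qed

lemma perm_act_forms_in:
  "\<sigma> permutes {..<n} \<Longrightarrow> p \<in> forms_in n d \<Longrightarrow> perm_act \<sigma> p \<in> forms_in n d"
  by (simp add: forms_in_iff perm_act_polys_in is_form_perm_act)

lemma permutes_mono: "\<sigma> permutes {..<m} \<Longrightarrow> m \<le> n \<Longrightarrow> \<sigma> permutes {..<n}" for m n :: nat
  by (rule permutes_subset) auto

text \<open>The multisets include the zero exponents, so that their equality yields a permutation of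
  the whole interval.\<close>

lemma ex_mono_act_eq:
  fixes a b :: monomial
  assumes "ks a \<subseteq> {g..<N}" "ks b \<subseteq> {g..<N}"
    and "image_mset (lk a) (mset_set {g..<N}) = image_mset (lk b) (mset_set {g..<N})"
  shows "\<exists>\<sigma>. \<sigma> permutes {g..<N} \<and> mono_act \<sigma> a = b"
proof -
  obtain p where p: "p permutes {g..<N}" "\<forall>x\<in>{g..<N}. lk a x = lk b (p x)"
    using image_mset_eq_implies_permutes[of "{g..<N}" "lk a" "lk b"] assms(3) by auto
  have "mono_act p a = b"
  proof (rule poly_mapping_eqI)
    fix i
    obtain j where j: "i = p j" using permutes_surj[OF p(1)] by (metis surjD)
    have "lk (mono_act p a) i = lk a j"
      unfolding j by (rule lookup_mono_act_inj[OF permutes_inj[OF p(1)]])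
    also have "\<dots> = lk b i"
    proof (cases "j \<in> {g..<N}")
      case True
      then show ?thesis using p(2) j by simp
    next
      case False
      moreover have "p j = j" using p(1) False by (simp add: permutes_not_in)
      ultimately show ?thesis using assms(1,2) j by (metis in_keys_iff subsetD)
    qed
    finally show "lk (mono_act p a) i = lk b i" .
  qed
  with p(1) show ?thesis by blast
qed

section \<open>Rationality for quotients satisfying the support condition\<close>

definition mon :: "monomial \<Rightarrow> 'k::field polynomials"
  where "mon m = sgl m 1"

lemma mon_add: "mon (a + b) = mon a * mon b"
  by (simp add: mon_def mult_single)

lemma mon_0: "mon 0 = 1"
  by (simp add: mon_def)

lemma perm_act_mon: "perm_act \<sigma> (mon m) = mon (mono_act \<sigma> m)"
  by (simp add: mon_def)

lemma keys_within_mon: "mon m \<in> keys_within T \<longleftrightarrow> m \<in> T"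
  by (simp add: mon_def)

lemma linear_mult_right: "pv.subspace Y \<Longrightarrow> pv.subspace {q. q * p \<in> Y}"
  by (rule pv.subspaceI)
    (auto simp: pv.subspace_0 pv.subspace_add pv.subspace_scale distrib_right simp flip: scalar_mult_mult_left)

lemma ex_permutation_extending:
  fixes h :: "nat \<Rightarrow> nat"
  assumes "inj_on h F" "F \<union> h ` F \<subseteq> {..<M}"
  shows "\<exists>\<sigma>. \<sigma> permutes {..<M} \<and> (\<forall>x\<in>F. \<sigma> x = h x)"
proof -
  have fin: "finite F" using assms(2) finite_subset[of F "{..<M}"] by simp
  have "card ({..<M} - F) = card ({..<M} - h ` F)"
    using assms fin by (simp add: card_Diff_subset card_image)
  then obtain h' where h': "bij_betw h' ({..<M} - F) ({..<M} - h ` F)"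
    using finite_same_card_bij[of "{..<M} - F" "{..<M} - h ` F"] by auto
  define \<sigma> where "\<sigma> x = (if x \<in> F then h x else if x < M then h' x else x)" for x
  have "bij_betw \<sigma> F (h ` F)"
    using assms(1) by (simp add: \<sigma>_def bij_betw_def inj_on_def)
  moreover have "bij_betw \<sigma> ({..<M} - F) ({..<M} - h ` F)"
    using h' by (rule bij_betw_cong[THEN iffD1, rotated]) (simp add: \<sigma>_def)
  ultimately have "bij_betw \<sigma> (F \<union> ({..<M} - F)) (h ` F \<union> ({..<M} - h ` F))"
    by (rule bij_betw_combine) auto
  moreover have "F \<union> ({..<M} - F) = {..<M}" "h ` F \<union> ({..<M} - h ` F) = {..<M}" using assms(2) by auto
  ultimately have "\<sigma> permutes {..<M}"
    using assms(2) by (intro bij_imp_permutes) (auto simp: \<sigma>_def)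
  then show ?thesis by (auto simp: \<sigma>_def)
qed

text \<open>The letters of a monomial. Modulo a subspace containing all
  \<open>p - \<sigma> p\<close>, they are all that remains of the variables that \<sigma> may
  move.\<close>

definition nzm :: "monomial \<Rightarrow> nat multiset"
  where "nzm a = image_mset (lk a) (mset_set (ks a))"

lemma nzm_superset:
  assumes "ks a \<subseteq> A" "finite A"
  shows "image_mset (lk a) (mset_set A) = nzm a + replicate_mset (card A - card (ks a)) 0"
proof -
  have "mset_set A = mset_set (ks a) + mset_set (A - ks a)"
    using assms by (subst mset_set_Union[symmetric]) (auto simp: Un_absorb1)
  moreover have "image_mset (lk a) (mset_set (A - ks a)) = image_mset (\<lambda>_. 0) (mset_set (A - ks a))"
    using assms by (intro image_mset_cong) (simp add: in_keys_iff)
  ultimately show ?thesis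
    using assms by (simp add: nzm_def image_mset_const_eq card_Diff_subset)
qed

lemma ex_mono_act_nzm:
  assumes "nzm a = nzm b" "ks a \<subseteq> {g..}" "ks b \<subseteq> {g..}"
  shows "\<exists>N \<sigma>. \<sigma> permutes {g..<N} \<and> mono_act \<sigma> a = b"
proof -
  have "finite (ks a \<union> ks b)" by simp
  then obtain N where N: "\<forall>i\<in>ks a \<union> ks b. i < N" using finite_nat_set_iff_bounded by blast
  have sub: "ks a \<subseteq> {g..<N}" "ks b \<subseteq> {g..<N}" using N assms(2,3) by auto
  have "card (ks a) = card (ks b)"
    using arg_cong[OF assms(1), of size] by (simp add: nzm_def)
  then have "image_mset (lk a) (mset_set {g..<N}) = image_mset (lk b) (mset_set {g..<N})"
    using sub assms(1) by (simp add: nzm_superset)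
  from ex_mono_act_eq[OF sub this] show ?thesis by blast
qed

lemma nzm_add:
  assumes "ks a \<inter> ks b = {}"
  shows "nzm (a + b) = nzm a + nzm b"
proof -
  have "nzm (a + b) = image_mset (lk (a + b)) (mset_set (ks a)) + image_mset (lk (a + b)) (mset_set (ks b))"
    using assms by (simp add: nzm_def keys_add_nat mset_set_Union)
  also have "image_mset (lk (a + b)) (mset_set (ks a)) = nzm a"
    unfolding nzm_def by (rule image_mset_cong) (use assms in \<open>auto simp: lookup_add in_keys_iff\<close>)
  also have "image_mset (lk (a + b)) (mset_set (ks b)) = nzm b"
    unfolding nzm_def by (rule image_mset_cong) (use assms in \<open>auto simp: lookup_add in_keys_iff\<close>)
  finally show ?thesis .
qed

lemma nzm_single: "b > 0 \<Longrightarrow> nzm (sgl i b) = {#b#}"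
  by (simp add: nzm_def)

text \<open>Writes the word \<open>L\<close> on consecutive variables from index \<open>n\<close>
  on; this gives representatives of the monomials with prescribed letters.\<close>

definition plc :: "nat \<Rightarrow> nat list \<Rightarrow> monomial"
  where "plc n L = (\<Sum>s<length L. sgl (n + s) (L ! s))"

lemma lookup_plc: "lk (plc n L) i = (if n \<le> i \<and> i < n + length L then L ! (i - n) else 0)"
proof -
  have "lk (plc n L) i = (\<Sum>s<length L. if s = i - n \<and> n \<le> i then L ! s else 0)"
    unfolding plc_def lookup_sum by (rule sum.cong) (auto simp: lookup_single when_def)
  then show ?thesis by auto
qed

lemma keys_plc: "0 \<notin> set L \<Longrightarrow> ks (plc n L) = {n..<n + length L}"
proof -
  assume L: "0 \<notin> set L"
  have "lk (plc n L) i \<noteq> 0 \<longleftrightarrow> n \<le> i \<and> i < n + length L" for i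
  proof (cases "n \<le> i \<and> i < n + length L")
    case True
    then have "L ! (i - n) \<in> set L" by (intro nth_mem) auto
    with L have "L ! (i - n) \<noteq> 0" by metis
    with True show ?thesis by (simp add: lookup_plc)
  next
    case False
    then have "lk (plc n L) i = 0" by (simp only: lookup_plc if_False)
    with False show ?thesis by simp
  qed
  then show ?thesis by (intro Set.set_eqI) (simp only: in_keys_iff atLeastLessThan_iff)
qed

lemma nzm_plc:
  assumes "0 \<notin> set L"
  shows "nzm (plc n L) = mset L"
proof -
  have "mset_set {n..<n + length L} = mset [n..<n + length L]" by simp
  then have "nzm (plc n L) = mset (map (lk (plc n L)) [n..<n + length L])"
    by (simp only: nzm_def keys_plc[OF assms] mset_map)
  also have "map (lk (plc n L)) [n..<n + length L] = L"
    by (rule nth_equalityI) (simp_all add: lookup_plc)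
  finally show ?thesis .
qed

lemma mdegree_plc: "mdegree (plc n L) = sum_list L"
  by (simp add: plc_def mdegree_sum sum_list_sum_nth atLeast0LessThan)

text \<open>The sorted word with \<open>\<alpha> ! b\<close> letters \<open>Suc b\<close>. The shift
  is due to the letter \<open>0\<close>, which would be an absent variable. Incrementing an entry of
  \<alpha> adjoins one letter, up to order.\<close>

definition letters :: "nat list \<Rightarrow> nat list"
  where "letters \<alpha> = concat (map (\<lambda>b. replicate (\<alpha> ! b) (Suc b)) [0..<length \<alpha>])"

lemma set_letters: "set (letters \<alpha>) \<subseteq> {1..length \<alpha>}"
  by (auto simp: letters_def)

lemma mset_letters: "mset (letters \<alpha>) = (\<Sum>b<length \<alpha>. replicate_mset (\<alpha> ! b) (Suc b))"
proof -
  have "mset (concat (map (\<lambda>b. replicate (f b) (Suc b)) [0..<n])) = (\<Sum>b<n. replicate_mset (f b) (Suc b))" for f n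
    by (induction n) simp_all
  then show ?thesis by (simp add: letters_def)
qed

lemma length_letters: "length (letters \<alpha>) = sum_list \<alpha>"
  by (simp add: letters_def length_concat comp_def sum_list_sum_nth atLeast0LessThan flip: sum_list_sum_nth)
    (simp add: interv_sum_list_conv_sum_set_nat atLeast0LessThan sum_list_sum_nth)

lemma sum_list_letters: "sum_list (letters \<alpha>) = (\<Sum>b<length \<alpha>. Suc b * \<alpha> ! b)"
proof -
  have sum_mset_sum: "sum_mset (\<Sum>b<n. f b) = (\<Sum>b<n. sum_mset (f b))" for f :: "nat \<Rightarrow> nat multiset" and n
    by (induction n) simp_all
  have "sum_list (letters \<alpha>) = sum_mset (mset (letters \<alpha>))" by (simp add: sum_mset_sum_list)
  also have "\<dots> = (\<Sum>b<length \<alpha>. sum_mset (replicate_mset (\<alpha> ! b) (Suc b)))"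
    unfolding mset_letters using sum_mset_sum[of "\<lambda>b. replicate_mset (\<alpha> ! b) (Suc b)"] by blast
  finally show ?thesis by (simp add: sum_mset_replicate_mset mult.commute)
qed

lemma count_mset_letters: "count (mset (letters \<alpha>)) a = (if 1 \<le> a \<and> a \<le> length \<alpha> then \<alpha> ! (a - 1) else 0)"
proof -
  have "count (mset (letters \<alpha>)) a = (\<Sum>b<length \<alpha>. if b = a - 1 \<and> 1 \<le> a then \<alpha> ! b else 0)"
    unfolding mset_letters count_sum by (rule sum.cong) auto
  also have "\<dots> = (if 1 \<le> a \<and> a \<le> length \<alpha> then \<alpha> ! (a - 1) else 0)"
    by auto
  finally show ?thesis .
qed

lemma mset_letters_incr:
  assumes "b < length \<alpha>"
  shows "mset (letters (incr b \<alpha>)) = add_mset (Suc b) (mset (letters \<alpha>))"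
  by (rule multiset_eqI) (use assms in \<open>auto simp: count_mset_letters incr_def nth_list_update\<close>)

section \<open>Elementary symmetric polynomials in powers of the variables\<close>

definition block :: "nat \<Rightarrow> nat set \<Rightarrow> monomial"
  where "block e B = (\<Sum>i\<in>B. sgl i e)"

lemma lookup_block: "finite B \<Longrightarrow> lk (block e B) i = (if i \<in> B then e else 0)"
  by (simp add: block_def lookup_sum lookup_single when_def)

lemma mdegree_block: "mdegree (block e B) = e * card B"
  by (simp add: block_def mdegree_sum)

text \<open>The \<open>l\<close>-th elementary symmetric polynomial in the \<open>e\<close>-th
  powers of the variables with index in \<open>A\<close>.\<close>

definition esym :: "nat \<Rightarrow> nat \<Rightarrow> nat set \<Rightarrow> 'k::field polynomials"
  where "esym e l A = (\<Sum>B\<in>{B. B \<subseteq> A \<and> card B = l}. mon (block e B))"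

lemma esym_0: "finite A \<Longrightarrow> esym e 0 A = 1"
proof -
  assume "finite A"
  then have "{B. B \<subseteq> A \<and> card B = 0} = {{}}" by (auto dest: finite_subset)
  then show ?thesis by (simp add: esym_def block_def mon_0)
qed

lemma perm_act_esym:
  assumes "\<sigma> permutes A" "finite A"
  shows "perm_act \<sigma> (esym e l A) = (esym e l A :: 'k::field polynomials)"
proof -
  have inj: "inj_on \<sigma> B" for B using permutes_inj_on[OF assms(1)] .
  have "perm_act \<sigma> (mon (block e B)) = (mon (block e (\<sigma> ` B)) :: 'k polynomials)" for B
    by (simp add: perm_act_mon block_def mono_act_sum sum.reindex[OF inj])
  then have "perm_act \<sigma> (esym e l A :: 'k polynomials) = (\<Sum>B\<in>{B. B \<subseteq> A \<and> card B = l}. mon (block e (\<sigma> ` B)))"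
    by (simp add: esym_def perm_act_sum)
  also have "\<dots> = (\<Sum>B\<in>(`) \<sigma> ` {B. B \<subseteq> A \<and> card B = l}. mon (block e B))"
    by (rule sum.reindex[symmetric, unfolded o_def], rule inj_onI)
      (simp add: inj_image_eq_iff[OF permutes_inj[OF assms(1)]])
  also have "(`) \<sigma> ` {B. B \<subseteq> A \<and> card B = l} = {B. B \<subseteq> A \<and> card B = l}"
  proof (intro equalityI subsetI)
    fix B assume "B \<in> (`) \<sigma> ` {B. B \<subseteq> A \<and> card B = l}"
    then obtain C where C: "B = \<sigma> ` C" "C \<subseteq> A" "card C = l" by blast
    then have "B \<subseteq> \<sigma> ` A" "card B = l" using card_image[OF inj] by auto
    then show "B \<in> {B. B \<subseteq> A \<and> card B = l}" using permutes_image[OF assms(1)] by simp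
  next
    fix B assume B: "B \<in> {B. B \<subseteq> A \<and> card B = l}"
    have "B \<subseteq> \<sigma> ` A" using B permutes_image[OF assms(1)] by simp
    then obtain C where C: "C \<subseteq> A" "B = \<sigma> ` C" using subset_imageE by metis
    then have "card C = l" using B card_image[OF inj] by auto
    then show "B \<in> (`) \<sigma> ` {B. B \<subseteq> A \<and> card B = l}" using C by blast
  qed
  finally show ?thesis by (simp add: esym_def)
qed

text \<open>Expanding \<open>\<Prod>a\<in>Z. (x\<^sub>i\<^sup>e - x\<^sub>a\<^sup>e) = 0\<close>.\<close>

lemma esym_relation:
  assumes "finite Z" "i \<in> Z"
  shows "(mon (sgl i (e * card Z)) :: 'k::field polynomials)
    = (\<Sum>l=1..card Z. scalar_mult ((-1) ^ Suc l) (esym e l Z * mon (sgl i (e * (card Z - l)))))"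
proof -
  define z where "z a = (mon (sgl a e) :: 'k polynomials)" for a
  have z_power: "z a ^ n = mon (sgl a (e * n))" for a n
    by (induction n) (simp_all add: z_def mon_0 flip: mon_add single_add)
  have z_prod: "(\<Prod>a\<in>Y. z a) = mon (block e Y)" for Y
    by (simp add: z_def mon_def block_def prod_single_1)
  have sc: "(-1) ^ n * p = scalar_mult ((-1) ^ n) p" for n and p :: "'k polynomials"
    by (induction n) (auto simp: pv.scale_minus_left)
  let ?t = "\<lambda>l. scalar_mult ((-1) ^ l) (esym e l Z * mon (sgl i (e * (card Z - l)))) :: 'k polynomials"
  have "0 = (\<Prod>a\<in>Z. z i - z a)" using assms by (intro prod_zero[symmetric]) auto
  also have "\<dots> = (\<Sum>Y\<in>Pow Z. (-1) ^ card Y * (\<Prod>a\<in>Y. z a) * (\<Prod>a\<in>Z - Y. z i))"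
    by (rule prod_diff_conv_sum[OF assms(1)])
  also have "\<dots> = (\<Sum>Y\<in>Pow Z. scalar_mult ((-1) ^ card Y) (mon (block e Y) * mon (sgl i (e * (card Z - card Y)))))"
  proof (rule sum.cong)
    fix Y assume Y: "Y \<in> Pow Z"
    then have "card (Z - Y) = card Z - card Y" using assms(1) by (auto intro: card_Diff_subset finite_subset)
    then show "(-1) ^ card Y * (\<Prod>a\<in>Y. z a) * (\<Prod>a\<in>Z - Y. z i)
        = scalar_mult ((-1) ^ card Y) (mon (block e Y) * mon (sgl i (e * (card Z - card Y))))"
      by (simp add: z_prod z_power mult.assoc sc scalar_mult_mult_left)
  qed simp
  also have "\<dots> = (\<Sum>l\<in>{0..card Z}. \<Sum>Y\<in>{Y \<in> Pow Z. card Y = l}. scalar_mult ((-1) ^ card Y) (mon (block e Y) * mon (sgl i (e * (card Z - card Y)))))"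
    using assms(1) by (intro sum.group[symmetric]) (auto intro: card_mono)
  also have "\<dots> = (\<Sum>l\<in>{0..card Z}. ?t l)"
  proof (rule sum.cong)
    fix l
    have "(\<Sum>Y\<in>{Y \<in> Pow Z. card Y = l}. scalar_mult ((-1) ^ card Y) (mon (block e Y) * mon (sgl i (e * (card Z - card Y)))))
        = (\<Sum>Y\<in>{Y. Y \<subseteq> Z \<and> card Y = l}. scalar_mult ((-1) ^ l) (mon (block e Y) * mon (sgl i (e * (card Z - l)))))"
      by (rule sum.cong) auto
    also have "\<dots> = ?t l"
      by (simp only: esym_def sum_distrib_right pv.scale_sum_right)
    finally show "(\<Sum>Y\<in>{Y \<in> Pow Z. card Y = l}. scalar_mult ((-1) ^ card Y) (mon (block e Y) * mon (sgl i (e * (card Z - card Y))))) = ?t l" .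
  qed simp
  also have "\<dots> = ?t 0 + (\<Sum>l=1..card Z. ?t l)"
    by (simp add: sum.atLeast_Suc_atMost)
  finally have "?t 0 = - (\<Sum>l=1..card Z. ?t l)" by (simp only: eq_neg_iff_add_eq_0)
  moreover have "- (\<Sum>l=1..card Z. ?t l) = (\<Sum>l=1..card Z. scalar_mult ((-1) ^ Suc l) (esym e l Z * mon (sgl i (e * (card Z - l)))))"
    unfolding sum_negf[symmetric] by (rule sum.cong) (simp_all add: pv.scale_minus_left)
  ultimately show ?thesis using assms(1) by (simp add: esym_0)
qed

text \<open>The common properties of the two subspaces whose Hilbert series are needed.
  \<open>J\<close> contains the ideal \<open>I\<close> but is only a subspace itself:
  \<open>var_J\<close> and \<open>esym_J\<close> allow just the multiplications by operators, from a
  threshold on that depends on the polynomial. The form \<open>f\<close> is homogeneous so that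
  rewriting with it stays in one degree.\<close>

locale dagger_space =
  fixes J I :: "'k::field polynomials set" and f :: "'k polynomials" and m1 :: monomial and D g k e :: nat
  assumes subJ: "pv.subspace J"
    and perm_J: "\<And>p \<sigma> N. \<sigma> permutes {g..<N} \<Longrightarrow> p - perm_act \<sigma> p \<in> J"
    and var_J: "\<And>p b. p \<in> J \<Longrightarrow> \<exists>N0. \<forall>N\<ge>N0. mon (sgl N b) * p \<in> J"
    and esym_J: "\<And>p l. p \<in> J \<Longrightarrow> \<exists>N0. \<forall>N\<ge>N0. esym e l {..<N} * p \<in> J"
    and IJ: "I \<subseteq> J" and idI: "poly_ideal I" and symI: "symmetric_ideal I"
    and fI: "f \<in> I" and form_f: "is_form D f" and m1: "m1 \<in> ks f"
    and dagger: "\<And>m. m \<in> ks f \<Longrightarrow> m \<noteq> m1 \<Longrightarrow> \<not> ks m \<subseteq> ks m1"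
    and k: "card (ks m1) = k"
    and e: "0 < e" "\<And>m i. m \<in> ks f \<Longrightarrow> lk m i < e"
begin

section \<open>The weight filtration and rewriting with (\<dagger>)\<close>

definition big :: "monomial \<Rightarrow> nat set"
  where "big m = {i. e \<le> lk m i}"

lemma big_subset: "big m \<subseteq> ks m"
  using e(1) by (auto simp: big_def in_keys_iff)

lemma finite_big: "finite (big m)"
  by (rule finite_subset[OF big_subset]) simp

definition tail :: "monomial \<Rightarrow> nat set"
  where "tail m = ks m \<inter> {g..}"

lemma finite_tail: "finite (tail m)"
  by (simp add: tail_def)

text \<open>
  Each of the variables outside the first \<open>g\<close> counts \<open>k + 1\<close>, so that a new variable in a term
  \<open>m \<noteq> m1\<close> of \<open>f\<close> outweighs the at most \<open>k\<close> exponents that drop below \<open>e\<close>.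
\<close>

definition wt :: "monomial \<Rightarrow> nat"
  where "wt m = card (big m) + (k + 1) * card (tail m)"

lemma big_mono: "big m \<subseteq> big (m + m')"
  by (auto simp: big_def lookup_add)

lemma tail_mono: "tail m \<subseteq> tail (m + m')"
  by (auto simp: tail_def keys_add_nat)

lemma wt_add: "wt m \<le> wt (m + m')"
  unfolding wt_def using card_mono[OF finite_big big_mono] card_mono[OF finite_tail tail_mono]
  by (simp add: add_mono)

lemma wt_le: "wt m \<le> (k + 2) * mdegree m"
proof -
  have "card (big m) \<le> mdegree m"
    using card_mono[OF finite_keys big_subset] card_keys_le_mdegree by (rule order_trans)
  moreover have "card (tail m) \<le> card (ks m)" unfolding tail_def by (rule card_mono) auto
  then have "card (tail m) \<le> mdegree m" using card_keys_le_mdegree by (rule order_trans)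
  then have "(k + 1) * card (tail m) \<le> (k + 1) * mdegree m" by (rule mult_left_mono) simp
  ultimately show ?thesis unfolding wt_def by (simp add: algebra_simps)
qed

definition W :: "nat \<Rightarrow> nat \<Rightarrow> 'k polynomials set"
  where "W d w = keys_within {m. mdegree m = d \<and> w \<le> wt m}"

definition U :: "nat \<Rightarrow> nat \<Rightarrow> 'k polynomials set"
  where "U d w = {x + y | x y. x \<in> W d w \<and> y \<in> J}"

lemma subspace_W: "pv.subspace (W d w)"
  unfolding W_def by (rule subspace_keys_within)

lemma subspace_U: "pv.subspace (U d w)"
  unfolding U_def by (rule pv.subspace_sums[OF subspace_W subJ])

lemma W_U: "x \<in> W d w \<Longrightarrow> x \<in> U d w"
  unfolding U_def using pv.subspace_0[OF subJ] by force

lemma J_U: "x \<in> J \<Longrightarrow> x \<in> U d w"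
  unfolding U_def using pv.subspace_0[OF subspace_W] by force

lemma W_antimono: "w \<le> w' \<Longrightarrow> W d w' \<subseteq> W d w"
  unfolding W_def by (rule keys_within_mono) auto

lemma mon_W: "mon m \<in> W d w \<longleftrightarrow> mdegree m = d \<and> w \<le> wt m"
  by (simp add: W_def keys_within_mon)

text \<open>Move the support of \<open>m1\<close> onto \<open>k\<close> big variables of
  \<open>m\<close> and the remaining variables of \<open>f\<close> to fresh ones. As all exponents
  of \<open>f\<close> are below \<open>e\<close>, the image of \<open>m1\<close> divides
  \<open>m\<close>, and a multiple of the image of \<open>f\<close> expresses \<open>m\<close>
  modulo \<open>J\<close> by its other terms. By (\<dagger>) each of these has a fresh variable,
  worth \<open>k + 1\<close>, against at most \<open>k\<close> big variables that are lost.\<close>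

lemma dagger_step:
  assumes "k \<le> card (big m)"
  shows "mon m \<in> U (mdegree m) (Suc (wt m))"
proof -
  define F where "F = (\<Union>m\<in>ks f. ks m)"
  have F: "finite F" "ks m1 \<subseteq> F" using m1 by (auto simp: F_def)
  obtain T where T: "T \<subseteq> big m" "card T = k" using obtain_subset_with_card_n[OF assms] by metis
  have finT: "finite T" using T(1) finite_big finite_subset by blast
  obtain h0 where h0: "bij_betw h0 (ks m1) T"
    using finite_same_card_bij[of "ks m1" T] finT T(2) k by auto
  \<comment> \<open>From \<open>n0\<close> on a variable is absent from \<open>m\<close> and not
    among the first \<open>g\<close>, so it counts fully in the weight.\<close>
  have "finite (ks m \<union> {..<g})" by simp
  then obtain n0 where n0: "\<forall>i\<in>ks m \<union> {..<g}. i < n0" using finite_nat_set_iff_bounded by blast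
  define h where "h x = (if x \<in> ks m1 then h0 x else n0 + x)" for x
  have h0T: "h0 x \<in> T" if "x \<in> ks m1" for x using h0 that by (auto simp: bij_betw_def)
  have T_small: "t < n0" if "t \<in> T" for t using T(1) big_subset n0 that by blast
  have "inj_on h F"
  proof (rule inj_onI)
    fix x y assume "h x = h y"
    then show "x = y"
      using h0 h0T[of x] h0T[of y] T_small[of "h0 x"] T_small[of "h0 y"]
      by (auto simp: h_def bij_betw_def inj_on_def split: if_splits)
  qed
  moreover have "finite (F \<union> h ` F)" using F(1) by simp
  then obtain M where "F \<union> h ` F \<subseteq> {..<M}" unfolding finite_nat_iff_bounded ..
  ultimately obtain \<sigma> where "\<sigma> permutes {..<M}" and \<sigma>_h: "\<forall>x\<in>F. \<sigma> x = h x"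
    using ex_permutation_extending[of h F M] by blast
  then have \<sigma>: "\<sigma> \<in> sym_infinity" "\<forall>x\<in>F. \<sigma> x = h x" by (auto simp: sym_infinity_def)
  have inj: "inj \<sigma>" using \<sigma>(1) by (auto simp: sym_infinity_def intro: permutes_inj)
  have \<sigma>S: "\<sigma> ` ks m1 = T"
    using \<sigma>(2) F(2) h0 by (auto simp: h_def bij_betw_def subset_iff image_iff)
  define m2 where "m2 = m - mono_act \<sigma> m1"
  have le: "lk (mono_act \<sigma> m1) i \<le> lk m i \<and> (i \<in> T \<longrightarrow> lk (mono_act \<sigma> m1) i < lk m i)
      \<and> (i \<notin> T \<longrightarrow> lk (mono_act \<sigma> m1) i = 0)" for i
  proof (cases "i \<in> T")
    case True
    then obtain j where "i = \<sigma> j" using \<sigma>S by blast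
    then have "lk (mono_act \<sigma> m1) i < e" using lookup_mono_act_inj[OF inj] e(2)[OF m1] by simp
    moreover have "e \<le> lk m i" using T(1) True by (auto simp: big_def)
    ultimately show ?thesis using True by simp
  next
    case False
    then have "i \<notin> ks (mono_act \<sigma> m1)" using keys_mono_act[OF inj] \<sigma>S by simp
    then show ?thesis using False by (simp add: in_keys_iff)
  qed
  have m: "m = mono_act \<sigma> m1 + m2"
    by (rule poly_mapping_eqI) (use le in \<open>simp add: m2_def lookup_add lookup_minus\<close>)
  \<comment> \<open>At each place of \<open>T\<close> the image of \<open>m1\<close> takes less than
    the full exponent, so every variable of \<open>m\<close> survives the division.\<close>
  have ks_m2: "ks m2 = ks m"
  proof (rule Set.set_eqI)
    fix i
    show "i \<in> ks m2 \<longleftrightarrow> i \<in> ks m"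
      using le[of i] by (cases "i \<in> T") (auto simp: m2_def in_keys_iff lookup_minus)
  qed
  define P where "P = perm_act \<sigma> f * mon m2"
  have "perm_act \<sigma> f \<in> I" using symI \<sigma>(1) fI by (simp add: symmetric_ideal_def)
  then have "mon m2 * perm_act \<sigma> f \<in> I" by (rule poly_ideal_mult[OF idI])
  then have "P \<in> J" using IJ unfolding P_def by (subst mult.commute) (rule subsetD)
  have step: "mon (mono_act \<sigma> m' + m2) \<in> W (mdegree m) (Suc (wt m))" if m': "m' \<in> ks f" "m' \<noteq> m1" for m'
  proof -
    let ?n = "mono_act \<sigma> m' + m2"
    obtain x where x: "x \<in> ks m'" "x \<notin> ks m1" using dagger[OF m'] by blast
    then have "x \<in> F" using m'(1) by (auto simp: F_def)
    then have \<sigma>x: "\<sigma> x = n0 + x" using \<sigma>(2) x(2) by (simp add: h_def)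
    have "\<sigma> x \<in> ks ?n" using x(1) by (simp add: keys_add_nat keys_mono_act[OF inj])
    moreover have "g \<le> n0" using n0 by (cases g) auto
    moreover have "\<sigma> x \<notin> ks m" using n0 \<sigma>x by fastforce
    ultimately have "insert (\<sigma> x) (tail m) \<subseteq> tail ?n" "\<sigma> x \<notin> tail m"
      using ks_m2 \<sigma>x by (auto simp: tail_def keys_add_nat)
    then have tail: "Suc (card (tail m)) \<le> card (tail ?n)"
      using card_mono[OF finite_tail, of "insert (\<sigma> x) (tail m)" ?n] by (simp add: finite_tail)
    \<comment> \<open>Only the \<open>k\<close> variables in \<open>T\<close> can stop being
      big.\<close>
    have "big m - T \<subseteq> big ?n"
      using le by (auto simp: big_def m2_def lookup_add lookup_minus)
    then have "card (big m - T) \<le> card (big ?n)" by (rule card_mono[OF finite_big])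
    then have "card (big m) \<le> card (big ?n) + k" using T finT by (simp add: card_Diff_subset)
    moreover have "(k + 1) * Suc (card (tail m)) \<le> (k + 1) * card (tail ?n)"
      using tail by (rule mult_left_mono) simp
    ultimately have "Suc (wt m) \<le> wt ?n" by (simp add: wt_def)
    moreover have "mdegree m' = D" "mdegree m1 = D" using form_f m'(1) m1 by (simp_all add: is_form_def)
    ultimately show ?thesis by (simp add: mon_W m)
  qed
  have "P = (\<Sum>m'\<in>ks f. scalar_mult (lk f m') (mon (mono_act \<sigma> m' + m2)))"
    by (simp add: P_def perm_act_eq sum_distrib_right mon_def mult_single)
  also have "\<dots> = scalar_mult (lk f m1) (mon m) + (\<Sum>m'\<in>ks f - {m1}. scalar_mult (lk f m') (mon (mono_act \<sigma> m' + m2)))"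
    using m1 by (subst sum.remove[of _ m1]) (simp_all flip: m)
  finally have "scalar_mult (lk f m1) (mon m) = P - (\<Sum>m'\<in>ks f - {m1}. scalar_mult (lk f m') (mon (mono_act \<sigma> m' + m2)))"
    by simp
  moreover have "(\<Sum>m'\<in>ks f - {m1}. scalar_mult (lk f m') (mon (mono_act \<sigma> m' + m2))) \<in> U (mdegree m) (Suc (wt m))"
    by (intro pv.subspace_sum[OF subspace_U] pv.subspace_scale[OF subspace_U] W_U step) auto
  ultimately have "scalar_mult (lk f m1) (mon m) \<in> U (mdegree m) (Suc (wt m))"
    using J_U[OF \<open>P \<in> J\<close>] by (simp add: pv.subspace_diff[OF subspace_U])
  then have "scalar_mult (1 / lk f m1) (scalar_mult (lk f m1) (mon m)) \<in> U (mdegree m) (Suc (wt m))"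
    by (rule pv.subspace_scale[OF subspace_U])
  then show ?thesis using m1 by (simp add: in_keys_iff)
qed

text \<open>The tail variables are packed to the indices from \<open>g\<close> on and are all big;
  small letters are left to the operators. An exponent of at least \<open>e + e * k\<close> still
  leaves \<open>e\<close> after the power \<open>e * q\<close>, with \<open>q \<le> k\<close> the
  number of big variables, is split off, so the variable stays big when \<open>esym_relation\<close>
  is applied to it. Smaller exponents are kept.\<close>

definition "gens = {(j, c). j \<le> k \<and> ks c \<subseteq> {..<g + j} \<and> (\<forall>i. lk c i < e + e * k) \<and> (\<forall>i\<in>{g..<g + j}. e \<le> lk c i)}"

lemma finite_gens: "finite gens"
proof (rule finite_subset)
  let ?M = "(g + k) * (e + e * k)"
  show "gens \<subseteq> {..k} \<times> (\<Union>d\<in>{..?M}. {c. ks c \<subseteq> {..<g + k} \<and> mdegree c = d})"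
  proof
    fix p assume "p \<in> gens"
    then obtain j c where p: "p = (j, c)" "j \<le> k" "ks c \<subseteq> {..<g + j}" "\<forall>i. lk c i < e + e * k"
      by (auto simp: gens_def)
    then have sub: "ks c \<subseteq> {..<g + k}" by auto
    then have "mdegree c = (\<Sum>i<g + k. lk c i)" by (intro mdegree_superset) auto
    also have "\<dots> \<le> of_nat (card {..<g + k}) * (e + e * k)"
      using p(4) by (intro sum_bounded_above) (simp add: less_imp_le)
    finally show "p \<in> {..k} \<times> (\<Union>d\<in>{..?M}. {c. ks c \<subseteq> {..<g + k} \<and> mdegree c = d})"
      using p sub by simp
  qed
  show "finite ({..k} \<times> (\<Union>d\<in>{..?M}. {c. ks c \<subseteq> {..<g + k} \<and> mdegree c = d}))"
    using finite_monomials by simp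
qed

definition gen :: "nat \<Rightarrow> nat \<times> monomial"
  where "gen = (SOME h. bij_betw h {0..<card gens} gens)"

lemma gen: "bij_betw gen {0..<card gens} gens"
  unfolding gen_def by (rule someI_ex[OF ex_bij_betw_nat_finite[OF finite_gens]])

lemma gen_in: "i < card gens \<Longrightarrow> gen i \<in> gens"
  using gen by (auto simp: bij_betw_def)

lemma gen_surj: "x \<in> gens \<Longrightarrow> \<exists>i<card gens. gen i = x"
proof -
  assume "x \<in> gens"
  then have "x \<in> gen ` {0..<card gens}" using gen by (simp add: bij_betw_def)
  then obtain i where "i \<in> {0..<card gens}" "x = gen i" by (rule imageE)
  then show ?thesis by (intro exI[of _ i]) simp
qed

definition E :: "nat set \<Rightarrow> nat list \<Rightarrow> 'k polynomials"
  where "E Z \<omega> = (\<Prod>l<k. esym e (Suc l) Z ^ (\<omega> ! l))"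

text \<open>A generator with operators of both kinds applied to it: the first \<open>k\<close>
  entries of \<omega> are exponents of symmetric polynomials, the others count the small letters.
  The symmetric polynomials run over the big variables of \<open>c\<close> only; those over
  \<open>{..<N}\<close> differ from them in higher weight (\<open>esym_diff_W\<close>).\<close>

definition uu :: "nat \<Rightarrow> monomial \<Rightarrow> nat list \<Rightarrow> 'k polynomials"
  where "uu j c \<omega> = mon c * E (big c) \<omega> * mon (plc (g + j) (letters (drop k \<omega>)))"

definition u :: "nat \<times> nat list \<Rightarrow> 'k polynomials"
  where "u p = uu (fst (gen (fst p))) (snd (gen (fst p))) (snd p)"

definition "dgen i = mdegree (snd (gen i))"
definition "wgen i = card (big (snd (gen i))) + (k + 1) * fst (gen i)"
text \<open>Degrees and weights of the operators. A symmetric polynomial in variables that are big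
  already changes neither the big variables nor the support, hence weight \<open>0\<close>. A new
  letter below \<open>e\<close> adds one tail variable and no big one, hence weight
  \<open>k + 1\<close>.\<close>

definition "\<delta> = map (\<lambda>l. e * Suc l) [0..<k] @ map Suc [0..<e - 1]"
definition "\<epsilon> = replicate k 0 @ replicate (e - 1) (k + 1)"

abbreviation S :: "nat \<Rightarrow> nat \<Rightarrow> (nat \<times> nat list) set"
  where "S \<equiv> graded_index (card gens) dgen wgen \<delta> \<epsilon>"

lemma length_\<delta>: "length \<delta> = k + (e - 1)" and length_\<epsilon>: "length \<epsilon> = k + (e - 1)"
  by (simp_all add: \<delta>_def \<epsilon>_def)

lemma \<delta>_nth: "l < k \<Longrightarrow> \<delta> ! l = e * Suc l" "k \<le> l \<Longrightarrow> l < k + (e - 1) \<Longrightarrow> \<delta> ! l = Suc (l - k)"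
  by (simp_all add: \<delta>_def nth_append)

lemma \<epsilon>_nth: "l < k \<Longrightarrow> \<epsilon> ! l = 0" "k \<le> l \<Longrightarrow> l < k + (e - 1) \<Longrightarrow> \<epsilon> ! l = k + 1"
  by (simp_all add: \<epsilon>_def nth_append)

lemma wdot_\<delta>:
  assumes "length \<omega> = k + (e - 1)"
  shows "wdot \<delta> \<omega> = (\<Sum>l<k. e * Suc l * \<omega> ! l) + sum_list (letters (drop k \<omega>))"
proof -
  have "wdot \<delta> (take k \<omega> @ drop k \<omega>) = wdot (map (\<lambda>l. e * Suc l) [0..<k]) (take k \<omega>) + wdot (map Suc [0..<e - 1]) (drop k \<omega>)"
    unfolding \<delta>_def using assms by (intro wdot_append) simp
  also have "wdot (map (\<lambda>l. e * Suc l) [0..<k]) (take k \<omega>) = (\<Sum>l<k. e * Suc l * \<omega> ! l)"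
    using assms by (subst wdot_conv_sum) (simp_all del: mult_Suc_right)
  also have "wdot (map Suc [0..<e - 1]) (drop k \<omega>) = sum_list (letters (drop k \<omega>))"
    using assms by (subst wdot_conv_sum) (simp_all add: sum_list_letters del: mult_Suc)
  finally show ?thesis by simp
qed

lemma wdot_\<epsilon>:
  assumes "length \<omega> = k + (e - 1)"
  shows "wdot \<epsilon> \<omega> = (k + 1) * sum_list (drop k \<omega>)"
proof -
  have "wdot \<epsilon> (take k \<omega> @ drop k \<omega>) = wdot (replicate k 0) (take k \<omega>) + wdot (replicate (e - 1) (k + 1)) (drop k \<omega>)"
    unfolding \<epsilon>_def using assms by (intro wdot_append) simp
  also have "wdot (replicate k 0) (take k \<omega>) = 0"
    using assms by (subst wdot_conv_sum) simp_all
  also have "wdot (replicate (e - 1) (k + 1)) (drop k \<omega>) = (\<Sum>l<e - 1. (k + 1) * drop k \<omega> ! l)"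
    using assms by (subst wdot_conv_sum) simp_all
  also have "\<dots> = (k + 1) * (\<Sum>l<e - 1. drop k \<omega> ! l)" by (rule sum_distrib_left[symmetric])
  also have "(\<Sum>l<e - 1. drop k \<omega> ! l) = sum_list (drop k \<omega>)"
    using assms by (simp add: sum_list_sum_nth atLeast0LessThan)
  finally show ?thesis by simp
qed

text \<open>Monomials that agree in their big variables and in their tail, and therefore in their
  weight. Each \<open>uu j c \<omega>\<close> lives on one such set (\<open>uu_Q\<close>), which
  pins down the weight of all its terms.\<close>

definition Q :: "nat set \<Rightarrow> nat set \<Rightarrow> nat \<Rightarrow> monomial set"
  where "Q Z T d = {m. mdegree m = d \<and> big m = Z \<and> tail m = T}"

lemma Q_wt: "m \<in> Q Z T d \<Longrightarrow> wt m = card Z + (k + 1) * card T"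
  by (simp add: Q_def wt_def)

lemma big_block: "finite B \<Longrightarrow> big (block e B + m) = B \<union> big m"
  by (auto simp: big_def lookup_add lookup_block)

lemma keys_block: "finite B \<Longrightarrow> ks (block e B) = B"
  using e(1) by (auto simp: in_keys_iff lookup_block split: if_splits)

lemma esym_keys: "finite A \<Longrightarrow> esym e l A \<in> keys_within {block e B | B. B \<subseteq> A \<and> card B = l}"
  unfolding esym_def by (intro pv.subspace_sum[OF subspace_keys_within]) (auto simp: keys_within_mon)

text \<open>The \<open>e\<close>-th powers multiply variables that are big already, so neither the
  big variables nor the support change.\<close>

lemma esym_Q:
  assumes "p \<in> keys_within (Q Z T d)" "finite Z"
  shows "esym e l Z * p \<in> keys_within (Q Z T (d + e * l))"
proof (rule keys_within_mult[OF esym_keys[OF assms(2)] assms(1)])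
  fix a b assume "a \<in> {block e B | B. B \<subseteq> Z \<and> card B = l}" and b: "b \<in> Q Z T d"
  then obtain B where B: "a = block e B" "B \<subseteq> Z" "card B = l" by blast
  have fin: "finite B" using B(2) assms(2) finite_subset by blast
  have "B \<subseteq> ks b" using B(2) b big_subset[of b] by (auto simp: Q_def)
  then have "tail (a + b) = tail b" by (auto simp: tail_def keys_add_nat B(1) keys_block[OF fin])
  then show "a + b \<in> Q Z T (d + e * l)"
    using b B by (auto simp: Q_def mdegree_block big_block[OF fin])
qed

lemma esym_power_Q:
  assumes "p \<in> keys_within (Q Z T d)" "finite Z"
  shows "esym e l Z ^ n * p \<in> keys_within (Q Z T (d + e * l * n))"
proof (induction n)
  case (Suc n)
  from esym_Q[OF Suc assms(2), of l] show ?case by (simp add: mult.assoc algebra_simps)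
qed (use assms in simp)

lemma E_Q:
  assumes "p \<in> keys_within (Q Z T d)" "finite Z"
  shows "E Z \<omega> * p \<in> keys_within (Q Z T (d + (\<Sum>l<k. e * Suc l * \<omega> ! l)))"
proof -
  have "(\<Prod>l\<in>A. esym e (Suc l) Z ^ (\<omega> ! l)) * p \<in> keys_within (Q Z T (d + (\<Sum>l\<in>A. e * Suc l * \<omega> ! l)))"
    if "finite A" for A
    using that
  proof (induction A rule: finite_induct)
    case (insert x A)
    from esym_power_Q[OF insert.IH assms(2), of "Suc x" "\<omega> ! x"] show ?case
      using insert.hyps by (simp add: mult.assoc add.assoc add.commute add.left_commute del: mult_Suc_right)
  qed (use assms in simp)
  then show ?thesis by (simp add: E_def)
qed

lemma letters_Q:
  assumes "p \<in> keys_within (Q Z {g..<g + j} d)" "length \<alpha> = e - 1"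
  shows "p * mon (plc (g + j) (letters \<alpha>)) \<in> keys_within (Q Z {g..<g + j + sum_list \<alpha>} (d + sum_list (letters \<alpha>)))"
proof (rule keys_within_mult[OF assms(1)])
  show "mon (plc (g + j) (letters \<alpha>)) \<in> keys_within {plc (g + j) (letters \<alpha>)}" by (simp add: keys_within_mon)
  fix a b assume a: "a \<in> Q Z {g..<g + j} d" and "b \<in> {plc (g + j) (letters \<alpha>)}"
  then have b: "b = plc (g + j) (letters \<alpha>)" by simp
  have L: "0 \<notin> set (letters \<alpha>)" "\<forall>x\<in>set (letters \<alpha>). x < e"
    using subsetD[OF set_letters[of \<alpha>]] assms(2) e(1) by fastforce+
  have kb: "ks b = {g + j..<g + j + sum_list \<alpha>}" unfolding b keys_plc[OF L(1)] by (simp add: length_letters)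
  have small: "lk b i < e" for i
  proof (cases "g + j \<le> i \<and> i < g + j + length (letters \<alpha>)")
    case True
    then have "letters \<alpha> ! (i - (g + j)) \<in> set (letters \<alpha>)" by (intro nth_mem) auto
    with L(2) True show ?thesis by (simp add: b lookup_plc)
  next
    case False
    then have "lk b i = 0" unfolding b by (simp only: lookup_plc if_False)
    then show ?thesis using e(1) by simp
  qed
  have zero: "lk a i = 0 \<or> lk b i = 0" for i
  proof (cases "i \<in> ks b")
    case True
    then have "i \<notin> tail a" "g \<le> i" using kb a by (auto simp: Q_def)
    then show ?thesis by (simp add: tail_def in_keys_iff)
  qed (simp add: in_keys_iff)
  have "big (a + b) = big a"
  proof (rule Set.set_eqI)
    fix i
    show "i \<in> big (a + b) \<longleftrightarrow> i \<in> big a"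
      using zero[of i] small[of i] e(1) by (auto simp: big_def lookup_add)
  qed
  moreover have "mdegree b = sum_list (letters \<alpha>)" by (simp add: b mdegree_plc)
  moreover have "tail (a + b) = {g..<g + j + sum_list \<alpha>}"
  proof -
    have "ks b \<inter> {g..} = {g + j..<g + j + sum_list \<alpha>}" unfolding kb by auto
    moreover have "tail a = {g..<g + j}" using a by (simp add: Q_def)
    ultimately have "tail (a + b) = {g..<g + j} \<union> {g + j..<g + j + sum_list \<alpha>}"
      by (simp only: tail_def keys_add_nat Int_Un_distrib2)
    then show ?thesis by (simp add: ivl_disj_un_two(3))
  qed
  ultimately show "a + b \<in> Q Z {g..<g + j + sum_list \<alpha>} (d + sum_list (letters \<alpha>))"
    using a \<open>mdegree b = sum_list (letters \<alpha>)\<close> by (auto simp: Q_def)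
qed

lemma gens_Q:
  assumes "ks c \<subseteq> {..<g + j}" "\<forall>i\<in>{g..<g + j}. e \<le> lk c i"
  shows "mon c \<in> keys_within (Q (big c) {g..<g + j} (mdegree c))"
proof -
  have "i \<in> ks c" if "i \<in> {g..<g + j}" for i
  proof -
    have "0 < lk c i" using bspec[OF assms(2) that] e(1) by linarith
    then show ?thesis by (simp add: in_keys_iff)
  qed
  then have "tail c = {g..<g + j}" using assms(1) by (auto simp: tail_def)
  then show ?thesis by (simp add: keys_within_mon Q_def)
qed

lemma uu_Q:
  assumes "ks c \<subseteq> {..<g + j}" "\<forall>i\<in>{g..<g + j}. e \<le> lk c i" "length \<omega> = k + (e - 1)"
  shows "uu j c \<omega> \<in> keys_within (Q (big c) {g..<g + j + sum_list (drop k \<omega>)} (mdegree c + wdot \<delta> \<omega>))"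
proof -
  have "E (big c) \<omega> * mon c \<in> keys_within (Q (big c) {g..<g + j} (mdegree c + (\<Sum>l<k. e * Suc l * \<omega> ! l)))"
    by (rule E_Q[OF gens_Q[OF assms(1,2)] finite_big])
  from letters_Q[OF this, of "drop k \<omega>"] show ?thesis
    using assms(3) by (simp add: uu_def wdot_\<delta>[OF assms(3)] add.assoc mult.commute[of "mon c"])
qed

lemma gens_D: "(j, c) \<in> gens \<Longrightarrow> j \<le> k \<and> ks c \<subseteq> {..<g + j} \<and> (\<forall>i\<in>{g..<g + j}. e \<le> lk c i)"
  by (simp add: gens_def)

lemma S_D:
  assumes "p \<in> S d w"
  obtains i j c \<omega> where "p = (i, \<omega>)" "gen i = (j, c)" "(j, c) \<in> gens" "i < card gens" "length \<omega> = k + (e - 1)"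
    "mdegree c + wdot \<delta> \<omega> = d" "card (big c) + (k + 1) * (j + sum_list (drop k \<omega>)) = w" "u p = uu j c \<omega>"
proof -
  obtain i \<omega> where p: "p = (i, \<omega>)" by (cases p)
  obtain j c where jc: "gen i = (j, c)" by (cases "gen i")
  have S: "i < card gens" "length \<omega> = k + (e - 1)" "dgen i + wdot \<delta> \<omega> = d" "wgen i + wdot \<epsilon> \<omega> = w"
    using assms by (simp_all add: p graded_index_def length_\<delta>)
  show ?thesis
    by (rule that[OF p jc]) (use S gen_in[OF S(1)] in \<open>simp_all add: jc p u_def dgen_def wgen_def wdot_\<epsilon> algebra_simps\<close>)
qed

lemma S_I:
  assumes "(j, c) \<in> gens" "length \<omega> = k + (e - 1)"
    "mdegree c + wdot \<delta> \<omega> = d" "card (big c) + (k + 1) * (j + sum_list (drop k \<omega>)) = w"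
  shows "\<exists>p. p \<in> S d w \<and> u p = uu j c \<omega>"
proof -
  obtain i where "i < card gens" "gen i = (j, c)" using gen_surj[OF assms(1)] by blast
  then show ?thesis using assms
    by (intro exI[of _ "(i, \<omega>)"]) (simp add: graded_index_def length_\<delta> u_def dgen_def wgen_def wdot_\<epsilon> algebra_simps)
qed

lemma u_in_W: "p \<in> S d w \<Longrightarrow> u p \<in> W d w"
proof -
  assume "p \<in> S d w"
  then obtain i j c \<omega> where *: "p = (i, \<omega>)" "gen i = (j, c)" "(j, c) \<in> gens" "i < card gens" "length \<omega> = k + (e - 1)"
    "mdegree c + wdot \<delta> \<omega> = d" "card (big c) + (k + 1) * (j + sum_list (drop k \<omega>)) = w" "u p = uu j c \<omega>"
    by (rule S_D)
  have "u p \<in> keys_within (Q (big c) {g..<g + j + sum_list (drop k \<omega>)} d)"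
    using uu_Q[of c j \<omega>] gens_D[OF *(3)] * by simp
  moreover have "Q (big c) {g..<g + j + sum_list (drop k \<omega>)} d \<subseteq> {m. mdegree m = d \<and> w \<le> wt m}"
  proof
    fix m assume "m \<in> Q (big c) {g..<g + j + sum_list (drop k \<omega>)} d"
    from Q_wt[OF this] this show "m \<in> {m. mdegree m = d \<and> w \<le> wt m}"
      using *(7) by (simp add: Q_def add.assoc)
  qed
  ultimately show ?thesis unfolding W_def using keys_within_mono by blast
qed

lemma finite_S: "finite (S d w)"
proof (rule finite_subset)
  show "S d w \<subseteq> {..<card gens} \<times> {\<omega>. length \<omega> = length \<delta> \<and> wdot \<delta> \<omega> \<le> d}"
    unfolding graded_index_def by auto
  show "finite ({..<card gens} \<times> {\<omega>. length \<omega> = length \<delta> \<and> wdot \<delta> \<omega> \<le> d})"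
    using e(1) by (intro finite_cartesian_product finite_wdot_le) (auto simp: \<delta>_def)
qed

lemma E_incr: "l < k \<Longrightarrow> k \<le> length \<omega> \<Longrightarrow> E Z (incr l \<omega>) = esym e (Suc l) Z * E Z \<omega>"
proof -
  assume l: "l < k" "k \<le> length \<omega>"
  have "E Z (incr l \<omega>) = esym e (Suc l) Z ^ (incr l \<omega> ! l) * (\<Prod>i\<in>{..<k} - {l}. esym e (Suc i) Z ^ (incr l \<omega> ! i))"
    unfolding E_def using l by (intro prod.remove) auto
  also have "(\<Prod>i\<in>{..<k} - {l}. esym e (Suc i) Z ^ (incr l \<omega> ! i)) = (\<Prod>i\<in>{..<k} - {l}. esym e (Suc i) Z ^ (\<omega> ! i))"
    by (rule prod.cong) (auto simp: incr_def)
  also have "incr l \<omega> ! l = Suc (\<omega> ! l)" using l by (simp add: incr_def)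
  finally have "E Z (incr l \<omega>) = esym e (Suc l) Z * (esym e (Suc l) Z ^ (\<omega> ! l) * (\<Prod>i\<in>{..<k} - {l}. esym e (Suc i) Z ^ (\<omega> ! i)))"
    by (simp add: mult.assoc)
  also have "esym e (Suc l) Z ^ (\<omega> ! l) * (\<Prod>i\<in>{..<k} - {l}. esym e (Suc i) Z ^ (\<omega> ! i)) = E Z \<omega>"
    unfolding E_def using l by (intro prod.remove[symmetric]) auto
  finally show ?thesis .
qed

lemma E_incr_ge: "k \<le> l \<Longrightarrow> E Z (incr l \<omega>) = E Z \<omega>"
  unfolding E_def by (rule prod.cong) (auto simp: incr_def)

lemma drop_incr: "l < k \<Longrightarrow> drop k (incr l \<omega>) = drop k \<omega>"
  "k \<le> l \<Longrightarrow> l < length \<omega> \<Longrightarrow> drop k (incr l \<omega>) = incr (l - k) (drop k \<omega>)"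
  by (simp_all add: incr_def drop_update_swap)

section \<open>The operators on the graded pieces\<close>

lemma u_incr:
  assumes "p \<in> S d w" "l < k" "p = (i, \<omega>)" "gen i = (j, c)"
  shows "u (pair_incr l p) = esym e (Suc l) (big c) * u p"
  using assms E_incr[of l \<omega> "big c"]
  by (simp add: pair_incr_def u_def uu_def drop_incr graded_index_def length_\<delta> mult_ac)

text \<open>The difference consists of the blocks not contained in \<open>Z\<close>. Such a block
  makes a variable outside \<open>Z\<close> big, and multiplication loses no tail variable.\<close>

lemma esym_diff_W:
  assumes "q \<in> keys_within (Q Z T d)" "Z \<subseteq> {..<N}" "card Z + (k + 1) * card T = w"
  shows "(esym e l {..<N} - esym e l Z) * q \<in> W (d + e * l) (Suc w)"
  unfolding W_def
proof (rule keys_within_mult[OF _ assms(1)])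
  let ?A = "{B. B \<subseteq> {..<N} \<and> card B = l}" and ?B = "{B. B \<subseteq> Z \<and> card B = l}"
  have "finite ?A" by (rule finite_subset[of _ "Pow {..<N}"]) auto
  moreover have "?B \<subseteq> ?A" using assms(2) by blast
  ultimately have "(esym e l {..<N} :: 'k polynomials) - esym e l Z = (\<Sum>B\<in>?A - ?B. mon (block e B))"
    unfolding esym_def by (rule sum_diff[symmetric])
  moreover have "(\<Sum>B\<in>?A - ?B. mon (block e B)) \<in> keys_within {block e B | B. B \<in> ?A - ?B}"
    by (intro pv.subspace_sum[OF subspace_keys_within]) (auto simp: keys_within_mon)
  ultimately show "(esym e l {..<N} :: 'k polynomials) - esym e l Z \<in> keys_within {block e B | B. B \<in> ?A - ?B}" by simp
next
  fix a b assume "a \<in> {block e B | B. B \<in> {B. B \<subseteq> {..<N} \<and> card B = l} - {B. B \<subseteq> Z \<and> card B = l}}" and b: "b \<in> Q Z T d"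
  then obtain B where B: "a = block e B" "B \<subseteq> {..<N}" "card B = l" "\<not> B \<subseteq> Z" by blast
  have fin: "finite B" using B(2) finite_subset by blast
  have "big b \<subset> big (a + b)" using b B(4) by (auto simp: B(1) big_block[OF fin] Q_def)
  then have "card (big b) < card (big (a + b))" by (rule psubset_card_mono[OF finite_big])
  moreover have "card (tail b) \<le> card (tail (a + b))"
    using card_mono[OF finite_tail tail_mono, of b a] by (simp add: add.commute)
  then have "(k + 1) * card (tail b) \<le> (k + 1) * card (tail (a + b))" by (rule mult_left_mono) simp
  ultimately have "Suc (wt b) \<le> wt (a + b)" unfolding wt_def by linarith
  then show "a + b \<in> {m. mdegree m = d + e * l \<and> Suc w \<le> wt m}"
    using b Q_wt[OF b] assms(3) by (simp add: Q_def B mdegree_block)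
qed

lemma esym_W: "p \<in> W d w \<Longrightarrow> esym e l {..<N} * p \<in> W (d + e * l) w"
  unfolding W_def
proof (rule keys_within_mult[OF esym_keys])
  fix a b assume "a \<in> {block e B | B. B \<subseteq> {..<N} \<and> card B = l}" "b \<in> {m. mdegree m = d \<and> w \<le> wt m}"
  then show "a + b \<in> {m. mdegree m = d + e * l \<and> w \<le> wt m}"
    using wt_add[of b a] by (auto simp: mdegree_block add.commute)
qed auto

lemma U_D: "x \<in> U d w \<Longrightarrow> \<exists>y z. x = y + z \<and> y \<in> W d w \<and> z \<in> J"
  unfolding U_def by blast

text \<open>Multiply the relation by the symmetric polynomial over \<open>{..<N}\<close>, which
  keeps the part in \<open>J\<close> there for large \<open>N\<close> and lowers no weight. Then
  replace it, index by index, by the one over the big variables of the generator; the error has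
  larger weight.\<close>

lemma U_step_esym:
  assumes l: "l < k" and x: "(\<Sum>p\<in>S d w. scalar_mult (a p) (u p)) \<in> U d (Suc w)"
  shows "(\<Sum>p\<in>S d w. scalar_mult (a p) (u (pair_incr l p))) \<in> U (d + e * Suc l) (Suc w)"
proof -
  let ?x = "\<Sum>p\<in>S d w. scalar_mult (a p) (u p)"
  obtain y z where yz: "?x = y + z" "y \<in> W d (Suc w)" "z \<in> J" using U_D[OF x] by blast
  obtain N0 where N0: "\<forall>N\<ge>N0. esym e (Suc l) {..<N} * z \<in> J" using esym_J[OF yz(3)] by blast
  \<comment> \<open>\<open>N0\<close> takes care of \<open>z\<close>, and \<open>g + k\<close>
    exceeds the indices of all variables of the generators.\<close>
  define N where "N = max N0 (g + k)"
  let ?F = "esym e (Suc l) {..<N} :: 'k polynomials"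
  have "?F * y \<in> W (d + e * Suc l) (Suc w)" by (rule esym_W[OF yz(2)])
  moreover have "?F * z \<in> J" using N0 by (simp add: N_def)
  ultimately have "?F * ?x \<in> U (d + e * Suc l) (Suc w)"
    unfolding yz(1) distrib_left by (intro pv.subspace_add[OF subspace_U] W_U J_U)
  moreover have "?F * u p - u (pair_incr l p) \<in> U (d + e * Suc l) (Suc w)" if p: "p \<in> S d w" for p
  proof -
    obtain i j c \<omega> where *: "p = (i, \<omega>)" "gen i = (j, c)" "(j, c) \<in> gens" "i < card gens" "length \<omega> = k + (e - 1)"
      "mdegree c + wdot \<delta> \<omega> = d" "card (big c) + (k + 1) * (j + sum_list (drop k \<omega>)) = w" "u p = uu j c \<omega>"
      using p by (rule S_D)
    have "u p \<in> keys_within (Q (big c) {g..<g + j + sum_list (drop k \<omega>)} d)"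
      using uu_Q[of c j \<omega>] gens_D[OF *(3)] * by simp
    then have "(?F - esym e (Suc l) (big c)) * u p \<in> W (d + e * Suc l) (Suc w)"
    proof (rule esym_diff_W)
      show "big c \<subseteq> {..<N}" using big_subset[of c] gens_D[OF *(3)] by (auto simp: N_def)
      show "card (big c) + (k + 1) * card {g..<g + j + sum_list (drop k \<omega>)} = w" using *(7) by (simp add: add.assoc)
    qed
    then show ?thesis by (intro W_U) (simp add: u_incr[OF p l *(1,2)] left_diff_distrib)
  qed
  then have "(\<Sum>p\<in>S d w. scalar_mult (a p) (?F * u p - u (pair_incr l p))) \<in> U (d + e * Suc l) (Suc w)"
    by (intro pv.subspace_sum[OF subspace_U] pv.subspace_scale[OF subspace_U])
  ultimately have "?F * ?x - (\<Sum>p\<in>S d w. scalar_mult (a p) (?F * u p - u (pair_incr l p))) \<in> U (d + e * Suc l) (Suc w)"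
    by (rule pv.subspace_diff[OF subspace_U])
  moreover have "?F * ?x - (\<Sum>p\<in>S d w. scalar_mult (a p) (?F * u p - u (pair_incr l p)))
      = (\<Sum>p\<in>S d w. scalar_mult (a p) (u (pair_incr l p)))"
    by (simp add: sum_distrib_left pv.scale_right_diff_distrib sum_subtractf flip: scalar_mult_mult_right)
  ultimately show ?thesis by (simp only:)
qed

lemma mono_act_fix_below: "\<sigma> permutes {n..<N} \<Longrightarrow> ks m \<subseteq> {..<n} \<Longrightarrow> mono_act \<sigma> m = m"
  by (rule mono_act_id, rule permutes_not_in[of _ "{n..<N}"]) auto

lemma perm_act_E_fix:
  assumes "\<sigma> permutes {n..<N}" "Z \<subseteq> {..<n}"
  shows "perm_act \<sigma> (E Z \<omega>) = E Z \<omega>"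
proof -
  have "perm_act \<sigma> (esym e l Z) = (esym e l Z :: 'k polynomials)" for l
    unfolding esym_def perm_act_sum perm_act_mon
  proof (rule sum.cong)
    fix B assume "B \<in> {B. B \<subseteq> Z \<and> card B = l}"
    then have B: "B \<subseteq> {..<n}" "finite B" using assms(2) finite_subset[of B "{..<n}"] by auto
    then show "mon (mono_act \<sigma> (block e B)) = (mon (block e B) :: 'k polynomials)"
      using mono_act_fix_below[OF assms(1), of "block e B"] by (simp add: keys_block)
  qed simp
  then show ?thesis by (simp add: E_def perm_act_prod perm_act_power)
qed

text \<open>The letters of \<open>a\<close> are moved to the places of \<open>b\<close> by a
  permutation that fixes the first \<open>n\<close> variables, hence \<open>c\<close> and the
  symmetric polynomials over \<open>Z\<close>.\<close>

lemma mon_congruent: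
  assumes "Z \<subseteq> {..<n}" "ks c \<subseteq> {..<n}" "g \<le> n" "ks a \<subseteq> {n..}" "ks b \<subseteq> {n..}" "nzm a = nzm b"
  shows "mon c * E Z \<omega> * mon a - mon c * E Z \<omega> * mon b \<in> J"
proof -
  obtain N \<sigma> where \<sigma>: "\<sigma> permutes {n..<N}" "mono_act \<sigma> a = b"
    using ex_mono_act_nzm[OF assms(6,4,5)] by blast
  have "\<sigma> permutes {g..<N}" using \<sigma>(1) assms(3) by (auto intro: permutes_subset)
  from perm_J[OF this, of "mon c * E Z \<omega> * mon a"] show ?thesis
    by (simp add: perm_act_mult perm_act_mon perm_act_E_fix[OF \<sigma>(1) assms(1)] \<sigma>(2)
      mono_act_fix_below[OF \<sigma>(1) assms(2)])
qed

text \<open>Multiply the relation by a power of a variable that does not occur. This adds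
  \<open>k + 1\<close> to the weight of the part \<open>y\<close>, and in each \<open>u p\<close>
  the new letter can be moved into the sorted word modulo \<open>J\<close>.\<close>

lemma U_step_var:
  assumes l: "k \<le> l" "l < k + (e - 1)" and x: "(\<Sum>p\<in>S d w. scalar_mult (a p) (u p)) \<in> U d (Suc w)"
  shows "(\<Sum>p\<in>S d w. scalar_mult (a p) (u (pair_incr l p))) \<in> U (d + Suc (l - k)) (Suc (w + (k + 1)))"
proof -
  let ?b = "Suc (l - k)" and ?U = "U (d + Suc (l - k)) (Suc (w + (k + 1)))"
  let ?x = "\<Sum>p\<in>S d w. scalar_mult (a p) (u p)"
  obtain y z where yz: "?x = y + z" "y \<in> W d (Suc w)" "z \<in> J" using U_D[OF x] by blast
  obtain N0 where N0: "\<forall>N\<ge>N0. mon (sgl N ?b) * z \<in> J" using var_J[OF yz(3)] by blast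
  obtain n1 where n1: "y \<in> polys_in n1" using ex_polys_in by blast
  \<comment> \<open>\<open>N\<close> lies beyond the threshold for \<open>z\<close>, the variables
    of \<open>y\<close> and those of every \<open>u p\<close>: the generator uses indices below
    \<open>g + k\<close>, and there are at most \<open>w\<close> small letters since each weighs
    \<open>k + 1\<close>.\<close>
  define N where "N = N0 + n1 + g + k + w"
  let ?V = "mon (sgl N ?b) :: 'k polynomials"
  have "?V * y \<in> W (d + ?b) (Suc (w + (k + 1)))"
    unfolding W_def
  proof (rule keys_within_mult)
    show "?V \<in> keys_within {sgl N ?b}" by (simp add: keys_within_mon)
    show "y \<in> keys_within {m. mdegree m = d \<and> Suc w \<le> wt m \<and> N \<notin> ks m}"
      using yz(2) n1 unfolding W_def polys_in_def keys_within_def N_def by fastforce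
    fix m' m assume "m' \<in> {sgl N ?b}" and m: "m \<in> {m. mdegree m = d \<and> Suc w \<le> wt m \<and> N \<notin> ks m}"
    then have m': "m' = sgl N ?b" by simp
    have "insert N (tail m) \<subseteq> tail (m' + m)" by (auto simp: tail_def keys_add_nat m' N_def)
    then have "Suc (card (tail m)) \<le> card (tail (m' + m))"
      using card_mono[OF finite_tail, of "insert N (tail m)" "m' + m"] m by (simp add: finite_tail tail_def)
    then have "(k + 1) * Suc (card (tail m)) \<le> (k + 1) * card (tail (m' + m))" by (rule mult_left_mono) simp
    moreover have "card (big m) \<le> card (big (m' + m))"
      using card_mono[OF finite_big big_mono, of m m'] by (simp add: add.commute)
    ultimately have "wt m + (k + 1) \<le> wt (m' + m)" unfolding wt_def by simp
    then show "m' + m \<in> {m. mdegree m = d + ?b \<and> Suc (w + (k + 1)) \<le> wt m}"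
      using m by (simp add: m')
  qed
  moreover have "?V * z \<in> J" using N0 by (simp add: N_def)
  ultimately have "?V * ?x \<in> ?U"
    unfolding yz(1) distrib_left by (intro pv.subspace_add[OF subspace_U] W_U J_U)
  moreover have "?V * u p - u (pair_incr l p) \<in> ?U" if p: "p \<in> S d w" for p
  proof -
    obtain i j c \<omega> where *: "p = (i, \<omega>)" "gen i = (j, c)" "(j, c) \<in> gens" "i < card gens" "length \<omega> = k + (e - 1)"
      "mdegree c + wdot \<delta> \<omega> = d" "card (big c) + (k + 1) * (j + sum_list (drop k \<omega>)) = w" "u p = uu j c \<omega>"
      using p by (rule S_D)
    let ?\<alpha> = "drop k \<omega>"
    have lb: "l - k < length ?\<alpha>" using l *(5) by simp
    have L0: "0 \<notin> set (letters \<alpha>)" for \<alpha> using set_letters[of \<alpha>] by auto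
    have "sum_list ?\<alpha> \<le> w" using *(7) by (simp add: algebra_simps)
    then have N: "g + j + sum_list ?\<alpha> \<le> N" using gens_D[OF *(3)] by (simp add: N_def)
    have "nzm (sgl N ?b + plc (g + j) (letters ?\<alpha>)) = nzm (plc (g + j) (letters (incr (l - k) ?\<alpha>)))"
      using N by (subst nzm_add) (simp_all add: keys_plc[OF L0] nzm_plc[OF L0] nzm_single mset_letters_incr[OF lb] length_letters)
    then have "mon c * E (big c) \<omega> * mon (sgl N ?b + plc (g + j) (letters ?\<alpha>))
        - mon c * E (big c) \<omega> * mon (plc (g + j) (letters (incr (l - k) ?\<alpha>))) \<in> J"
      using gens_D[OF *(3)] big_subset[of c] N
      by (intro mon_congruent[of "big c" "g + j" c]) (auto simp: keys_add_nat keys_plc[OF L0])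
    moreover have "u (pair_incr l p) = mon c * E (big c) \<omega> * mon (plc (g + j) (letters (incr (l - k) ?\<alpha>)))"
      using l *(5) by (simp add: u_def pair_incr_def *(1,2) uu_def E_incr_ge drop_incr)
    ultimately have "?V * u p - u (pair_incr l p) \<in> J"
      by (simp add: *(8) uu_def mon_add mult_ac)
    then show ?thesis by (rule J_U)
  qed
  then have "(\<Sum>p\<in>S d w. scalar_mult (a p) (?V * u p - u (pair_incr l p))) \<in> ?U"
    by (intro pv.subspace_sum[OF subspace_U] pv.subspace_scale[OF subspace_U])
  ultimately have "?V * ?x - (\<Sum>p\<in>S d w. scalar_mult (a p) (?V * u p - u (pair_incr l p))) \<in> ?U"
    by (rule pv.subspace_diff[OF subspace_U])
  moreover have "?V * ?x - (\<Sum>p\<in>S d w. scalar_mult (a p) (?V * u p - u (pair_incr l p)))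
      = (\<Sum>p\<in>S d w. scalar_mult (a p) (u (pair_incr l p)))"
    by (simp add: sum_distrib_left pv.scale_right_diff_distrib sum_subtractf flip: scalar_mult_mult_right)
  ultimately show ?thesis by (simp only:)
qed

text \<open>Induction on the degree of \<open>c\<close>. By \<open>esym_relation\<close> a large
  power of a big variable is a combination of smaller powers with symmetric polynomials as
  coefficients, so degree moves from \<open>c\<close> into \<open>E\<close>, and the total degree
  and the big variables stay the same. \<open>Y\<close> is an arbitrary subspace so that the small
  letters, which take no part in this, can be absorbed into it.\<close>

lemma gens_reduce:
  assumes Y: "pv.subspace Y"
    and base: "\<And>c \<omega>. (j, c) \<in> gens \<Longrightarrow> big c = Z \<Longrightarrow> length \<omega> = k + (e - 1) \<Longrightarrow> drop k \<omega> = \<alpha> \<Longrightarrow>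
      mdegree c + wdot \<delta> \<omega> = d \<Longrightarrow> mon c * E Z \<omega> \<in> Y"
    and "j \<le> k" "card Z \<le> k"
  shows "ks c \<subseteq> {..<g + j} \<Longrightarrow> \<forall>i\<in>{g..<g + j}. e \<le> lk c i \<Longrightarrow> big c = Z \<Longrightarrow> length \<omega> = k + (e - 1) \<Longrightarrow>
    drop k \<omega> = \<alpha> \<Longrightarrow> mdegree c + wdot \<delta> \<omega> = d \<Longrightarrow> mon c * E Z \<omega> \<in> Y"
proof (induction "mdegree c" arbitrary: c \<omega> rule: less_induct)
  case less
  show ?case
  proof (cases "\<forall>i. lk c i < e + e * k")
    case True
    then have "(j, c) \<in> gens" using less.prems assms(3) by (simp add: gens_def)
    then show ?thesis by (rule base) (use less.prems in simp_all)
  next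
    case False
    then obtain i where i: "e + e * k \<le> lk c i" by (auto simp: not_less)
    let ?q = "card Z"
    have finZ: "finite Z" using less.prems(3) finite_big by blast
    have iZ: "i \<in> Z" using i less.prems(3) by (auto simp: big_def)
    have qk: "e * ?q \<le> e * k" using assms(4) by simp
    \<comment> \<open>The exponent of \<open>x_i\<close> stays at least \<open>e\<close> even
      without the split-off power, so all monomials arising below have the same big
      variables.\<close>
    have le: "e * ?q \<le> lk c i" "e \<le> lk c i - e * ?q" using i qk by linarith+
    define c2 where "c2 = c - sgl i (e * ?q)"
    have c: "c = c2 + sgl i (e * ?q)"
      by (rule poly_mapping_eqI) (use le in \<open>auto simp: c2_def lookup_add lookup_minus lookup_single when_def\<close>)
    have c2i: "e \<le> lk c2 i" using le(2) by (simp add: c2_def lookup_minus lookup_single)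
    have "mon c * E Z \<omega> = mon c2 * E Z \<omega> * mon (sgl i (e * ?q))"
      by (subst c) (simp add: mon_add mult_ac)
    also have "\<dots> = (\<Sum>l=1..?q. scalar_mult ((-1) ^ Suc l)
        (mon (c2 + sgl i (e * (?q - l))) * E Z (incr (l - 1) \<omega>)))"
      unfolding esym_relation[OF finZ iZ] sum_distrib_left
    proof (rule sum.cong)
      fix l assume l: "l \<in> {1..?q}"
      \<comment> \<open>The exponent of the \<open>l\<close>-th symmetric polynomial is stored at
        position \<open>l - 1\<close>.\<close>
      then have "l - 1 < k" "k \<le> length \<omega>" using assms(4) less.prems(4) by auto
      from E_incr[OF this, of Z] l have "E Z (incr (l - 1) \<omega>) = esym e l Z * E Z \<omega>" by simp
      then show "mon c2 * E Z \<omega> * scalar_mult ((-1) ^ Suc l) (esym e l Z * mon (sgl i (e * (?q - l))))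
          = scalar_mult ((-1) ^ Suc l) (mon (c2 + sgl i (e * (?q - l))) * E Z (incr (l - 1) \<omega>))"
        by (simp add: mon_add mult_ac flip: scalar_mult_mult_right)
    qed simp
    finally have eq: "mon c * E Z \<omega> = (\<Sum>l=1..?q. scalar_mult ((-1) ^ Suc l)
        (mon (c2 + sgl i (e * (?q - l))) * E Z (incr (l - 1) \<omega>)))" .
    show ?thesis
      unfolding eq
    proof (intro pv.subspace_sum[OF Y] pv.subspace_scale[OF Y])
      fix l assume l: "l \<in> {1..?q}"
      let ?c = "c2 + sgl i (e * (?q - l))"
      have lk: "l - 1 < k" using l assms(4) by auto
      have lookup_ne: "lk ?c x = lk c x" if "x \<noteq> i" for x
        using that by (subst c) (simp add: lookup_add lookup_single)
      have lookup_i: "e \<le> lk ?c i" using c2i by (simp add: lookup_add)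
      have deg: "mdegree ?c + e * l = mdegree c"
      proof -
        have "e * (?q - l) + e * l = e * ?q" using l by (simp flip: distrib_left)
        moreover have "mdegree c = mdegree c2 + e * ?q" using arg_cong[OF c, of mdegree] by simp
        ultimately show ?thesis by simp
      qed
      show "mon ?c * E Z (incr (l - 1) \<omega>) \<in> Y"
      proof (rule less.hyps)
        show "mdegree ?c < mdegree c" using deg l e(1) by (metis add_gr_0 atLeastAtMost_iff less_add_same_cancel1 nat_0_less_mult_iff zero_less_one less_le_trans)
        show "ks ?c \<subseteq> {..<g + j}"
        proof
          fix x assume "x \<in> ks ?c"
          then have "x \<in> ks c"
            using lookup_ne[of x] i e(1) by (cases "x = i") (auto simp: in_keys_iff)
          then show "x \<in> {..<g + j}" using less.prems(1) by blast
        qed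
        show "\<forall>x\<in>{g..<g + j}. e \<le> lk ?c x"
          using less.prems(2) lookup_ne lookup_i by metis
        show "big ?c = Z"
        proof (rule Set.set_eqI)
          fix x
          show "x \<in> big ?c \<longleftrightarrow> x \<in> Z"
            using lookup_ne[of x] lookup_i iZ less.prems(3) by (cases "x = i") (auto simp: big_def)
        qed
        show "length (incr (l - 1) \<omega>) = k + (e - 1)" using less.prems(4) by simp
        show "drop k (incr (l - 1) \<omega>) = \<alpha>" using less.prems(5) lk by (simp add: drop_incr)
        have "wdot \<delta> (incr (l - 1) \<omega>) = wdot \<delta> \<omega> + \<delta> ! (l - 1)"
          using lk less.prems(4) by (intro wdot_incr) (simp_all add: length_\<delta>)
        moreover have "\<delta> ! (l - 1) = e * l" using \<delta>_nth(1)[OF lk] l by (simp del: mult_Suc_right)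
        ultimately show "mdegree ?c + wdot \<delta> (incr (l - 1) \<omega>) = d"
          using deg less.prems(6) by simp
      qed
    qed
  qed
qed

section \<open>Spanning the graded pieces\<close>

lemma wt_mono_act:
  assumes "\<sigma> permutes {g..<N}"
  shows "card (big (mono_act \<sigma> m)) = card (big m)" "wt (mono_act \<sigma> m) = wt m"
proof -
  have inj: "inj \<sigma>" by (rule permutes_inj[OF assms])
  have surj: "\<exists>y. x = \<sigma> y" for x using permutes_surj[OF assms] by (metis surjD)
  have "x \<in> big (mono_act \<sigma> m) \<longleftrightarrow> x \<in> \<sigma> ` big m" for x
  proof -
    obtain y where "x = \<sigma> y" using surj by blast
    then show ?thesis by (simp add: big_def lookup_mono_act_inj[OF inj] inj_image_mem_iff[OF inj])
  qed
  then have big: "big (mono_act \<sigma> m) = \<sigma> ` big m" by blast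
  have "\<sigma> x \<ge> g \<longleftrightarrow> x \<ge> g" for x
  proof (cases "x \<in> {g..<N}")
    case True
    then show ?thesis using permutes_in_image[OF assms, of x] by simp
  next
    case False
    then show ?thesis using permutes_not_in[OF assms] by simp
  qed
  then have "tail (mono_act \<sigma> m) = \<sigma> ` tail m"
    by (auto simp: tail_def keys_mono_act[OF inj])
  with big show "card (big (mono_act \<sigma> m)) = card (big m)" "wt (mono_act \<sigma> m) = wt m"
    by (simp_all add: wt_def card_image inj_on_subset[OF inj])
qed

text \<open>Modulo \<open>J\<close> the tail of \<open>m\<close> may be permuted so that the big
  letters come first, from index \<open>g\<close> on, followed by the sorted small letters. The
  result is a \<open>uu\<close> without symmetric factors, and it remains to reduce its first part
  by \<open>gens_reduce\<close>. The bound on the big variables ensures that at most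
  \<open>k\<close> big letters are placed.\<close>

lemma mon_in_comb:
  assumes d: "mdegree m = d" and w: "wt m = w" and small: "card (big m) < k"
  shows "mon m \<in> pv.comb (U d (Suc w)) (S d w) u"
proof -
  let ?X = "pv.comb (U d (Suc w)) (S d w) u"
  have subX: "pv.subspace ?X" by (rule pv.subspace_comb[OF subspace_U])
  define m0 where "m0 = (\<Sum>i\<in>ks m \<inter> {..<g}. sgl i (lk m i))"
  define mY where "mY = (\<Sum>i\<in>tail m. sgl i (lk m i))"
  have "m = (\<Sum>i\<in>(ks m \<inter> {..<g}) \<union> tail m. sgl i (lk m i))"
  proof -
    have "(ks m \<inter> {..<g}) \<union> tail m = ks m" by (auto simp: tail_def)
    then show ?thesis by (simp add: sum_keys)
  qed
  also have "\<dots> = m0 + mY"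
    unfolding m0_def mY_def by (rule sum.union_disjoint) (auto simp: tail_def)
  finally have m: "m = m0 + mY" .
  have ks0: "ks m0 \<subseteq> {..<g}" and ksY: "ks mY \<subseteq> {g..}"
    unfolding m0_def mY_def
    using keys_sum_subset[of "\<lambda>i. sgl i (lk m i)" "ks m \<inter> {..<g}"] keys_sum_subset[of "\<lambda>i. sgl i (lk m i)" "tail m"]
    by (auto simp: tail_def split: if_splits)
  have lkY: "lk mY i = lk m i" if "i \<in> ks mY" for i
  proof -
    have "i \<notin> ks m0" using that ks0 ksY by fastforce
    then show ?thesis by (simp add: m lookup_add in_keys_iff)
  qed
  have no0: "0 \<notin># nzm mY" by (auto simp: nzm_def in_keys_iff)
  obtain bl where bl: "mset bl = filter_mset (\<lambda>a. e \<le> a) (nzm mY)" using ex_mset by blast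
  define \<alpha> where "\<alpha> = map (\<lambda>b. count (nzm mY) (Suc b)) [0..<e - 1]"
  have len\<alpha>: "length \<alpha> = e - 1" by (simp add: \<alpha>_def)
  have letters: "mset (letters \<alpha>) = filter_mset (\<lambda>a. \<not> e \<le> a) (nzm mY)"
  proof (rule multiset_eqI)
    fix a
    show "count (mset (letters \<alpha>)) a = count (filter_mset (\<lambda>a. \<not> e \<le> a) (nzm mY)) a"
    proof (cases "1 \<le> a \<and> a < e")
      case True
      then have a: "a - 1 < e - 1" "Suc (a - 1) = a" by auto
      then have "\<alpha> ! (a - 1) = count (nzm mY) a" by (simp add: \<alpha>_def)
      then show ?thesis using True a by (simp add: count_mset_letters len\<alpha>)
    next
      case False
      then have "a = 0 \<or> e \<le> a" by auto
      then show ?thesis using no0 by (auto simp: count_mset_letters len\<alpha> count_eq_zero_iff)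
    qed
  qed
  let ?j = "length bl"
  have "?j = size (filter_mset (\<lambda>a. e \<le> a) (nzm mY))" by (simp flip: bl)
  also have "\<dots> = card {i \<in> ks mY. e \<le> lk mY i}"
    by (simp add: nzm_def filter_mset_image_mset filter_mset_mset_set)
  also have "\<dots> \<le> card (big m)"
    by (rule card_mono[OF finite_big]) (auto simp: big_def lkY)
  finally have jk: "?j \<le> k" using small by simp
  have bl0: "0 \<notin> set bl" "\<forall>a\<in>set bl. e \<le> a"
  proof -
    show "\<forall>a\<in>set bl. e \<le> a" using arg_cong[OF bl, of set_mset] by auto
    then show "0 \<notin> set bl" using e(1) by auto
  qed
  have L0: "0 \<notin> set (letters \<alpha>)" using set_letters[of \<alpha>] by auto
  let ?b = "plc g bl + plc (g + ?j) (letters \<alpha>)"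
  have "nzm ?b = nzm mY"
    by (subst nzm_add)
      (auto simp: keys_plc[OF L0] keys_plc[OF bl0(1)] nzm_plc[OF L0] nzm_plc[OF bl0(1)] bl letters
        simp flip: multiset_partition)
  moreover have "ks ?b \<subseteq> {g..}" by (auto simp: keys_add_nat keys_plc[OF L0] keys_plc[OF bl0(1)])
  ultimately obtain N \<sigma> where \<sigma>: "\<sigma> permutes {g..<N}" "mono_act \<sigma> mY = ?b"
    using ex_mono_act_nzm[of mY ?b g] ksY by metis
  have act: "mono_act \<sigma> m = m0 + ?b"
    by (simp add: m mono_act_add \<sigma>(2) mono_act_fix_below[OF \<sigma>(1) ks0])
  define c where "c = m0 + plc g bl"
  \<comment> \<open>There are no symmetric factors yet, so \<open>E\<close> is \<open>1\<close>;
    \<open>c\<close> may still have exponents too large for \<open>gens\<close>.\<close>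
  define \<omega> where "\<omega> = replicate k 0 @ \<alpha>"
  have \<omega>: "length \<omega> = k + (e - 1)" "drop k \<omega> = \<alpha>" by (simp_all add: \<omega>_def len\<alpha>)
  have E1: "E Z \<omega> = 1" for Z unfolding E_def by (rule prod.neutral) (simp add: \<omega>_def nth_append)
  have wd: "wdot \<delta> \<omega> = sum_list (letters \<alpha>)" unfolding wdot_\<delta>[OF \<omega>(1)] \<omega>(2) by (simp add: \<omega>_def nth_append)
  have ksc: "ks c \<subseteq> {..<g + ?j}" using ks0 by (auto simp: c_def keys_add_nat keys_plc[OF bl0(1)])
  have bigc: "\<forall>i\<in>{g..<g + ?j}. e \<le> lk c i"
  proof
    fix i assume i: "i \<in> {g..<g + ?j}"
    then have "bl ! (i - g) \<in> set bl" by (intro nth_mem) auto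
    then show "e \<le> lk c i" using bl0(2) i by (simp add: c_def lookup_add lookup_plc trans_le_add2)
  qed
  have mon_act: "mon (mono_act \<sigma> m) = uu ?j c \<omega>"
    unfolding act uu_def E1 \<omega>(2) c_def by (simp add: mon_add mult_ac)
  have "mono_act \<sigma> m \<in> Q (big c) {g..<g + ?j + sum_list \<alpha>} (mdegree c + wdot \<delta> \<omega>)"
    using uu_Q[OF ksc bigc \<omega>(1)] unfolding mon_act[symmetric] \<omega>(2) keys_within_mon .
  then have Q: "mdegree c + wdot \<delta> \<omega> = d" "card (big c) < k" "card (big c) + (k + 1) * (?j + sum_list \<alpha>) = w"
    using Q_wt[of "mono_act \<sigma> m"] wt_mono_act[OF \<sigma>(1), of m] d w small by (auto simp: Q_def add.assoc)
  have "mon c * E (big c) \<omega> \<in> {q. q * mon (plc (g + ?j) (letters \<alpha>)) \<in> ?X}"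
  proof (rule gens_reduce[OF linear_mult_right[OF subX] _ jk _ ksc bigc refl \<omega> Q(1)])
    show "card (big c) \<le> k" using Q(2) by simp
  next
    fix c' \<omega>' assume *: "(?j, c') \<in> gens" "big c' = big c" "length \<omega>' = k + (e - 1)" "drop k \<omega>' = \<alpha>" "mdegree c' + wdot \<delta> \<omega>' = d"
    obtain p where p: "p \<in> S d w" "u p = uu ?j c' \<omega>'"
      using S_I[OF *(1,3,5), of w] *(2,4) Q(3) by auto
    have "u p \<in> ?X" by (rule pv.comb_base[OF subspace_U p(1) finite_S])
    then show "mon c' * E (big c) \<omega>' \<in> {q. q * mon (plc (g + ?j) (letters \<alpha>)) \<in> ?X}"
      by (simp add: p(2) uu_def *(2,4))
  qed
  then have "mon (mono_act \<sigma> m) \<in> ?X" by (simp add: mon_act uu_def \<omega>(2))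
  moreover have "mon m - mon (mono_act \<sigma> m) \<in> ?X"
    by (rule subsetD[OF pv.subset_comb J_U]) (use perm_J[OF \<sigma>(1), of "mon m"] in \<open>simp add: perm_act_mon\<close>)
  ultimately show ?thesis using pv.subspace_add[OF subX] by fastforce
qed

text \<open>Monomials of larger weight are harmless, those with at least \<open>k\<close> big
  variables are pushed to larger weight by (\<dagger>), and those with fewer are spanned by the
  \<open>u p\<close>.\<close>

lemma U_span:
  assumes "x \<in> U d w"
  shows "x \<in> pv.comb (U d (Suc w)) (S d w) u"
proof -
  let ?X = "pv.comb (U d (Suc w)) (S d w) u"
  have subX: "pv.subspace ?X" by (rule pv.subspace_comb[OF subspace_U])
  obtain y z where yz: "x = y + z" "y \<in> W d w" "z \<in> J" using U_D[OF assms] by blast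
  have sub: "U d (Suc w) \<subseteq> ?X" by (rule pv.subset_comb)
  have "y \<in> ?X"
  proof (rule poly_in_subspace[OF subX])
    fix m assume "m \<in> ks y"
    then have m: "mdegree m = d" "w \<le> wt m" using yz(2) by (auto simp: W_def keys_within_def)
    consider "Suc w \<le> wt m" | "wt m = w" "k \<le> card (big m)" | "wt m = w" "card (big m) < k"
      using m(2) by linarith
    then have "mon m \<in> ?X"
    proof cases
      case 1
      then have "mon m \<in> W d (Suc w)" using m(1) by (simp add: mon_W)
      then show ?thesis using W_U sub by blast
    next
      case 2
      then show ?thesis using dagger_step[of m] m(1) sub by auto
    next
      case 3
      then show ?thesis using mon_in_comb m(1) by blast
    qed
    then show "sgl m 1 \<in> ?X" by (simp add: mon_def)
  qed
  moreover have "z \<in> ?X" using J_U[OF yz(3)] sub by blast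
  ultimately show ?thesis unfolding yz(1) by (rule pv.subspace_add[OF subX])
qed

lemma filtered_family: "filtered_family scalar_mult (card gens) dgen wgen \<delta> \<epsilon> u J U (\<lambda>d. Suc ((k + 2) * d))"
proof unfold_locales
  show "\<forall>d\<in>set \<delta>. 0 < d" using e(1) by (auto simp: \<delta>_def)
  show "length \<epsilon> = length \<delta>" by (simp add: length_\<delta> length_\<epsilon>)
  show "pv.subspace J" by (rule subJ)
  show "pv.subspace (U d w)" for d w by (rule subspace_U)
  show "J \<subseteq> U d w" for d w using J_U by blast
  show "U d (Suc w) \<subseteq> U d w" for d w
  proof -
    have "W d (Suc w) \<subseteq> W d w" by (rule W_antimono) simp
    then show ?thesis unfolding U_def by blast
  qed
  \<comment> \<open>By \<open>wt_le\<close> no monomial of degree \<open>d\<close> has a weight this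
    large.\<close>
  show "U d w \<subseteq> J" if "Suc ((k + 2) * d) \<le> w" for d w
  proof
    fix x assume "x \<in> U d w"
    then obtain y z where yz: "x = y + z" "y \<in> W d w" "z \<in> J" using U_D by blast
    have "ks y = {}"
    proof (rule ccontr)
      assume "ks y \<noteq> {}"
      then obtain m where "m \<in> ks y" by blast
      then have "mdegree m = d" "w \<le> wt m" using yz(2) by (auto simp: W_def keys_within_def)
      then show False using wt_le[of m] that by simp
    qed
    then have "y = 0" using sum_keys[of y] by simp
    then show "x \<in> J" using yz by simp
  qed
  show "u p \<in> U d w" if "p \<in> S d w" for d w p using u_in_W[OF that] by (rule W_U)
  show "\<exists>a. x - (\<Sum>p\<in>S d w. scalar_mult (a p) (u p)) \<in> U d (Suc w)" if "x \<in> U d w" for d w x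
    using U_span[OF that] by (simp add: pv.comb_def)
  show "(\<Sum>p\<in>S d w. scalar_mult (a p) (u (pair_incr l p))) \<in> U (d + \<delta> ! l) (Suc (w + \<epsilon> ! l))"
    if "l < length \<delta>" "(\<Sum>p\<in>S d w. scalar_mult (a p) (u p)) \<in> U d (Suc w)" for d w a l
  proof (cases "l < k")
    case True
    from U_step_esym[OF True that(2)] show ?thesis by (simp add: \<delta>_nth(1)[OF True] \<epsilon>_nth(1)[OF True] del: mult_Suc_right)
  next
    case False
    then have l: "k \<le> l" "l < k + (e - 1)" using that(1) by (simp_all add: length_\<delta>)
    from U_step_var[OF l that(2)] show ?thesis by (simp only: \<delta>_nth(2)[OF l] \<epsilon>_nth(2)[OF l])
  qed
qed

theorem rational_rdim_forms: "is_rational_series (Abs_fps (\<lambda>d. of_nat (pv.rdim J {p. is_form d p})))"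
proof -
  interpret ff: filtered_family scalar_mult "card gens" dgen wgen \<delta> \<epsilon> u J U "\<lambda>d. Suc ((k + 2) * d)"
    by (rule filtered_family)
  have W0: "W d 0 = {p. is_form d p}" for d by (simp add: W_def is_form_keys_within)
  have "pv.rdim J (U d 0) = pv.rdim J {p. is_form d p}" for d
  proof (rule pv.rdim_cong[OF subJ])
    fix x assume "x \<in> U d 0"
    then obtain y z where "x = y + z" "y \<in> W d 0" "z \<in> J" using U_D by blast
    then show "\<exists>y\<in>{p. is_form d p}. x - y \<in> J" unfolding W0[symmetric] by (intro bexI[of _ y]) simp_all
  next
    fix y :: "'k polynomials" assume "y \<in> {p. is_form d p}"
    then show "\<exists>x\<in>U d 0. x - y \<in> J" unfolding W0[symmetric]
      by (intro bexI[of _ y] W_U) (simp_all add: pv.subspace_0[OF subJ])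
  qed
  with ff.rational_rdim show ?thesis by simp
qed

end

section \<open>Representations on spaces of polynomials\<close>

definition stable :: "nat \<Rightarrow> 'k::field polynomials set \<Rightarrow> bool"
  where "stable n Q \<longleftrightarrow> pv.subspace Q \<and> (\<forall>\<sigma>. \<sigma> permutes {..<n} \<longrightarrow> (\<forall>q\<in>Q. perm_act \<sigma> q \<in> Q))"

definition irr :: "nat \<Rightarrow> 'k::field polynomials set \<Rightarrow> bool"
  where "irr n Q \<longleftrightarrow> Q \<noteq> {0} \<and> (\<forall>U. stable n U \<longrightarrow> U \<subseteq> Q \<longrightarrow> U = {0} \<or> U = Q)"

definition poly_rep :: "'k::field polynomials set \<Rightarrow> ('k, 'k polynomials) sym_rep"
  where "poly_rep Q = \<lparr>carrier = Q, monoid.mult = undefined, one = undefined,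
    zero = 0, add = (+), smult = scalar_mult, act = perm_act\<rparr>"

text \<open>The pieces of the quotient ring consist of cosets. Along such a map all questions about
  \<open>V\<close> are moved to a space of polynomials, and the laws of \<open>V\<close> are
  inherited from \<open>Q\<close>.\<close>

definition rep_map :: "nat \<Rightarrow> ('k::field polynomials \<Rightarrow> 'v) \<Rightarrow> 'k polynomials set \<Rightarrow> ('k, 'v) sym_rep \<Rightarrow> bool"
  where "rep_map n \<phi> Q V \<longleftrightarrow> stable n Q \<and> bij_betw \<phi> Q (carrier V) \<and> \<phi> 0 = \<zero>\<^bsub>V\<^esub> \<and>
    (\<forall>x\<in>Q. \<forall>y\<in>Q. \<phi> (x + y) = \<phi> x \<oplus>\<^bsub>V\<^esub> \<phi> y) \<and>
    (\<forall>c. \<forall>x\<in>Q. \<phi> (scalar_mult c x) = c \<odot>\<^bsub>V\<^esub> \<phi> x) \<and>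
    (\<forall>\<sigma>. \<sigma> permutes {..<n} \<longrightarrow> (\<forall>x\<in>Q. \<phi> (perm_act \<sigma> x) = act V \<sigma> (\<phi> x)))"

lemma stableD:
  assumes "stable n Q"
  shows "pv.subspace Q" "\<And>\<sigma> q. \<sigma> permutes {..<n} \<Longrightarrow> q \<in> Q \<Longrightarrow> perm_act \<sigma> q \<in> Q"
  using assms by (simp_all add: stable_def)

lemma rep_mapD:
  assumes "rep_map n \<phi> Q V"
  shows "stable n Q" "inj_on \<phi> Q" "\<phi> ` Q = carrier V" "\<phi> 0 = \<zero>\<^bsub>V\<^esub>"
    "\<And>x y. x \<in> Q \<Longrightarrow> y \<in> Q \<Longrightarrow> \<phi> x \<oplus>\<^bsub>V\<^esub> \<phi> y = \<phi> (x + y)"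
    "\<And>c x. x \<in> Q \<Longrightarrow> c \<odot>\<^bsub>V\<^esub> \<phi> x = \<phi> (scalar_mult c x)"
    "\<And>\<sigma> x. \<sigma> permutes {..<n} \<Longrightarrow> x \<in> Q \<Longrightarrow> act V \<sigma> (\<phi> x) = \<phi> (perm_act \<sigma> x)"
  using assms by (simp_all add: rep_map_def bij_betw_def)

lemma rep_map_restrict:
  assumes "rep_map n \<phi> Q V" "stable n U" "U \<subseteq> Q"
  shows "rep_map n \<phi> U (V\<lparr>carrier := \<phi> ` U\<rparr>)"
proof -
  have "inj_on \<phi> U" using rep_mapD(2)[OF assms(1)] assms(3) by (rule inj_on_subset)
  then show ?thesis
    using assms rep_mapD[OF assms(1)] by (auto simp: rep_map_def bij_betw_def subset_iff)
qed

lemma rep_map_inv: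
  assumes V: "rep_map n \<phi> Q V" and x: "x \<in> Q"
  shows "m_inv (add_monoid V) (\<phi> x) = \<phi> (- x)"
proof -
  note D = rep_mapD[OF V]
  have Q: "pv.subspace Q" by (rule stableD[OF D(1)])
  have mx: "- x \<in> Q" using Q x by (rule pv.subspace_neg)
  have 0: "0 \<in> Q" using Q by (rule pv.subspace_0)
  show ?thesis
    unfolding m_inv_def
  proof (rule the_equality)
    show "\<phi> (- x) \<in> carrier (add_monoid V) \<and> \<phi> x \<otimes>\<^bsub>add_monoid V\<^esub> \<phi> (- x) = \<one>\<^bsub>add_monoid V\<^esub> \<and>
        \<phi> (- x) \<otimes>\<^bsub>add_monoid V\<^esub> \<phi> x = \<one>\<^bsub>add_monoid V\<^esub>"
      using D(3) mx by (auto simp: D(5)[OF x mx] D(5)[OF mx x] D(4))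
    fix y assume y: "y \<in> carrier (add_monoid V) \<and> \<phi> x \<otimes>\<^bsub>add_monoid V\<^esub> y = \<one>\<^bsub>add_monoid V\<^esub> \<and>
        y \<otimes>\<^bsub>add_monoid V\<^esub> \<phi> x = \<one>\<^bsub>add_monoid V\<^esub>"
    then have "y \<in> \<phi> ` Q" unfolding D(3) by simp
    then obtain z where z: "z \<in> Q" "y = \<phi> z" by blast
    have "\<phi> (x + z) = \<phi> 0" using y by (simp add: z(2) D(5)[OF x z(1)] D(4))
    then have "x + z = 0" using D(2) pv.subspace_add[OF Q x z(1)] 0 by (simp add: inj_on_eq_iff)
    then have "- x = z" by (rule minus_unique)
    then show "y = \<phi> (- x)" using z(2) by simp
  qed
qed

lemma subrep_image:
  assumes V: "rep_map n \<phi> Q V" and U: "U \<subseteq> Q"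
  shows "subrep n (\<phi> ` U) V \<longleftrightarrow> stable n U"
proof -
  note D = rep_mapD[OF V]
  have Q: "pv.subspace Q" by (rule stableD[OF D(1)])
  have mem: "\<phi> x \<in> \<phi> ` U \<longleftrightarrow> x \<in> U" if "x \<in> Q" for x
    using inj_on_image_mem_iff[OF D(2) that U] .
  have UQ: "x \<in> U \<Longrightarrow> x \<in> Q" for x using U by blast
  show ?thesis
  proof
    assume s: "subrep n (\<phi> ` U) V"
    then have sub: "submodule (\<phi> ` U) (ring_of_type_algebra :: 'a ring) V"
      and st: "\<And>\<sigma> u. \<sigma> permutes {..<n} \<Longrightarrow> u \<in> \<phi> ` U \<Longrightarrow> act V \<sigma> u \<in> \<phi> ` U"
      unfolding subrep_def by blast+
    have sg: "subgroup (\<phi> ` U) (add_monoid V)" using sub by (simp add: submodule_def)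
    have "pv.subspace U"
    proof (rule pv.subspaceI)
      have "\<phi> 0 \<in> \<phi> ` U" using subgroup.one_closed[OF sg] D(4) by simp
      then show "0 \<in> U" using mem pv.subspace_0[OF Q] by blast
    next
      fix x y assume xy: "x \<in> U" "y \<in> U"
      then have "\<phi> (x + y) \<in> \<phi> ` U"
        using subgroup.m_closed[OF sg, of "\<phi> x" "\<phi> y"] by (simp add: D(5) UQ)
      then show "x + y \<in> U" using mem pv.subspace_add[OF Q] xy UQ by blast
    next
      fix c x assume x: "x \<in> U"
      then have "\<phi> (scalar_mult c x) \<in> \<phi> ` U"
        using submodule.smult_closed[OF sub, of c "\<phi> x"] by (simp add: D(6) UQ ring_of_type_algebra_def)
      then show "scalar_mult c x \<in> U" using mem pv.subspace_scale[OF Q] x UQ by blast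
    qed
    moreover have "perm_act \<sigma> x \<in> U" if "\<sigma> permutes {..<n}" "x \<in> U" for \<sigma> x
      using st[OF that(1), of "\<phi> x"] that mem stableD(2)[OF D(1) that(1)] D(7) UQ by (metis imageI)
    ultimately show "stable n U" by (simp add: stable_def)
  next
    assume s: "stable n U"
    note S = stableD[OF s]
    have "subgroup (\<phi> ` U) (add_monoid V)"
    proof
      show "\<phi> ` U \<subseteq> carrier (add_monoid V)" using D(3) U by auto
      show "\<one>\<^bsub>add_monoid V\<^esub> \<in> \<phi> ` U"
        using pv.subspace_0[OF S(1)] D(4) by (simp add: image_iff) (metis)
    next
      fix x y assume "x \<in> \<phi> ` U" "y \<in> \<phi> ` U"
      then obtain x' y' where "x = \<phi> x'" "y = \<phi> y'" "x' \<in> U" "y' \<in> U" by blast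
      then show "x \<otimes>\<^bsub>add_monoid V\<^esub> y \<in> \<phi> ` U" using pv.subspace_add[OF S(1)] by (simp add: D(5) UQ)
    next
      fix x assume "x \<in> \<phi> ` U"
      then obtain x' where "x = \<phi> x'" "x' \<in> U" by blast
      then show "m_inv (add_monoid V) x \<in> \<phi> ` U"
        using pv.subspace_neg[OF S(1)] by (simp add: rep_map_inv[OF V] UQ)
    qed
    moreover have "submodule_axioms (\<phi> ` U) (ring_of_type_algebra :: 'a ring) V"
    proof
      fix c x assume "x \<in> \<phi> ` U"
      then obtain x' where "x = \<phi> x'" "x' \<in> U" by blast
      then show "c \<odot>\<^bsub>V\<^esub> x \<in> \<phi> ` U" using pv.subspace_scale[OF S(1)] by (simp add: D(6) UQ)
    qed
    moreover have "act V \<sigma> u \<in> \<phi> ` U" if \<sigma>: "\<sigma> permutes {..<n}" and u: "u \<in> \<phi> ` U" for \<sigma> u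
    proof -
      obtain x where "u = \<phi> x" "x \<in> U" using u by blast
      then show ?thesis using S(2)[OF \<sigma>] by (simp add: D(7)[OF \<sigma>] UQ)
    qed
    ultimately show "subrep n (\<phi> ` U) V" by (simp add: subrep_def submodule_def)
  qed
qed

lemma irreducible_image:
  assumes V: "rep_map n \<phi> Q V"
  shows "irreducible_rep n V \<longleftrightarrow> irr n Q"
proof -
  note D = rep_mapD[OF V]
  have Q: "pv.subspace Q" by (rule stableD[OF D(1)])
  have 0: "0 \<in> Q" using Q by (rule pv.subspace_0)
  have zero: "\<phi> ` U = {\<zero>\<^bsub>V\<^esub>} \<longleftrightarrow> U = {0}" if "U \<subseteq> Q" for U
    using inj_on_image_eq_iff[OF D(2) that, of "{0}"] 0 by (simp add: D(4))
  have full: "\<phi> ` U = carrier V \<longleftrightarrow> U = Q" if "U \<subseteq> Q" for U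
    using inj_on_image_eq_iff[OF D(2) that, of Q] by (simp add: D(3))
  have pre: "\<exists>U'\<subseteq>Q. U = \<phi> ` U'" if "subrep n U V" for U
  proof -
    have "U \<subseteq> carrier V"
      using that subgroup.subset[of U "add_monoid V"] by (simp add: subrep_def submodule_def)
    then show ?thesis using D(3) by (metis subset_imageE)
  qed
  show ?thesis
    unfolding irreducible_rep_def irr_def
  proof (intro conj_cong)
    show "carrier V \<noteq> {\<zero>\<^bsub>V\<^esub>} \<longleftrightarrow> Q \<noteq> {0}" using zero[of Q] by (simp add: D(3))
    show "(\<forall>U. subrep n U V \<longrightarrow> U = {\<zero>\<^bsub>V\<^esub>} \<or> U = carrier V) \<longleftrightarrow> (\<forall>U. stable n U \<longrightarrow> U \<subseteq> Q \<longrightarrow> U = {0} \<or> U = Q)"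
    proof (intro iffI allI impI)
      fix U assume "\<forall>U. subrep n U V \<longrightarrow> U = {\<zero>\<^bsub>V\<^esub>} \<or> U = carrier V" "stable n U" "U \<subseteq> Q"
      then show "U = {0} \<or> U = Q" using subrep_image[OF V] zero full by metis
    next
      fix U assume *: "\<forall>U. stable n U \<longrightarrow> U \<subseteq> Q \<longrightarrow> U = {0} \<or> U = Q" "subrep n U V"
      obtain U' where U': "U' \<subseteq> Q" "U = \<phi> ` U'" using pre[OF *(2)] by blast
      then show "U = {\<zero>\<^bsub>V\<^esub>} \<or> U = carrier V" using subrep_image[OF V U'(1)] zero[OF U'(1)] full[OF U'(1)] * by metis
    qed
  qed
qed

lemma rep_map_abelian_monoid:
  assumes V: "rep_map n \<phi> Q V"
  shows "abelian_monoid V"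
proof -
  note D = rep_mapD[OF V]
  have Q: "pv.subspace Q" by (rule stableD[OF D(1)])
  have pre: "\<exists>x'. x' \<in> Q \<and> x = \<phi> x'" if "x \<in> carrier V" for x using that D(3) by blast
  have add: "x \<in> Q \<Longrightarrow> y \<in> Q \<Longrightarrow> x + y \<in> Q" for x y by (rule pv.subspace_add[OF Q])
  have 0: "0 \<in> Q" using Q by (rule pv.subspace_0)
  show ?thesis
  proof (rule abelian_monoidI)
    fix x y assume "x \<in> carrier V" "y \<in> carrier V"
    then obtain x' y' where *: "x = \<phi> x'" "y = \<phi> y'" "x' \<in> Q" "y' \<in> Q" using pre by blast
    then show "x \<oplus>\<^bsub>V\<^esub> y \<in> carrier V" using D(3) add by (auto simp: D(5))
    show "x \<oplus>\<^bsub>V\<^esub> y = y \<oplus>\<^bsub>V\<^esub> x" using * by (simp add: D(5) add.commute)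
  next
    show "\<zero>\<^bsub>V\<^esub> \<in> carrier V" using D(3,4) 0 by (metis imageI)
  next
    fix x y z assume "x \<in> carrier V" "y \<in> carrier V" "z \<in> carrier V"
    then obtain x' y' z' where *: "x = \<phi> x'" "y = \<phi> y'" "z = \<phi> z'" "x' \<in> Q" "y' \<in> Q" "z' \<in> Q"
      using pre[of x] pre[of y] pre[of z] by auto
    then show "x \<oplus>\<^bsub>V\<^esub> y \<oplus>\<^bsub>V\<^esub> z = x \<oplus>\<^bsub>V\<^esub> (y \<oplus>\<^bsub>V\<^esub> z)" using add by (simp add: D(5) add.assoc)
  next
    fix x assume "x \<in> carrier V"
    then obtain x' where *: "x = \<phi> x'" "x' \<in> Q" using pre by blast
    then show "\<zero>\<^bsub>V\<^esub> \<oplus>\<^bsub>V\<^esub> x = x" using D(5)[OF 0, of x'] by (simp add: D(4))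
  qed
qed

lemma rep_map_finsum:
  assumes V: "rep_map n \<phi> Q V" and "finite A" "\<And>i. i \<in> A \<Longrightarrow> w i \<in> Q"
  shows "finsum V (\<lambda>i. \<phi> (w i)) A = \<phi> (\<Sum>i\<in>A. w i)"
  using assms(2,3)
proof (induction A rule: finite_induct)
  case empty
  then show ?case using abelian_monoid.finsum_empty[OF rep_map_abelian_monoid[OF V]] rep_mapD(4)[OF V] by simp
next
  case (insert x A)
  note D = rep_mapD[OF V]
  have Q: "pv.subspace Q" by (rule stableD[OF D(1)])
  have "finsum V (\<lambda>i. \<phi> (w i)) (insert x A) = \<phi> (w x) \<oplus>\<^bsub>V\<^esub> finsum V (\<lambda>i. \<phi> (w i)) A"
    using insert.hyps insert.prems D(3)
    by (intro abelian_monoid.finsum_insert[OF rep_map_abelian_monoid[OF V]]) auto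
  also have "\<dots> = \<phi> (w x) \<oplus>\<^bsub>V\<^esub> \<phi> (\<Sum>i\<in>A. w i)" using insert by simp
  also have "\<dots> = \<phi> (w x + (\<Sum>i\<in>A. w i))"
    using insert.prems by (intro D(5) pv.subspace_sum[OF Q]) auto
  finally show ?case using insert.hyps by simp
qed

section \<open>Decompositions and multiplicities\<close>

definition direct_sum :: "nat \<Rightarrow> (nat \<Rightarrow> 'k::field polynomials set) \<Rightarrow> 'k polynomials set \<Rightarrow> bool"
  where "direct_sum r U Q \<longleftrightarrow> (\<forall>x\<in>Q. \<exists>!w. w \<in> (\<Pi>\<^sub>E i\<in>{..<r}. U i) \<and> x = (\<Sum>i<r. w i))"

definition poly_decomposition :: "nat \<Rightarrow> nat \<Rightarrow> (nat \<Rightarrow> 'k::field polynomials set) \<Rightarrow> 'k polynomials set \<Rightarrow> bool"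
  where "poly_decomposition n r U Q \<longleftrightarrow>
    (\<forall>i<r. stable n (U i) \<and> U i \<subseteq> Q \<and> irr n (U i)) \<and> direct_sum r U Q"

text \<open>\<open>push\<close> and \<open>pull\<close> carry families of components back and forth.
  They turn sums into sums because \<phi> is additive, and they are inverse to each other because
  the families are extensional.\<close>

lemma irreducible_decomposition_image:
  assumes V: "rep_map n \<phi> Q V" and U: "\<And>i. i < r \<Longrightarrow> U i \<subseteq> Q"
  shows "irreducible_decomposition n V r (\<lambda>i. \<phi> ` U i) \<longleftrightarrow> poly_decomposition n r U Q"
proof -
  note D = rep_mapD[OF V]
  have fs: "finsum V w {..<r} = \<phi> (\<Sum>i<r. w' i)"
    if "\<And>i. i < r \<Longrightarrow> w' i \<in> Q \<and> w i = \<phi> (w' i)" for w w'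
  proof -
    have "finsum V w {..<r} = finsum V (\<lambda>i. \<phi> (w' i)) {..<r}"
      by (rule abelian_monoid.finsum_cong'[OF rep_map_abelian_monoid[OF V]]) (use that D(3) in auto)
    also have "\<dots> = \<phi> (\<Sum>i<r. w' i)" using that by (intro rep_map_finsum[OF V]) auto
    finally show ?thesis .
  qed
  have Q: "pv.subspace Q" by (rule stableD[OF D(1)])
  have sumQ: "(\<Sum>i<r. w i) \<in> Q" if "w \<in> (\<Pi>\<^sub>E i\<in>{..<r}. U i)" for w
    using that U by (intro pv.subspace_sum[OF Q]) (auto simp: PiE_iff)
  define push where "push w = (\<lambda>i\<in>{..<r}. \<phi> (w i))" for w :: "nat \<Rightarrow> _"
  define pull where "pull w = (\<lambda>i\<in>{..<r}. inv_into Q \<phi> (w i))" for w :: "nat \<Rightarrow> _"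
  have push: "push w \<in> (\<Pi>\<^sub>E i\<in>{..<r}. \<phi> ` U i) \<and> finsum V (push w) {..<r} = \<phi> (\<Sum>i<r. w i)"
    if w: "w \<in> (\<Pi>\<^sub>E i\<in>{..<r}. U i)" for w
  proof
    show "push w \<in> (\<Pi>\<^sub>E i\<in>{..<r}. \<phi> ` U i)" using w by (auto simp: push_def PiE_iff)
    show "finsum V (push w) {..<r} = \<phi> (\<Sum>i<r. w i)"
      by (rule fs) (use w U in \<open>auto simp: push_def PiE_iff\<close>)
  qed
  have pull: "pull w \<in> (\<Pi>\<^sub>E i\<in>{..<r}. U i) \<and> push (pull w) = w" if w: "w \<in> (\<Pi>\<^sub>E i\<in>{..<r}. \<phi> ` U i)" for w
  proof -
    have *: "inv_into Q \<phi> (w i) \<in> U i \<and> \<phi> (inv_into Q \<phi> (w i)) = w i" if "i < r" for i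
    proof -
      have "w i \<in> \<phi> ` U i" using w that by (auto simp: PiE_iff)
      then obtain x where x: "w i = \<phi> x" "x \<in> U i" by blast
      then have "inv_into Q \<phi> (w i) = x" using inv_into_f_f[OF D(2), of x] U[OF that] by auto
      then show ?thesis using x by simp
    qed
    then show ?thesis using w by (auto simp: pull_def push_def PiE_iff extensional_def fun_eq_iff)
  qed
  have push_inj: "w = w'" if "w \<in> (\<Pi>\<^sub>E i\<in>{..<r}. U i)" "w' \<in> (\<Pi>\<^sub>E i\<in>{..<r}. U i)" "push w = push w'" for w w'
  proof (rule PiE_ext[OF that(1,2)])
    fix i assume i: "i \<in> {..<r}"
    then have "\<phi> (w i) = \<phi> (w' i)" using fun_cong[OF that(3), of i] by (simp add: push_def)
    moreover have "w i \<in> Q" "w' i \<in> Q" using that(1,2) i U by (auto simp: PiE_iff)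
    ultimately show "w i = w' i" using D(2) by (simp add: inj_on_eq_iff)
  qed
  have "(\<forall>v\<in>carrier V. \<exists>!w. w \<in> (\<Pi>\<^sub>E i\<in>{..<r}. \<phi> ` U i) \<and> v = finsum V w {..<r}) \<longleftrightarrow> direct_sum r U Q"
  proof -
    have "(\<exists>!w. w \<in> (\<Pi>\<^sub>E i\<in>{..<r}. \<phi> ` U i) \<and> \<phi> x = finsum V w {..<r}) \<longleftrightarrow>
        (\<exists>!w. w \<in> (\<Pi>\<^sub>E i\<in>{..<r}. U i) \<and> x = (\<Sum>i<r. w i))" (is "?L \<longleftrightarrow> ?R") if x: "x \<in> Q" for x
    proof -
      have eq: "\<phi> x = finsum V (push w) {..<r} \<longleftrightarrow> x = (\<Sum>i<r. w i)" if "w \<in> (\<Pi>\<^sub>E i\<in>{..<r}. U i)" for w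
        using push[OF that] inj_on_eq_iff[OF D(2) x sumQ[OF that]] by simp
      show ?thesis
      proof
        assume ?L
        then obtain v where "v \<in> (\<Pi>\<^sub>E i\<in>{..<r}. \<phi> ` U i) \<and> \<phi> x = finsum V v {..<r}"
          and uniq: "\<forall>v'. v' \<in> (\<Pi>\<^sub>E i\<in>{..<r}. \<phi> ` U i) \<and> \<phi> x = finsum V v' {..<r} \<longrightarrow> v' = v" by (rule ex1E)
        then have v: "v \<in> (\<Pi>\<^sub>E i\<in>{..<r}. \<phi> ` U i)" "\<phi> x = finsum V v {..<r}" by simp_all
        show ?R
        proof (rule ex1I[of _ "pull v"])
          show "pull v \<in> (\<Pi>\<^sub>E i\<in>{..<r}. U i) \<and> x = (\<Sum>i<r. pull v i)" using pull[OF v(1)] v(2) eq[of "pull v"] by simp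
          fix w assume w: "w \<in> (\<Pi>\<^sub>E i\<in>{..<r}. U i) \<and> x = (\<Sum>i<r. w i)"
          then have "push w = v" using push[of w] eq[of w] by (intro uniq[rule_format]) auto
          then show "w = pull v" using push_inj[of w "pull v"] pull[OF v(1)] w by simp
        qed
      next
        assume ?R
        then obtain w where "w \<in> (\<Pi>\<^sub>E i\<in>{..<r}. U i) \<and> x = (\<Sum>i<r. w i)"
          and uniq: "\<forall>w'. w' \<in> (\<Pi>\<^sub>E i\<in>{..<r}. U i) \<and> x = (\<Sum>i<r. w' i) \<longrightarrow> w' = w" by (rule ex1E)
        then have w: "w \<in> (\<Pi>\<^sub>E i\<in>{..<r}. U i)" "x = (\<Sum>i<r. w i)" by simp_all
        show ?L
        proof (rule ex1I[of _ "push w"])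
          show "push w \<in> (\<Pi>\<^sub>E i\<in>{..<r}. \<phi> ` U i) \<and> \<phi> x = finsum V (push w) {..<r}" using push[OF w(1)] w(2) by simp
          fix v assume v: "v \<in> (\<Pi>\<^sub>E i\<in>{..<r}. \<phi> ` U i) \<and> \<phi> x = finsum V v {..<r}"
          then have "pull v = w" using pull[of v] eq[of "pull v"] by (intro uniq[rule_format]) auto
          then show "v = push w" using pull[of v] v by simp
        qed
      qed
    qed
    then show ?thesis unfolding direct_sum_def D(3)[symmetric] by simp
  qed
  moreover have "subrep n (\<phi> ` U i) V \<and> irreducible_rep n (V\<lparr>carrier := \<phi> ` U i\<rparr>) \<longleftrightarrow> stable n (U i) \<and> U i \<subseteq> Q \<and> irr n (U i)"
    if "i < r" for i
    using subrep_image[OF V U[OF that]] irreducible_image[OF rep_map_restrict[OF V _ U[OF that]]] U[OF that] by blast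
  ultimately show ?thesis unfolding irreducible_decomposition_def poly_decomposition_def by simp
qed

lemma rep_iso_image:
  assumes V: "rep_map n \<phi> U V"
  shows "rep_iso n S V \<longleftrightarrow> rep_iso n S (poly_rep U)"
proof -
  note D = rep_mapD[OF V]
  let ?\<psi> = "inv_into U \<phi>"
  have \<psi>: "?\<psi> (\<phi> x) = x" if "x \<in> U" for x using D(2) that by (rule inv_into_f_f)
  have bij: "bij_betw \<phi> U (carrier V)" using V by (simp add: rep_map_def)
  have U: "pv.subspace U" by (rule stableD[OF D(1)])
  show ?thesis
  proof
    assume "rep_iso n S V"
    then obtain f where f: "bij_betw f (carrier S) (carrier V)"
      "\<And>u v. u \<in> carrier S \<Longrightarrow> v \<in> carrier S \<Longrightarrow> f (u \<oplus>\<^bsub>S\<^esub> v) = f u \<oplus>\<^bsub>V\<^esub> f v"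
      "\<And>c v. v \<in> carrier S \<Longrightarrow> f (c \<odot>\<^bsub>S\<^esub> v) = c \<odot>\<^bsub>V\<^esub> f v"
      "\<And>\<sigma> v. \<sigma> permutes {..<n} \<Longrightarrow> v \<in> carrier S \<Longrightarrow> f (act S \<sigma> v) = act V \<sigma> (f v)"
      unfolding rep_iso_def by blast
    have pre: "\<exists>x. x \<in> U \<and> f v = \<phi> x" if "v \<in> carrier S" for v
      using f(1) that D(3) unfolding bij_betw_def by blast
    have "bij_betw (?\<psi> \<circ> f) (carrier S) U"
      using f(1) bij_betw_inv_into[OF bij] by (rule bij_betw_trans)
    moreover have "?\<psi> (f (u \<oplus>\<^bsub>S\<^esub> v)) = ?\<psi> (f u) + ?\<psi> (f v)" if uv: "u \<in> carrier S" "v \<in> carrier S" for u v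
    proof -
      obtain x y where "x \<in> U" "f u = \<phi> x" "y \<in> U" "f v = \<phi> y" using pre uv by blast
      then show ?thesis using pv.subspace_add[OF U] by (simp add: f(2)[OF uv] D(5) \<psi>)
    qed
    moreover have "?\<psi> (f (c \<odot>\<^bsub>S\<^esub> v)) = scalar_mult c (?\<psi> (f v))" if v: "v \<in> carrier S" for c v
    proof -
      obtain x where "x \<in> U" "f v = \<phi> x" using pre v by blast
      then show ?thesis using pv.subspace_scale[OF U] by (simp add: f(3)[OF v] D(6) \<psi>)
    qed
    moreover have "?\<psi> (f (act S \<sigma> v)) = perm_act \<sigma> (?\<psi> (f v))" if v: "\<sigma> permutes {..<n}" "v \<in> carrier S" for \<sigma> v
    proof -
      obtain x where "x \<in> U" "f v = \<phi> x" using pre v by blast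
      then show ?thesis using stableD(2)[OF D(1) v(1)] by (simp add: f(4)[OF v] D(7)[OF v(1)] \<psi>)
    qed
    ultimately show "rep_iso n S (poly_rep U)"
      unfolding rep_iso_def by (intro exI[of _ "?\<psi> \<circ> f"]) (simp add: poly_rep_def)
  next
    assume "rep_iso n S (poly_rep U)"
    then obtain f where f: "bij_betw f (carrier S) U"
      "\<And>u v. u \<in> carrier S \<Longrightarrow> v \<in> carrier S \<Longrightarrow> f (u \<oplus>\<^bsub>S\<^esub> v) = f u + f v"
      "\<And>c v. v \<in> carrier S \<Longrightarrow> f (c \<odot>\<^bsub>S\<^esub> v) = scalar_mult c (f v)"
      "\<And>\<sigma> v. \<sigma> permutes {..<n} \<Longrightarrow> v \<in> carrier S \<Longrightarrow> f (act S \<sigma> v) = perm_act \<sigma> (f v)"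
      unfolding rep_iso_def poly_rep_def by auto
    have fU: "f v \<in> U" if "v \<in> carrier S" for v using f(1) that by (auto simp: bij_betw_def)
    have "bij_betw (\<phi> \<circ> f) (carrier S) (carrier V)" using f(1) bij by (rule bij_betw_trans)
    then show "rep_iso n S V"
      unfolding rep_iso_def by (intro exI[of _ "\<phi> \<circ> f"]) (simp add: f D fU)
  qed
qed

text \<open>\<open>multiplicity_of\<close> is a definite description: besides one decomposition it
  requires the same count in all of them. Preimages under \<phi> turn every decomposition of
  \<open>V\<close> into one of \<open>Q\<close>.\<close>

lemma multiplicity_of_eqI:
  assumes V: "rep_map n \<phi> Q V"
    and ex: "\<exists>r U. poly_decomposition n r U Q"
    and count: "\<And>r U. poly_decomposition n r U Q \<Longrightarrow> card {i. i < r \<and> rep_iso n S (poly_rep (U i))} = m"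
  shows "multiplicity_of n S V = m"
proof -
  note D = rep_mapD[OF V]
  have cnt: "card {i. i < r \<and> rep_iso n S (V\<lparr>carrier := \<phi> ` U i\<rparr>)} = m" if dec: "poly_decomposition n r U Q" for r U
  proof -
    have "rep_iso n S (V\<lparr>carrier := \<phi> ` U i\<rparr>) \<longleftrightarrow> rep_iso n S (poly_rep (U i))" if "i < r" for i
      by (rule rep_iso_image[OF rep_map_restrict[OF V]]) (use dec that in \<open>auto simp: poly_decomposition_def\<close>)
    then have "{i. i < r \<and> rep_iso n S (V\<lparr>carrier := \<phi> ` U i\<rparr>)} = {i. i < r \<and> rep_iso n S (poly_rep (U i))}" by blast
    then show ?thesis using count[OF dec] by simp
  qed
  show ?thesis
    unfolding multiplicity_of_def
  proof (rule the_equality)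
    obtain r U where dec: "poly_decomposition n r U Q" using ex by blast
    then have "irreducible_decomposition n V r (\<lambda>i. \<phi> ` U i)"
      using irreducible_decomposition_image[OF V] by (simp add: poly_decomposition_def)
    then show "\<exists>r U. irreducible_decomposition n V r U \<and> m = card {i. i < r \<and> rep_iso n S (V\<lparr>carrier := U i\<rparr>)}"
      using cnt[OF dec] by (intro exI[of _ r] exI[of _ "\<lambda>i. \<phi> ` U i"]) simp
  next
    fix m' assume "\<exists>r U. irreducible_decomposition n V r U \<and> m' = card {i. i < r \<and> rep_iso n S (V\<lparr>carrier := U i\<rparr>)}"
    then obtain r U where dec: "irreducible_decomposition n V r U"
      and m': "m' = card {i. i < r \<and> rep_iso n S (V\<lparr>carrier := U i\<rparr>)}" by blast
    define U' where "U' i = {x \<in> Q. \<phi> x \<in> U i}" for i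
    have U: "U i = \<phi> ` U' i" if "i < r" for i
    proof -
      have "U i \<subseteq> carrier V"
        using dec that subgroup.subset[of "U i" "add_monoid V"]
        by (simp add: irreducible_decomposition_def subrep_def submodule_def)
      then show ?thesis unfolding U'_def D(3)[symmetric] by blast
    qed
    have "irreducible_decomposition n V r (\<lambda>i. \<phi> ` U' i)"
    proof -
      have "(\<Pi>\<^sub>E i\<in>{..<r}. U i) = (\<Pi>\<^sub>E i\<in>{..<r}. \<phi> ` U' i)" by (rule PiE_cong) (simp add: U)
      then show ?thesis using dec U by (simp add: irreducible_decomposition_def)
    qed
    then have dec': "poly_decomposition n r U' Q"
      using irreducible_decomposition_image[OF V, of r U'] by (simp add: U'_def)
    have "{i. i < r \<and> rep_iso n S (V\<lparr>carrier := U i\<rparr>)} = {i. i < r \<and> rep_iso n S (V\<lparr>carrier := \<phi> ` U' i\<rparr>)}"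
      using U by auto
    then show "m' = m" using cnt[OF dec'] m' by simp
  qed
qed

text \<open>\<open>Q\<close> is an invariant complement of \<open>I\<close> in the forms of degree
  \<open>d\<close>, so every coset has exactly one representative in it.\<close>

lemma quotient_piece_rep_map:
  fixes I :: "'k::field polynomials set"
  assumes I: "poly_ideal I" "symmetric_ideal I"
    and Q: "stable n Q" "Q \<subseteq> forms_in n d" "Q \<inter> I = {0}"
    and sum: "\<And>p. p \<in> forms_in n d \<Longrightarrow> \<exists>q\<in>Q. p - q \<in> I"
  shows "rep_map n (\<lambda>p. p +o (I \<inter> polys_in n)) Q (quotient_piece I n d)"
proof -
  define In where "In = I \<inter> polys_in n"
  have sIn: "pv.subspace In"
    unfolding In_def polys_in_keys_within by (intro pv.subspace_inter poly_ideal_subspace I(1) subspace_keys_within)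
  have coset: "x +o In = y +o In \<longleftrightarrow> x - y \<in> In" for x y
  proof
    assume "x +o In = y +o In"
    moreover have "x \<in> x +o In" using pv.subspace_0[OF sIn] by (force simp: elt_set_plus_def)
    ultimately obtain z where "z \<in> In" "x = y + z" by (auto simp: elt_set_plus_def)
    then show "x - y \<in> In" by simp
  next
    assume xy: "x - y \<in> In"
    have "x +o In \<subseteq> y +o In" if "x - y \<in> In" for x y
    proof
      fix z assume "z \<in> x +o In"
      then obtain t where "t \<in> In" "z = x + t" by (auto simp: elt_set_plus_def)
      then have "z = y + (x - y + t)" "x - y + t \<in> In" using pv.subspace_add[OF sIn that] by simp_all
      then show "z \<in> y +o In" unfolding elt_set_plus_def by blast
    qed
    from this[OF xy] this[of y x] show "x +o In = y +o In"
      using pv.subspace_neg[OF sIn xy] by simp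
  qed
  have QP: "x \<in> polys_in n \<and> is_form d x" if "x \<in> Q" for x using Q(2) that forms_in_iff by blast
  have subQ: "pv.subspace Q" by (rule stableD[OF Q(1)])
  have "inj_on (\<lambda>p. p +o In) Q"
  proof (rule inj_onI)
    fix x y assume "x \<in> Q" "y \<in> Q" "x +o In = y +o In"
    then have "x - y \<in> Q \<inter> I" using coset pv.subspace_diff[OF subQ] by (auto simp: In_def)
    then show "x = y" using Q(3) by auto
  qed
  moreover have "(\<lambda>p. p +o In) ` Q = {p +o In | p. p \<in> polys_in n \<and> is_form d p}"
  proof (intro equalityI subsetI)
    fix X' assume "X' \<in> {p +o In | p. p \<in> polys_in n \<and> is_form d p}"
    then obtain p where p: "X' = p +o In" "p \<in> forms_in n d" by (auto simp: forms_in_iff)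
    obtain q where q: "q \<in> Q" "p - q \<in> I" using sum[OF p(2)] by blast
    have "p - q \<in> forms_in n d" using p(2) q(1) Q(2) pv.subspace_diff[OF subspace_forms_in] by blast
    then have "p - q \<in> In" using q(2) by (simp add: In_def forms_in_iff)
    then have "X' = q +o In" unfolding p(1) by (simp add: coset)
    then show "X' \<in> (\<lambda>p. p +o In) ` Q" using q(1) by blast
  qed (use QP in blast)
  moreover have "(x + y) +o In = (x +o In) + (y +o In)" for x y
  proof -
    have "In + In = In"
    proof (intro equalityI subsetI)
      fix z assume "z \<in> In + In"
      then show "z \<in> In" using pv.subspace_add[OF sIn] by (auto simp: set_plus_def)
    next
      fix z assume "z \<in> In"
      then have "z + 0 \<in> In + In" using pv.subspace_0[OF sIn] by (rule set_plus_intro)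
      then show "z \<in> In + In" by simp
    qed
    then show ?thesis by (metis set_plus_rearrange)
  qed
  moreover have "scalar_mult c x +o In = scalar_mult c ` (x +o In) + In" for c x
  proof (intro equalityI subsetI)
    fix z assume "z \<in> scalar_mult c x +o In"
    then obtain t where t: "t \<in> In" "z = scalar_mult c x + t" by (auto simp: elt_set_plus_def)
    have "x \<in> x +o In" using pv.subspace_0[OF sIn] by (force simp: elt_set_plus_def)
    then show "z \<in> scalar_mult c ` (x +o In) + In" unfolding t(2) using t(1) by (intro set_plus_intro imageI)
  next
    fix z assume "z \<in> scalar_mult c ` (x +o In) + In"
    then obtain s t where st: "s \<in> In" "t \<in> In" "z = scalar_mult c (x + s) + t"
      by (auto simp: elt_set_plus_def set_plus_def)
    then have "z = scalar_mult c x + (scalar_mult c s + t)" by (simp add: pv.scale_right_distrib add.assoc)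
    moreover have "scalar_mult c s + t \<in> In" using st pv.subspace_add[OF sIn] pv.subspace_scale[OF sIn] by blast
    ultimately show "z \<in> scalar_mult c x +o In" by (auto simp: elt_set_plus_def)
  qed
  moreover have "perm_act \<sigma> x +o In = perm_act \<sigma> ` (x +o In)" if \<sigma>: "\<sigma> permutes {..<n}" for \<sigma> x
  proof -
    have In_act: "perm_act \<tau> t \<in> In" if "\<tau> permutes {..<n}" "t \<in> In" for \<tau> t
      using that I(2) perm_act_polys_in[OF that(1)] by (auto simp: In_def symmetric_ideal_def sym_infinity_def)
    show ?thesis
    proof (intro equalityI subsetI)
      fix z assume "z \<in> perm_act \<sigma> x +o In"
      then obtain t where t: "t \<in> In" "z = perm_act \<sigma> x + t" by (auto simp: elt_set_plus_def)
      have "z = perm_act \<sigma> (x + perm_act (pinv \<sigma>) t)"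
        by (simp add: t(2) perm_act_add perm_act_pinv[OF permutes_bij[OF \<sigma>]])
      moreover have "x + perm_act (pinv \<sigma>) t \<in> x +o In"
        using In_act[OF permutes_inv[OF \<sigma>] t(1)] by (auto simp: elt_set_plus_def)
      ultimately show "z \<in> perm_act \<sigma> ` (x +o In)" by blast
    next
      fix z assume "z \<in> perm_act \<sigma> ` (x +o In)"
      then obtain t where t: "t \<in> In" "z = perm_act \<sigma> x + perm_act \<sigma> t"
        by (auto simp: elt_set_plus_def perm_act_add)
      then show "z \<in> perm_act \<sigma> x +o In" using In_act[OF \<sigma> t(1)] by (auto simp: elt_set_plus_def)
    qed
  qed
  ultimately show ?thesis
    unfolding In_def[symmetric] using Q(1) coset[of 0 0]
    by (simp add: rep_map_def quotient_piece_def Let_def bij_betw_def flip: In_def)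
qed

section \<open>Maschke's theorem\<close>

text \<open>The action of the element of the group algebra with coefficients \<open>a\<close> on
  \<open>A\<close>. Row symmetrizers and column antisymmetrizers are instances.\<close>

definition gsum :: "(nat \<Rightarrow> nat) set \<Rightarrow> ((nat \<Rightarrow> nat) \<Rightarrow> 'k::field) \<Rightarrow> 'k polynomials \<Rightarrow> 'k polynomials"
  where "gsum A a x = (\<Sum>\<sigma>\<in>A. scalar_mult (a \<sigma>) (perm_act \<sigma> x))"

lemma gsum_add: "gsum A a (x + y) = gsum A a x + gsum A a y"
  by (simp add: gsum_def perm_act_add pv.scale_right_distrib sum.distrib)

lemma gsum_scalar: "gsum A a (scalar_mult c x) = scalar_mult c (gsum A a x)"
  by (simp add: gsum_def perm_act_scalar pv.scale_sum_right mult.commute)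

lemma gsum_0 [simp]: "gsum A a 0 = 0"
  by (simp add: gsum_def)

lemma gsum_diff: "gsum A a (x - y) = gsum A a x - gsum A a y"
  by (simp add: gsum_def perm_act_diff pv.scale_right_diff_distrib sum_subtractf)

lemma gsum_sum: "gsum A a (\<Sum>i\<in>B. f i) = (\<Sum>i\<in>B. gsum A a (f i))"
  by (induction B rule: infinite_finite_induct) (simp_all add: gsum_add)

lemma gsum_stable:
  assumes "stable n Q" "\<And>\<sigma>. \<sigma> \<in> A \<Longrightarrow> \<sigma> permutes {..<n}" "x \<in> Q"
  shows "gsum A a x \<in> Q"
  unfolding gsum_def
  by (intro pv.subspace_sum pv.subspace_scale stableD[OF assms(1)] assms)

lemma hom_component_gsum: "hom_component d (gsum A a p) = gsum A a (hom_component d p)"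
  by (simp add: gsum_def hom_component_sum hom_component_scalar hom_component_perm_act)

lemma gsum_mult_fixed:
  assumes "\<And>\<sigma>. \<sigma> \<in> A \<Longrightarrow> perm_act \<sigma> F = F"
  shows "gsum A a (F * p) = F * gsum A a p"
  unfolding gsum_def sum_distrib_left
  by (rule sum.cong) (simp_all add: perm_act_mult assms scalar_mult_mult_right)

abbreviation perms :: "nat \<Rightarrow> (nat \<Rightarrow> nat) set"
  where "perms n \<equiv> {\<sigma>. \<sigma> permutes {..<n}}"

lemma finite_perms: "finite (perms n)"
  by (rule finite_permutations) simp

lemma perm_act_pinv_comp:
  assumes "\<tau> permutes S" "\<sigma> permutes S"
  shows "perm_act (pinv (\<tau> \<circ> \<sigma>)) (perm_act \<tau> x) = perm_act (pinv \<sigma>) x"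
proof -
  have "pinv (\<tau> \<circ> \<sigma>) = pinv \<sigma> \<circ> pinv \<tau>"
    by (rule o_inv_distrib) (use assms permutes_bij in blast)+
  then show ?thesis
    by (simp add: perm_act_pinv[OF permutes_bij[OF assms(1)]] flip: perm_act_comp)
qed

text \<open>A linear projection of the whole polynomial ring onto \<open>Z\<close> is averaged over
  the group, which is possible in characteristic \<open>0\<close>. The complement is the kernel of
  the average within \<open>P\<close>.\<close>

lemma maschke:
  fixes P Z :: "'k::field_char_0 polynomials set"
  assumes P: "stable n P" and Z: "stable n Z" "Z \<subseteq> P"
  shows "\<exists>Z'. stable n Z' \<and> Z' \<subseteq> P \<and> Z \<inter> Z' = {0} \<and> (\<forall>x\<in>P. \<exists>z\<in>Z. x - z \<in> Z')"
proof -
  note SZ = stableD[OF Z(1)] and SP = stableD[OF P]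
  obtain f where f: "Vector_Spaces.linear scalar_mult scalar_mult f" "\<And>x. f x \<in> Z" "\<And>x. x \<in> Z \<Longrightarrow> f x = x"
    using pv.ex_linear_projection[OF SZ(1)] by blast
  interpret f: Vector_Spaces.linear scalar_mult scalar_mult f by (fact f(1))
  define N where "N = (of_nat (card (perms n)) :: 'k)"
  have "id \<in> perms n" by (simp add: permutes_id)
  then have "card (perms n) \<noteq> 0" using finite_perms[of n] card_0_eq by blast
  then have N: "N \<noteq> 0" by (simp add: N_def)
  define h where "h x = scalar_mult (1 / N) (\<Sum>\<sigma>\<in>perms n. perm_act \<sigma> (f (perm_act (pinv \<sigma>) x)))" for x
  have h_add: "h (x + y) = h x + h y" for x y
    by (simp add: h_def perm_act_add f.add sum.distrib pv.scale_right_distrib)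
  have h_scale: "h (scalar_mult c x) = scalar_mult c (h x)" for c x
    by (simp add: h_def perm_act_scalar f.scale pv.scale_sum_right mult.commute)
  have h_Z: "h x \<in> Z" for x
    unfolding h_def by (intro pv.subspace_scale pv.subspace_sum SZ f(2)) simp
  have h_id: "h z = z" if "z \<in> Z" for z
  proof -
    have "perm_act \<sigma> (f (perm_act (pinv \<sigma>) z)) = z" if "\<sigma> \<in> perms n" for \<sigma>
      using that \<open>z \<in> Z\<close> f(3)[OF SZ(2)[OF permutes_inv]] perm_act_pinv(1)[OF permutes_bij] by simp
    then have "h z = scalar_mult (1 / N) (\<Sum>\<sigma>\<in>perms n. z)" by (simp add: h_def)
    also have "(\<Sum>\<sigma>\<in>perms n. z) = scalar_mult N z"
      unfolding N_def by (rule pv.sum_constant_scale)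
    finally show ?thesis using N by simp
  qed
  have h_act: "h (perm_act \<tau> x) = perm_act \<tau> (h x)" if "\<tau> permutes {..<n}" for \<tau> x
  proof -
    have "(\<Sum>\<sigma>\<in>perms n. perm_act \<sigma> (f (perm_act (pinv \<sigma>) (perm_act \<tau> x))))
        = (\<Sum>\<sigma>\<in>perms n. perm_act (\<tau> \<circ> \<sigma>) (f (perm_act (pinv (\<tau> \<circ> \<sigma>)) (perm_act \<tau> x))))"
      by (rule setum_permutations_compose_left[OF that])
    also have "\<dots> = (\<Sum>\<sigma>\<in>perms n. perm_act \<tau> (perm_act \<sigma> (f (perm_act (pinv \<sigma>) x))))"
    proof (rule sum.cong)
      fix \<sigma> assume "\<sigma> \<in> perms n"
      then show "perm_act (\<tau> \<circ> \<sigma>) (f (perm_act (pinv (\<tau> \<circ> \<sigma>)) (perm_act \<tau> x))) = perm_act \<tau> (perm_act \<sigma> (f (perm_act (pinv \<sigma>) x)))"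
        by (simp only: mem_Collect_eq perm_act_pinv_comp[OF that] perm_act_comp[symmetric, of \<tau> \<sigma>])
    qed simp
    finally show ?thesis by (simp add: h_def perm_act_scalar perm_act_sum)
  qed
  have h_diff: "h (x - y) = h x - h y" for x y
    using h_add[of "x - y" y] by (simp add: algebra_simps)
  define Z' where "Z' = {x \<in> P. h x = 0}"
  have h0: "h 0 = 0" using h_diff[of 0 0] by simp
  have "stable n Z'"
    unfolding stable_def
  proof (intro conjI allI impI ballI)
    show "pv.subspace Z'"
      by (rule pv.subspaceI)
        (auto simp: Z'_def h0 h_add h_scale pv.subspace_0[OF SP(1)] pv.subspace_add[OF SP(1)] pv.subspace_scale[OF SP(1)])
    show "perm_act \<sigma> q \<in> Z'" if "\<sigma> permutes {..<n}" "q \<in> Z'" for \<sigma> q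
      using that SP(2) by (simp add: Z'_def h_act)
  qed
  moreover have "Z \<inter> Z' = {0}"
    using h_id pv.subspace_0[OF SZ(1)] pv.subspace_0[OF SP(1)] h0 by (auto simp: Z'_def)
  moreover have "\<exists>z\<in>Z. x - z \<in> Z'" if "x \<in> P" for x
    using h_Z[of x] pv.subspace_diff[OF SP(1) that] Z(2) h_id[OF h_Z, of x]
    by (intro bexI[of _ "h x"]) (auto simp: Z'_def h_diff)
  ultimately show ?thesis unfolding Z'_def by blast
qed

section \<open>Complete reducibility\<close>

lemma rdim_0_less:
  assumes A: "pv.subspace A" and B: "pv.subspace B" "A \<subset> B" "pv.rel_fg {0} B"
  shows "pv.rdim {0} A < pv.rdim {0} B"
proof -
  have "pv.rdim {0} B = pv.rdim {0} (B \<inter> A) + pv.rdim A B"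
    by (rule pv.rdim_add[OF pv.subspace_single_0 A B(1) _ B(3)]) (simp add: pv.subspace_0[OF A])
  moreover have "B \<inter> A = A" using B(2) by blast
  moreover have "pv.rdim A B \<noteq> 0"
  proof
    assume "pv.rdim A B = 0"
    have "pv.rel_fg A B" by (rule pv.rel_fg_subset[OF B(3)]) (simp_all add: pv.subspace_0[OF A])
    then obtain T where T: "pv.rel_basis A B T (\<lambda>x. x)" using pv.rel_basis_exists[OF A] by blast
    have "T = {}" using pv.rdim_eq_card[OF A T] \<open>pv.rdim A B = 0\<close> T by (simp add: pv.rel_basis_def)
    then have "B \<subseteq> A" using T by (auto simp: pv.rel_basis_def)
    then show False using B(2) by blast
  qed
  ultimately show ?thesis by simp
qed

lemma ex_irr_subset:
  assumes "stable n P" "pv.rel_fg {0} P" "P \<noteq> {0}"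
  shows "\<exists>Q. stable n Q \<and> Q \<subseteq> P \<and> irr n Q"
  using assms
proof (induction "pv.rdim {0} P" arbitrary: P rule: less_induct)
  case less
  show ?case
  proof (cases "irr n P")
    case False
    then obtain U where U: "stable n U" "U \<subseteq> P" "U \<noteq> {0}" "U \<noteq> P"
      using less.prems(3) by (auto simp: irr_def)
    have "pv.rel_fg {0} U" by (rule pv.rel_fg_subset[OF less.prems(2) U(2)]) simp
    moreover have "pv.rdim {0} U < pv.rdim {0} P"
      using U less.prems by (intro rdim_0_less stableD(1)) auto
    ultimately obtain Q where "stable n Q" "Q \<subseteq> U" "irr n Q" using less.hyps U(1,3) by blast
    then show ?thesis using U(2) by blast
  qed (use less.prems in blast)
qed

text \<open>Induction on the dimension: an irreducible \<open>Q\<close> is split off together with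
  an invariant complement \<open>P'\<close>, and it becomes the last summand.\<close>

lemma ex_poly_decomposition:
  fixes P :: "'k::field_char_0 polynomials set"
  assumes "stable n P" "pv.rel_fg {0} P"
  shows "\<exists>r U. poly_decomposition n r U P"
  using assms
proof (induction "pv.rdim {0} P" arbitrary: P rule: less_induct)
  case less
  show ?case
  proof (cases "P = {0}")
    case True
    have "poly_decomposition n 0 (\<lambda>_. {0}) P"
      by (auto simp: poly_decomposition_def direct_sum_def True)
    then show ?thesis by blast
  next
    case False
    obtain Q where Q: "stable n Q" "Q \<subseteq> P" "irr n Q"
      using ex_irr_subset[OF less.prems False] by blast
    obtain P' where P': "stable n P'" "P' \<subseteq> P" "Q \<inter> P' = {0}" "\<forall>x\<in>P. \<exists>z\<in>Q. x - z \<in> P'"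
      using maschke[OF less.prems(1) Q(1,2)] by blast
    have "P' \<noteq> P" using P'(3) Q(2,3) by (auto simp: irr_def)
    then have "pv.rdim {0} P' < pv.rdim {0} P"
      using P' less.prems by (intro rdim_0_less stableD(1)) auto
    moreover have "pv.rel_fg {0} P'" by (rule pv.rel_fg_subset[OF less.prems(2) P'(2)]) simp
    ultimately obtain r U where U: "poly_decomposition n r U P'" using less.hyps P'(1) by blast
    have Ur: "\<And>i. i < r \<Longrightarrow> stable n (U i) \<and> U i \<subseteq> P' \<and> irr n (U i)" and ds: "direct_sum r U P'"
      using U by (auto simp: poly_decomposition_def)
    define U' where "U' = U(r := Q)"
    have sQ: "pv.subspace Q" and sP': "pv.subspace P'" using Q(1) P'(1) stableD(1) by blast+
    have sum_in: "(\<Sum>i<r. w i) \<in> P'" if "\<And>i. i < r \<Longrightarrow> w i \<in> U i" for w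
      using that Ur by (intro pv.subspace_sum[OF sP']) blast
    have "direct_sum (Suc r) U' P"
      unfolding direct_sum_def
    proof
      fix x assume "x \<in> P"
      then obtain z where z: "z \<in> Q" "x - z \<in> P'" using P'(4) by blast
      from bspec[OF ds[unfolded direct_sum_def] z(2)] obtain w
        where "w \<in> (\<Pi>\<^sub>E i\<in>{..<r}. U i) \<and> x - z = (\<Sum>i<r. w i)"
          and uniq: "\<forall>w'. w' \<in> (\<Pi>\<^sub>E i\<in>{..<r}. U i) \<and> x - z = (\<Sum>i<r. w' i) \<longrightarrow> w' = w" by (rule ex1E)
      then have w: "w \<in> (\<Pi>\<^sub>E i\<in>{..<r}. U i)" "x - z = (\<Sum>i<r. w i)" by simp_all
      show "\<exists>!w. w \<in> (\<Pi>\<^sub>E i\<in>{..<Suc r}. U' i) \<and> x = (\<Sum>i<Suc r. w i)"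
      proof (rule ex1I[of _ "w(r := z)"])
        have "w(r := z) \<in> (\<Pi>\<^sub>E i\<in>{..<Suc r}. U' i)"
          using w(1) z(1) by (auto simp: PiE_iff U'_def extensional_def less_Suc_eq)
        moreover have "x = (\<Sum>i<Suc r. (w(r := z)) i)" using w(2) by (simp add: algebra_simps)
        ultimately show "w(r := z) \<in> (\<Pi>\<^sub>E i\<in>{..<Suc r}. U' i) \<and> x = (\<Sum>i<Suc r. (w(r := z)) i)" ..
      next
        fix v assume v: "v \<in> (\<Pi>\<^sub>E i\<in>{..<Suc r}. U' i) \<and> x = (\<Sum>i<Suc r. v i)"
        have vU: "v i \<in> U i" if "i < r" for i
        proof -
          have "v i \<in> U' i" using v that by (auto simp: PiE_iff)
          then show ?thesis using that by (simp add: U'_def)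
        qed
        have "v r \<in> U' r" using v by (auto simp: PiE_iff)
        then have vr: "v r \<in> Q" by (simp add: U'_def)
        have "z - v r = (\<Sum>i<r. v i) - (x - z)" using v by (simp add: algebra_simps)
        moreover have "(\<Sum>i<r. v i) - (x - z) \<in> P'" by (rule pv.subspace_diff[OF sP' sum_in[OF vU] z(2)])
        ultimately have "z - v r \<in> P'" by (simp only:)
        moreover have "z - v r \<in> Q" by (rule pv.subspace_diff[OF sQ z(1) vr])
        ultimately have "z - v r \<in> Q \<inter> P'" by (rule IntI[rotated])
        then have zv: "v r = z" unfolding P'(3) by simp
        have "restrict v {..<r} \<in> (\<Pi>\<^sub>E i\<in>{..<r}. U i)" using vU by auto
        moreover have "x - z = (\<Sum>i<r. restrict v {..<r} i)" using v zv by simp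
        ultimately have "restrict v {..<r} = w" using uniq by blast
        then have vw: "v i = w i" if "i < r" for i using that by (auto simp: fun_eq_iff restrict_def split: if_splits)
        show "v = w(r := z)"
        proof
          fix i
          consider "i < r" | "i = r" | "i \<notin> {..<Suc r}" by fastforce
          then show "v i = (w(r := z)) i"
          proof cases
            case 3
            then show ?thesis using v w(1) by (auto simp: PiE_iff extensional_def)
          qed (use vw zv in auto)
        qed
      qed
    qed
    moreover have "stable n (U' i) \<and> U' i \<subseteq> P \<and> irr n (U' i)" if "i < Suc r" for i
      using that Ur[of i] Q P'(2) by (cases "i = r") (auto simp: U'_def)
    ultimately show ?thesis by (intro exI[of _ "Suc r"] exI[of _ U']) (simp add: poly_decomposition_def)
  qed
qed

section \<open>Counting copies of a cyclic representation\<close>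

text \<open>
  \<open>R\<close> and \<open>C\<close> play the role of the row and column groups of a tableau, \<open>\<Delta>\<close> that of its polytabloid
  and \<open>mt\<close> that of its tabloid. The multiplicity of the representation generated by \<open>\<Delta>\<close> is the rank
  of the product of the row symmetrizer and the column antisymmetrizer.
\<close>

locale specht_setting =
  fixes n D :: nat and R C :: "(nat \<Rightarrow> nat) set" and \<epsilon> :: "(nat \<Rightarrow> nat) \<Rightarrow> 'k::field_char_0"
    and \<Delta> :: "'k polynomials" and mt :: monomial and cC :: 'k
  assumes R: "\<And>\<sigma>. \<sigma> \<in> R \<Longrightarrow> \<sigma> permutes {..<n}" "id \<in> R"
      "\<And>\<sigma> \<tau>. \<sigma> \<in> R \<Longrightarrow> \<tau> \<in> R \<Longrightarrow> \<sigma> \<circ> \<tau> \<in> R" "\<And>\<sigma>. \<sigma> \<in> R \<Longrightarrow> pinv \<sigma> \<in> R"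
    and C: "\<And>\<sigma>. \<sigma> \<in> C \<Longrightarrow> \<sigma> permutes {..<n}"
    and mt: "mon mt \<in> (forms_in n D :: 'k polynomials set)" "\<And>\<sigma>. \<sigma> permutes {..<n} \<Longrightarrow> mono_act \<sigma> mt = mt \<longleftrightarrow> \<sigma> \<in> R"
    and \<Delta>: "\<Delta> \<in> forms_in n D"
    and antisym: "\<And>p. p \<in> forms_in n D \<Longrightarrow> \<exists>c. gsum C \<epsilon> p = scalar_mult c \<Delta>"
    and antisym_\<Delta>: "gsum C \<epsilon> \<Delta> = scalar_mult cC \<Delta>" "cC \<noteq> 0"
    and sym_\<Delta>: "gsum R (\<lambda>_. 1) \<Delta> \<noteq> 0"
begin

abbreviation \<rho> :: "'k polynomials \<Rightarrow> 'k polynomials" where "\<rho> \<equiv> gsum R (\<lambda>_. 1)"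
abbreviation \<kappa> :: "'k polynomials \<Rightarrow> 'k polynomials" where "\<kappa> \<equiv> gsum C \<epsilon>"

definition S :: "'k polynomials set"
  where "S = pv.span {perm_act \<sigma> \<Delta> | \<sigma>. \<sigma> permutes {..<n}}"

lemma finite_R: "finite R"
  by (rule finite_subset[OF _ finite_perms[of n]]) (use R(1) in blast)

lemma S_subset:
  assumes "stable n U" "\<Delta> \<in> U"
  shows "S \<subseteq> U"
  unfolding S_def using assms by (intro pv.span_minimal) (auto simp: stable_def)

lemma \<Delta>_S: "\<Delta> \<in> S"
proof -
  have "perm_act id \<Delta> \<in> {perm_act \<sigma> \<Delta> | \<sigma>. \<sigma> permutes {..<n}}" using permutes_id by blast
  then show ?thesis unfolding S_def by (intro pv.span_base) simp
qed

lemma stable_S: "stable n S"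
  unfolding stable_def
proof (intro conjI allI impI ballI)
  show "pv.subspace S" unfolding S_def by (rule pv.subspace_span)
  fix \<sigma> q assume \<sigma>: "\<sigma> permutes {..<n}" and q: "q \<in> S"
  have "pv.span {perm_act \<tau> \<Delta> | \<tau>. \<tau> permutes {..<n}} \<subseteq> {q. perm_act \<sigma> q \<in> S}"
  proof (rule pv.span_minimal)
    show "pv.subspace {q. perm_act \<sigma> q \<in> S}"
      unfolding S_def by (rule pv.subspaceI)
        (simp_all add: perm_act_add perm_act_scalar pv.span_zero pv.span_add pv.span_scale)
    show "{perm_act \<tau> \<Delta> | \<tau>. \<tau> permutes {..<n}} \<subseteq> {q. perm_act \<sigma> q \<in> S}"
    proof safe
      fix \<tau> assume "\<tau> permutes {..<n}"
      then have "\<sigma> \<circ> \<tau> permutes {..<n}" using \<sigma> by (rule permutes_compose)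
      then show "perm_act \<sigma> (perm_act \<tau> \<Delta>) \<in> S"
        unfolding S_def perm_act_comp by (intro pv.span_base) blast
    qed
  qed
  then show "perm_act \<sigma> q \<in> S" using q unfolding S_def by blast
qed

lemma stable_forms_in: "stable n (forms_in n d :: 'k polynomials set)"
  by (simp add: stable_def subspace_forms_in perm_act_forms_in)

lemma S_forms: "S \<subseteq> forms_in n D"
  by (rule S_subset[OF stable_forms_in \<Delta>])

lemma \<rho>_perm_act:
  assumes "\<tau> \<in> R"
  shows "\<rho> (perm_act \<tau> x) = \<rho> x"
proof -
  have bij: "bij \<tau>" using R(1)[OF assms] by (rule permutes_bij)
  have "\<rho> (perm_act \<tau> x) = (\<Sum>\<sigma>\<in>R. perm_act (\<sigma> \<circ> \<tau>) x)"
    by (simp add: gsum_def perm_act_comp)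
  also have "\<dots> = (\<Sum>\<sigma>\<in>R. perm_act \<sigma> x)"
  proof (rule sum.reindex_bij_witness[of _ "\<lambda>\<sigma>. \<sigma> \<circ> pinv \<tau>" "\<lambda>\<sigma>. \<sigma> \<circ> \<tau>"])
    fix \<sigma> assume "\<sigma> \<in> R"
    then show "\<sigma> \<circ> \<tau> \<in> R" "\<sigma> \<circ> pinv \<tau> \<in> R" using R(3) R(4) assms by blast+
    show "\<sigma> \<circ> \<tau> \<circ> pinv \<tau> = \<sigma>" "\<sigma> \<circ> pinv \<tau> \<circ> \<tau> = \<sigma>"
      using bij by (auto simp: fun_eq_iff bij_is_surj surj_f_inv_f bij_is_inj)
  qed simp
  finally show ?thesis by (simp add: gsum_def)
qed

text \<open>The vector is the image of \<Delta>. An isomorphism commutes with group sums, so the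
  behaviour of \<Delta> under \<rho> and \<kappa> carries over to \<open>U\<close>.\<close>

lemma iso_vector:
  assumes "rep_iso n (poly_rep S) (poly_rep U)" "stable n U"
  shows "\<exists>w. w \<in> U \<and> \<rho> w \<noteq> 0 \<and> \<kappa> w = scalar_mult cC w \<and> (\<forall>q\<in>U. \<exists>a. \<kappa> q = scalar_mult a w)"
proof -
  obtain f where f: "bij_betw f S U" "\<And>u v. u \<in> S \<Longrightarrow> v \<in> S \<Longrightarrow> f (u + v) = f u + f v"
    "\<And>c v. v \<in> S \<Longrightarrow> f (scalar_mult c v) = scalar_mult c (f v)"
    "\<And>\<sigma> v. \<sigma> permutes {..<n} \<Longrightarrow> v \<in> S \<Longrightarrow> f (perm_act \<sigma> v) = perm_act \<sigma> (f v)"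
    using assms(1) unfolding rep_iso_def poly_rep_def by auto
  note SS = stableD[OF stable_S]
  have f0: "f 0 = 0" using f(3)[of 0 0] pv.subspace_0[OF SS(1)] by simp
  have f_gsum: "f (gsum A a v) = gsum A a (f v)" if "finite A" "A \<subseteq> perms n" "v \<in> S" for A a v
    using that
  proof (induction A rule: finite_induct)
    case empty
    then show ?case by (simp add: gsum_def f0)
  next
    case (insert \<sigma> A)
    have \<sigma>: "\<sigma> permutes {..<n}" using insert.prems by blast
    have 1: "scalar_mult (a \<sigma>) (perm_act \<sigma> v) \<in> S" using SS \<sigma> insert.prems(2) pv.subspace_scale by blast
    have 2: "gsum A a v \<in> S" by (rule gsum_stable[OF stable_S]) (use insert.prems in auto)
    have "gsum (insert \<sigma> A) a x = scalar_mult (a \<sigma>) (perm_act \<sigma> x) + gsum A a x" for x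
      using insert.hyps by (simp add: gsum_def)
    then show ?case using insert.IH insert.prems f(2)[OF 1 2] f(3)[OF SS(2)[OF \<sigma>]] f(4)[OF \<sigma>] by simp
  qed
  have finC: "finite C" "C \<subseteq> perms n" "R \<subseteq> perms n" using C R(1) finite_subset[OF _ finite_perms[of n]] by blast+
  have fU: "f v \<in> U" if "v \<in> S" for v using f(1) that by (auto simp: bij_betw_def)
  have "\<rho> (f \<Delta>) = f (\<rho> \<Delta>)" using f_gsum[OF finite_R finC(3) \<Delta>_S] by simp
  moreover have "\<rho> \<Delta> \<in> S" by (rule gsum_stable[OF stable_S R(1) \<Delta>_S])
  then have "f (\<rho> \<Delta>) \<noteq> f 0" using sym_\<Delta> f(1) pv.subspace_0[OF SS(1)] by (auto simp: bij_betw_def inj_on_eq_iff)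
  ultimately have "\<rho> (f \<Delta>) \<noteq> 0" by (simp add: f0)
  moreover have "\<kappa> (f \<Delta>) = scalar_mult cC (f \<Delta>)"
    using f_gsum[OF finC(1,2) \<Delta>_S, of \<epsilon>] f(3)[OF \<Delta>_S] by (simp add: antisym_\<Delta>)
  moreover have "\<exists>a. \<kappa> q = scalar_mult a (f \<Delta>)" if "q \<in> U" for q
  proof -
    have "q \<in> f ` S" using f(1) that by (simp add: bij_betw_def)
    then obtain s where s: "s \<in> S" "q = f s" by blast
    obtain c where "\<kappa> s = scalar_mult c \<Delta>" using antisym S_forms s(1) by blast
    then have "\<kappa> q = scalar_mult c (f \<Delta>)" using f_gsum[OF finC(1,2) s(1), of \<epsilon>] f(3)[OF \<Delta>_S, of c] s(2) by simp
    then show ?thesis by blast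
  qed
  ultimately show ?thesis using fU[OF \<Delta>_S] by blast
qed

text \<open>Frobenius reciprocity: a coefficient of \<open>\<rho> v\<close> is a functional \<phi>
  invariant under \<open>R\<close>, so it induces an equivariant map \<Phi> into the permutation
  module spanned by the translates of \<open>mt\<close>. There \<kappa> yields only multiples of
  \<Delta>, so \<open>\<Phi> (\<kappa> u)\<close> is one, and it is nonzero by the choice of the
  coefficient. Irreducibility of \<open>U\<close> does the rest.\<close>

lemma rep_iso_if:
  assumes U: "stable n U" "irr n U" and u: "u \<in> U" "\<rho> (\<kappa> u) \<noteq> 0"
  shows "rep_iso n (poly_rep S) (poly_rep U)"
proof -
  note SU = stableD[OF U(1)] and SS = stableD[OF stable_S]
  obtain m where m: "lk (\<rho> (\<kappa> u)) m \<noteq> 0"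
    using u(2) poly_mapping_eqI[of "\<rho> (\<kappa> u)" 0] by auto
  define \<phi> where "\<phi> v = lk (\<rho> v) m" for v
  have \<phi>_add: "\<phi> (v + w) = \<phi> v + \<phi> w" and \<phi>_scalar: "\<phi> (scalar_mult c v) = c * \<phi> v" for v w c
    by (simp_all add: \<phi>_def gsum_add gsum_scalar lookup_add)
  define \<Phi> where "\<Phi> v = (\<Sum>\<sigma>\<in>perms n. scalar_mult (\<phi> (perm_act (pinv \<sigma>) v)) (mon (mono_act \<sigma> mt)))" for v
  have \<Phi>_add: "\<Phi> (v + w) = \<Phi> v + \<Phi> w" for v w
    by (simp add: \<Phi>_def perm_act_add \<phi>_add pv.scale_left_distrib sum.distrib)
  have \<Phi>_scalar: "\<Phi> (scalar_mult c v) = scalar_mult c (\<Phi> v)" for c v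
    by (simp add: \<Phi>_def perm_act_scalar \<phi>_scalar pv.scale_sum_right)
  have \<Phi>_0: "\<Phi> 0 = 0" using \<Phi>_scalar[of 0 0] by simp
  have \<Phi>_diff: "\<Phi> (v - w) = \<Phi> v - \<Phi> w" for v w
    using \<Phi>_add[of "v - w" w] by (simp add: algebra_simps)
  have \<Phi>_act: "\<Phi> (perm_act \<tau> v) = perm_act \<tau> (\<Phi> v)" if \<tau>: "\<tau> permutes {..<n}" for \<tau> v
  proof -
    have "\<Phi> (perm_act \<tau> v) = (\<Sum>\<sigma>\<in>perms n. scalar_mult (\<phi> (perm_act (pinv (\<tau> \<circ> \<sigma>)) (perm_act \<tau> v))) (mon (mono_act (\<tau> \<circ> \<sigma>) mt)))"
      unfolding \<Phi>_def by (rule setum_permutations_compose_left[OF \<tau>])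
    also have "\<dots> = (\<Sum>\<sigma>\<in>perms n. perm_act \<tau> (scalar_mult (\<phi> (perm_act (pinv \<sigma>) v)) (mon (mono_act \<sigma> mt))))"
      by (rule sum.cong) (simp_all add: perm_act_pinv_comp[OF \<tau>] perm_act_scalar perm_act_mon mono_act_comp)
    finally show ?thesis by (simp add: \<Phi>_def perm_act_sum)
  qed
  have \<Phi>_sum: "\<Phi> (\<Sum>i\<in>A. f i) = (\<Sum>i\<in>A. \<Phi> (f i))" for A :: "(nat \<Rightarrow> nat) set" and f
    by (induction A rule: infinite_finite_induct) (simp_all add: \<Phi>_add \<Phi>_0)
  have \<Phi>_gsum: "\<Phi> (\<kappa> v) = \<kappa> (\<Phi> v)" for v
    unfolding gsum_def \<Phi>_sum by (rule sum.cong) (simp_all add: \<Phi>_scalar \<Phi>_act C)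
  have \<Phi>_forms: "\<Phi> v \<in> forms_in n D" for v
    unfolding \<Phi>_def
  proof (intro pv.subspace_sum[OF subspace_forms_in] pv.subspace_scale[OF subspace_forms_in])
    fix \<sigma> assume "\<sigma> \<in> perms n"
    then show "mon (mono_act \<sigma> mt) \<in> (forms_in n D :: 'k polynomials set)"
      using perm_act_forms_in[OF _ mt(1), of \<sigma>] by (simp add: perm_act_mon)
  qed
  \<comment> \<open>Exactly the permutations in \<open>R\<close> fix \<open>mt\<close>, and \<phi>
    does not distinguish the translates of \<open>v\<close> by \<open>R\<close>.\<close>
  have coeff: "lk (\<Phi> v) mt = of_nat (card R) * \<phi> v" for v
  proof -
    have "lk (\<Phi> v) mt = (\<Sum>\<sigma>\<in>perms n. if \<sigma> \<in> R then \<phi> (perm_act (pinv \<sigma>) v) else 0)"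
      unfolding \<Phi>_def lookup_sum
      by (rule sum.cong) (use mt(2) in \<open>auto simp: mon_def lookup_single when_def\<close>)
    also have "\<dots> = (\<Sum>\<sigma>\<in>R. \<phi> (perm_act (pinv \<sigma>) v))"
      using R(1) by (intro sum.mono_neutral_cong_right finite_perms) auto
    also have "\<dots> = (\<Sum>\<sigma>\<in>R. \<phi> v)"
      by (rule sum.cong) (simp_all add: \<phi>_def \<rho>_perm_act R(4))
    finally show ?thesis by simp
  qed
  obtain c where c: "\<Phi> (\<kappa> u) = scalar_mult c \<Delta>" using antisym[OF \<Phi>_forms] \<Phi>_gsum by metis
  have "card R \<noteq> 0" using finite_R R(2) by auto
  then have "lk (\<Phi> (\<kappa> u)) mt \<noteq> 0" using m by (simp add: coeff \<phi>_def)
  then have ne: "\<Phi> (\<kappa> u) \<noteq> 0" by auto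
  then have c0: "c \<noteq> 0" using c by auto
  have ku: "\<kappa> u \<in> U" by (rule gsum_stable[OF U(1) C u(1)])
  \<comment> \<open>As in Schur's lemma: both the kernel of \<Phi> and the preimage of
    \<open>S\<close> are stable subspaces of the irreducible \<open>U\<close>.\<close>
  have "stable n {v \<in> U. \<Phi> v = 0}"
    unfolding stable_def
  proof (intro conjI allI impI ballI)
    show "pv.subspace {v \<in> U. \<Phi> v = 0}"
      by (rule pv.subspaceI)
        (auto simp: \<Phi>_0 \<Phi>_add \<Phi>_scalar pv.subspace_0[OF SU(1)] pv.subspace_add[OF SU(1)] pv.subspace_scale[OF SU(1)])
  qed (simp add: \<Phi>_act SU(2))
  moreover have "{v \<in> U. \<Phi> v = 0} \<noteq> U" using ne ku by blast
  ultimately have ker: "{v \<in> U. \<Phi> v = 0} = {0}" using U(2) unfolding irr_def by blast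
  have "stable n {v \<in> U. \<Phi> v \<in> S}"
    unfolding stable_def
  proof (intro conjI allI impI ballI)
    show "pv.subspace {v \<in> U. \<Phi> v \<in> S}"
      by (rule pv.subspaceI)
        (auto simp: \<Phi>_0 \<Phi>_add \<Phi>_scalar pv.subspace_0[OF SU(1)] pv.subspace_add[OF SU(1)] pv.subspace_scale[OF SU(1)]
          pv.subspace_0[OF SS(1)] pv.subspace_add[OF SS(1)] pv.subspace_scale[OF SS(1)])
  qed (simp add: \<Phi>_act SU(2) SS(2))
  moreover have "\<kappa> u \<in> {v \<in> U. \<Phi> v \<in> S}" using ku c pv.subspace_scale[OF SS(1) \<Delta>_S] by simp
  moreover have "\<kappa> u \<noteq> 0" using ne \<Phi>_0 by auto
  ultimately have img: "{v \<in> U. \<Phi> v \<in> S} = U" using U(2) unfolding irr_def by blast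
  have inj: "inj_on \<Phi> U"
  proof (rule inj_onI)
    fix v w assume "v \<in> U" "w \<in> U" "\<Phi> v = \<Phi> w"
    then have "v - w \<in> {v \<in> U. \<Phi> v = 0}" using pv.subspace_diff[OF SU(1)] by (simp add: \<Phi>_diff)
    then show "v = w" using ker by simp
  qed
  have "stable n (\<Phi> ` U)"
    unfolding stable_def
  proof (intro conjI allI impI ballI)
    show "pv.subspace (\<Phi> ` U)"
    proof (rule pv.subspaceI)
      show "0 \<in> \<Phi> ` U" using \<Phi>_0 pv.subspace_0[OF SU(1)] by force
      fix x y c assume "x \<in> \<Phi> ` U"
      then obtain v where v: "x = \<Phi> v" "v \<in> U" by blast
      then have "scalar_mult c x = \<Phi> (scalar_mult c v)" by (simp add: \<Phi>_scalar)
      then show "scalar_mult c x \<in> \<Phi> ` U" using pv.subspace_scale[OF SU(1) v(2)] by blast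
      assume "y \<in> \<Phi> ` U"
      then obtain w where w: "y = \<Phi> w" "w \<in> U" by blast
      then have "x + y = \<Phi> (v + w)" using v by (simp add: \<Phi>_add)
      then show "x + y \<in> \<Phi> ` U" using pv.subspace_add[OF SU(1) v(2) w(2)] by blast
    qed
    fix \<sigma> q assume \<sigma>: "\<sigma> permutes {..<n}" and "q \<in> \<Phi> ` U"
    then obtain v where v: "q = \<Phi> v" "v \<in> U" by blast
    then have "perm_act \<sigma> q = \<Phi> (perm_act \<sigma> v)" by (simp add: \<Phi>_act[OF \<sigma>])
    then show "perm_act \<sigma> q \<in> \<Phi> ` U" using SU(2)[OF \<sigma> v(2)] by blast
  qed
  moreover have "\<Delta> \<in> \<Phi> ` U"
  proof
    show "scalar_mult (1 / c) (\<kappa> u) \<in> U" using ku by (rule pv.subspace_scale[OF SU(1)])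
    show "\<Delta> = \<Phi> (scalar_mult (1 / c) (\<kappa> u))" using c0 by (simp add: \<Phi>_scalar c)
  qed
  ultimately have "S \<subseteq> \<Phi> ` U" by (rule S_subset)
  with img have "\<Phi> ` U = S" by blast
  with inj have bij: "bij_betw \<Phi> U S" by (simp add: bij_betw_def)
  let ?f = "inv_into U \<Phi>"
  have f: "?f (\<Phi> v) = v" if "v \<in> U" for v using inj that by (rule inv_into_f_f)
  have pre: "\<exists>v. v \<in> U \<and> s = \<Phi> v" if "s \<in> S" for s using that \<open>\<Phi> ` U = S\<close> by blast
  have "?f (x + y) = ?f x + ?f y" if "x \<in> S" "y \<in> S" for x y
  proof -
    obtain v w where "v \<in> U" "x = \<Phi> v" "w \<in> U" "y = \<Phi> w" using pre \<open>x \<in> S\<close> \<open>y \<in> S\<close> by metis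
    then show ?thesis using pv.subspace_add[OF SU(1)] by (simp add: f flip: \<Phi>_add)
  qed
  moreover have "?f (scalar_mult a x) = scalar_mult a (?f x)" if "x \<in> S" for a x
  proof -
    obtain v where "v \<in> U" "x = \<Phi> v" using pre \<open>x \<in> S\<close> by metis
    then show ?thesis using pv.subspace_scale[OF SU(1)] by (simp add: f flip: \<Phi>_scalar)
  qed
  moreover have "?f (perm_act \<sigma> x) = perm_act \<sigma> (?f x)" if \<sigma>: "\<sigma> permutes {..<n}" and x: "x \<in> S" for \<sigma> x
  proof -
    obtain v where "v \<in> U" "x = \<Phi> v" using pre x by metis
    then show ?thesis using SU(2)[OF \<sigma>] by (simp add: f flip: \<Phi>_act[OF \<sigma>])
  qed
  ultimately show ?thesis
    unfolding rep_iso_def using bij_betw_inv_into[OF bij]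
    by (intro exI[of _ ?f]) (simp add: poly_rep_def)
qed

lemma subspace_\<rho>_preimage: "pv.subspace I \<Longrightarrow> pv.subspace {h. \<rho> h \<in> I}"
  by (rule pv.subspaceI) (simp_all add: gsum_add gsum_scalar pv.subspace_0 pv.subspace_add pv.subspace_scale)

text \<open>On a summand isomorphic to \<open>S\<close> the antisymmetrizer has rank one, and its
  image is spanned by a vector \<open>w i\<close> that \<rho> does not kill. On the other summands
  \<rho> after \<kappa> vanishes by \<open>rep_iso_if\<close>. So the \<open>w i\<close> form the
  required relative basis.\<close>

lemma count:
  assumes I: "pv.subspace I" "\<And>\<sigma> p. \<sigma> permutes {..<n} \<Longrightarrow> p \<in> I \<Longrightarrow> perm_act \<sigma> p \<in> I"
    and Q: "stable n Q" "Q \<subseteq> forms_in n d" "Q \<inter> I = {0}"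
    and sum: "\<And>p. p \<in> forms_in n d \<Longrightarrow> \<exists>q\<in>Q. p - q \<in> I"
    and dec: "poly_decomposition n r U Q"
  shows "card {i. i < r \<and> rep_iso n (poly_rep S) (poly_rep (U i))} = pv.rdim {h. \<rho> h \<in> I} (\<kappa> ` forms_in n d)"
proof -
  let ?J = "{h. \<rho> h \<in> I}" and ?A = "{i. i < r \<and> rep_iso n (poly_rep S) (poly_rep (U i))}"
  have J: "pv.subspace ?J" by (rule subspace_\<rho>_preimage[OF I(1)])
  have sI: "stable n I" using I by (simp add: stable_def)
  have U: "\<And>i. i < r \<Longrightarrow> stable n (U i) \<and> U i \<subseteq> Q \<and> irr n (U i)" and ds: "direct_sum r U Q"
    using dec by (auto simp: poly_decomposition_def)
  define w where "w i = (SOME w. w \<in> U i \<and> \<rho> w \<noteq> 0 \<and> \<kappa> w = scalar_mult cC w \<and> (\<forall>q\<in>U i. \<exists>a. \<kappa> q = scalar_mult a w))" for i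
  have w: "w i \<in> U i \<and> \<rho> (w i) \<noteq> 0 \<and> \<kappa> (w i) = scalar_mult cC (w i) \<and> (\<forall>q\<in>U i. \<exists>a. \<kappa> q = scalar_mult a (w i))"
    if "i \<in> ?A" for i
  proof -
    have "\<exists>w. w \<in> U i \<and> \<rho> w \<noteq> 0 \<and> \<kappa> w = scalar_mult cC w \<and> (\<forall>q\<in>U i. \<exists>a. \<kappa> q = scalar_mult a w)"
      using that U by (intro iso_vector) auto
    then show ?thesis unfolding w_def by (rule someI_ex)
  qed
  have zero: "\<forall>i<r. v i = 0" if v: "\<And>i. i < r \<Longrightarrow> v i \<in> U i" "(\<Sum>i<r. v i) = 0" for v
  proof -
    have 0: "0 \<in> Q" using pv.subspace_0[OF stableD(1)[OF Q(1)]] .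
    let ?z = "\<lambda>i\<in>{..<r}. 0 :: 'k polynomials"
    have "?z \<in> (\<Pi>\<^sub>E i\<in>{..<r}. U i) \<and> 0 = (\<Sum>i<r. ?z i)"
      using U pv.subspace_0[OF stableD(1)] by auto
    moreover have "restrict v {..<r} \<in> (\<Pi>\<^sub>E i\<in>{..<r}. U i) \<and> 0 = (\<Sum>i<r. restrict v {..<r} i)"
      using v by auto
    ultimately have eq: "restrict v {..<r} = ?z"
      using bspec[OF ds[unfolded direct_sum_def] 0] by blast
    show ?thesis
    proof (intro allI impI)
      fix i assume "i < r"
      then show "v i = 0" using fun_cong[OF eq, of i] by simp
    qed
  qed
  have "pv.rel_basis ?J (\<kappa> ` forms_in n d) ?A w"
    unfolding pv.rel_basis_def
  proof (intro conjI ballI allI impI)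
    show "finite ?A" by simp
    show "w ` ?A \<subseteq> \<kappa> ` forms_in n d"
    proof
      fix x assume "x \<in> w ` ?A"
      then obtain i where i: "i \<in> ?A" "x = w i" by blast
      have "x = \<kappa> (scalar_mult (1 / cC) (w i))" using w[OF i(1)] antisym_\<Delta>(2) i(2) by (simp add: gsum_scalar)
      moreover have "scalar_mult (1 / cC) (w i) \<in> forms_in n d"
        using w[OF i(1)] i(1) U Q(2) by (intro pv.subspace_scale[OF subspace_forms_in]) blast
      ultimately show "x \<in> \<kappa> ` forms_in n d" by blast
    qed
  next
    fix x assume "x \<in> \<kappa> ` forms_in n d"
    then obtain p where p: "p \<in> forms_in n d" "x = \<kappa> p" by blast
    obtain q where q: "q \<in> Q" "p - q \<in> I" using sum[OF p(1)] by blast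
    obtain v where v: "v \<in> (\<Pi>\<^sub>E i\<in>{..<r}. U i)" "q = (\<Sum>i<r. v i)"
      using bspec[OF ds[unfolded direct_sum_def] q(1)] by (metis (no_types, lifting))
    have vU: "v i \<in> U i" if "i < r" for i using v(1) that by (auto simp: PiE_iff)
    define a where "a i = (SOME a. \<kappa> (v i) = scalar_mult a (w i))" for i
    have a: "\<kappa> (v i) = scalar_mult (a i) (w i)" if "i \<in> ?A" for i
      unfolding a_def by (rule someI_ex) (use w[OF that] vU that in blast)
    have z: "\<rho> (\<kappa> (v i)) = 0" if "i < r" "i \<notin> ?A" for i
      using rep_iso_if[of "U i" "v i"] U[OF that(1)] vU[OF that(1)] that by blast
    have "\<rho> (\<kappa> q) = (\<Sum>i<r. \<rho> (\<kappa> (v i)))" by (simp add: v(2) gsum_sum)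
    also have "\<dots> = (\<Sum>i\<in>?A. \<rho> (\<kappa> (v i)))" by (rule sum.mono_neutral_right) (use z in auto)
    also have "\<dots> = \<rho> (\<Sum>i\<in>?A. scalar_mult (a i) (w i))" by (simp add: gsum_sum a)
    finally have "\<rho> (x - (\<Sum>i\<in>?A. scalar_mult (a i) (w i))) = \<rho> (\<kappa> (p - q))"
      by (simp add: p(2) gsum_diff)
    also have "\<rho> (\<kappa> (p - q)) \<in> I" by (rule gsum_stable[OF sI R(1) gsum_stable[OF sI C q(2)]])
    finally show "\<exists>a. x - (\<Sum>i\<in>?A. scalar_mult (a i) (w i)) \<in> ?J" by (intro exI[of _ a]) simp
  next
    fix a i assume s: "(\<Sum>i\<in>?A. scalar_mult (a i) (w i)) \<in> ?J" and i: "i \<in> ?A"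
    \<comment> \<open>Applying \<rho> to the relation gives an element of
      \<open>Q \<inter> I\<close>, which is \<open>0\<close>; the direct sum then separates its
      terms.\<close>
    let ?v = "\<lambda>i. if i \<in> ?A then scalar_mult (a i) (\<rho> (w i)) else 0"
    have v: "?v j \<in> U j" if "j < r" for j
    proof (cases "j \<in> ?A")
      case True
      have sj: "stable n (U j)" using U[OF that] by blast
      show ?thesis using True w[OF True] gsum_stable[OF sj R(1)] pv.subspace_scale[OF stableD(1)[OF sj]] by auto
    qed (use pv.subspace_0[OF stableD(1)] U[OF that] in auto)
    have "(\<Sum>j<r. ?v j) = (\<Sum>j\<in>?A. ?v j)" by (rule sum.mono_neutral_right) auto
    also have "\<dots> = \<rho> (\<Sum>i\<in>?A. scalar_mult (a i) (w i))" by (simp add: gsum_sum gsum_scalar)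
    finally have eq: "(\<Sum>j<r. ?v j) = \<rho> (\<Sum>i\<in>?A. scalar_mult (a i) (w i))" .
    then have "(\<Sum>j<r. ?v j) \<in> I" using s by simp
    moreover have "(\<Sum>j<r. ?v j) \<in> Q"
      by (rule pv.subspace_sum[OF stableD(1)[OF Q(1)]]) (use v U in blast)
    ultimately have "(\<Sum>j<r. ?v j) = 0" using Q(3) by blast
    from zero[OF v this] i have "?v i = 0" by blast
    then have "scalar_mult (a i) (\<rho> (w i)) = 0" using i by simp
    then show "a i = 0" using w[OF i] by (simp only: pv.scale_eq_0_iff) simp
  qed
  from pv.rdim_eq_card[OF J this] show ?thesis by simp
qed

theorem multiplicity_quotient_piece:
  assumes I: "poly_ideal I" "symmetric_ideal I"
  shows "multiplicity_of n (poly_rep S) (quotient_piece I n d) = pv.rdim {h. \<rho> h \<in> I} (\<kappa> ` forms_in n d)"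
proof -
  have sI: "pv.subspace I" by (rule poly_ideal_subspace[OF I(1)])
  have aI: "perm_act \<sigma> p \<in> I" if "\<sigma> permutes {..<n}" "p \<in> I" for \<sigma> p
    using I(2) that by (auto simp: symmetric_ideal_def sym_infinity_def)
  let ?Z = "I \<inter> forms_in n d"
  have "stable n ?Z"
    using aI stable_forms_in[of d] sI by (auto simp: stable_def intro: pv.subspace_inter)
  from maschke[OF stable_forms_in[of d] this] obtain Q
    where Q: "stable n Q" "Q \<subseteq> forms_in n d" "?Z \<inter> Q = {0}" "\<forall>x\<in>forms_in n d. \<exists>z\<in>?Z. x - z \<in> Q" by blast
  have QI: "Q \<inter> I = {0}" using Q(2,3) by blast
  have sum: "\<exists>q\<in>Q. p - q \<in> I" if p: "p \<in> forms_in n d" for p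
  proof -
    obtain z where "z \<in> ?Z" "p - z \<in> Q" using Q(4) p by blast
    then show ?thesis by (intro bexI[of _ "p - z"]) simp_all
  qed
  have "pv.rel_fg {0} Q" by (rule pv.rel_fg_subset[OF rel_fg_forms_in[OF pv.subspace_single_0] Q(2)]) simp
  then have ex: "\<exists>r U. poly_decomposition n r U Q" by (rule ex_poly_decomposition[OF Q(1)])
  have "rep_map n (\<lambda>p. p +o (I \<inter> polys_in n)) Q (quotient_piece I n d)"
    by (rule quotient_piece_rep_map[OF I Q(1,2) QI sum])
  then show ?thesis
    using ex by (rule multiplicity_of_eqI) (rule count[OF sI aI Q(1,2) QI sum])
qed

end

section \<open>Specht polynomials\<close>

text \<open>Remove the maximum, which is at least the number of the other elements. In the end this
  forces the exponents within a column of the tableau to be \<open>0, 1, 2, ...\<close> in some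
  order.\<close>

lemma sum_ge_sum_lessThan:
  fixes B :: "nat set"
  assumes "finite B"
  shows "\<Sum>{..<card B} \<le> \<Sum>B \<and> (\<Sum>B = \<Sum>{..<card B} \<longrightarrow> B = {..<card B})"
  using assms
proof (induction "card B" arbitrary: B)
  case 0
  then show ?case by simp
next
  case (Suc c)
  define M where "M = Max B"
  have ne: "B \<noteq> {}" using Suc by auto
  have M: "M \<in> B" "\<And>x. x \<in> B \<Longrightarrow> x \<le> M" unfolding M_def using Suc.prems ne by auto
  let ?B = "B - {M}"
  have card: "card ?B = c" using Suc.hyps(2) M(1) Suc.prems by simp
  have IH: "\<Sum>{..<c} \<le> \<Sum>?B" "\<Sum>?B = \<Sum>{..<c} \<Longrightarrow> ?B = {..<c}"
    using Suc.hyps(1)[of ?B] card Suc.prems by auto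
  have sum: "\<Sum>B = M + \<Sum>?B" using M(1) Suc.prems by (rule sum.remove[rotated])
  have "?B \<subseteq> {..<M}" using M(2) by (auto simp: less_le)
  then have cM: "c \<le> M" using card_mono[of "{..<M}" ?B] card by simp
  have "B = {..<Suc c}" if "\<Sum>B = \<Sum>{..<Suc c}"
  proof -
    have "M = c" "\<Sum>?B = \<Sum>{..<c}" using that sum IH(1) cM by simp_all
    with IH(2) have "?B = {..<M}" by simp
    then have "B = insert M {..<M}" using M(1) by blast
    then show ?thesis using \<open>M = c\<close> by (simp add: lessThan_Suc)
  qed
  then show ?case using sum IH(1) cM by (simp flip: Suc.hyps(2))
qed

lemma var_eq_iff: "(var i :: 'k::field polynomials) = var j \<longleftrightarrow> i = j"
proof
  assume eq: "(var i :: 'k polynomials) = var j"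
  have "lk (var i :: 'k polynomials) (sgl i 1) = 1" by (simp add: var_def)
  then have "lk (var j :: 'k polynomials) (sgl i 1) \<noteq> 0" by (simp add: eq)
  then have "(sgl j 1 :: monomial) = sgl i 1" by (simp add: var_def lookup_single when_def split: if_splits)
  then have "lk (sgl j 1 :: monomial) i = lk (sgl i 1 :: monomial) i" by simp
  then show "i = j" by (simp add: lookup_single when_def split: if_splits)
qed simp

lemma var_diff_forms_in: "i < n \<Longrightarrow> j < n \<Longrightarrow> var i - var j \<in> forms_in n 1"
  by (rule pv.subspace_diff[OF subspace_forms_in]) (simp_all add: forms_in_def var_def)

lemma prod_forms_in:
  "finite A \<Longrightarrow> (\<And>x. x \<in> A \<Longrightarrow> f x \<in> forms_in n 1) \<Longrightarrow> (\<Prod>x\<in>A. f x) \<in> forms_in n (card A)"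
proof (induction A rule: finite_induct)
  case empty
  then show ?case by (simp add: forms_in_def flip: single_one)
next
  case (insert x A)
  have "f x * (\<Prod>x\<in>A. f x) \<in> forms_in n (Suc (card A))"
    unfolding forms_in_def
    by (rule keys_within_mult) (use insert in \<open>auto simp: forms_in_def keys_add_nat\<close>)
  then show ?case using insert.hyps by simp
qed

text \<open>\<nu> lists the rows below the first one, and \<open>b\<close> fills their cells with
  the smallest entries. The first row receives the remaining numbers in order and never ends, so
  that one filling serves all large \<open>n\<close> at once.\<close>

locale tableau =
  fixes \<nu> :: "nat list" and b :: "nat \<times> nat \<Rightarrow> nat"
  assumes sorted: "sorted_wrt (\<ge>) \<nu>"
    and b: "bij_betw b {(i, j). i < length \<nu> \<and> j < \<nu> ! i} {..<sum_list \<nu>}"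
begin

abbreviation g :: nat where "g \<equiv> sum_list \<nu>"
abbreviation "lower \<equiv> {(i, j). i < length \<nu> \<and> j < \<nu> ! i}"

definition h :: nat where "h = (if \<nu> = [] then 0 else \<nu> ! 0)"
text \<open>The cells below the first row together with the first-row cells that have a cell below
  them. Entries from \<open>q\<close> on are alone in their columns
  (\<open>same_column_less_q\<close>).\<close>

definition q :: nat where "q = g + h"

definition T :: "nat \<times> nat \<Rightarrow> nat"
  where "T x = (case fst x of 0 \<Rightarrow> g + snd x | Suc i \<Rightarrow> b (i, snd x))"

definition rw :: "nat \<Rightarrow> nat"
  where "rw v = (if v < g then Suc (fst (inv_into lower b v)) else 0)"

definition cl :: "nat \<Rightarrow> nat"
  where "cl v = (if v < g then snd (inv_into lower b v) else v - g)"

lemma nth_le_h: "i < length \<nu> \<Longrightarrow> \<nu> ! i \<le> h"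
  using sorted_wrt_nth_less[OF sorted, of 0 i] by (cases "i = 0") (auto simp: h_def)

lemma nth_antimono: "i \<le> i' \<Longrightarrow> i' < length \<nu> \<Longrightarrow> \<nu> ! i' \<le> \<nu> ! i"
  using sorted_wrt_nth_less[OF sorted, of i i'] by (cases "i = i'") auto

lemma lower_cell:
  assumes "v < g"
  obtains i j where "i < length \<nu>" "j < \<nu> ! i" "rw v = Suc i" "cl v = j" "b (i, j) = v"
proof -
  have v: "v \<in> b ` lower" using b assms by (simp add: bij_betw_def)
  obtain i j where ij: "inv_into lower b v = (i, j)" by (cases "inv_into lower b v")
  have "(i, j) \<in> lower" using inv_into_into[OF v] ij by simp
  moreover have "b (i, j) = v" using f_inv_into_f[OF v] ij by simp
  ultimately show ?thesis using that[of i j] assms ij by (simp add: rw_def cl_def)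
qed

lemma b_cell: "i < length \<nu> \<Longrightarrow> j < \<nu> ! i \<Longrightarrow> b (i, j) < g \<and> rw (b (i, j)) = Suc i \<and> cl (b (i, j)) = j"
proof -
  assume "i < length \<nu>" "j < \<nu> ! i"
  then have ij: "(i, j) \<in> lower" by simp
  have "b (i, j) < g" using b ij by (auto simp: bij_betw_def)
  moreover have "inv_into lower b (b (i, j)) = (i, j)"
    using b ij by (intro inv_into_f_f) (auto simp: bij_betw_def)
  ultimately show ?thesis by (simp add: rw_def cl_def)
qed

lemma rw_cl_inj: "rw v = rw w \<Longrightarrow> cl v = cl w \<Longrightarrow> v = w"
proof -
  assume eq: "rw v = rw w" "cl v = cl w"
  show ?thesis
  proof (cases "v < g")
    case True
    then obtain i j where v: "rw v = Suc i" "cl v = j" "b (i, j) = v" by (rule lower_cell)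
    have "w < g" using v(1) eq(1) by (auto simp: rw_def split: if_splits)
    then obtain i' j' where w: "rw w = Suc i'" "cl w = j'" "b (i', j') = w" by (rule lower_cell)
    show ?thesis using v w eq by simp
  next
    case False
    then have "\<not> w < g" using eq(1) by (auto simp: rw_def split: if_splits)
    then show ?thesis using False eq(2) by (simp add: cl_def)
  qed
qed

lemma T_rw_cl: "T (rw v, cl v) = v"
proof (cases "v < g")
  case True
  then obtain i j where "rw v = Suc i" "cl v = j" "b (i, j) = v" by (rule lower_cell)
  then show ?thesis by (simp add: T_def)
qed (simp add: T_def rw_def cl_def)

abbreviation la :: "nat \<Rightarrow> nat list" where "la n \<equiv> (n - g) # \<nu>"

lemma cells_la: "(i, j) \<in> cells (la n) \<longleftrightarrow> (case i of 0 \<Rightarrow> j < n - g | Suc i' \<Rightarrow> i' < length \<nu> \<and> j < \<nu> ! i')"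
  by (auto simp: cells_def split: nat.splits)

lemma T_cell:
  assumes "(i, j) \<in> cells (la n)" "g \<le> n"
  shows "T (i, j) < n" "rw (T (i, j)) = i" "cl (T (i, j)) = j"
proof -
  have "T (i, j) < n \<and> rw (T (i, j)) = i \<and> cl (T (i, j)) = j"
  proof (cases i)
    case 0
    then show ?thesis using assms by (simp add: cells_la T_def) (simp add: rw_def cl_def)
  next
    case (Suc i')
    then show ?thesis using assms b_cell[of i' j] by (simp add: cells_la T_def)
  qed
  then show "T (i, j) < n" "rw (T (i, j)) = i" "cl (T (i, j)) = j" by simp_all
qed

lemma rw_cl_cell: "v < n \<Longrightarrow> g \<le> n \<Longrightarrow> (rw v, cl v) \<in> cells (la n)"
proof (cases "v < g")
  case True
  then obtain i j where "i < length \<nu>" "j < \<nu> ! i" "rw v = Suc i" "cl v = j" by (rule lower_cell)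
  then show ?thesis by (simp add: cells_la)
qed (auto simp: cells_la rw_def cl_def)

lemma bij_T: "g \<le> n \<Longrightarrow> bij_betw T (cells (la n)) {..<n}"
proof -
  assume n: "g \<le> n"
  show ?thesis
  proof (rule bij_betw_byWitness[where f' = "\<lambda>v. (rw v, cl v)"])
    show "\<forall>a\<in>cells (la n). (rw (T a), cl (T a)) = a" using T_cell n by auto
    show "\<forall>a'\<in>{..<n}. T (rw a', cl a') = a'" by (simp add: T_rw_cl)
    show "T ` cells (la n) \<subseteq> {..<n}" using T_cell(1) n by auto
    show "(\<lambda>v. (rw v, cl v)) ` {..<n} \<subseteq> cells (la n)" using rw_cl_cell n by auto
  qed
qed

text \<open>The rows get shorter downwards, so columns have no gaps. A witness in the first row is
  below \<open>q\<close> because the column of \<open>v\<close> has a cell below the first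
  row.\<close>

lemma cell_above:
  assumes "v < n" "q \<le> n" "i < rw v"
  shows "\<exists>u<q. rw u = i \<and> cl u = cl v"
proof -
  have "v < g" using assms(3) by (auto simp: rw_def split: if_splits)
  then obtain i' j where v: "i' < length \<nu>" "j < \<nu> ! i'" "rw v = Suc i'" "cl v = j" by (rule lower_cell)
  have jh: "j < h" using v nth_le_h[of i'] by simp
  show ?thesis
  proof (cases i)
    case 0
    then show ?thesis using jh v(4) by (intro exI[of _ "g + j"]) (simp add: q_def rw_def cl_def)
  next
    case (Suc i2)
    then have "i2 \<le> i'" using assms(3) v(3) by simp
    then have "i2 < length \<nu>" "j < \<nu> ! i2" using v nth_antimono[of i2 i'] by auto
    then show ?thesis using b_cell[of i2 j] Suc v(4) by (intro exI[of _ "b (i2, j)"]) (simp add: q_def)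
  qed
qed

lemma same_column_less_q:
  assumes "cl v = cl w" "v \<noteq> w"
  shows "v < q"
proof (cases "v < g")
  case False
  have "w < g"
  proof (rule ccontr)
    assume "\<not> w < g"
    then have "rw v = rw w" using False by (simp add: rw_def)
    then show False using rw_cl_inj assms by blast
  qed
  then obtain i j where w: "i < length \<nu>" "j < \<nu> ! i" "rw w = Suc i" "cl w = j" by (rule lower_cell)
  then have "cl v < h" using assms(1) nth_le_h[of i] by simp
  then show ?thesis using False by (simp add: q_def cl_def)
qed (simp add: q_def)

section \<open>Row group, column group and Specht polynomial\<close>

definition R :: "nat \<Rightarrow> (nat \<Rightarrow> nat) set"
  where "R n = {\<sigma>. \<sigma> permutes {..<n} \<and> (\<forall>v. rw (\<sigma> v) = rw v)}"

text \<open>A column-preserving permutation fixes all entries from \<open>q\<close> on, so this is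
  the column group of the tableau for every \<open>n \<ge> q\<close>.\<close>

definition C :: "(nat \<Rightarrow> nat) set"
  where "C = {\<sigma>. \<sigma> permutes {..<q} \<and> (\<forall>v. cl (\<sigma> v) = cl v)}"

definition pairs :: "(nat \<times> nat) set"
  where "pairs = {(u, v). u < q \<and> v < q \<and> cl u = cl v \<and> rw u < rw v}"

text \<open>The degree of the Specht polynomial: \<open>rw v\<close> is the number of cells above
  \<open>v\<close> in its column (\<open>card_pairs\<close>).\<close>

definition D :: nat where "D = (\<Sum>v<q. rw v)"

text \<open>The exponent of a variable is its row, so the stabilizer is the row group
  (\<open>mono_act_mt\<close>) and the monomial stands for the tabloid.\<close>

definition mt :: monomial where "mt = (\<Sum>v<q. sgl v (rw v))"

lemma rw_0: "q \<le> v \<Longrightarrow> rw v = 0"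
  by (simp add: rw_def q_def)

lemma lookup_mt: "lk mt v = rw v"
proof -
  have "lk mt v = (\<Sum>i<q. if i = v then rw i else 0)"
    unfolding mt_def lookup_sum by (rule sum.cong) (auto simp: lookup_single when_def)
  then show ?thesis by (cases "v < q") (simp_all add: rw_0)
qed

lemma mdegree_mt: "mdegree mt = D"
  by (simp add: mt_def D_def mdegree_sum)

lemma keys_mt: "ks mt \<subseteq> {..<q}"
proof
  fix x assume "x \<in> ks mt"
  then have "rw x \<noteq> 0" by (simp add: in_keys_iff lookup_mt)
  then show "x \<in> {..<q}" using rw_0[of x] by (cases "q \<le> x") simp_all
qed

lemma finite_pairs: "finite pairs"
  by (rule finite_subset[of _ "{..<q} \<times> {..<q}"]) (auto simp: pairs_def)

lemma card_pairs: "card pairs = D"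
proof -
  have "pairs = (\<lambda>(v, u). (u, v)) ` (SIGMA v:{..<q}. {u. u < q \<and> cl u = cl v \<and> rw u < rw v})"
    by (auto simp: pairs_def image_iff)
  moreover have "inj_on (\<lambda>(v, u). (u, v)) A" for A :: "(nat \<times> nat) set" by (auto intro: inj_onI)
  ultimately have "card pairs = card (SIGMA v:{..<q}. {u. u < q \<and> cl u = cl v \<and> rw u < rw v})"
    by (simp add: card_image)
  also have "\<dots> = (\<Sum>v<q. card {u. u < q \<and> cl u = cl v \<and> rw u < rw v})"
    by (rule card_SigmaI) auto
  also have "\<dots> = (\<Sum>v<q. rw v)"
  proof (rule sum.cong)
    fix v assume v: "v \<in> {..<q}"
    have "rw ` {u. u < q \<and> cl u = cl v \<and> rw u < rw v} = {..<rw v}"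
    proof (intro equalityI subsetI)
      fix i assume "i \<in> {..<rw v}"
      then obtain u where "u < q" "rw u = i" "cl u = cl v" using cell_above[of v q i] v by auto
      then show "i \<in> rw ` {u. u < q \<and> cl u = cl v \<and> rw u < rw v}" using \<open>i \<in> {..<rw v}\<close> by blast
    qed auto
    moreover have "inj_on rw {u. u < q \<and> cl u = cl v \<and> rw u < rw v}"
      by (rule inj_onI) (use rw_cl_inj in auto)
    ultimately show "card {u. u < q \<and> cl u = cl v \<and> rw u < rw v} = rw v"
      using card_image[of rw "{u. u < q \<and> cl u = cl v \<and> rw u < rw v}"] by simp
  qed simp
  finally show ?thesis by (simp add: D_def)
qed

definition \<Delta> :: "'k::field_char_0 polynomials"
  where "\<Delta> = (\<Prod>(u, v)\<in>pairs. var u - var v)"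

lemma \<Delta>_forms: "q \<le> n \<Longrightarrow> \<Delta> \<in> forms_in n D"
  unfolding \<Delta>_def card_pairs[symmetric] using finite_pairs
  by (intro prod_forms_in) (auto simp: pairs_def intro!: var_diff_forms_in[unfolded One_nat_def])

lemma \<Delta>_nonzero: "\<Delta> \<noteq> 0"
  unfolding \<Delta>_def using finite_pairs by (auto simp: pairs_def var_eq_iff)

lemma perm_act_\<Delta>: "perm_act \<sigma> \<Delta> = (\<Prod>(u, v)\<in>pairs. var (\<sigma> u) - var (\<sigma> v))"
  unfolding \<Delta>_def perm_act_prod by (rule prod.cong) (auto simp: perm_act_diff)

text \<open>The product of differences over ordered pairs is invariant under the column group and
  equals the square of \<Delta> up to sign. Hence an element of the column group maps \<Delta> to
  \<Delta> or to its negative.\<close>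

definition full :: "(nat \<times> nat) set"
  where "full = {(u, v). u < q \<and> v < q \<and> cl u = cl v \<and> u \<noteq> v}"

lemma prod_full: "(\<Prod>(u, v)\<in>full. f u - f v) = (-1) ^ card pairs * (\<Prod>(u, v)\<in>pairs. f u - f v)\<^sup>2"
  for f :: "nat \<Rightarrow> 'a::comm_ring_1"
proof -
  have full: "full = pairs \<union> prod.swap ` pairs"
  proof (intro equalityI subsetI)
    fix x assume x: "x \<in> full"
    then obtain u v where uv: "x = (u, v)" "u < q" "v < q" "cl u = cl v" "u \<noteq> v" by (auto simp: full_def)
    then have "rw u < rw v \<or> rw v < rw u" using rw_cl_inj[of u v] by linarith
    then show "x \<in> pairs \<union> prod.swap ` pairs" using uv by (auto simp: pairs_def image_iff)
  qed (auto simp: full_def pairs_def)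
  have "(\<Prod>(u, v)\<in>full. f u - f v) = (\<Prod>(u, v)\<in>pairs. f u - f v) * (\<Prod>(u, v)\<in>prod.swap ` pairs. f u - f v)"
    unfolding full using finite_pairs by (intro prod.union_disjoint) (auto simp: pairs_def)
  also have "(\<Prod>(u, v)\<in>prod.swap ` pairs. f u - f v) = (\<Prod>(u, v)\<in>pairs. - (f u - f v))"
    by (subst prod.reindex) (auto intro!: prod.cong)
  also have "\<dots> = (-1) ^ card pairs * (\<Prod>(u, v)\<in>pairs. f u - f v)"
    using prod_uminus[of "\<lambda>(u, v). f u - f v" pairs] by (simp add: case_prod_unfold)
  finally show ?thesis by (simp add: power2_eq_square mult_ac)
qed

lemma C_D: "\<sigma> \<in> C \<Longrightarrow> \<sigma> permutes {..<q} \<and> cl (\<sigma> v) = cl v"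
  by (simp add: C_def)

lemma perm_act_\<Delta>_cases:
  assumes "\<sigma> \<in> C"
  shows "perm_act \<sigma> \<Delta> = (\<Delta> :: 'k::field_char_0 polynomials) \<or> perm_act \<sigma> \<Delta> = - (\<Delta> :: 'k polynomials)"
proof -
  have perm: "\<sigma> permutes {..<q}" using C_D[OF assms] by blast
  have inj: "inj \<sigma>" by (rule permutes_inj[OF perm])
  have bij: "bij_betw (map_prod \<sigma> \<sigma>) full full"
    unfolding bij_betw_def
  proof
    show "inj_on (map_prod \<sigma> \<sigma>) full" using inj by (auto intro!: inj_onI simp: inj_eq)
    show "map_prod \<sigma> \<sigma> ` full = full"
    proof (intro equalityI subsetI)
      fix x assume "x \<in> map_prod \<sigma> \<sigma> ` full"
      then show "x \<in> full"
        using permutes_in_image[OF perm] C_D[OF assms] inj by (auto simp: full_def inj_eq)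
    next
      fix x assume "x \<in> full"
      then obtain u v where uv: "x = (u, v)" "u < q" "v < q" "cl u = cl v" "u \<noteq> v" by (auto simp: full_def)
      obtain u' v' where *: "u = \<sigma> u'" "v = \<sigma> v'" using permutes_surj[OF perm] by (metis surjD)
      then have "u' < q" "v' < q" "cl u' = cl v'" "u' \<noteq> v'"
        using uv permutes_in_image[OF perm] C_D[OF assms] by auto
      then show "x \<in> map_prod \<sigma> \<sigma> ` full" using uv(1) * by (force simp: full_def)
    qed
  qed
  let ?F = "\<lambda>(u, v). (var u - var v :: 'k polynomials)"
  have "(\<Prod>x\<in>full. ?F (map_prod \<sigma> \<sigma> x)) = (\<Prod>x\<in>full. ?F x)"
    by (rule prod.reindex_bij_betw[OF bij])
  moreover have "(\<Prod>x\<in>full. ?F (map_prod \<sigma> \<sigma> x)) = (\<Prod>(u, v)\<in>full. (var (\<sigma> u) - var (\<sigma> v)))"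
    by (rule prod.cong) auto
  moreover have "(-1) ^ card pairs * (perm_act \<sigma> \<Delta> :: 'k polynomials)\<^sup>2 = (\<Prod>(u, v)\<in>full. (var (\<sigma> u) - var (\<sigma> v)))"
    by (simp only: perm_act_\<Delta> prod_full[of "\<lambda>u. var (\<sigma> u)"])
  moreover have "(-1) ^ card pairs * (\<Delta> :: 'k polynomials)\<^sup>2 = (\<Prod>x\<in>full. ?F x)"
    by (simp only: \<Delta>_def prod_full[of var])
  ultimately have "(-1) ^ card pairs * (perm_act \<sigma> \<Delta> :: 'k polynomials)\<^sup>2 = (-1) ^ card pairs * \<Delta>\<^sup>2"
    by (simp only:)
  then have "(perm_act \<sigma> \<Delta> :: 'k polynomials)\<^sup>2 = \<Delta>\<^sup>2" by simp
  then show ?thesis by (simp add: power2_eq_iff)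
qed

text \<open>The sign, read off from the action on \<Delta>. In this form it is multiplicative
  because \<Delta> is not zero.\<close>

definition \<epsilon> :: "(nat \<Rightarrow> nat) \<Rightarrow> 'k::field_char_0"
  where "\<epsilon> \<sigma> = (if perm_act \<sigma> \<Delta> = (\<Delta> :: 'k polynomials) then 1 else - 1)"

lemma \<epsilon>_\<Delta>: "\<sigma> \<in> C \<Longrightarrow> perm_act \<sigma> \<Delta> = scalar_mult (\<epsilon> \<sigma>) \<Delta>"
  using perm_act_\<Delta>_cases[of \<sigma>] by (auto simp: \<epsilon>_def pv.scale_minus_left)

lemma \<epsilon>_square: "\<epsilon> \<sigma> * \<epsilon> \<sigma> = (1 :: 'k::field_char_0)"
  by (simp add: \<epsilon>_def)

lemma C_comp: "\<sigma> \<in> C \<Longrightarrow> \<tau> \<in> C \<Longrightarrow> \<sigma> \<circ> \<tau> \<in> C"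
  by (simp add: C_def permutes_compose)

lemma C_pinv: "\<sigma> \<in> C \<Longrightarrow> pinv \<sigma> \<in> C"
proof -
  assume s: "\<sigma> \<in> C"
  then have perm: "\<sigma> permutes {..<q}" by (simp add: C_def)
  have "cl (pinv \<sigma> v) = cl v" for v
    using C_D[OF s, of "pinv \<sigma> v"] by (simp add: permutes_inverses(1)[OF perm])
  then show ?thesis using permutes_inv[OF perm] by (simp add: C_def)
qed

lemma \<epsilon>_comp: "\<sigma> \<in> C \<Longrightarrow> \<tau> \<in> C \<Longrightarrow> \<epsilon> (\<sigma> \<circ> \<tau>) = (\<epsilon> \<sigma> * \<epsilon> \<tau> :: 'k::field_char_0)"
proof -
  assume s: "\<sigma> \<in> C" and t: "\<tau> \<in> C"
  have "scalar_mult (\<epsilon> (\<sigma> \<circ> \<tau>)) \<Delta> = perm_act \<sigma> (perm_act \<tau> (\<Delta> :: 'k polynomials))"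
    by (simp add: \<epsilon>_\<Delta>[OF C_comp[OF s t]] perm_act_comp)
  also have "\<dots> = scalar_mult (\<epsilon> \<sigma> * \<epsilon> \<tau>) \<Delta>"
    by (simp add: \<epsilon>_\<Delta>[OF s] \<epsilon>_\<Delta>[OF t] perm_act_scalar mult.commute)
  finally show ?thesis by (simp add: \<Delta>_nonzero)
qed

abbreviation \<kappa> :: "'k::field_char_0 polynomials \<Rightarrow> 'k polynomials"
  where "\<kappa> \<equiv> gsum C \<epsilon>"

lemma finite_C: "finite C"
  by (rule finite_subset[OF _ finite_perms[of q]]) (auto simp: C_def)

lemma id_C: "id \<in> C"
  by (simp add: C_def permutes_id)

lemma \<kappa>_\<Delta>: "\<kappa> \<Delta> = scalar_mult (of_nat (card C)) \<Delta>"
proof -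
  have "\<kappa> \<Delta> = (\<Sum>\<sigma>\<in>C. \<Delta> :: 'a polynomials)"
    unfolding gsum_def by (rule sum.cong) (simp_all add: \<epsilon>_\<Delta> \<epsilon>_square)
  then show ?thesis by (simp only: pv.sum_constant_scale)
qed

lemma \<kappa>_perm_act:
  assumes t: "\<tau> \<in> C"
  shows "\<kappa> (perm_act \<tau> x) = scalar_mult (\<epsilon> \<tau>) (\<kappa> x)"
proof -
  have bij: "bij \<tau>" using C_D[OF t] permutes_bij by blast
  have "scalar_mult (\<epsilon> \<sigma>) (perm_act \<sigma> (perm_act \<tau> x)) = scalar_mult (\<epsilon> \<tau>) (scalar_mult (\<epsilon> (\<sigma> \<circ> \<tau>)) (perm_act (\<sigma> \<circ> \<tau>) x))"
    if s: "\<sigma> \<in> C" for \<sigma>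
  proof -
    have "\<epsilon> \<tau> * \<epsilon> (\<sigma> \<circ> \<tau>) = (\<epsilon> \<tau> * \<epsilon> \<tau>) * (\<epsilon> \<sigma> :: 'a)" by (simp add: \<epsilon>_comp[OF s t])
    then show ?thesis by (simp add: perm_act_comp \<epsilon>_square)
  qed
  then have "\<kappa> (perm_act \<tau> x) = (\<Sum>\<sigma>\<in>C. scalar_mult (\<epsilon> \<tau>) (scalar_mult (\<epsilon> (\<sigma> \<circ> \<tau>)) (perm_act (\<sigma> \<circ> \<tau>) x)))"
    unfolding gsum_def by (intro sum.cong) simp_all
  also have "\<dots> = scalar_mult (\<epsilon> \<tau>) (\<Sum>\<sigma>\<in>C. scalar_mult (\<epsilon> (\<sigma> \<circ> \<tau>)) (perm_act (\<sigma> \<circ> \<tau>) x))"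
    by (rule pv.scale_sum_right[symmetric])
  also have "(\<Sum>\<sigma>\<in>C. scalar_mult (\<epsilon> (\<sigma> \<circ> \<tau>)) (perm_act (\<sigma> \<circ> \<tau>) x)) = \<kappa> x"
    unfolding gsum_def
  proof (rule sum.reindex_bij_witness[of _ "\<lambda>\<sigma>. \<sigma> \<circ> pinv \<tau>" "\<lambda>\<sigma>. \<sigma> \<circ> \<tau>"])
    fix \<sigma> assume "\<sigma> \<in> C"
    then show "\<sigma> \<circ> \<tau> \<in> C" "\<sigma> \<circ> pinv \<tau> \<in> C" using C_comp C_pinv t by blast+
    show "\<sigma> \<circ> \<tau> \<circ> pinv \<tau> = \<sigma>" "\<sigma> \<circ> pinv \<tau> \<circ> \<tau> = \<sigma>"
      using bij by (auto simp: fun_eq_iff bij_is_surj surj_f_inv_f bij_is_inj)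
  qed simp
  finally show ?thesis .
qed

text \<open>
  The sign of a transposition is found by identifying the two variables in the product of the
  remaining factors of \<open>\<Delta>\<close>.
\<close>

lemma \<epsilon>_transpose:
  assumes ab: "a < q" "b' < q" "cl a = cl b'" "rw a < rw b'"
  shows "\<epsilon> (Transposition.transpose a b') = (- 1 :: 'k::field_char_0)"
proof (rule ccontr)
  let ?\<tau> = "Transposition.transpose a b'"
  assume "\<not> ?thesis"
  then have eq: "perm_act ?\<tau> \<Delta> = (\<Delta> :: 'k polynomials)" by (auto simp: \<epsilon>_def split: if_splits)
  have ne: "a \<noteq> b'" using ab(4) by auto
  have ab_in: "(a, b') \<in> pairs" using ab by (simp add: pairs_def)
  define \<Delta>' where "\<Delta>' = (\<Prod>(u, v)\<in>pairs - {(a, b')}. var u - var v :: 'k polynomials)"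
  have "\<Delta> = (var a - var b') * \<Delta>'"
    unfolding \<Delta>_def \<Delta>'_def using prod.remove[OF finite_pairs ab_in, of "\<lambda>(u, v). var u - var v"] by simp
  then have "(var b' - var a) * perm_act ?\<tau> \<Delta>' = (var a - var b') * \<Delta>'"
    using eq by (simp add: perm_act_mult perm_act_diff)
  then have "(var a - var b') * (\<Delta>' + perm_act ?\<tau> \<Delta>') = 0" by (simp add: algebra_simps)
  moreover have "(var a - var b' :: 'k polynomials) \<noteq> 0" using ne by (simp add: var_eq_iff)
  ultimately have neg: "\<Delta>' + perm_act ?\<tau> \<Delta>' = 0" by (simp only: mult_eq_0_iff simp_thms)
  define s where "s x = (if x = b' then a else x)" for x
  have "s \<circ> ?\<tau> = s" by (auto simp: fun_eq_iff Transposition.transpose_def s_def)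
  then have "perm_act s \<Delta>' + perm_act s \<Delta>' = 0"
    using arg_cong[OF neg, of "perm_act s"] by (simp add: perm_act_add perm_act_comp)
  then have "scalar_mult 2 (perm_act s \<Delta>') = 0"
    using pv.scale_left_distrib[of 1 1 "perm_act s \<Delta>'"] by simp
  then have "perm_act s \<Delta>' = 0" by simp
  moreover have "perm_act s \<Delta>' = (\<Prod>(u, v)\<in>pairs - {(a, b')}. var (s u) - var (s v))"
    unfolding \<Delta>'_def perm_act_prod by (rule prod.cong) (auto simp: perm_act_diff)
  ultimately have "\<exists>x\<in>pairs - {(a, b')}. (case x of (u, v) \<Rightarrow> (var (s u) - var (s v) :: 'k polynomials)) = 0"
    using finite_pairs by simp
  then obtain x where x: "x \<in> pairs - {(a, b')}" "(case x of (u, v) \<Rightarrow> (var (s u) - var (s v) :: 'k polynomials)) = 0"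
    by (rule bexE)
  obtain u v where uv: "x = (u, v)" by (cases x)
  have "s u = s v" using x(2) by (simp add: uv var_eq_iff)
  then show False using x(1) uv ab(4) by (auto simp: pairs_def s_def split: if_splits)
qed

text \<open>The transposition of \<open>v\<close> and \<open>w\<close> fixes \<open>m\<close> and
  has sign \<open>-1\<close>, so \<open>\<kappa> (mon m)\<close> is its own negative.\<close>

lemma \<kappa>_mon_zero:
  assumes vw: "cl v = cl w" "v \<noteq> w" "lk m v = lk m w"
  shows "\<kappa> (mon m) = (0 :: 'k::field_char_0 polynomials)"
proof -
  have "rw v < rw w \<or> rw w < rw v" using rw_cl_inj vw(1,2) by (metis linorder_neqE_nat)
  then obtain a b' where ab: "cl a = cl b'" "a \<noteq> b'" "lk m a = lk m b'" "rw a < rw b'"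
    using vw by metis
  let ?\<tau> = "Transposition.transpose a b'"
  have q: "a < q" "b' < q" using same_column_less_q[of a b'] same_column_less_q[of b' a] ab by auto
  have "?\<tau> permutes {..<q}" using q by (intro permutes_swap_id) auto
  then have C: "?\<tau> \<in> C" using ab(1) by (auto simp: C_def Transposition.transpose_def)
  have inj: "inj ?\<tau>" by simp
  have "mono_act ?\<tau> m = m"
  proof (rule poly_mapping_eqI)
    fix i
    have "lk (mono_act ?\<tau> m) (?\<tau> (?\<tau> i)) = lk m (?\<tau> i)" by (rule lookup_mono_act_inj[OF inj])
    then show "lk (mono_act ?\<tau> m) i = lk m i" using ab(3) by (auto simp: Transposition.transpose_def split: if_splits)
  qed
  then have "\<kappa> (mon m) = \<kappa> (perm_act ?\<tau> (mon m :: 'k polynomials))" by (simp add: perm_act_mon)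
  also have "\<dots> = - \<kappa> (mon m)" by (simp add: \<kappa>_perm_act[OF C] \<epsilon>_transpose[OF q ab(1,4)] pv.scale_minus_left)
  finally have "scalar_mult 2 (\<kappa> (mon m)) = (0 :: 'k polynomials)"
    using pv.scale_left_distrib[of 1 1 "\<kappa> (mon m) :: 'k polynomials"] by simp
  then show ?thesis by simp
qed

text \<open>Distinct exponents in a column add up to at least the sum of its row numbers. The total
  degree \<open>D\<close> leaves no slack, so each column carries exactly its row numbers in some
  order, and \<pi> sorts them.\<close>

lemma ex_C_mono_act:
  assumes n: "q \<le> n" and m: "ks m \<subseteq> {..<n}" "mdegree m = D"
    and inj: "\<And>v w. cl v = cl w \<Longrightarrow> v \<noteq> w \<Longrightarrow> lk m v \<noteq> lk m w"
  shows "\<exists>\<pi>\<in>C. mono_act \<pi> mt = m"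
proof -
  define A where "A j = {v. v < n \<and> cl v = j}" for j
  have finA: "finite (A j)" for j by (simp add: A_def)
  have injm: "inj_on (lk m) (A j)" for j
  proof (rule inj_onI)
    fix v w assume "v \<in> A j" "w \<in> A j" "lk m v = lk m w"
    then show "v = w" using inj[of v w] by (auto simp: A_def)
  qed
  have injr: "inj_on rw (A j)" for j by (rule inj_onI) (use rw_cl_inj in \<open>auto simp: A_def\<close>)
  have rwA: "rw ` A j = {..<card (A j)}" for j
  proof -
    have "\<exists>l. rw ` A j = {..<l}"
    proof (cases "A j = {}")
      case True
      then show ?thesis by (intro exI[of _ 0]) simp
    next
      case False
      then have M: "Max (rw ` A j) \<in> rw ` A j" using finA by (intro Max_in) auto
      then obtain v where v: "v \<in> A j" "rw v = Max (rw ` A j)" by auto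
      have "rw ` A j = {..<Suc (rw v)}"
      proof (intro equalityI subsetI)
        fix i assume "i \<in> rw ` A j"
        then have "i \<le> rw v" unfolding v(2) using finA by (intro Max_ge) auto
        then show "i \<in> {..<Suc (rw v)}" by simp
      next
        fix i assume "i \<in> {..<Suc (rw v)}"
        then have "i = rw v \<or> i < rw v" by auto
        then show "i \<in> rw ` A j"
        proof
          assume "i < rw v"
          then obtain u where "u < q" "rw u = i" "cl u = cl v" using cell_above[of v n i] v(1) n by (auto simp: A_def)
          then show ?thesis using v(1) n by (intro image_eqI[of _ _ u]) (auto simp: A_def)
        qed (use v(1) in blast)
      qed
      then show ?thesis by blast
    qed
    then obtain l where l: "rw ` A j = {..<l}" by blast
    then have "card (A j) = l" using card_image[OF injr, of j] by simp
    with l show ?thesis by simp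
  qed
  have sum_m: "\<Sum>{..<card (A j)} \<le> (\<Sum>v\<in>A j. lk m v)"
    and eq_m: "(\<Sum>v\<in>A j. lk m v) = \<Sum>{..<card (A j)} \<Longrightarrow> lk m ` A j = {..<card (A j)}" for j
    using sum_ge_sum_lessThan[of "lk m ` A j"] finA[of j] card_image[OF injm, of j] sum.reindex[OF injm, of "\<lambda>x. x" j]
    by auto
  have sum_r: "(\<Sum>v\<in>A j. rw v) = \<Sum>{..<card (A j)}" for j
    using sum.reindex[OF injr, of "\<lambda>x. x" j] by (simp add: rwA)
  \<comment> \<open>Any bound on the column numbers would do; it makes the grouping by columns a
    finite sum.\<close>
  have cl_le: "cl v < n + g" if "v < n" for v
  proof (cases "v < g")
    case True
    then obtain i j where "i < length \<nu>" "j < \<nu> ! i" "cl v = j" by (rule lower_cell)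
    then show ?thesis using nth_le_h[of i] n by (simp add: q_def)
  qed (use that in \<open>simp add: cl_def\<close>)
  have group: "(\<Sum>v<n. f v) = (\<Sum>j<n + g. \<Sum>v\<in>A j. f v)" for f :: "nat \<Rightarrow> nat"
  proof -
    have "(\<Sum>j<n + g. \<Sum>v\<in>{v \<in> {..<n}. cl v = j}. f v) = (\<Sum>v<n. f v)"
      by (rule sum.group) (use cl_le in auto)
    then show ?thesis by (simp add: A_def)
  qed
  have "(\<Sum>v<n. lk m v) = D" using m mdegree_superset[of "{..<n}" m] by simp
  moreover have "(\<Sum>v<n. rw v) = D"
    unfolding D_def by (rule sum.mono_neutral_right) (use n rw_0 in auto)
  ultimately have tot: "(\<Sum>j<n + g. \<Sum>v\<in>A j. lk m v) = (\<Sum>j<n + g. \<Sum>{..<card (A j)})"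
    by (simp add: group[symmetric] sum_r[symmetric])
  have eq: "(\<Sum>v\<in>A j. lk m v) = \<Sum>{..<card (A j)}" if "j < n + g" for j
  proof (rule ccontr)
    assume "(\<Sum>v\<in>A j. lk m v) \<noteq> \<Sum>{..<card (A j)}"
    then have "\<Sum>{..<card (A j)} < (\<Sum>v\<in>A j. lk m v)" using sum_m[of j] by simp
    then have "(\<Sum>j<n + g. \<Sum>{..<card (A j)}) < (\<Sum>j<n + g. \<Sum>v\<in>A j. lk m v)"
      using that sum_m by (intro sum_strict_mono_ex1) auto
    then show False using tot by simp
  qed
  have ex: "\<exists>w. w < n \<and> cl w = cl v \<and> lk m w = rw v" if "v < n" for v
  proof -
    have "rw v \<in> rw ` A (cl v)" using that by (auto simp: A_def)
    then have "rw v \<in> lk m ` A (cl v)" using eq_m[OF eq[OF cl_le[OF that]]] rwA by simp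
    then show ?thesis by (auto simp: A_def)
  qed
  define \<pi> where "\<pi> v = (if v < n then SOME w. w < n \<and> cl w = cl v \<and> lk m w = rw v else v)" for v
  have \<pi>: "\<pi> v < n \<and> cl (\<pi> v) = cl v \<and> lk m (\<pi> v) = rw v" if "v < n" for v
    using someI_ex[OF ex[OF that]] that by (simp add: \<pi>_def)
  have \<pi>_inj: "inj_on \<pi> {..<n}"
    by (rule inj_onI) (metis \<pi> lessThan_iff rw_cl_inj)
  have "\<pi> ` {..<n} = {..<n}"
    by (rule endo_inj_surj) (use \<pi> \<pi>_inj in auto)
  with \<pi>_inj have "\<pi> permutes {..<n}"
    by (intro bij_imp_permutes) (auto simp: bij_betw_def \<pi>_def)
  moreover have cl_\<pi>: "cl (\<pi> v) = cl v" for v using \<pi>[of v] by (cases "v < n") (simp_all add: \<pi>_def)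
  \<comment> \<open>An entry from \<open>q\<close> on is alone in its column, so \<pi> cannot move
    it.\<close>
  moreover have "\<pi> v = v" if "v \<in> {..<n} - {..<q}" for v
    using same_column_less_q[of v "\<pi> v"] cl_\<pi>[of v] that by fastforce
  ultimately have perm: "\<pi> permutes {..<n}" "\<pi> permutes {..<q}" by - (assumption, rule permutes_superset)
  have "mono_act \<pi> mt = m"
  proof (rule poly_mapping_eqI)
    fix i
    obtain v where v: "i = \<pi> v" using permutes_surj[OF perm(1)] by (metis surjD)
    have "lk (mono_act \<pi> mt) (\<pi> v) = rw v"
      by (simp add: lookup_mono_act_inj[OF permutes_inj[OF perm(1)]] lookup_mt)
    moreover have "lk m (\<pi> v) = rw v"
    proof (cases "v < n")
      case False
      then have "\<pi> v = v" "v \<notin> ks m" using m(1) by (auto simp: \<pi>_def)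
      then show ?thesis using False n by (simp add: in_keys_iff rw_0)
    qed (use \<pi> in simp)
    ultimately show "lk (mono_act \<pi> mt) i = lk m i" by (simp add: v)
  qed
  moreover have "\<pi> \<in> C" using perm(2) cl_\<pi> by (simp add: C_def)
  ultimately show ?thesis by blast
qed

text \<open>Reduce to monomials: if two exponents in a column agree, \<kappa> gives
  \<open>0\<close>, and otherwise the monomial is a translate of \<open>mt\<close> by the column
  group, which changes the result only by a sign.\<close>

lemma \<kappa>_form:
  assumes n: "q \<le> n" and p: "p \<in> forms_in n D"
  shows "\<exists>c. \<kappa> p = scalar_mult c (\<kappa> (mon mt) :: 'k::field_char_0 polynomials)"
proof -
  let ?X = "{p. \<exists>c. \<kappa> p = scalar_mult c (\<kappa> (mon mt) :: 'k polynomials)}"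
  have "pv.subspace ?X"
  proof (rule pv.subspaceI)
    show "0 \<in> ?X" by (auto intro: exI[of _ 0])
  next
    fix x y assume "x \<in> ?X" "y \<in> ?X"
    then obtain c d where "\<kappa> x = scalar_mult c (\<kappa> (mon mt))" "\<kappa> y = scalar_mult d (\<kappa> (mon mt))" by blast
    then have "\<kappa> (x + y) = scalar_mult (c + d) (\<kappa> (mon mt))" by (simp add: gsum_add pv.scale_left_distrib)
    then show "x + y \<in> ?X" by blast
  next
    fix a x assume "x \<in> ?X"
    then obtain c where "\<kappa> x = scalar_mult c (\<kappa> (mon mt))" by blast
    then have "\<kappa> (scalar_mult a x) = scalar_mult (a * c) (\<kappa> (mon mt))" by (simp add: gsum_scalar)
    then show "scalar_mult a x \<in> ?X" by blast
  qed
  then have "p \<in> ?X"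
  proof (rule poly_in_subspace)
    fix m assume "m \<in> ks p"
    then have m: "ks m \<subseteq> {..<n}" "mdegree m = D" using p by (auto simp: forms_in_def keys_within_def)
    have "mon m \<in> ?X"
    proof (cases "\<exists>v w. cl v = cl w \<and> v \<noteq> w \<and> lk m v = lk m w")
      case True
      then have "\<kappa> (mon m) = (0 :: 'k polynomials)" using \<kappa>_mon_zero by blast
      then show ?thesis by (auto intro: exI[of _ 0])
    next
      case False
      then obtain \<pi> where \<pi>: "\<pi> \<in> C" "mono_act \<pi> mt = m" using ex_C_mono_act[OF n m] by blast
      have "\<kappa> (mon m) = scalar_mult (\<epsilon> \<pi>) (\<kappa> (mon mt) :: 'k polynomials)"
        using \<kappa>_perm_act[OF \<pi>(1), of "mon mt"] by (simp add: perm_act_mon \<pi>(2))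
      then show ?thesis by blast
    qed
    then show "sgl m 1 \<in> ?X" by (simp add: mon_def)
  qed
  then show ?thesis by blast
qed

text \<open>\<open>\<kappa> \<Delta>\<close> is a multiple of \<open>\<kappa> (mon mt)\<close>, and
  it is also \<Delta> times the order of the column group.\<close>

lemma \<Delta>_eq: "\<exists>c. c \<noteq> 0 \<and> \<Delta> = scalar_mult c (\<kappa> (mon mt) :: 'k::field_char_0 polynomials)"
proof -
  obtain c where "\<kappa> \<Delta> = scalar_mult c (\<kappa> (mon mt) :: 'k polynomials)" using \<kappa>_form[OF order_refl \<Delta>_forms[OF order_refl]] by blast
  then have "scalar_mult (of_nat (card C)) \<Delta> = scalar_mult c (\<kappa> (mon mt) :: 'k polynomials)" by (simp add: \<kappa>_\<Delta>)
  moreover define N where "N = (of_nat (card C) :: 'k)"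
  moreover have N: "N \<noteq> 0" using finite_C id_C by (auto simp: N_def)
  ultimately have "scalar_mult (1 / N) (scalar_mult N \<Delta>) = scalar_mult (1 / N) (scalar_mult c (\<kappa> (mon mt) :: 'k polynomials))"
    by (simp only:)
  then have "\<Delta> = scalar_mult (c / N) (\<kappa> (mon mt) :: 'k polynomials)" using N by simp
  moreover from this have "c / N \<noteq> 0" using \<Delta>_nonzero by force
  ultimately show ?thesis by blast
qed

lemma mono_act_mt:
  assumes "\<sigma> permutes {..<n}"
  shows "mono_act \<sigma> mt = mt \<longleftrightarrow> \<sigma> \<in> R n"
proof
  have inj: "inj \<sigma>" by (rule permutes_inj[OF assms])
  { assume "mono_act \<sigma> mt = mt"
    then have "rw (\<sigma> v) = rw v" for v using lookup_mono_act_inj[OF inj, of mt v] by (simp add: lookup_mt)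
    then show "\<sigma> \<in> R n" using assms by (simp add: R_def) }
  assume R: "\<sigma> \<in> R n"
  show "mono_act \<sigma> mt = mt"
  proof (rule poly_mapping_eqI)
    fix i
    obtain v where "i = \<sigma> v" using permutes_surj[OF assms] by (metis surjD)
    then show "lk (mono_act \<sigma> mt) i = lk mt i"
      using R lookup_mono_act_inj[OF inj, of mt v] by (simp add: lookup_mt R_def)
  qed
qed

lemma R_group: "id \<in> R n" "\<And>\<sigma> \<tau>. \<sigma> \<in> R n \<Longrightarrow> \<tau> \<in> R n \<Longrightarrow> \<sigma> \<circ> \<tau> \<in> R n" "\<And>\<sigma>. \<sigma> \<in> R n \<Longrightarrow> pinv \<sigma> \<in> R n"
proof -
  show "id \<in> R n" by (simp add: R_def permutes_id)
  show "\<sigma> \<circ> \<tau> \<in> R n" if "\<sigma> \<in> R n" "\<tau> \<in> R n" for \<sigma> \<tau> using that by (simp add: R_def permutes_compose)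
  show "pinv \<sigma> \<in> R n" if "\<sigma> \<in> R n" for \<sigma>
  proof -
    have perm: "\<sigma> permutes {..<n}" and rw: "\<And>v. rw (\<sigma> v) = rw v" using that by (simp_all add: R_def)
    have "rw (pinv \<sigma> v) = rw v" for v using rw[of "pinv \<sigma> v"] by (simp add: permutes_inverses(1)[OF perm])
    then show ?thesis using permutes_inv[OF perm] by (simp add: R_def)
  qed
qed

abbreviation \<rho> :: "nat \<Rightarrow> 'k::field_char_0 polynomials \<Rightarrow> 'k polynomials"
  where "\<rho> n \<equiv> gsum (R n) (\<lambda>_. 1)"

lemma finite_R: "finite (R n)"
  by (rule finite_subset[OF _ finite_perms[of n]]) (auto simp: R_def)

text \<open>\<open>mt\<close> arises from \<open>\<sigma> \<circ> \<pi>\<close> only if this lies in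
  the row group. Then \<pi> preserves rows as well as columns, so it is the identity. The
  coefficient of \<open>mt\<close> is therefore the order of the row group, up to the factor from
  \<open>\<Delta>_eq\<close>.\<close>

lemma \<rho>_\<Delta>_nonzero:
  assumes n: "q \<le> n"
  shows "\<rho> n \<Delta> \<noteq> (0 :: 'k::field_char_0 polynomials)"
proof -
  have C_n: "\<pi> permutes {..<n}" if "\<pi> \<in> C" for \<pi> using that n by (auto simp: C_def intro: permutes_mono)
  have "lk (\<rho> n (\<kappa> (mon mt)) :: 'k polynomials) mt = (\<Sum>\<sigma>\<in>R n. \<Sum>\<pi>\<in>C. if \<pi> = id then \<epsilon> id else 0)"
    unfolding gsum_def perm_act_sum lookup_sum pv.scale_one
  proof (intro sum.cong refl)
    fix \<sigma> \<pi> assume s: "\<sigma> \<in> R n" and p: "\<pi> \<in> C"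
    have sn: "\<sigma> permutes {..<n}" using s by (simp add: R_def)
    have "mono_act (\<sigma> \<circ> \<pi>) mt = mt \<longleftrightarrow> \<pi> = id"
    proof
      assume "mono_act (\<sigma> \<circ> \<pi>) mt = mt"
      then have "\<sigma> \<circ> \<pi> \<in> R n" using mono_act_mt[OF permutes_compose[OF C_n[OF p] sn]] by simp
      then have "rw (\<pi> v) = rw v" for v using s by (simp add: R_def)
      then have "\<pi> v = v" for v using rw_cl_inj[of "\<pi> v" v] C_D[OF p] by simp
      then show "\<pi> = id" by (simp add: fun_eq_iff)
    next
      assume "\<pi> = id"
      then show "mono_act (\<sigma> \<circ> \<pi>) mt = mt" using mono_act_mt[OF sn] s by simp
    qed
    then show "lk (perm_act \<sigma> (scalar_mult (\<epsilon> \<pi>) (perm_act \<pi> (mon mt)))) mt = (if \<pi> = id then \<epsilon> id else 0 :: 'k)"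
      by (simp add: perm_act_scalar perm_act_mon mono_act_comp) (auto simp: mon_def lookup_single when_def)
  qed
  also have "\<dots> = of_nat (card (R n)) * \<epsilon> id" using finite_C id_C by simp
  also have "\<dots> \<noteq> (0 :: 'k)" using finite_R R_group(1) by (auto simp: \<epsilon>_def)
  finally have ne: "\<rho> n (\<kappa> (mon mt)) \<noteq> (0 :: 'k polynomials)" by auto
  obtain c where "c \<noteq> 0" "\<Delta> = scalar_mult c (\<kappa> (mon mt) :: 'k polynomials)" using \<Delta>_eq by blast
  then show ?thesis using ne by (simp add: gsum_scalar)
qed

lemma specht_setting: "q \<le> n \<Longrightarrow> specht_setting n D (R n) C (\<epsilon> :: _ \<Rightarrow> 'k::field_char_0) \<Delta> mt (of_nat (card C))"
proof -
  assume n: "q \<le> n"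
  show ?thesis
  proof
    show "\<sigma> permutes {..<n}" if "\<sigma> \<in> R n" for \<sigma> using that by (simp add: R_def)
    show "\<sigma> permutes {..<n}" if "\<sigma> \<in> C" for \<sigma> using that n by (auto simp: C_def intro: permutes_mono)
    show "mon mt \<in> (forms_in n D :: 'k polynomials set)"
      using keys_mt n by (auto simp: forms_in_def keys_within_mon mdegree_mt)
    show "\<Delta> \<in> (forms_in n D :: 'k polynomials set)" by (rule \<Delta>_forms[OF n])
    show "\<exists>c. \<kappa> p = scalar_mult c \<Delta>" if p: "p \<in> forms_in n D" for p :: "'k polynomials"
    proof -
      obtain c where c: "\<kappa> p = scalar_mult c (\<kappa> (mon mt))" using \<kappa>_form[OF n p] by blast
      obtain d where d: "d \<noteq> 0" "\<Delta> = scalar_mult d (\<kappa> (mon mt) :: 'k polynomials)" using \<Delta>_eq by blast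
      have "\<kappa> p = scalar_mult (c / d) \<Delta>" using d by (simp add: c)
      then show ?thesis by blast
    qed
    show "\<kappa> \<Delta> = scalar_mult (of_nat (card C)) (\<Delta> :: 'k polynomials)" by (rule \<kappa>_\<Delta>)
    show "(of_nat (card C) :: 'k) \<noteq> 0" using finite_C id_C by auto
    show "\<rho> n \<Delta> \<noteq> (0 :: 'k polynomials)" by (rule \<rho>_\<Delta>_nonzero[OF n])
  qed (use R_group mono_act_mt in auto)
qed

section \<open>Identification with the Specht module\<close>

lemma specht_poly_eq:
  assumes n: "q \<le> n" and \<sigma>: "\<And>x. x \<in> cells (la n) \<Longrightarrow> t x = \<sigma> (T x)"
  shows "specht_poly (la n) t = (perm_act \<sigma> \<Delta> :: 'k::field_char_0 polynomials)"
proof -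
  have gn: "g \<le> n" using n by (simp add: q_def)
  let ?I = "{(i, i', j). i < i' \<and> (i, j) \<in> cells (la n) \<and> (i', j) \<in> cells (la n)}"
  show ?thesis
    unfolding specht_poly_def perm_act_\<Delta>
  proof (rule prod.reindex_bij_witness[of _ "\<lambda>(u, v). (rw u, rw v, cl u)" "\<lambda>(i, i', j). (T (i, j), T (i', j))"])
    fix a assume "a \<in> ?I"
    then obtain i i' j where a: "a = (i, i', j)" "i < i'" "(i, j) \<in> cells (la n)" "(i', j) \<in> cells (la n)" by blast
    note c = T_cell[OF a(3) gn] T_cell[OF a(4) gn]
    have "T (i, j) \<noteq> T (i', j)"
    proof
      assume "T (i, j) = T (i', j)"
      then show False using c(2) c(5) a(2) by simp
    qed
    then have "T (i, j) < q" "T (i', j) < q"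
      using same_column_less_q[of "T (i, j)" "T (i', j)"] same_column_less_q[of "T (i', j)" "T (i, j)"] c(3,6) by simp_all
    then show "(case a of (i, i', j) \<Rightarrow> (T (i, j), T (i', j))) \<in> pairs" using c a by (simp add: pairs_def)
    show "(case case a of (i, i', j) \<Rightarrow> (T (i, j), T (i', j)) of (u, v) \<Rightarrow> (rw u, rw v, cl u)) = a"
      using c a by simp
    show "(case case a of (i, i', j) \<Rightarrow> (T (i, j), T (i', j)) of (u, v) \<Rightarrow> var (\<sigma> u) - var (\<sigma> v))
        = (case a of (i, i', j) \<Rightarrow> (var (t (i, j)) - var (t (i', j)) :: 'k polynomials))"
      using a \<sigma> by simp
  next
    fix x assume "x \<in> pairs"
    then obtain u v where x: "x = (u, v)" "u < q" "v < q" "cl u = cl v" "rw u < rw v" by (auto simp: pairs_def)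
    then show "(case case x of (u, v) \<Rightarrow> (rw u, rw v, cl u) of (i, i', j) \<Rightarrow> (T (i, j), T (i', j))) = x"
      using T_rw_cl[of u] T_rw_cl[of v] by simp
    have "(rw u, cl u) \<in> cells (la n)" "(rw v, cl v) \<in> cells (la n)"
      using rw_cl_cell[of u n] rw_cl_cell[of v n] x(2,3) n gn by simp_all
    then show "(case x of (u, v) \<Rightarrow> (rw u, rw v, cl u)) \<in> ?I" using x by simp
  qed
qed

lemma specht_module_eq:
  assumes n: "q \<le> n"
  shows "specht_module (la n) n = poly_rep (pv.span {perm_act \<sigma> \<Delta> | \<sigma>. \<sigma> permutes {..<n}} :: 'k::field_char_0 polynomials set)"
proof -
  have gn: "g \<le> n" using n by (simp add: q_def)
  have "{specht_poly (la n) t | t. bij_betw t (cells (la n)) {..<n}} = ({perm_act \<sigma> \<Delta> | \<sigma>. \<sigma> permutes {..<n}} :: 'k polynomials set)"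
  proof (intro equalityI subsetI)
    fix p :: "'k polynomials" assume "p \<in> {specht_poly (la n) t | t. bij_betw t (cells (la n)) {..<n}}"
    then obtain t where t: "p = specht_poly (la n) t" "bij_betw t (cells (la n)) {..<n}" by blast
    define \<sigma> where "\<sigma> v = (if v < n then t (rw v, cl v) else v)" for v
    have inv: "bij_betw (\<lambda>v. (rw v, cl v)) {..<n} (cells (la n))"
    proof (rule bij_betw_byWitness[where f' = T])
      show "\<forall>a'\<in>cells (la n). (rw (T a'), cl (T a')) = a'" using T_cell gn by auto
      show "\<forall>a\<in>{..<n}. T (rw a, cl a) = a" by (simp add: T_rw_cl)
      show "T ` cells (la n) \<subseteq> {..<n}" using T_cell(1) gn by auto
      show "(\<lambda>v. (rw v, cl v)) ` {..<n} \<subseteq> cells (la n)" using rw_cl_cell gn by auto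
    qed
    have "bij_betw (t \<circ> (\<lambda>v. (rw v, cl v))) {..<n} {..<n}" by (rule bij_betw_trans[OF inv t(2)])
    then have "bij_betw \<sigma> {..<n} {..<n}"
      by (rule bij_betw_cong[THEN iffD1, rotated]) (simp add: \<sigma>_def)
    then have perm: "\<sigma> permutes {..<n}" by (rule bij_imp_permutes) (simp add: \<sigma>_def)
    have "t x = \<sigma> (T x)" if "x \<in> cells (la n)" for x
      using that T_cell[of "fst x" "snd x" n] gn by (simp add: \<sigma>_def)
    then have "p = perm_act \<sigma> \<Delta>" unfolding t(1) by (rule specht_poly_eq[OF n])
    then show "p \<in> {perm_act \<sigma> \<Delta> | \<sigma>. \<sigma> permutes {..<n}}" using perm by blast
  next
    fix p :: "'k polynomials" assume "p \<in> {perm_act \<sigma> \<Delta> | \<sigma>. \<sigma> permutes {..<n}}"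
    then obtain \<sigma> where \<sigma>: "p = perm_act \<sigma> \<Delta>" "\<sigma> permutes {..<n}" by blast
    have "p = specht_poly (la n) (\<sigma> \<circ> T)" unfolding \<sigma>(1) by (rule specht_poly_eq[OF n, symmetric]) simp
    moreover have "bij_betw (\<sigma> \<circ> T) (cells (la n)) {..<n}"
      using bij_T[OF gn] permutes_imp_bij[OF \<sigma>(2)] by (rule bij_betw_trans)
    ultimately show "p \<in> {specht_poly (la n) t | t. bij_betw t (cells (la n)) {..<n}}" by blast
  qed
  then show ?thesis by (simp add: specht_module_def poly_rep_def)
qed

theorem multiplicity_specht:
  fixes I :: "'k::field_char_0 polynomials set"
  assumes "q \<le> n" "poly_ideal I" "symmetric_ideal I"
  shows "multiplicity_of n (specht_module (la n) n) (quotient_piece I n d)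
    = pv.rdim {p. \<rho> n p \<in> I} (\<kappa> ` forms_in n d)"
proof -
  interpret s: specht_setting n D "R n" C "\<epsilon> :: _ \<Rightarrow> 'k" \<Delta> mt "of_nat (card C)"
    by (rule specht_setting[OF assms(1)])
  show ?thesis
    using s.multiplicity_quotient_piece[OF assms(2,3)] by (simp add: specht_module_eq[OF assms(1)] s.S_def)
qed

end

section \<open>Stabilization of the multiplicities\<close>

text \<open>At most \<open>mdegree m\<close> variables of \<open>m\<close> lie beyond the first
  \<open>q\<close>, and they can be moved next to these. So \<open>q + d\<close> variables suffice
  in degree \<open>d\<close>.\<close>

lemma ex_mono_act_pack:
  assumes "ks m \<subseteq> {..<n}" "q + mdegree m \<le> n"
  shows "\<exists>\<sigma>. \<sigma> permutes {q..<n} \<and> ks (mono_act \<sigma> m) \<subseteq> {..<q + mdegree m}"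
proof -
  let ?K = "ks m - {..<q}"
  have "card ?K \<le> card (ks m)" by (rule card_mono) auto
  then have cK: "card ?K \<le> mdegree m" using card_keys_le_mdegree by (rule order_trans)
  obtain h0 where h0: "bij_betw h0 ?K {q..<q + card ?K}"
    using finite_same_card_bij[of ?K "{q..<q + card ?K}"] by auto
  define h where "h x = (if x < q then x else h0 x)" for x
  have h0_in: "q \<le> h0 x \<and> h0 x < q + card ?K" if "x \<in> ?K" for x
    using bspec[OF bij_betwE[OF h0] that] unfolding atLeastLessThan_iff .
  have inj0: "inj_on h0 ?K" using h0 by (simp add: bij_betw_def)
  have "inj_on h ({..<q} \<union> ?K)"
  proof (rule inj_onI)
    fix x y assume "x \<in> {..<q} \<union> ?K" "y \<in> {..<q} \<union> ?K" "h x = h y"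
    then show "x = y" using h0_in[of x] h0_in[of y] inj_onD[OF inj0, of x y]
      by (cases "x < q"; cases "y < q") (simp_all add: h_def)
  qed
  moreover have hb: "h x < q + mdegree m" if "x \<in> {..<q} \<union> ?K" for x
    using that h0_in[of x] cK by (auto simp: h_def)
  have "({..<q} \<union> ?K) \<union> h ` ({..<q} \<union> ?K) \<subseteq> {..<n}"
  proof (intro Un_least image_subsetI)
    show "{..<q} \<subseteq> {..<n}" using assms(2) by auto
    show "?K \<subseteq> {..<n}" using assms(1) by blast
    show "h x \<in> {..<n}" if "x \<in> {..<q} \<union> ?K" for x using hb[OF that] assms(2) by simp
  qed
  ultimately obtain \<sigma> where \<sigma>: "\<sigma> permutes {..<n}" "\<forall>x\<in>{..<q} \<union> ?K. \<sigma> x = h x"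
    using ex_permutation_extending by blast
  have "\<sigma> permutes {q..<n}" using \<sigma> by (intro permutes_superset[OF \<sigma>(1)]) (auto simp: h_def)
  moreover have "ks (mono_act \<sigma> m) \<subseteq> {..<q + mdegree m}"
    using \<sigma>(2) hb
    unfolding keys_mono_act[OF permutes_inj[OF \<sigma>(1)]] by auto
  ultimately show ?thesis by blast
qed

locale tableau_ideal = tableau \<nu> b for \<nu> b +
  fixes I :: "'k::field_char_0 polynomials set"
  assumes hom_I: "homogeneous_ideal I" and sym_I: "symmetric_ideal I"
begin

lemma ideal_I: "poly_ideal I"
  using hom_I by (simp add: homogeneous_ideal_def)

lemma sub_I: "pv.subspace I"
  by (rule poly_ideal_subspace[OF ideal_I])

lemma stable_I: "stable n I"
  using sub_I sym_I by (auto simp: stable_def symmetric_ideal_def sym_infinity_def)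

lemma R_permutes: "\<sigma> \<in> R n \<Longrightarrow> \<sigma> permutes {..<n}"
  by (simp add: R_def)

lemma R_I: "\<sigma> permutes {g..<N} \<Longrightarrow> N \<le> n \<Longrightarrow> \<sigma> \<in> R n"
proof -
  assume \<sigma>: "\<sigma> permutes {g..<N}" "N \<le> n"
  have "rw (\<sigma> v) = rw v" for v
  proof (cases "v \<in> {g..<N}")
    case True
    then have "\<sigma> v \<in> {g..<N}" using permutes_in_image[OF \<sigma>(1)] by blast
    then show ?thesis using True by (simp add: rw_def)
  next
    case False
    then show ?thesis using permutes_not_in[OF \<sigma>(1)] by simp
  qed
  moreover have "\<sigma> permutes {..<n}" using \<sigma> by (auto intro: permutes_subset)
  ultimately show ?thesis by (simp add: R_def)
qed

section \<open>The two limit subspaces\<close>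

definition Jn :: "nat \<Rightarrow> 'k polynomials set"
  where "Jn n = {p. \<rho> n p \<in> I}"

lemma sub_Jn: "pv.subspace (Jn n)"
  unfolding Jn_def
  by (rule pv.subspaceI)
    (simp_all add: gsum_add gsum_scalar pv.subspace_0[OF sub_I] pv.subspace_add[OF sub_I] pv.subspace_scale[OF sub_I])

lemma \<rho>_perm: "q \<le> n \<Longrightarrow> \<tau> \<in> R n \<Longrightarrow> \<rho> n (perm_act \<tau> x) = (\<rho> n x :: 'k polynomials)"
  by (rule specht_setting.\<rho>_perm_act[OF specht_setting])

text \<open>As \<open>R n\<close> is a subgroup of \<open>R n'\<close>, the larger symmetrizer
  absorbs the smaller one up to the factor \<open>card (R n)\<close>, which is invertible in
  characteristic \<open>0\<close>.\<close>

lemma Jn_mono: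
  assumes "q \<le> n'" "n \<le> n'"
  shows "Jn n \<subseteq> Jn n'"
proof
  fix p assume p: "p \<in> Jn n"
  have "\<sigma> \<in> R n'" if "\<sigma> \<in> R n" for \<sigma> using that assms(2) by (auto simp: R_def intro: permutes_mono)
  then have "\<rho> n' (\<rho> n p) = (\<Sum>\<sigma>\<in>R n. \<rho> n' p)"
    using \<rho>_perm[OF assms(1)] by (simp add: gsum_def[of "R n"] gsum_sum)
  also have "\<dots> = scalar_mult (of_nat (card (R n))) (\<rho> n' p)" by (rule pv.sum_constant_scale)
  finally have eq: "\<rho> n' (\<rho> n p) = scalar_mult (of_nat (card (R n))) (\<rho> n' p)" .
  have "\<rho> n' (\<rho> n p) \<in> I"
    by (rule gsum_stable[OF stable_I R_permutes]) (use p in \<open>simp_all add: Jn_def\<close>)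
  then have "scalar_mult (1 / of_nat (card (R n))) (\<rho> n' (\<rho> n p)) \<in> I" by (rule pv.subspace_scale[OF sub_I])
  moreover have "(of_nat (card (R n)) :: 'k) \<noteq> 0" using finite_R R_group(1) by auto
  ultimately show "p \<in> Jn n'" unfolding eq by (simp add: Jn_def)
qed

lemma Jn_perm: "q \<le> n \<Longrightarrow> \<sigma> \<in> R n \<Longrightarrow> p - perm_act \<sigma> p \<in> Jn n"
  by (simp add: Jn_def gsum_diff \<rho>_perm pv.subspace_0[OF sub_I])

definition J1 :: "'k polynomials set"
  where "J1 = (\<Union>n\<in>{q..}. Jn n)"

definition J2 :: "'k polynomials set"
  where "J2 = {x + y | x y. x \<in> J1 \<and> y \<in> range \<kappa>}"

lemma J1_iff: "p \<in> J1 \<longleftrightarrow> (\<exists>n\<ge>q. \<forall>n'\<ge>n. p \<in> Jn n')"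
proof
  assume "p \<in> J1"
  then obtain n where n: "q \<le> n" "p \<in> Jn n" by (auto simp: J1_def)
  then have "p \<in> Jn n'" if "n \<le> n'" for n' using Jn_mono[of n' n] that by auto
  then show "\<exists>n\<ge>q. \<forall>n'\<ge>n. p \<in> Jn n'" using n(1) by blast
qed (auto simp: J1_def)

lemma Jn_J1: "q \<le> n \<Longrightarrow> Jn n \<subseteq> J1"
  by (auto simp: J1_def)

lemma sub_J1: "pv.subspace J1"
proof (rule pv.subspaceI)
  show "0 \<in> J1" using pv.subspace_0[OF sub_Jn] by (auto simp: J1_def)
next
  fix x y assume "x \<in> J1" "y \<in> J1"
  then obtain m n where "q \<le> m" "\<forall>n'\<ge>m. x \<in> Jn n'" "\<forall>n'\<ge>n. y \<in> Jn n'" by (auto simp: J1_iff)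
  then have "\<forall>n'\<ge>max m n. x + y \<in> Jn n'" using pv.subspace_add[OF sub_Jn] by simp
  then show "x + y \<in> J1" unfolding J1_iff using \<open>q \<le> m\<close> by (intro exI[of _ "max m n"]) simp
next
  fix c x assume "x \<in> J1"
  then show "scalar_mult c x \<in> J1" using pv.subspace_scale[OF sub_Jn] by (auto simp: J1_def)
qed

lemma sub_range_\<kappa>: "pv.subspace V \<Longrightarrow> pv.subspace (\<kappa> ` V :: 'k polynomials set)"
proof -
  assume V: "pv.subspace V"
  show ?thesis
  proof (rule pv.subspaceI)
    show "0 \<in> \<kappa> ` V" using pv.subspace_0[OF V] gsum_0 by (metis imageI)
    fix x y c assume "x \<in> \<kappa> ` V"
    then obtain v where v: "x = \<kappa> v" "v \<in> V" by blast
    then show "scalar_mult c x \<in> \<kappa> ` V" using pv.subspace_scale[OF V v(2), of c] by (metis gsum_scalar imageI)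
    assume "y \<in> \<kappa> ` V"
    then obtain w where w: "y = \<kappa> w" "w \<in> V" by blast
    then show "x + y \<in> \<kappa> ` V" using v pv.subspace_add[OF V v(2) w(2)] by (metis gsum_add imageI)
  qed
qed

lemma sub_J2: "pv.subspace J2"
  unfolding J2_def by (intro pv.subspace_sums sub_J1 sub_range_\<kappa>) simp

lemma J1_J2: "J1 \<subseteq> J2"
proof
  fix x assume "x \<in> J1"
  moreover have "0 \<in> range (\<kappa> :: 'k polynomials \<Rightarrow> _)" using gsum_0 by (metis rangeI)
  ultimately show "x \<in> J2" unfolding J2_def by force
qed

lemma I_J1: "I \<subseteq> J1"
  using gsum_stable[OF stable_I R_permutes] by (auto simp: J1_def Jn_def)

lemma J1_perm: "\<sigma> permutes {g..<N} \<Longrightarrow> p - perm_act \<sigma> p \<in> J1"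
  using Jn_perm[of "max q N" \<sigma> p] R_I[of \<sigma> N "max q N"] by (auto simp: J1_def)

text \<open>A factor fixed by \<open>R n\<close> can be pulled out of \<open>\<rho> n\<close>. The
  index \<open>n\<close> may depend on \<open>N\<close>: the symmetric polynomial in
  \<open>N\<close> variables is used with \<open>n = N\<close>, the variable with index
  \<open>N\<close> with some \<open>n \<le> N\<close>, as \<open>R n\<close> does not move
  it.\<close>

lemma J1_mult:
  assumes p: "p \<in> J1" and F: "\<And>N. N0 \<le> N \<Longrightarrow> \<exists>n\<ge>q. n0 \<le> n \<and> (\<forall>\<sigma>\<in>R n. perm_act \<sigma> (F N) = F N)"
    and n0: "\<forall>n\<ge>n0. p \<in> Jn n"
  shows "\<forall>N\<ge>N0. F N * p \<in> J1"
proof (intro allI impI)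
  fix N assume "N0 \<le> N"
  then obtain n where n: "q \<le> n" "n0 \<le> n" "\<forall>\<sigma>\<in>R n. perm_act \<sigma> (F N) = F N" using F by blast
  have "\<rho> n (F N * p) = F N * \<rho> n p" using n(3) by (intro gsum_mult_fixed) blast
  moreover have "\<rho> n p \<in> I" using n0 n(2) by (simp add: Jn_def)
  ultimately have "F N * p \<in> Jn n" using poly_ideal_mult[OF ideal_I] by (simp add: Jn_def)
  then show "F N * p \<in> J1" using n(1) by (auto simp: J1_def)
qed

lemma fixed_esym: "\<sigma> permutes {..<N} \<Longrightarrow> perm_act \<sigma> (esym e l {..<N}) = (esym e l {..<N} :: 'k polynomials)"
  by (rule perm_act_esym) simp_all

lemma fixed_var: "\<sigma> permutes {..<n} \<Longrightarrow> n \<le> N \<Longrightarrow> perm_act \<sigma> (mon (sgl N a)) = (mon (sgl N a) :: 'k polynomials)"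
  using permutes_not_in[of \<sigma> "{..<n}" N] by (simp add: perm_act_mon)

lemma J1_esym:
  assumes "p \<in> J1"
  shows "\<exists>N0\<ge>q. \<forall>N\<ge>N0. esym e l {..<N} * p \<in> J1"
proof -
  obtain n0 where n0: "q \<le> n0" "\<forall>n\<ge>n0. p \<in> Jn n" using assms by (auto simp: J1_iff)
  have "\<forall>N\<ge>n0. esym e l {..<N} * p \<in> J1"
  proof (rule J1_mult[OF assms _ n0(2)])
    fix N assume "n0 \<le> N"
    then show "\<exists>n\<ge>q. n0 \<le> n \<and> (\<forall>\<sigma>\<in>R n. perm_act \<sigma> (esym e l {..<N}) = (esym e l {..<N} :: 'k polynomials))"
      using n0(1) fixed_esym R_permutes by (intro exI[of _ N]) auto
  qed
  then show ?thesis using n0(1) by blast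
qed

lemma J1_var:
  assumes "p \<in> J1"
  shows "\<exists>N0\<ge>q. \<forall>N\<ge>N0. mon (sgl N a) * p \<in> J1"
proof -
  obtain n0 where n0: "q \<le> n0" "\<forall>n\<ge>n0. p \<in> Jn n" using assms by (auto simp: J1_iff)
  have "\<forall>N\<ge>n0. mon (sgl N a) * p \<in> J1"
  proof (rule J1_mult[OF assms _ n0(2)])
    fix N assume "n0 \<le> N"
    then show "\<exists>n\<ge>q. n0 \<le> n \<and> (\<forall>\<sigma>\<in>R n. perm_act \<sigma> (mon (sgl N a)) = (mon (sgl N a) :: 'k polynomials))"
      using n0(1) by (intro exI[of _ n0] conjI ballI fixed_var[OF R_permutes]) simp_all
  qed
  then show ?thesis using n0(1) by blast
qed

text \<open>The factor is also fixed by the column group, which moves only indices below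
  \<open>q\<close>, so it passes through \<kappa>.\<close>

lemma J2_mult:
  assumes "\<exists>N0\<ge>q. \<forall>N\<ge>N0. F N * x \<in> J1" "\<And>N \<pi>. q \<le> N \<Longrightarrow> \<pi> permutes {..<q} \<Longrightarrow> perm_act \<pi> (F N) = F N"
  shows "\<exists>N0. \<forall>N\<ge>N0. F N * (x + \<kappa> y) \<in> J2"
proof -
  obtain N0 where N0: "q \<le> N0" "\<forall>N\<ge>N0. F N * x \<in> J1" using assms(1) by blast
  have "F N * (x + \<kappa> y) \<in> J2" if "N0 \<le> N" for N
  proof -
    have "\<kappa> (F N * y) = F N * \<kappa> y"
      using assms(2) N0(1) that by (intro gsum_mult_fixed) (simp add: C_def)
    then have "F N * (x + \<kappa> y) = F N * x + \<kappa> (F N * y)" by (simp add: distrib_left)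
    then show ?thesis using N0(2) that unfolding J2_def by blast
  qed
  then show ?thesis by blast
qed

lemma J2_esym:
  assumes "p \<in> J2"
  shows "\<exists>N0. \<forall>N\<ge>N0. esym e l {..<N} * p \<in> J2"
proof -
  obtain x y where p: "p = x + \<kappa> y" "x \<in> J1" using assms by (auto simp: J2_def)
  show ?thesis unfolding p(1)
    by (rule J2_mult[OF J1_esym[OF p(2)]]) (auto intro: fixed_esym permutes_mono)
qed

lemma J2_var:
  assumes "p \<in> J2"
  shows "\<exists>N0. \<forall>N\<ge>N0. mon (sgl N a) * p \<in> J2"
proof -
  obtain x y where p: "p = x + \<kappa> y" "x \<in> J1" using assms by (auto simp: J2_def)
  show ?thesis unfolding p(1)
    by (rule J2_mult[OF J1_var[OF p(2)]]) (auto intro: fixed_var)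
qed

lemma rational_J:
  assumes "dagger_condition I"
  shows "is_rational_series (Abs_fps (\<lambda>d. of_nat (pv.rdim J1 {p. is_form d p})))"
    and "is_rational_series (Abs_fps (\<lambda>d. of_nat (pv.rdim J2 {p. is_form d p})))"
proof -
  obtain f0 and N :: nat and c :: "nat \<Rightarrow> 'k" and m :: "nat \<Rightarrow> monomial" where f0: "f0 \<in> I" and N: "N \<ge> 1" and c: "\<forall>i\<in>{1..N}. c i \<noteq> 0" and m: "inj_on m {1..N}"
    and f0_eq: "f0 = (\<Sum>i=1..N. sgl (m i) (c i))"
    and dg: "\<forall>i\<in>{1..N}. i \<noteq> 1 \<longrightarrow> \<not> ks (m i) \<subseteq> ks (m 1)"
    using assms unfolding dagger_condition_def by (elim bexE exE conjE) (rule that)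
  \<comment> \<open>(\<dagger>) passes to the homogeneous component that contains
    \<open>m 1\<close>: it lies in \<open>I\<close>, and its monomials are among those of
    \<open>f0\<close>. No exponent exceeds the degree \<open>d0\<close>, so \<open>Suc d0\<close>
    can serve as \<open>e\<close>.\<close>
  define d0 where "d0 = mdegree (m 1)"
  define f where "f = hom_component d0 f0"
  have f: "f \<in> I" using hom_I f0 by (simp add: f_def homogeneous_ideal_def)
  have form: "is_form d0 f" unfolding f_def by (rule is_form_hom_component)
  have lk_f0: "lk f0 (m i) = c i" if "i \<in> {1..N}" for i
  proof -
    have "lk f0 (m i) = (\<Sum>j=1..N. if j = i then c j else 0)"
      unfolding f0_eq lookup_sum
      by (rule sum.cong) (use m that in \<open>auto simp: lookup_single when_def inj_on_eq_iff\<close>)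
    then show ?thesis using that sum.delta[of "{1..N}" i c] by simp
  qed
  have keys: "\<exists>i\<in>{1..N}. x = m i" if "x \<in> ks f" for x
  proof -
    have "x \<in> ks f0" using that by (auto simp: f_def in_keys_iff lookup_hom_component split: if_splits)
    then have "x \<in> (\<Union>i\<in>{1..N}. ks (sgl (m i) (c i)))"
      unfolding f0_eq using keys_sum_subset[of "\<lambda>i. sgl (m i) (c i)" "{1..N}"] by (rule subsetD[rotated])
    then show ?thesis by (auto split: if_splits)
  qed
  have m1: "m 1 \<in> ks f"
  proof -
    have "1 \<in> {1..N}" using N by simp
    then have "lk f0 (m 1) \<noteq> 0" using lk_f0 c by metis
    then show ?thesis by (simp add: f_def in_keys_iff lookup_hom_component d0_def)
  qed
  have small: "lk x i < Suc d0" if "x \<in> ks f" for x i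
    using lookup_le_mdegree[of x i] form that by (simp add: is_form_def)
  have dagger: "\<not> ks x \<subseteq> ks (m 1)" if "x \<in> ks f" "x \<noteq> m 1" for x
    using keys[OF that(1)] dg that(2) by auto
  interpret J1: dagger_space J1 I f "m 1" d0 g "card (ks (m 1))" "Suc d0"
  proof
    show "\<exists>N0. \<forall>N\<ge>N0. mon (sgl N b) * p \<in> J1" if "p \<in> J1" for p b using J1_var[OF that] by blast
    show "\<exists>N0. \<forall>N\<ge>N0. esym (Suc d0) l {..<N} * p \<in> J1" if "p \<in> J1" for p l using J1_esym[OF that] by blast
  qed (use sub_J1 J1_perm I_J1 ideal_I sym_I f form m1 dagger small in auto)
  interpret J2: dagger_space J2 I f "m 1" d0 g "card (ks (m 1))" "Suc d0"
  proof
    show "I \<subseteq> J2" using I_J1 J1_J2 by (rule subset_trans)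
    show "p - perm_act \<sigma> p \<in> J2" if "\<sigma> permutes {g..<N}" for p \<sigma> N using J1_perm[OF that] J1_J2 by blast
  qed (use sub_J2 J2_var J2_esym ideal_I sym_I f form m1 dagger small in auto)
  show "is_rational_series (Abs_fps (\<lambda>d. of_nat (pv.rdim J1 {p. is_form d p})))"
    by (rule J1.rational_rdim_forms)
  show "is_rational_series (Abs_fps (\<lambda>d. of_nat (pv.rdim J2 {p. is_form d p})))"
    by (rule J2.rational_rdim_forms)
qed

section \<open>Ranks for finite \<open>n\<close> and in the limit\<close>

lemma \<kappa>_commute:
  assumes "\<sigma> permutes {q..<n}"
  shows "\<kappa> (perm_act \<sigma> x) = (perm_act \<sigma> (\<kappa> x) :: 'k polynomials)"
  unfolding gsum_def perm_act_sum perm_act_scalar perm_act_comp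
proof (rule sum.cong)
  fix \<pi> assume \<pi>: "\<pi> \<in> C"
  then have perm: "\<pi> permutes {..<q}" by (simp add: C_def)
  have "\<pi> (\<sigma> v) = \<sigma> (\<pi> v)" for v
  proof (cases "v < q")
    case True
    then have "\<pi> v < q" using permutes_in_image[OF perm, of v] by simp
    then show ?thesis using True permutes_not_in[OF assms] by simp
  next
    case False
    then have "\<not> \<sigma> v < q" using permutes_in_image[OF assms, of v] permutes_not_in[OF assms, of v] by (cases "v < n") auto
    then show ?thesis using False permutes_not_in[OF perm] by simp
  qed
  then have "\<pi> \<circ> \<sigma> = \<sigma> \<circ> \<pi>" by (simp add: fun_eq_iff)
  then show "scalar_mult (\<epsilon> \<pi>) (perm_act (\<pi> \<circ> \<sigma>) x) = scalar_mult (\<epsilon> \<pi>) (perm_act (\<sigma> \<circ> \<pi>) x)" by simp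
qed simp

text \<open>Permutations of the indices from \<open>q\<close> on lie in the row group and commute
  with \<kappa>, so one packing serves \<open>x\<close> and \<open>\<kappa> x\<close> at the same
  time.\<close>

lemma pack:
  assumes n: "q + d \<le> n" and x: "x \<in> forms_in n d"
  shows "\<exists>y\<in>forms_in (q + d) d. x - y \<in> Jn n \<and> \<kappa> x - \<kappa> y \<in> Jn n"
proof -
  let ?P = "forms_in (q + d) d :: 'k polynomials set"
  let ?X = "{x. \<exists>y\<in>?P. x - y \<in> Jn n \<and> \<kappa> x - \<kappa> y \<in> Jn n}"
  have "pv.subspace ?X"
  proof (rule pv.subspaceI)
    show "0 \<in> ?X" using pv.subspace_0[OF subspace_forms_in] pv.subspace_0[OF sub_Jn] by force
  next
    fix x x' assume "x \<in> ?X" "x' \<in> ?X"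
    then obtain y y' where y: "y \<in> ?P" "x - y \<in> Jn n" "\<kappa> x - \<kappa> y \<in> Jn n"
      and y': "y' \<in> ?P" "x' - y' \<in> Jn n" "\<kappa> x' - \<kappa> y' \<in> Jn n" by blast
    have "(x + x') - (y + y') = (x - y) + (x' - y')" "\<kappa> (x + x') - \<kappa> (y + y') = (\<kappa> x - \<kappa> y) + (\<kappa> x' - \<kappa> y')"
      by (simp_all add: gsum_add)
    then have "(x + x') - (y + y') \<in> Jn n" "\<kappa> (x + x') - \<kappa> (y + y') \<in> Jn n"
      using pv.subspace_add[OF sub_Jn] y y' by metis+
    then show "x + x' \<in> ?X" using pv.subspace_add[OF subspace_forms_in y(1) y'(1)] by blast
  next
    fix c x assume "x \<in> ?X"
    then obtain y where y: "y \<in> ?P" "x - y \<in> Jn n" "\<kappa> x - \<kappa> y \<in> Jn n" by blast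
    have "scalar_mult c x - scalar_mult c y \<in> Jn n" "\<kappa> (scalar_mult c x) - \<kappa> (scalar_mult c y) \<in> Jn n"
      using pv.subspace_scale[OF sub_Jn y(2), of c] pv.subspace_scale[OF sub_Jn y(3), of c]
      by (simp_all add: gsum_scalar pv.scale_right_diff_distrib)
    then show "scalar_mult c x \<in> ?X" using pv.subspace_scale[OF subspace_forms_in y(1), of c] by blast
  qed
  then have "x \<in> ?X"
  proof (rule poly_in_subspace)
    fix m assume "m \<in> ks x"
    then have m: "ks m \<subseteq> {..<n}" "mdegree m = d" using x by (auto simp: forms_in_def keys_within_def)
    obtain \<sigma> where \<sigma>: "\<sigma> permutes {q..<n}" "ks (mono_act \<sigma> m) \<subseteq> {..<q + d}"
      using ex_mono_act_pack[OF m(1), of q] m(2) n by auto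
    have "\<sigma> permutes {g..<n}" using \<sigma>(1) by (rule permutes_subset) (auto simp: q_def)
    then have "\<sigma> \<in> R n" by (rule R_I) simp
    then have "x - perm_act \<sigma> x \<in> Jn n" for x using n by (intro Jn_perm) auto
    from this[of "mon m"] this[of "\<kappa> (mon m)"]
    have "mon m - mon (mono_act \<sigma> m) \<in> Jn n" "\<kappa> (mon m) - \<kappa> (mon (mono_act \<sigma> m)) \<in> Jn n"
      using \<kappa>_commute[OF \<sigma>(1), of "mon m"] by (simp_all add: perm_act_mon)
    moreover have "mon (mono_act \<sigma> m) \<in> ?P" using \<sigma>(2) m(2) by (simp add: forms_in_def keys_within_mon)
    ultimately have "mon m \<in> ?X" by blast
    then show "sgl m 1 \<in> ?X" by (simp add: mon_def)
  qed
  then show ?thesis by blast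
qed

lemma forms_in_mono: "m \<le> n \<Longrightarrow> forms_in m d \<subseteq> (forms_in n d :: 'k polynomials set)"
  unfolding forms_in_def by (rule keys_within_mono) auto

lemma pack_form:
  assumes "is_form d x"
  shows "\<exists>y\<in>forms_in (q + d) d. x - y \<in> J1 \<and> \<kappa> x - \<kappa> y \<in> J1"
proof -
  obtain n0 where n0: "x \<in> polys_in n0" using ex_polys_in by blast
  let ?n = "max n0 (q + d)"
  have "x \<in> forms_in ?n d" using n0 assms polys_in_mono[of n0 ?n] by (auto simp: forms_in_iff)
  then obtain y where y: "y \<in> forms_in (q + d) d" "x - y \<in> Jn ?n" "\<kappa> x - \<kappa> y \<in> Jn ?n"
    using pack[of d ?n x] by auto
  have "Jn ?n \<subseteq> J1" by (rule Jn_J1) simp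
  then show ?thesis using y by (intro bexI[of _ y] conjI) (rule subsetD, assumption+)+
qed

lemma J1_hom: "p \<in> J1 \<Longrightarrow> hom_component d p \<in> J1"
proof -
  assume "p \<in> J1"
  then obtain n where n: "q \<le> n" "\<rho> n p \<in> I" by (auto simp: J1_def Jn_def)
  then have "\<rho> n (hom_component d p) \<in> I" using hom_I by (simp add: homogeneous_ideal_def flip: hom_component_gsum)
  then show ?thesis using n(1) by (auto simp: J1_def Jn_def)
qed

lemma \<kappa>_forms: "\<kappa> ` forms_in (q + d) d \<subseteq> (forms_in (q + d) d :: 'k polynomials set)"
proof
  fix x assume "x \<in> \<kappa> ` (forms_in (q + d) d :: 'k polynomials set)"
  then obtain y where y: "x = \<kappa> y" "y \<in> forms_in (q + d) d" by blast
  show "x \<in> forms_in (q + d) d"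
    unfolding y(1)
  proof (rule gsum_stable[OF _ _ y(2)])
    show "stable (q + d) (forms_in (q + d) d :: 'k polynomials set)"
      by (simp add: stable_def subspace_forms_in perm_act_forms_in)
    show "\<sigma> permutes {..<q + d}" if "\<sigma> \<in> C" for \<sigma> using that by (auto simp: C_def intro: permutes_mono)
  qed
qed

lemma rdim_forms:
  assumes "pv.subspace J" "J1 \<subseteq> J"
  shows "pv.rdim J (forms_in (q + d) d) = pv.rdim J {p. is_form d p}"
proof (rule pv.rdim_cong[OF assms(1)])
  fix x assume "x \<in> (forms_in (q + d) d :: 'k polynomials set)"
  then show "\<exists>y\<in>{p. is_form d p}. x - y \<in> J"
    by (intro bexI[of _ x]) (simp_all add: pv.subspace_0[OF assms(1)] forms_in_iff)
next
  fix y :: "'k polynomials" assume "y \<in> {p. is_form d p}"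
  then obtain x where x: "x \<in> forms_in (q + d) d" "y - x \<in> J1" using pack_form[of d y] by auto
  then have "y - x \<in> J" using assms(2) by blast
  then have "x - y \<in> J" using pv.subspace_neg[OF assms(1)] by fastforce
  then show "\<exists>x\<in>forms_in (q + d) d. x - y \<in> J" using x(1) by blast
qed

text \<open>This is \<open>rdim_add\<close> for \<open>J1 \<subseteq> J2\<close> on the forms in
  \<open>q + d\<close> variables, which represent all forms of degree \<open>d\<close> modulo
  \<open>J1\<close>. As \<open>J1\<close> and \<kappa> are compatible with homogeneous components,
  the forms in \<open>J2\<close> are, modulo \<open>J1\<close>, the values of \<kappa> on
  forms.\<close>

lemma rdim_J1: "pv.rdim J1 {p. is_form d p} = pv.rdim J1 (\<kappa> ` forms_in (q + d) d) + pv.rdim J2 {p. is_form d p}"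
proof -
  let ?P = "forms_in (q + d) d :: 'k polynomials set"
  have "pv.rdim J1 ?P = pv.rdim J1 (?P \<inter> J2) + pv.rdim J2 ?P"
    by (rule pv.rdim_add[OF sub_J1 sub_J2 subspace_forms_in J1_J2 rel_fg_forms_in[OF sub_J1]])
  moreover have "pv.rdim J1 (?P \<inter> J2) = pv.rdim J1 (\<kappa> ` ?P)"
  proof (rule pv.rdim_cong[OF sub_J1])
    fix x assume x: "x \<in> ?P \<inter> J2"
    then obtain j z where jz: "x = j + \<kappa> z" "j \<in> J1" by (auto simp: J2_def)
    let ?z = "hom_component d z"
    have "x = hom_component d x" using x by (intro hom_component_form[symmetric]) (simp add: forms_in_iff)
    then have eq: "x = hom_component d j + \<kappa> ?z" by (subst (asm) (2) jz(1)) (simp add: hom_component_add hom_component_gsum)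
    obtain y where y: "y \<in> ?P" "\<kappa> ?z - \<kappa> y \<in> J1" using pack_form[OF is_form_hom_component[of d z]] by blast
    have e: "x - \<kappa> y = hom_component d j + (\<kappa> ?z - \<kappa> y)" by (subst eq) simp
    have "x - \<kappa> y \<in> J1" unfolding e by (rule pv.subspace_add[OF sub_J1 J1_hom[OF jz(2)] y(2)])
    then show "\<exists>y\<in>\<kappa> ` ?P. x - y \<in> J1" using y(1) by blast
  next
    fix y assume y: "y \<in> \<kappa> ` ?P"
    have "0 + y \<in> J2" unfolding J2_def using y pv.subspace_0[OF sub_J1] by blast
    then show "\<exists>x\<in>?P \<inter> J2. x - y \<in> J1"
      using y \<kappa>_forms[of d] pv.subspace_0[OF sub_J1] by (intro bexI[of _ y]) auto
  qed
  ultimately show ?thesis using rdim_forms[OF sub_J1] rdim_forms[OF sub_J2 J1_J2] by simp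
qed

text \<open>The forms in \<open>q + d\<close> variables that belong to \<open>J1\<close> have a
  finite basis, which lies in \<open>Jn n\<close> for all large \<open>n\<close>. From then on
  \<open>Jn n\<close> and \<open>J1\<close> agree on these forms, and packing reduces the forms in
  \<open>n\<close> variables to them.\<close>

lemma eventually_rdim: "\<exists>n0\<ge>q. \<forall>n\<ge>n0. pv.rdim (Jn n) (\<kappa> ` forms_in n d) = pv.rdim J1 (\<kappa> ` forms_in (q + d) d)"
proof -
  let ?P = "forms_in (q + d) d :: 'k polynomials set"
  have "pv.rel_fg {0} (?P \<inter> J1)"
    by (rule pv.rel_fg_subset[OF rel_fg_forms_in[OF pv.subspace_single_0, of "q + d" d]]) auto
  then obtain A where A: "pv.rel_basis {0} (?P \<inter> J1) A (\<lambda>x. x)" using pv.rel_basis_exists[OF pv.subspace_single_0] by blast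
  have finA: "finite A" and AJ: "A \<subseteq> ?P \<inter> J1" using A by (auto simp: pv.rel_basis_def)
  have "\<exists>n0. \<forall>n\<ge>n0. A \<subseteq> Jn n"
    using finA AJ
  proof (induction A rule: finite_induct)
    case (insert a A)
    then obtain n0 where n0: "\<forall>n\<ge>n0. A \<subseteq> Jn n" by blast
    obtain n1 where n1: "\<forall>n\<ge>n1. a \<in> Jn n" using insert.prems by (auto simp: J1_iff)
    show ?case using n0 n1 by (intro exI[of _ "max n0 n1"]) auto
  qed simp
  then obtain n0 where n0: "\<forall>n\<ge>n0. A \<subseteq> Jn n" by blast
  have "pv.rdim (Jn n) (\<kappa> ` forms_in n d) = pv.rdim J1 (\<kappa> ` ?P)" if n: "max n0 (q + d) \<le> n" for n
  proof -
    have qn: "q \<le> n" "q + d \<le> n" "n0 \<le> n" using n by auto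
    have sub: "?P \<inter> J1 \<subseteq> Jn n"
    proof
      fix x assume x: "x \<in> ?P \<inter> J1"
      have "\<forall>x\<in>?P \<inter> J1. \<exists>a. x - (\<Sum>i\<in>A. scalar_mult (a i) i) \<in> {0}"
        using A unfolding pv.rel_basis_def by (elim conjE)
      from bspec[OF this x] obtain a where "x - (\<Sum>i\<in>A. scalar_mult (a i) i) \<in> {0}" ..
      then have "x = (\<Sum>i\<in>A. scalar_mult (a i) i)" by simp
      moreover have "(\<Sum>i\<in>A. scalar_mult (a i) i) \<in> Jn n"
        using n0 qn(3) by (intro pv.subspace_sum[OF sub_Jn] pv.subspace_scale[OF sub_Jn]) blast
      ultimately show "x \<in> Jn n" by simp
    qed
    have "pv.rdim (Jn n) (\<kappa> ` forms_in n d) = pv.rdim (Jn n) (\<kappa> ` ?P)"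
    proof (rule pv.rdim_cong[OF sub_Jn])
      fix x assume "x \<in> \<kappa> ` (forms_in n d :: 'k polynomials set)"
      then obtain z where z: "x = \<kappa> z" "z \<in> forms_in n d" by blast
      then show "\<exists>y\<in>\<kappa> ` ?P. x - y \<in> Jn n" using pack[OF qn(2) z(2)] by blast
    next
      fix y assume "y \<in> \<kappa> ` ?P"
      then show "\<exists>x\<in>\<kappa> ` forms_in n d. x - y \<in> Jn n"
        using forms_in_mono[OF qn(2), of d] pv.subspace_0[OF sub_Jn] by (intro bexI[of _ y]) auto
    qed
    also have "\<dots> = pv.rdim J1 (\<kappa> ` ?P)"
    proof (rule pv.rdim_eq_if_Int_eq[OF sub_Jn sub_J1])
      show "pv.subspace (\<kappa> ` ?P)" by (rule sub_range_\<kappa>[OF subspace_forms_in])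
      show "\<kappa> ` ?P \<inter> Jn n = \<kappa> ` ?P \<inter> J1" using sub \<kappa>_forms[of d] Jn_J1[OF qn(1)] by blast
      show "pv.rel_fg (Jn n) (\<kappa> ` ?P)" by (rule pv.rel_fg_subset[OF rel_fg_forms_in[OF sub_Jn] \<kappa>_forms subset_refl])
    qed
    finally show ?thesis .
  qed
  then show ?thesis by (intro exI[of _ "max n0 (q + d)"]) auto
qed

lemma rational_multiplicity_series:
  assumes "dagger_condition I"
  shows "is_rational_series (Abs_fps (\<lambda>d. of_nat (lim (\<lambda>n. multiplicity_of n (specht_module (la n) n) (quotient_piece I n d)))))"
proof -
  have "lim (\<lambda>n. multiplicity_of n (specht_module (la n) n) (quotient_piece I n d)) = pv.rdim J1 (\<kappa> ` forms_in (q + d) d)" for d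
  proof (rule limI, rule tendsto_eventually)
    obtain n0 where n0: "q \<le> n0" "\<forall>n\<ge>n0. pv.rdim (Jn n) (\<kappa> ` forms_in n d) = pv.rdim J1 (\<kappa> ` forms_in (q + d) d)"
      using eventually_rdim by blast
    then show "\<forall>\<^sub>F n in sequentially. multiplicity_of n (specht_module (la n) n) (quotient_piece I n d) = pv.rdim J1 (\<kappa> ` forms_in (q + d) d)"
      unfolding eventually_sequentially
      by (intro exI[of _ n0]) (simp add: multiplicity_specht[OF _ ideal_I sym_I] flip: Jn_def)
  qed
  moreover have "Abs_fps (\<lambda>d. of_nat (pv.rdim J1 (\<kappa> ` forms_in (q + d) d)))
      = Abs_fps (\<lambda>d. rat_of_nat (pv.rdim J1 {p. is_form d p})) - Abs_fps (\<lambda>d. of_nat (pv.rdim J2 {p. is_form d p}))"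
    by (rule fps_ext) (simp add: rdim_J1)
  ultimately show ?thesis
    using is_rational_series_diff[OF rational_J[OF assms]] by simp
qed

end

lemma lim_cong_eventually:
  fixes a b :: "nat \<Rightarrow> nat"
  assumes "\<forall>\<^sub>F n in sequentially. a n = b n"
  shows "lim a = lim b"
  unfolding lim_def using tendsto_cong[OF assms] by simp

theorem theorem1p3:
  fixes I :: "'k::field_char_0 polynomials set" and \<mu> :: "nat list" and n\<^sub>0 :: nat
  assumes "homogeneous_ideal I"
    and "symmetric_ideal I"
    and "dagger_condition I"
    and "is_partition \<mu> n\<^sub>0"
  shows "is_rational_series (isotypic_hilbert_series I \<mu>)"
proof -
  \<comment> \<open>The first part of \<mu> enters only the length of the first row of \<mu>(n),
    which \<open>n\<close> and the other rows determine. The empty partition is the case without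
    lower rows.\<close>
  define \<nu> where "\<nu> = tl \<mu>"
  have sorted: "sorted_wrt (\<ge>) \<nu>"
    using assms(4) unfolding is_partition_def \<nu>_def by (cases \<mu>) auto
  let ?L = "{(i, j). i < length \<nu> \<and> j < \<nu> ! i}"
  have L: "?L = (SIGMA i:{..<length \<nu>}. {..<\<nu> ! i})" by auto
  have "card ?L = sum_list \<nu>" unfolding L by (simp add: sum_list_sum_nth atLeast0LessThan)
  moreover have "finite ?L" unfolding L by simp
  ultimately obtain b where b: "bij_betw b ?L {..<sum_list \<nu>}"
    using finite_same_card_bij[of ?L "{..<sum_list \<nu>}"] by auto
  interpret tableau_ideal \<nu> b I
    by unfold_locales (use sorted b assms(1,2) in auto)
  have padded: "padded \<mu> n = (n - sum_list \<nu>) # \<nu>" if "sum_list \<mu> \<le> n" for n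
    using that by (cases \<mu>) (auto simp: padded_def \<nu>_def)
  have "lim (\<lambda>n. isotypic_mult I \<mu> d n)
      = lim (\<lambda>n. multiplicity_of n (specht_module ((n - sum_list \<nu>) # \<nu>) n) (quotient_piece I n d))" for d
    by (rule lim_cong_eventually) (auto simp: isotypic_mult_def eventually_sequentially padded intro!: exI[of _ "sum_list \<mu>"])
  then show ?thesis
    using rational_multiplicity_series[OF assms(3)] by (simp add: isotypic_hilbert_series_def)
qed

end
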